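(* Let $R$ be a commutative ring with $2\in R^*$, let $n\geq 4$ and $1\leq m<n$ with $\frac nm\in\mathbb N$, and put $N=\binom nm$, $k=\frac nm$. If $n\neq 2m$, then $\bigwedge^m\mathrm{GL}_n(R)=\overline{G}_f(R)$. If $n=2m$, then $\overline G_f(R)=\mathrm{GO}_N(R)$ for even $m$ and $\overline G_f(R)=\mathrm{GSp}_N(R)$ for odd $m$; so in this case $\bigwedge^m\mathrm{GL}_n(R)$ is a subgroup of the (general) orthogonal, respectively symplectic, group.
   Context: Vectors $x\in R^N\cong\bigwedge^mR^n$ have coordinates $x_I$ indexed by the $m$-element subsets $I$ of $[n]=\{1,\dots,n\}$ (with respect to the basis $e_{i_1}\wedge\dots\wedge e_{i_m}$, $i_1<\dots<i_m$). The $k$-linear form $f$ on $R^N$ is $$f(x^1,\dots,x^k)=\sum\operatorname{sgn}(I_1,\dots,I_k)\,x^1_{I_1}\cdots x^k_{I_k},$$ where the sum is over all ordered partitions $(I_1,\dots,I_k)$ of $[n]$ into $m$-element subsets and $\operatorname{sgn}(I_1,\dots,I_k)$ is the sign of the permutation of $[n]$ obtained by writing the elements of $I_1$ in increasing order, then those of $I_2$, and so on (so $f$ is symmetric for even $m$ and alternating for odd $m$). $\overline G_f(R)$ is the group of all $g\in\mathrm{GL}_N(R)$ for which there exists $\lambda\in R^*$ with $f(gx^1,\dots,gx^k)=\lambda f(x^1,\dots,x^k)$ for all $x^1,\dots,x^k\in R^N$. $\bigwedge^m\mathrm{GL}_n$ denotes the scheme-theoretic (categorical) image of the homomorphism of group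 schemes $\bigwedge^m\colon\mathrm{GL}_n\to\mathrm{GL}_N$ over $\mathbb Z$, $\bigwedge^m(g)(e_{i_1}\wedge\dots\wedge e_{i_m})=ge_{i_1}\wedge\dots\wedge ge_{i_m}$, i.e. the closed subgroup scheme of $\mathrm{GL}_N$ that is the fppf sheaf image; $\bigwedge^m\mathrm{GL}_n(R)$ is its group of $R$-points (it may be strictly larger than the set-theoretic image of $\mathrm{GL}_n(R)$). $\mathrm{GO}_N(R)$ and $\mathrm{GSp}_N(R)$ are the groups of similitudes (with multiplier in $R^*$) of the standard split symmetric, respectively alternating, bilinear form on $R^N$; the identification with $\overline G_f(R)$ is understood after reordering the basis and changing signs of basis vectors. *)

theory Defs
  imports "Jordan_Normal_Form.Determinant" "HOL-Library.Poly_Mapping"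
begin

text \<open>
  Indices are 0-based: \<open>[n]\<close> is \<open>{..<n}\<close>.  A vector of \<open>R\<^sup>N\<close> with \<open>N = n choose m\<close> is a vector
  in \<open>carrier_vec N\<close>; its coordinates are numbered by the \<open>m\<close>-subsets of \<open>{..<n}\<close> in
  lexicographic order.
\<close>

definition msubsets :: "nat \<Rightarrow> nat \<Rightarrow> nat set set" where
  "msubsets n m = {I. I \<subseteq> {..<n} \<and> card I = m}"

definition msubset_list :: "nat \<Rightarrow> nat \<Rightarrow> nat set list" where
  "msubset_list n m = map set (filter (\<lambda>is. length is = m) (subseqs [0..<n]))"

definition idx :: "nat \<Rightarrow> nat \<Rightarrow> nat set \<Rightarrow> nat" where
  "idx n m I = (THE i. i < n choose m \<and> msubset_list n m ! i = I)"

lemma set_msubset_list: "set (msubset_list n m) = msubsets n m"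
proof (intro Set.set_eqI iffI)
  fix I assume "I \<in> set (msubset_list n m)"
  then obtain xs where xs: "xs \<in> set (subseqs [0..<n])" "length xs = m" "I = set xs"
    by (auto simp: msubset_list_def)
  have "distinct xs" using xs(1) by (meson distinct_upt subseqs_distinctD)
  moreover have "set xs \<in> Pow {..<n}"
    using xs(1) subseqs_powset[of "[0..<n]"] by (metis atLeast_upt imageI)
  ultimately show "I \<in> msubsets n m" using xs by (auto simp: msubsets_def distinct_card)
next
  fix I assume I: "I \<in> msubsets n m"
  then have "I \<in> set ` set (subseqs [0..<n])"
    using subseqs_powset[of "[0..<n]"] by (auto simp: msubsets_def lessThan_atLeast0)
  then obtain xs where xs: "xs \<in> set (subseqs [0..<n])" "I = set xs" by auto
  have "distinct xs" using xs(1) by (meson distinct_upt subseqs_distinctD)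
  with xs I have "length xs = m" by (simp add: msubsets_def distinct_card)
  with xs show "I \<in> set (msubset_list n m)" by (auto simp: msubset_list_def)
qed

lemma distinct_msubset_list: "distinct (msubset_list n m)"
proof -
  have "distinct (map set (subseqs [0..<n]))" by (rule distinct_set_subseqs) simp
  then show ?thesis
    unfolding msubset_list_def by (rule distinct_map_filter)
qed

lemma length_msubset_list: "length (msubset_list n m) = n choose m"
  using distinct_card[OF distinct_msubset_list, of n m] n_subsets[of "{..<n}" m]
  by (simp add: set_msubset_list msubsets_def)

lemma idx_msubset_list: "i < n choose m \<Longrightarrow> idx n m (msubset_list n m ! i) = i"
  unfolding idx_def
  by (rule the_equality)
    (auto simp: nth_eq_iff_index_eq[OF distinct_msubset_list] length_msubset_list)

lemma idx_less: "I \<in> msubsets n m \<Longrightarrow> idx n m I < n choose m"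
  by (metis idx_msubset_list in_set_conv_nth length_msubset_list set_msubset_list)

lemma msubset_list_idx: "I \<in> msubsets n m \<Longrightarrow> msubset_list n m ! idx n m I = I"
  by (metis idx_msubset_list in_set_conv_nth length_msubset_list set_msubset_list)


definition ordered_partitions :: "nat \<Rightarrow> nat \<Rightarrow> nat set list set" where
  "ordered_partitions n m = {Is. length Is = n div m \<and> set Is \<subseteq> msubsets n m \<and>
     (\<forall>i<length Is. \<forall>j<length Is. i \<noteq> j \<longrightarrow> Is ! i \<inter> Is ! j = {}) \<and> \<Union> (set Is) = {..<n}}"

definition partition_sign :: "nat \<Rightarrow> nat set list \<Rightarrow> int" where
  "partition_sign n Is =
     sign (\<lambda>i. if i < n then concat (map sorted_list_of_set Is) ! i else i)"

text \<open>The form \<open>f\<close>; its \<open>k = n div m\<close> arguments are passed as a list.\<close>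

definition ext_form :: "nat \<Rightarrow> nat \<Rightarrow> 'a::comm_ring_1 vec list \<Rightarrow> 'a" where
  "ext_form n m xs = (\<Sum>Is\<in>ordered_partitions n m.
     of_int (partition_sign n Is) * (\<Prod>j<n div m. (xs ! j) $ idx n m (Is ! j)))"

definition GL :: "nat \<Rightarrow> 'a::comm_ring_1 mat monoid" where
  "GL N = units_of (ring_mat TYPE('a) N ())"

text \<open>The group of similitudes of \<open>f\<close> with multiplier in \<open>R\<^sup>*\<close>, as a set of matrices.\<close>

definition form_similitudes :: "nat \<Rightarrow> nat \<Rightarrow> 'a::comm_ring_1 mat set" where
  "form_similitudes n m = {g \<in> carrier (GL (n choose m)). \<exists>c::'a. c dvd 1 \<and>
     (\<forall>xs. length xs = n div m \<and> set xs \<subseteq> carrier_vec (n choose m) \<longrightarrow>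
        ext_form n m (map (\<lambda>x. g *\<^sub>v x) xs) = c * ext_form n m xs)}"


text \<open>
  \<open>wedge n m vs\<close> is \<open>v\<^sub>1 \<and> \<dots> \<and> v\<^sub>m\<close> for \<open>vs = [v\<^sub>1, \<dots>, v\<^sub>m]\<close> in \<open>R\<^sup>n\<close>.  Expanding multilinearly, its
  coefficient at \<open>e\<^sub>I\<close> is the determinant of the matrix with columns \<open>v\<^sub>1, \<dots>, v\<^sub>m\<close>
  restricted to the rows in \<open>I\<close>.
\<close>

definition wedge :: "nat \<Rightarrow> nat \<Rightarrow> 'a::comm_ring_1 vec list \<Rightarrow> 'a vec" where
  "wedge n m vs = vec (n choose m) (\<lambda>i.
     det (mat m m (\<lambda>(a, b). (vs ! b) $ (sorted_list_of_set (msubset_list n m ! i) ! a))))"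

text \<open>The column numbered by \<open>J = {j\<^sub>1 < \<dots> < j\<^sub>m}\<close> is \<open>g e\<^bsub>j\<^sub>1\<^esub> \<and> \<dots> \<and> g e\<^bsub>j\<^sub>m\<^esub>\<close>.\<close>

definition ext_power :: "nat \<Rightarrow> nat \<Rightarrow> 'a::comm_ring_1 mat \<Rightarrow> 'a mat" where
  "ext_power n m g = mat_of_cols (n choose m)
     (map (\<lambda>J. wedge n m (map (\<lambda>j. g *\<^sub>v unit_vec n j) (sorted_list_of_set J)))
       (msubset_list n m))"


text \<open>Polynomials over \<open>\<int>\<close> in matrix entries \<open>x\<^sub>i\<^sub>j\<close>: the variables are the pairs \<open>(i, j)\<close>.\<close>

type_synonym ipoly = "((nat \<times> nat) \<Rightarrow>\<^sub>0 nat) \<Rightarrow>\<^sub>0 int"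

definition matrix_polys :: "nat \<Rightarrow> ipoly set" where
  "matrix_polys N = {F. \<forall>u \<in> Poly_Mapping.keys F. Poly_Mapping.keys u \<subseteq> {..<N} \<times> {..<N}}"

definition eval_at :: "'a::comm_ring_1 mat \<Rightarrow> ipoly \<Rightarrow> 'a" where
  "eval_at g F = (\<Sum>u\<in>Poly_Mapping.keys F. of_int (Poly_Mapping.lookup F u) *
     (\<Prod>p\<in>Poly_Mapping.keys u. (g $$ p) ^ Poly_Mapping.lookup u p))"

definition generic_mat :: "nat \<Rightarrow> ipoly mat" where
  "generic_mat n = mat n n (\<lambda>p. Poly_Mapping.single (Poly_Mapping.single p 1) 1)"

text \<open>
  The comorphism of \<open>\<And>\<^sup>m : GL\<^sub>n \<rightarrow> GL\<^sub>N\<close> is the ring homomorphism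
  \<open>\<phi> : \<int>[GL\<^sub>N] = \<int>[x\<^sub>I\<^sub>J][1/det x] \<rightarrow> \<int>[GL\<^sub>n] = \<int>[y\<^sub>i\<^sub>j][1/det y]\<close>, \<open>x \<mapsto> \<And>\<^sup>m y\<close>, and the
  scheme-theoretic image is the closed subscheme of \<open>GL\<^sub>N\<close> cut out by \<open>ker \<phi>\<close>.
  An element of \<open>\<int>[GL\<^sub>N]\<close> is a fraction \<open>F / (det x)\<^sup>r\<close>; as \<open>det x\<close> is a unit there, the fraction
  lies in \<open>ker \<phi>\<close> iff \<open>F\<close> does, that is (zero in a localization), iff some power of \<open>det y\<close>
  annihilates \<open>F(\<And>\<^sup>m y)\<close>.  Likewise the fraction vanishes at \<open>g \<in> GL\<^sub>N(R)\<close> iff \<open>F(g) = 0\<close>.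
  So it suffices to record the numerators.
\<close>

definition comorphism_kernel :: "nat \<Rightarrow> nat \<Rightarrow> ipoly set" where
  "comorphism_kernel n m = {F \<in> matrix_polys (n choose m).
     \<exists>s. det (generic_mat n) ^ s * eval_at (ext_power n m (generic_mat n)) F = 0}"

definition ext_power_GL :: "nat \<Rightarrow> nat \<Rightarrow> 'a::comm_ring_1 mat set" where
  "ext_power_GL n m =
     {g \<in> carrier (GL (n choose m)). \<forall>F \<in> comorphism_kernel n m. eval_at g F = 0}"


definition bilinear_similitudes ::
    "nat \<Rightarrow> ('a::comm_ring_1 vec \<Rightarrow> 'a vec \<Rightarrow> 'a) \<Rightarrow> 'a mat set" where
  "bilinear_similitudes N B = {g \<in> carrier (GL N). \<exists>c. c dvd 1 \<and>
     (\<forall>x \<in> carrier_vec N. \<forall>y \<in> carrier_vec N. B (g *\<^sub>v x) (g *\<^sub>v y) = c * B x y)}"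

text \<open>
  The split forms, for even \<open>N\<close>, with hyperbolic pairs \<open>(e\<^sub>i, e\<^bsub>N - 1 - i\<^esub>)\<close> for \<open>i < N div 2\<close>.
\<close>

definition split_symmetric_form :: "nat \<Rightarrow> 'a::comm_ring_1 vec \<Rightarrow> 'a vec \<Rightarrow> 'a" where
  "split_symmetric_form N x y =
     (\<Sum>i<N div 2. x $ i * y $ (N - 1 - i) + x $ (N - 1 - i) * y $ i)"

definition split_alternating_form :: "nat \<Rightarrow> 'a::comm_ring_1 vec \<Rightarrow> 'a vec \<Rightarrow> 'a" where
  "split_alternating_form N x y =
     (\<Sum>i<N div 2. x $ i * y $ (N - 1 - i) - x $ (N - 1 - i) * y $ i)"

definition GO :: "nat \<Rightarrow> 'a::comm_ring_1 mat set" where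
  "GO N = bilinear_similitudes N (split_symmetric_form N)"

definition GSp :: "nat \<Rightarrow> 'a::comm_ring_1 mat set" where
  "GSp N = bilinear_similitudes N (split_alternating_form N)"

text \<open>Base changes that permute the basis vectors and change signs.\<close>

definition signed_permutation_mats :: "nat \<Rightarrow> 'a::comm_ring_1 mat set" where
  "signed_permutation_mats N =
     {mat N N (\<lambda>(i, j). if i = p j then of_int (e j) else 0) | p e.
        p permutes {..<N} \<and> (\<forall>j. e j \<in> {1, -1 :: int})}"

definition conjugate_set :: "nat \<Rightarrow> 'a::comm_ring_1 mat \<Rightarrow> 'a mat set \<Rightarrow> 'a mat set" where
  "conjugate_set N P H = (\<lambda>h. P \<otimes>\<^bsub>GL N\<^esub> h \<otimes>\<^bsub>GL N\<^esub> inv\<^bsub>GL N\<^esub> P) ` H"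

end

theory Submission
  imports Defs "Jordan_Normal_Form.Char_Poly"
begin

text \<open>
  The form is the top coefficient of the product \<open>x\<^sup>1 \<and> \<dots> \<and> x\<^sup>k\<close> in the exterior algebra.

  Let \<open>k \<ge> 3\<close>. A similitude \<open>g\<close> satisfies \<open>x \<and> y = x' \<and> y' \<Longrightarrow> g x \<and> g y = g x' \<and> g y'\<close>, because the product
  of two arguments is determined by its pairings with the remaining ones. Hence the images of decomposable
  vectors satisfy the quadratic Pluecker relations. Over a local ring this makes them decomposable;
  after composing \<open>g\<close> with some \<open>\<And>\<^sup>m A\<close> it fixes the vectors \<open>e\<^sub>I\<close> of a partition of \<open>[n]\<close> into blocks up to units.
  The tangent directions at these vectors are then matched by a further diagonalization, and \<open>g\<close>
  becomes a scalar \<open>u\<close> once all \<open>e\<^sub>I\<close> at distance one from a fixed one are known to be fixed.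
  So \<open>g = u \<cdot> \<And>\<^sup>m A\<close>. Every polynomial in the kernel of the comorphism vanishes at such \<open>g\<close>: its homogeneous
  components lie in the kernel as well, and \<open>det y\<close> is not a zero divisor generically. Over an
  arbitrary ring, \<open>F(g)\<close> is zero because it is zero in every localization at a prime.

  Conversely, being a similitude is expressed by polynomial equations that hold for \<open>\<And>\<^sup>m y\<close>.

  For \<open>k = 2\<close> the form pairs \<open>x\<^sub>I\<close> with \<open>y\<^sub>J\<close>, \<open>J\<close> the complement of \<open>I\<close>. Complementation reverses
  the lexicographic order, so sign changes alone produce the standard split form.
\<close>

section \<open>The exterior algebra\<close>

text \<open>The quadratic relations rest on a rank count: multiplication by \<open>G e_J\<close>
  kills every \<open>G e_T\<close> with T meeting J, so its rank is at most the number of m-sets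
  disjoint from J, and a unit coordinate of \<open>G e_J\<close> exhibits an invertible minor of
  just that size. The assumption k >= 3 does more than detect x \<and> y: as n >= 3m, any two m-sets
  leave m - 1 spare indices, and multiplying by them isolates one coordinate inside a product; and a
  block can be compared with two others, which makes the coefficients between blocks factor.
  Three-term relations, evaluated at sums of two or four basis vectors, replace all further
  geometry. Every normalization divides by a unit coordinate, hence the passage to local rings; the
  scalar u survives since it need not be an m-th power. That the scheme-theoretic image is a group
  is proved apart, over an arbitrary ring where its points need not come from matrices: products and
  inverses are handled on the kernel polynomials themselves. For k = 2 it is this that makes the
  image a subgroup of the similitude group.\<close>

text \<open>\<open>sg I J\<close> is the sign in \<open>e\<^sub>I \<and> e\<^sub>J = \<plusminus> e\<^bsub>I \<union> J\<^esub>\<close>, for disjoint \<open>I\<close> and \<open>J\<close>.\<close>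

definition sg :: "nat set \<Rightarrow> nat set \<Rightarrow> 'a::comm_ring_1" where
  "sg I J = (-1) ^ card {p \<in> I \<times> J. snd p < fst p}"

lemma sg_square [simp]: "sg I J * sg I J = (1::'a::comm_ring_1)"
  by (simp add: sg_def flip: power_mult_distrib)

lemma sg_square_left [simp]: "sg I J * (sg I J * c) = (c::'a::comm_ring_1)"
  by (simp flip: mult.assoc)

lemma sg_cases: "sg I J = (1::'a::comm_ring_1) \<or> sg I J = (-1::'a)"
  by (cases "even (card {p \<in> I \<times> J. snd p < fst p})") (auto simp: sg_def)

lemma sg_dvd_1: "(sg I J :: 'a::comm_ring_1) dvd 1"
  by (metis dvd_triv_left sg_square)

lemma sg_empty [simp]: "sg {} J = 1" "sg I {} = 1"
  by (auto simp: sg_def)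

lemma sg_union_left:
  assumes "finite I" "finite J" "finite K" "I \<inter> J = {}"
  shows "sg (I \<union> J) K = sg I K * (sg J K :: 'a::comm_ring_1)"
proof -
  have "{p \<in> (I \<union> J) \<times> K. snd p < fst p} =
      {p \<in> I \<times> K. snd p < fst p} \<union> {p \<in> J \<times> K. snd p < fst p}" by auto
  moreover have "{p \<in> I \<times> K. snd p < fst p} \<inter> {p \<in> J \<times> K. snd p < fst p} = {}"
    using assms(4) by auto
  ultimately show ?thesis
    unfolding sg_def using assms(1-3) by (simp add: card_Un_disjoint power_add)
qed

lemma sg_union_right:
  assumes "finite I" "finite J" "finite K" "J \<inter> K = {}"
  shows "sg I (J \<union> K) = sg I J * (sg I K :: 'a::comm_ring_1)"
proof -
  have "{p \<in> I \<times> (J \<union> K). snd p < fst p} =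
      {p \<in> I \<times> J. snd p < fst p} \<union> {p \<in> I \<times> K. snd p < fst p}" by auto
  moreover have "{p \<in> I \<times> J. snd p < fst p} \<inter> {p \<in> I \<times> K. snd p < fst p} = {}"
    using assms(4) by auto
  ultimately show ?thesis
    unfolding sg_def using assms(1-3) by (simp add: card_Un_disjoint power_add)
qed

lemma sg_singleton_less: "(\<And>j. j \<in> J \<Longrightarrow> i \<le> j) \<Longrightarrow> sg {i} J = 1"
proof -
  assume "\<And>j. j \<in> J \<Longrightarrow> i \<le> j"
  then have *: "{p \<in> {i} \<times> J. snd p < fst p} = {}" by fastforce
  show ?thesis unfolding sg_def * by simp
qed

lemma sg_swap:
  assumes "finite I" "finite J" "I \<inter> J = {}"
  shows "sg J I = (-1) ^ (card I * card J) * (sg I J :: 'a::comm_ring_1)"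
proof -
  let ?A = "{p \<in> I \<times> J. snd p < fst p}" and ?B = "{p \<in> J \<times> I. snd p < fst p}"
  have B: "card ?B = card {p \<in> I \<times> J. fst p < snd p}"
    by (rule bij_betw_same_card[of prod.swap]) (auto simp: bij_betw_def inj_on_def image_iff)
  have "I \<times> J = ?A \<union> {p \<in> I \<times> J. fst p < snd p}"
    using assms(3) by (auto simp: not_less_iff_gr_or_eq)
  then have "card I * card J = card (?A \<union> {p \<in> I \<times> J. fst p < snd p})"
    by (metis card_cartesian_product)
  also have "\<dots> = card ?A + card ?B"
    unfolding B using assms by (subst card_Un_disjoint) auto
  finally have *: "card I * card J = card ?A + card ?B" .
  show ?thesis unfolding sg_def * power_add
    by (metis (no_types, lifting) left_minus_one_mult_self mult.commute mult.left_commute)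
qed

text \<open>A coefficient of a product is a sum over the subsets of its index, which makes sense
  only for a finite index; coordinates at infinite sets are forced to be 0, as otherwise
  \<open>1\<close> would not be neutral. One type serves all n and m, and the bounds are imposed by
  \<open>lambda_space\<close> and \<open>lambda_all\<close>.\<close>

typedef (overloaded) 'a ext = "{x :: nat set \<Rightarrow> 'a::comm_ring_1. \<forall>K. infinite K \<longrightarrow> x K = 0}"
  morphisms coord Abs_ext
  by (rule exI[of _ "\<lambda>_. 0"]) simp

setup_lifting type_definition_ext

lemma ext_eqI: "(\<And>K. finite K \<Longrightarrow> coord x K = coord y K) \<Longrightarrow> x = y"
  by (transfer, metis ext)

lift_definition basis :: "nat set \<Rightarrow> 'a::comm_ring_1 ext" is
  "\<lambda>I K. if K = I \<and> finite I then 1 else 0" by auto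

lift_definition sc :: "'a::comm_ring_1 \<Rightarrow> 'a ext \<Rightarrow> 'a ext" is "\<lambda>c x K. c * x K" by auto

instantiation ext :: (comm_ring_1) "{zero, plus, uminus, minus, one, times}"
begin
lift_definition zero_ext :: "'a ext" is "\<lambda>_. 0" by auto
lift_definition plus_ext :: "'a ext \<Rightarrow> 'a ext \<Rightarrow> 'a ext" is "\<lambda>x y K. x K + y K" by auto
lift_definition uminus_ext :: "'a ext \<Rightarrow> 'a ext" is "\<lambda>x K. - x K" by auto
lift_definition minus_ext :: "'a ext \<Rightarrow> 'a ext \<Rightarrow> 'a ext" is "\<lambda>x y K. x K - y K" by auto
definition one_ext :: "'a ext" where "one_ext = basis {}"
lift_definition times_ext :: "'a ext \<Rightarrow> 'a ext \<Rightarrow> 'a ext" is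
  "\<lambda>x y K. \<Sum>I\<in>Pow K. sg I (K - I) * (x I * y (K - I))" by auto
instance ..
end

lemma coord_infinite: "infinite K \<Longrightarrow> coord x K = 0"
  by transfer auto

lemmas coord_simps [simp] = zero_ext.rep_eq plus_ext.rep_eq uminus_ext.rep_eq minus_ext.rep_eq sc.rep_eq

lemma coord_basis: "finite I \<Longrightarrow> coord (basis I) K = (if K = I then 1 else 0)"
  by transfer auto

lemmas coord_times = times_ext.rep_eq

lemma coord_one: "coord 1 K = (if K = {} then 1 else 0)"
  by (simp add: one_ext_def coord_basis)

text \<open>Both sides sum over the ordered splittings of K into three parts, weighted with the
  signs of the three pairs of parts, because \<open>sg\<close> is multiplicative over disjoint
  unions in either argument.\<close>

lemma ext_assoc: "(x * y) * z = x * (y * (z :: 'a::comm_ring_1 ext))"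
proof (rule ext_eqI)
  fix K :: "nat set" assume K: "finite K"
  have "coord ((x * y) * z) K = (\<Sum>A\<in>Pow K. \<Sum>I\<in>Pow A. sg A (K - A) * (sg I (A - I) *
      (coord x I * coord y (A - I))) * coord z (K - A))"
    by (simp add: coord_times sum_distrib_left sum_distrib_right mult.assoc)
  also have "\<dots> = (\<Sum>(A, I)\<in>Sigma (Pow K) Pow. sg A (K - A) * (sg I (A - I) *
      (coord x I * coord y (A - I))) * coord z (K - A))"
    using K by (subst sum.Sigma) (auto intro: finite_subset)
  also have "\<dots> = (\<Sum>(I, B)\<in>Sigma (Pow K) (\<lambda>I. Pow (K - I)). sg I (K - I) * (coord x I *
      (sg B (K - I - B) * (coord y B * coord z (K - I - B)))))"
  proof (rule sum.reindex_bij_witness[of _ "\<lambda>(I, B). (I \<union> B, I)" "\<lambda>(A, I). (I, A - I)"], goal_cases)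
    case (5 p)
    obtain A I where p: "p = (A, I)" by (cases p)
    with 5 have sub: "A \<subseteq> K" "I \<subseteq> A" by auto
    then have fin: "finite A" "finite I" "finite (A - I)" "finite (K - A)"
      using K by (auto intro: finite_subset)
    have eq: "K - I - (A - I) = K - A" "K - I = (A - I) \<union> (K - A)" "A = I \<union> (A - I)" using sub by auto
    have "sg I (K - I) = sg I (A - I) * (sg I (K - A) :: 'a)"
      unfolding eq(2) by (rule sg_union_right) (use fin in auto)
    moreover have "sg A (K - A) = sg I (K - A) * (sg (A - I) (K - A) :: 'a)"
      using sg_union_left[of I "A - I" "K - A"] fin sub by (metis Diff_disjoint eq(3))
    ultimately show ?case by (simp add: p eq(1) algebra_simps)
  qed auto
  also have "\<dots> = (\<Sum>I\<in>Pow K. \<Sum>B\<in>Pow (K - I). sg I (K - I) * (coord x I *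
      (sg B (K - I - B) * (coord y B * coord z (K - I - B)))))"
    using K by (subst sum.Sigma) (auto intro: finite_subset)
  also have "\<dots> = coord (x * (y * z)) K"
    by (simp add: coord_times sum_distrib_left mult.assoc)
  finally show "coord ((x * y) * z) K = coord (x * (y * z)) K" .
qed

lemma ext_one_left: "1 * x = (x :: 'a::comm_ring_1 ext)"
proof (rule ext_eqI)
  fix K :: "nat set" assume K: "finite K"
  have "coord (1 * x) K = (\<Sum>I\<in>{{}}. sg I (K - I) * (coord 1 I * coord x (K - I)))"
    unfolding coord_times using K by (intro sum.mono_neutral_right) (auto simp: coord_one)
  then show "coord (1 * x) K = coord x K" by (simp add: coord_one)
qed

lemma ext_one_right: "x * 1 = (x :: 'a::comm_ring_1 ext)"
proof (rule ext_eqI)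
  fix K :: "nat set" assume K: "finite K"
  have "coord (x * 1) K = (\<Sum>I\<in>{K}. sg I (K - I) * (coord x I * coord 1 (K - I)))"
    unfolding coord_times using K by (intro sum.mono_neutral_right) (auto simp: coord_one)
  then show "coord (x * 1) K = coord x K" by (simp add: coord_one)
qed

instance ext :: (comm_ring_1) ring_1
proof
  fix x y z :: "'a ext"
  show "(x * y) * z = x * (y * z)" by (rule ext_assoc)
  show "1 * x = x" "x * 1 = x" by (rule ext_one_left ext_one_right)+
  show "(x + y) * z = x * z + y * z" "x * (y + z) = x * y + x * z"
    by (rule ext_eqI, simp add: coord_times algebra_simps sum.distrib)+
  show "(0 :: 'a ext) \<noteq> 1"
  proof
    assume "(0 :: 'a ext) = 1"
    then have "coord (0 :: 'a ext) {} = coord 1 {}" by simp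
    then show False by (simp add: coord_one)
  qed
qed (rule ext_eqI, simp)+

lemma coord_sum: "coord (sum f A) K = (\<Sum>a\<in>A. coord (f a) K)"
  by (induction A rule: infinite_finite_induct) auto

lemma sc_mult_left: "sc c x * y = sc c (x * y)"
  by (rule ext_eqI) (simp add: coord_times sum_distrib_left algebra_simps)

lemma sc_mult_right: "x * sc c y = sc c (x * y)"
  by (rule ext_eqI) (simp add: coord_times sum_distrib_left algebra_simps)

lemma sc_sc [simp]: "sc a (sc b x) = sc (a * b) x"
  by (rule ext_eqI) (simp add: algebra_simps)

lemma sc_one [simp]: "sc 1 x = x" and sc_zero [simp]: "sc 0 x = 0" "sc c 0 = 0"
  and sc_minus_one [simp]: "sc (- 1) x = - x"
  by (rule ext_eqI, simp)+

lemma sc_add: "sc (a + b) x = sc a x + sc b x" "sc a (x + y) = sc a x + sc a y"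
  by (rule ext_eqI, simp add: algebra_simps)+

lemma sc_uminus: "sc (- a) x = - sc a x" "sc a (- x) = - sc a x"
  by (rule ext_eqI, simp add: algebra_simps)+

lemma sc_sum: "sc c (sum f A) = (\<Sum>a\<in>A. sc c (f a))"
  by (rule ext_eqI) (simp add: coord_sum sum_distrib_left)

lemma basis_mult:
  assumes "finite I" "finite J"
  shows "basis I * basis J = (if I \<inter> J = {} then sc (sg I J) (basis (I \<union> J)) else (0 :: 'a::comm_ring_1 ext))"
proof (rule ext_eqI)
  fix K :: "nat set" assume K: "finite K"
  have *: "coord (basis I * basis J :: 'a ext) K =
      (\<Sum>L\<in>Pow K. if L = I \<and> K - L = J then sg L (K - L) else 0)"
    unfolding coord_times using assms by (intro sum.cong) (auto simp: coord_basis)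
  show "coord (basis I * basis J) K = coord (if I \<inter> J = {} then sc (sg I J) (basis (I \<union> J)) else (0 :: 'a ext)) K"
  proof (cases "I \<inter> J = {} \<and> K = I \<union> J")
    case True
    then have "coord (basis I * basis J :: 'a ext) K = (\<Sum>L\<in>{I}. if L = I \<and> K - L = J then sg L (K - L) else 0)"
      unfolding * using K by (intro sum.mono_neutral_right) auto
    moreover have "K - I = J" using True by auto
    ultimately show ?thesis using True assms by (simp add: coord_basis)
  next
    case False
    then have "coord (basis I * basis J :: 'a ext) K = 0"
      unfolding * by (intro sum.neutral) auto
    with False assms show ?thesis by (auto simp: coord_basis)
  qed
qed

lemma ext_expand:
  assumes "finite F" "\<And>I. coord x I \<noteq> 0 \<Longrightarrow> I \<in> F"
  shows "x = (\<Sum>I\<in>F. sc (coord x I) (basis I))"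
proof (rule ext_eqI)
  fix K :: "nat set" assume K: "finite K"
  have "coord (\<Sum>I\<in>F. sc (coord x I) (basis I)) K = (\<Sum>I\<in>F. coord x I * (if I = K then 1 else 0))"
    unfolding coord_sum using K by (intro sum.cong) (auto simp: coord_basis basis.rep_eq coord_infinite)
  also have "\<dots> = (if K \<in> F then coord x K else 0)"
    using assms(1) by (simp add: if_distrib[of "\<lambda>c. _ * c"] cong: if_cong)
  finally show "coord x K = coord (\<Sum>I\<in>F. sc (coord x I) (basis I)) K"
    using assms(2) by auto
qed

section \<open>Homogeneous elements\<close>

definition lambda_space :: "nat \<Rightarrow> nat \<Rightarrow> 'a::comm_ring_1 ext set" where
  "lambda_space n m = {x. \<forall>I. coord x I \<noteq> 0 \<longrightarrow> I \<in> msubsets n m}"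

definition lambda_all :: "nat \<Rightarrow> 'a::comm_ring_1 ext set" where
  "lambda_all n = {x. \<forall>I. coord x I \<noteq> 0 \<longrightarrow> I \<subseteq> {..<n}}"

lemma finite_msubsets [simp]: "finite (msubsets n m)"
  by (rule finite_subset[of _ "Pow {..<n}"]) (auto simp: msubsets_def)

lemma msubsets_finite: "I \<in> msubsets n m \<Longrightarrow> finite I"
  by (auto simp: msubsets_def intro: finite_subset)

lemma lambda_space_iff: "x \<in> lambda_space n m \<longleftrightarrow> (\<forall>I. I \<notin> msubsets n m \<longrightarrow> coord x I = 0)"
  by (auto simp: lambda_space_def)

lemma lambda_all_iff: "x \<in> lambda_all n \<longleftrightarrow> (\<forall>I. \<not> I \<subseteq> {..<n} \<longrightarrow> coord x I = 0)"
  by (auto simp: lambda_all_def)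

lemma lambda_space_zero [simp]: "0 \<in> lambda_space n m"
  and lambda_space_add: "x \<in> lambda_space n m \<Longrightarrow> y \<in> lambda_space n m \<Longrightarrow> x + y \<in> lambda_space n m"
  and lambda_space_sc: "x \<in> lambda_space n m \<Longrightarrow> sc c x \<in> lambda_space n m"
  by (simp_all add: lambda_space_iff)

lemma lambda_space_sum: "(\<And>a. a \<in> A \<Longrightarrow> f a \<in> lambda_space n m) \<Longrightarrow> sum f A \<in> lambda_space n m"
  by (induction A rule: infinite_finite_induct) (auto intro: lambda_space_add)

lemma lambda_all_zero [simp]: "0 \<in> lambda_all n"
  and lambda_all_add: "x \<in> lambda_all n \<Longrightarrow> y \<in> lambda_all n \<Longrightarrow> x + y \<in> lambda_all n"
  and lambda_all_sc: "x \<in> lambda_all n \<Longrightarrow> sc c x \<in> lambda_all n"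
  by (simp_all add: lambda_all_iff)

lemma lambda_all_sum: "(\<And>a. a \<in> A \<Longrightarrow> f a \<in> lambda_all n) \<Longrightarrow> sum f A \<in> lambda_all n"
  by (induction A rule: infinite_finite_induct) (auto intro: lambda_all_add)

lemma lambda_all_times: "x \<in> lambda_all n \<Longrightarrow> y \<in> lambda_all n \<Longrightarrow> x * y \<in> lambda_all n"
proof -
  assume a: "x \<in> lambda_all n" "y \<in> lambda_all n"
  { fix K assume "coord (x * y) K \<noteq> 0"
    then obtain I where "I \<in> Pow K" "sg I (K - I) * (coord x I * coord y (K - I)) \<noteq> 0"
      unfolding coord_times by (metis (no_types, lifting) sum.neutral)
    then have "coord x I \<noteq> 0" "coord y (K - I) \<noteq> 0" by auto
    then have "I \<subseteq> {..<n}" "K - I \<subseteq> {..<n}" using a by (simp_all add: lambda_all_def)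
    then have "K \<subseteq> {..<n}" by blast }
  then show ?thesis by (auto simp: lambda_all_def)
qed

lemma lambda_all_one [simp]: "1 \<in> lambda_all n"
  by (auto simp: lambda_all_def coord_one split: if_splits)

lemma lambda_all_basis: "I \<subseteq> {..<n} \<Longrightarrow> basis I \<in> lambda_all n"
  by (auto simp: lambda_all_def basis.rep_eq split: if_splits)

lemma lambda_space_subset_all: "x \<in> lambda_space n m \<Longrightarrow> x \<in> lambda_all n"
  by (auto simp: lambda_space_def lambda_all_def msubsets_def)

lemma lambda_space_times:
  assumes "x \<in> lambda_space n a" "y \<in> lambda_space n b"
  shows "x * y \<in> lambda_space n (a + b)"
proof -
  { fix K assume *: "coord (x * y) K \<noteq> 0"
    then have K: "finite K" using coord_infinite by blast
    from * obtain I where I: "I \<in> Pow K" "sg I (K - I) * (coord x I * coord y (K - I)) \<noteq> 0"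
      unfolding coord_times by (metis (no_types, lifting) sum.neutral)
    then have "coord x I \<noteq> 0" "coord y (K - I) \<noteq> 0" by auto
    with assms have *: "I \<subseteq> {..<n}" "K - I \<subseteq> {..<n}" "card I = a" "card (K - I) = b"
      by (auto simp: lambda_space_def msubsets_def)
    then have "K \<subseteq> {..<n}" by blast
    moreover have "card K = a + b" using * I K
      by (metis PowD add.commute card_Diff_subset card_mono finite_subset le_add_diff_inverse2)
    ultimately have "K \<in> msubsets n (a + b)" by (simp add: msubsets_def) }
  then show ?thesis by (auto simp: lambda_space_def)
qed

lemma basis_in_lambda_space [intro]: "I \<in> msubsets n m \<Longrightarrow> basis I \<in> lambda_space n m"
  by (auto simp: lambda_space_def basis.rep_eq split: if_splits)

lemma lambda_space_expand: "x \<in> lambda_space n m \<Longrightarrow> x = (\<Sum>I\<in>msubsets n m. sc (coord x I) (basis I))"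
  by (rule ext_expand) (auto simp: lambda_space_def)

lemma lambda_all_expand: "x \<in> lambda_all n \<Longrightarrow> x = (\<Sum>I\<in>Pow {..<n}. sc (coord x I) (basis I))"
  by (rule ext_expand) (auto simp: lambda_all_def)

lemma basis_coord_zero: "x \<in> lambda_space n m \<Longrightarrow> I \<notin> msubsets n m \<Longrightarrow> coord x I = 0"
  by (auto simp: lambda_space_def)

lemma lambda_spaceD: "x \<in> lambda_space n m \<Longrightarrow> coord x I \<noteq> 0 \<Longrightarrow> I \<in> msubsets n m"
  by (auto simp: lambda_space_def)

section \<open>Vectors of degree one and products of anticommuting families\<close>

definition evec :: "nat \<Rightarrow> (nat \<Rightarrow> 'a::comm_ring_1) \<Rightarrow> 'a ext" where
  "evec n a = (\<Sum>i<n. sc (a i) (basis {i}))"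

lemma evec_in: "evec n a \<in> lambda_space n 1"
  unfolding evec_def by (intro lambda_space_sum lambda_space_sc basis_in_lambda_space) (auto simp: msubsets_def)

lemma coord_evec: "coord (evec n a) {i} = (if i < n then a i else 0)"
  by (simp add: evec_def coord_sum coord_basis if_distrib[of "\<lambda>c. _ * c"] eq_commute[of i] cong: if_cong)

lemma basis_anticommute: "i \<noteq> j \<Longrightarrow> basis {i} * basis {j} = - (basis {j} * basis {i} :: 'a::comm_ring_1 ext)"
proof -
  assume "i \<noteq> j"
  then have "sg {i} {j} = - (sg {j} {i} :: 'a)"
    by (subst sg_swap[of "{j}" "{i}"]) auto
  with \<open>i \<noteq> j\<close> show ?thesis by (simp add: basis_mult insert_commute sc_uminus)
qed

lemma basis_square: "finite I \<Longrightarrow> I \<noteq> {} \<Longrightarrow> basis I * basis I = (0 :: 'a::comm_ring_1 ext)"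
  by (simp add: basis_mult)

lemma evec_anticommute: "evec n a * evec n b = - (evec n b * evec n a)"
proof -
  have *: "basis {i} * basis {j} = - (basis {j} * basis {i} :: 'a ext)" for i j :: nat
    by (cases "i = j") (simp add: basis_square, rule basis_anticommute)
  have "evec n a * evec n b = (\<Sum>i<n. \<Sum>j<n. sc (a i * b j) (basis {i} * basis {j}))"
    by (simp add: evec_def sum_distrib_left sum_distrib_right sc_mult_left sc_mult_right sc_sum algebra_simps)
       (subst sum.swap, simp)
  also have "\<dots> = - (\<Sum>i<n. \<Sum>j<n. sc (b j * a i) (basis {j} * basis {i}))"
    by (subst *) (simp add: sum_negf sc_uminus mult.commute)
  also have "(\<Sum>i<n. \<Sum>j<n. sc (b j * a i) (basis {j} * basis {i})) = evec n b * evec n a"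
    by (simp add: evec_def sum_distrib_left sum_distrib_right sc_mult_left sc_mult_right sc_sum algebra_simps)
  finally show ?thesis .
qed

text \<open>Anticommutation of the vector with itself gives only that twice the square vanishes, so
  a separate argument is made: the cross terms with each new generator cancel.\<close>

lemma evec_square: "evec n a * evec n a = 0"
proof (induction n)
  case (Suc n)
  have "evec n a * basis {n} = - (basis {n} * evec n a)"
    by (simp add: evec_def sum_distrib_left sum_distrib_right sc_mult_left sc_mult_right sum_negf[symmetric] basis_anticommute[of _ n] sc_uminus)
  then show ?case using Suc
    by (simp add: evec_def algebra_simps sc_mult_left sc_mult_right basis_square sc_uminus)
qed (simp add: evec_def)

text \<open>The defining relations of an exterior algebra, imposed on an arbitrary family in place
  of the generators.\<close>

definition anti :: "nat set \<Rightarrow> (nat \<Rightarrow> 'a::comm_ring_1 ext) \<Rightarrow> bool" where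
  "anti S v \<longleftrightarrow> (\<forall>i\<in>S. \<forall>j\<in>S. v i * v j = - (v j * v i) \<and> v i * v i = 0)"

lemma anti_mono: "anti S v \<Longrightarrow> T \<subseteq> S \<Longrightarrow> anti T v"
  unfolding anti_def by blast

lemma antiD: "anti S v \<Longrightarrow> i \<in> S \<Longrightarrow> j \<in> S \<Longrightarrow> v i * v j = - (v j * v i)"
  and anti_square: "anti S v \<Longrightarrow> i \<in> S \<Longrightarrow> v i * v i = 0"
  unfolding anti_def by blast+

definition oprod :: "(nat \<Rightarrow> 'a::comm_ring_1 ext) \<Rightarrow> nat set \<Rightarrow> 'a ext" where
  "oprod v I = prod_list (map v (sorted_list_of_set I))"

lemma oprod_empty [simp]: "oprod v {} = 1"
  by (simp add: oprod_def)

lemma oprod_insert_less: "finite J \<Longrightarrow> (\<And>j. j \<in> J \<Longrightarrow> i < j) \<Longrightarrow> oprod v (insert i J) = v i * oprod v J"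
proof -
  assume a: "finite J" "\<And>j. j \<in> J \<Longrightarrow> i < j"
  then have "i \<notin> J" by auto
  then have "sorted_list_of_set (insert i J) = insort i (sorted_list_of_set J)"
    using a(1) by (simp add: sorted_list_of_set_insert_remove)
  also have "\<dots> = i # sorted_list_of_set J"
    using a by (intro insort_is_Cons) (auto intro: less_imp_le)
  finally show ?thesis by (simp add: oprod_def)
qed

text \<open>A new minimum prepends a factor to an ordered product without any sign, hence an
  induction from below.\<close>

lemma finite_min_induct [consumes 1, case_names empty insert]:
  fixes J :: "nat set"
  assumes "finite J" "P {}"
    "\<And>i J. finite J \<Longrightarrow> (\<And>j. j \<in> J \<Longrightarrow> i < j) \<Longrightarrow> P J \<Longrightarrow> P (insert i J)"
  shows "P J"
proof -
  have "P J" if "card J = k" "finite J" for k J using that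
  proof (induction k arbitrary: J)
    case 0 then show ?case using assms(2) by simp
  next
    case (Suc k)
    then have ne: "J \<noteq> {}" by auto
    have "P (insert (Min J) (J - {Min J}))"
    proof (rule assms(3))
      show "finite (J - {Min J})" using Suc by simp
      show "Min J < j" if "j \<in> J - {Min J}" for j
        using that Suc.prems by (metis DiffD1 DiffD2 Min_le insertI1 le_neq_implies_less)
      show "P (J - {Min J})" using Suc ne by (intro Suc.IH) auto
    qed
    then show ?case using Suc.prems ne by (simp add: insert_absorb)
  qed
  then show ?thesis using assms(1) by blast
qed

text \<open>The factor \<open>v i\<close> moves to the right past the factors of smaller index, with
  one sign for each; these are exactly the pairs counted by \<open>sg {i} J\<close>.\<close>

lemma oprod_left_mult:
  assumes "finite J" "anti (insert i J) v"
  shows "v i * oprod v J = (if i \<in> J then 0 else sc (sg {i} J) (oprod v (insert i J)))"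
  using assms
proof (induction J rule: finite_min_induct)
  case empty
  show ?case by (simp add: oprod_def)
next
  case (insert j J)
  have IH: "v i * oprod v J = (if i \<in> J then 0 else sc (sg {i} J) (oprod v (insert i J)))"
    by (rule insert.IH) (use insert.prems in \<open>auto elim!: anti_mono\<close>)
  have vj: "oprod v (insert j J) = v j * oprod v J"
    using insert by (intro oprod_insert_less) auto
  consider "i < j" | "i = j" | "j < i" by linarith
  then show ?case
  proof cases
    case 1
    then have l: "\<And>l. l \<in> insert j J \<Longrightarrow> i < l" using insert(2) by force
    then have "oprod v (insert i (insert j J)) = v i * oprod v (insert j J)"
      using insert(1) by (intro oprod_insert_less) auto
    moreover have "sg {i} (insert j J) = (1 :: 'a)" using l by (intro sg_singleton_less) force
    ultimately show ?thesis using l by auto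
  next
    case 2
    then have "v i * v j = 0" using anti_square[OF insert.prems, of i] by simp
    then show ?thesis using 2 by (simp add: vj flip: mult.assoc)
  next
    case 3
    have "v i * v j = - (v j * v i)" by (rule antiD[OF insert.prems]) simp_all
    then have "(v i * v j) * oprod v J = - (v j * v i) * oprod v J" by (rule arg_cong)
    then have "v i * oprod v (insert j J) = - (v j * (v i * oprod v J))"
      by (simp add: vj mult.assoc)
    also have "\<dots> = (if i \<in> J then 0 else - sc (sg {i} J) (v j * oprod v (insert i J)))"
      by (simp add: IH sc_mult_right)
    also have "v j * oprod v (insert i J) = oprod v (insert j (insert i J))"
      using insert 3 by (intro oprod_insert_less[symmetric]) auto
    finally have *: "v i * oprod v (insert j J) =
       (if i \<in> J then 0 else - sc (sg {i} J) (oprod v (insert j (insert i J))))" .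
    have "sg {i} ({j} \<union> J) = sg {i} {j} * (sg {i} J :: 'a)"
      using insert(1,2) by (intro sg_union_right) auto
    moreover have "sg {j} {i} = (1 :: 'a)" using 3 by (intro sg_singleton_less) simp
    then have "sg {i} {j} = (-1 :: 'a)" using 3 sg_swap[of "{j}" "{i}", where 'a = 'a] by simp
    ultimately have "sg {i} (insert j J) = - (sg {i} J :: 'a)" by simp
    then show ?thesis using * 3 by (auto simp: insert_commute sc_uminus)
  qed
qed

text \<open>The multiplication table of \<open>basis_mult\<close> holds for any anticommuting
  family. This is the universal property of the exterior algebra in coordinates, and it makes
  \<open>Lam\<close> multiplicative.\<close>

lemma oprod_mult:
  assumes "finite I" "finite J" "anti (I \<union> J) v"
  shows "oprod v I * oprod v J = (if I \<inter> J = {} then sc (sg I J) (oprod v (I \<union> J)) else 0)"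
  using assms
proof (induction I rule: finite_min_induct)
  case empty
  then show ?case by simp
next
  case (insert i I)
  have IH: "oprod v I * oprod v J = (if I \<inter> J = {} then sc (sg I J) (oprod v (I \<union> J)) else 0)"
    by (rule insert.IH) (use insert.prems in \<open>auto elim!: anti_mono\<close>)
  have "oprod v (insert i I) = v i * oprod v I"
    using insert by (intro oprod_insert_less) auto
  then have "oprod v (insert i I) * oprod v J = v i * (oprod v I * oprod v J)"
    by (simp add: mult.assoc)
  also have "\<dots> = (if I \<inter> J = {} then sc (sg I J) (v i * oprod v (I \<union> J)) else 0)"
    by (simp add: IH sc_mult_right)
  also have "v i * oprod v (I \<union> J) = (if i \<in> I \<union> J then 0 else sc (sg {i} (I \<union> J)) (oprod v (insert i (I \<union> J))))"
    using insert(1) insert.prems by (intro oprod_left_mult) (auto elim!: anti_mono)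
  finally have *: "oprod v (insert i I) * oprod v J =
     (if I \<inter> J = {} \<and> i \<notin> J then sc (sg I J * sg {i} (I \<union> J)) (oprod v (insert i (I \<union> J))) else 0)"
    using insert(2) by (auto split: if_splits)
  show ?case
  proof (cases "I \<inter> J = {} \<and> i \<notin> J")
    case True
    have "sg {i} (I \<union> J) = sg {i} I * (sg {i} J :: 'a)"
      using insert True by (intro sg_union_right) auto
    also have "sg {i} I = (1 :: 'a)" using insert(2) by (intro sg_singleton_less) force
    finally have "sg {i} (I \<union> J) = (sg {i} J :: 'a)" by simp
    moreover have "sg ({i} \<union> I) J = sg {i} J * (sg I J :: 'a)"
      using insert True by (intro sg_union_left) auto
    ultimately show ?thesis unfolding * using True by (simp add: mult.commute)
  next
    case False
    then show ?thesis unfolding * by auto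
  qed
qed

lemma oprod_basis: "finite I \<Longrightarrow> oprod (\<lambda>i. basis {i}) I = basis I"
proof (induction I rule: finite_min_induct)
  case empty show ?case by (simp add: one_ext_def)
next
  case (insert i I)
  then show ?case
    by (subst oprod_insert_less) (auto simp: basis_mult sg_singleton_less less_imp_le)
qed

lemma prod_list_in_lambda_space:
  assumes "\<And>x. x \<in> set xs \<Longrightarrow> x \<in> lambda_space n m"
  shows "prod_list xs \<in> lambda_space n (length xs * m)"
  using assms
proof (induction xs)
  case Nil
  show ?case by (auto simp: lambda_space_def coord_one msubsets_def split: if_splits)
next
  case (Cons x xs)
  then show ?case using lambda_space_times[of x n m "prod_list xs" "length xs * m"] by simp
qed

lemma oprod_in: "finite I \<Longrightarrow> (\<And>i. i \<in> I \<Longrightarrow> v i \<in> lambda_space n 1) \<Longrightarrow> oprod v I \<in> lambda_space n (card I)"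
  using prod_list_in_lambda_space[of "map v (sorted_list_of_set I)" n 1]
  by (auto simp: oprod_def)

section \<open>The action of matrices on the exterior algebra\<close>

definition cvec :: "'a::comm_ring_1 mat \<Rightarrow> nat \<Rightarrow> 'a ext" where
  "cvec A j = evec (dim_row A) (\<lambda>i. A $$ (i, j))"

text \<open>The algebra endomorphism induced by A. Coordinates at sets that reach beyond
  \<open>dim_row A\<close> are dropped, so the identity matrix acts as the identity only on
  \<open>lambda_all\<close>.\<close>

definition Lam :: "'a::comm_ring_1 mat \<Rightarrow> 'a ext \<Rightarrow> 'a ext" where
  "Lam A x = (\<Sum>I\<in>Pow {..<dim_row A}. sc (coord x I) (oprod (cvec A) I))"

lemma Lam_add: "Lam A (x + y) = Lam A x + Lam A y"
  by (simp add: Lam_def sc_add sum.distrib)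

lemma Lam_sc: "Lam A (sc c x) = sc c (Lam A x)"
  by (simp add: Lam_def sc_sum)

lemma Lam_zero [simp]: "Lam A 0 = 0"
  by (simp add: Lam_def)

lemma Lam_sum: "Lam A (sum f S) = (\<Sum>s\<in>S. Lam A (f s))"
  by (induction S rule: infinite_finite_induct) (auto simp: Lam_add)

lemma Lam_basis: "I \<subseteq> {..<dim_row A} \<Longrightarrow> Lam A (basis I) = oprod (cvec A) I"
proof -
  assume I: "I \<subseteq> {..<dim_row A}"
  then have "finite I" by (rule finite_subset) simp
  then have "Lam A (basis I) = (\<Sum>J\<in>{I}. sc (coord (basis I) J) (oprod (cvec A) J))"
    unfolding Lam_def using I by (intro sum.mono_neutral_right) (auto simp: coord_basis)
  with \<open>finite I\<close> show ?thesis by (simp add: coord_basis)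
qed

lemma anti_cvec: "anti S (cvec A)"
  unfolding anti_def cvec_def by (metis evec_anticommute evec_square)

lemma Lam_one: "Lam A 1 = 1"
  by (simp add: one_ext_def Lam_basis oprod_def)

lemma Lam_times:
  assumes "x \<in> lambda_all (dim_row A)" "y \<in> lambda_all (dim_row A)"
  shows "Lam A (x * y) = Lam A x * Lam A y"
proof -
  let ?n = "dim_row A"
  have b: "Lam A (basis I * basis J) = Lam A (basis I) * Lam A (basis J)"
    if "I \<in> Pow {..<?n}" "J \<in> Pow {..<?n}" for I J
  proof -
    have "finite I" "finite J" using that by (auto intro: finite_subset)
    then show ?thesis using that
      by (simp add: basis_mult Lam_basis Lam_sc oprod_mult[OF _ _ anti_cvec])
  qed
  have "Lam A (x * y) = Lam A ((\<Sum>I\<in>Pow {..<?n}. sc (coord x I) (basis I)) * (\<Sum>J\<in>Pow {..<?n}. sc (coord y J) (basis J)))"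
    using lambda_all_expand[OF assms(1)] lambda_all_expand[OF assms(2)] by simp
  also have "\<dots> = (\<Sum>I\<in>Pow {..<?n}. \<Sum>J\<in>Pow {..<?n}. sc (coord x I * coord y J) (Lam A (basis I) * Lam A (basis J)))"
    by (simp add: sum_distrib_left sum_distrib_right sc_mult_left sc_mult_right sc_sum Lam_sum Lam_sc b mult.commute)
       (subst sum.swap, simp)
  also have "\<dots> = Lam A (\<Sum>I\<in>Pow {..<?n}. sc (coord x I) (basis I)) * Lam A (\<Sum>J\<in>Pow {..<?n}. sc (coord y J) (basis J))"
    by (simp add: sum_distrib_left sum_distrib_right sc_mult_left sc_mult_right sc_sum Lam_sum Lam_sc mult.commute)
       (subst sum.swap, simp)
  also have "\<dots> = Lam A x * Lam A y"
    using lambda_all_expand[OF assms(1)] lambda_all_expand[OF assms(2)] by simp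
  finally show ?thesis .
qed

lemma cvec_in: "cvec A j \<in> lambda_space (dim_row A) 1"
  unfolding cvec_def by (rule evec_in)

lemma Lam_in: "x \<in> lambda_space (dim_row A) m \<Longrightarrow> Lam A x \<in> lambda_space (dim_row A) m"
proof -
  assume x: "x \<in> lambda_space (dim_row A) m"
  have "sc (coord x I) (oprod (cvec A) I) \<in> lambda_space (dim_row A) m" if "I \<subseteq> {..<dim_row A}" for I
  proof (cases "coord x I = 0")
    case False
    then have "card I = m" "finite I" using x that by (auto simp: lambda_space_def msubsets_def intro: finite_subset)
    then show ?thesis using oprod_in[of I "cvec A" "dim_row A"] cvec_in by (auto intro: lambda_space_sc)
  qed simp
  then show ?thesis unfolding Lam_def by (intro lambda_space_sum) auto
qed

lemma lambda_all_prod_list: "set xs \<subseteq> lambda_all n \<Longrightarrow> prod_list xs \<in> lambda_all n"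
  by (induction xs) (simp_all add: lambda_all_times)

lemma Lam_prod_list: "set xs \<subseteq> lambda_all (dim_row A) \<Longrightarrow> Lam A (prod_list xs) = prod_list (map (Lam A) xs)"
  by (induction xs) (simp_all add: Lam_one Lam_times lambda_all_prod_list)

lemma Lam_basis1: "j < dim_row A \<Longrightarrow> Lam A (basis {j}) = cvec A j"
  by (simp add: Lam_basis oprod_def)

lemma Lam_evec: "Lam A (evec (dim_row A) a) = (\<Sum>j<dim_row A. sc (a j) (cvec A j))"
  by (simp add: evec_def Lam_sum Lam_sc Lam_basis1)

lemma Lam_cvec:
  assumes "A \<in> carrier_mat n n" "B \<in> carrier_mat n n" "j < n"
  shows "Lam A (cvec B j) = cvec (A * B) j"
proof -
  have "Lam A (cvec B j) = (\<Sum>k<n. sc (B $$ (k, j)) (cvec A k))"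
    using Lam_evec[of A] assms by (simp add: cvec_def)
  also have "\<dots> = (\<Sum>i<n. sc (\<Sum>k<n. A $$ (i, k) * B $$ (k, j)) (basis {i}))"
  proof -
    have s: "sc (\<Sum>k<n. f k) x = (\<Sum>k<n. sc (f k) x)" for f and x :: "'a ext"
      by (induction n) (auto simp: sc_add)
    show ?thesis using assms(1) unfolding s
      by (simp add: cvec_def evec_def sc_sum mult.commute) (rule sum.swap)
  qed
  also have "\<dots> = cvec (A * B) j"
    using assms by (simp add: cvec_def evec_def scalar_prod_def lessThan_atLeast0)
  finally show ?thesis .
qed

lemma Lam_mult:
  assumes "A \<in> carrier_mat n n" "B \<in> carrier_mat n n"
  shows "Lam A (Lam B x) = Lam (A * B) x"
proof -
  have "Lam A (oprod (cvec B) I) = oprod (cvec (A * B)) I" if "I \<subseteq> {..<n}" for I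
  proof -
    have fin: "finite I" using that by (rule finite_subset) simp
    have "Lam A (oprod (cvec B) I) = prod_list (map (Lam A) (map (cvec B) (sorted_list_of_set I)))"
      unfolding oprod_def
      using assms cvec_in[of B] by (intro Lam_prod_list) (auto intro: lambda_space_subset_all)
    also have "map (Lam A) (map (cvec B) (sorted_list_of_set I)) = map (cvec (A * B)) (sorted_list_of_set I)"
      using that fin assms by (auto simp: Lam_cvec)
    finally show ?thesis by (simp add: oprod_def)
  qed
  then show ?thesis
    using assms by (simp add: Lam_def[of B] Lam_sum Lam_sc) (simp add: Lam_def)
qed

lemma cvec_one: "j < n \<Longrightarrow> cvec (1\<^sub>m n) j = basis {j}"
  by (simp add: cvec_def evec_def if_distrib[of "\<lambda>c. sc c _"] cong: if_cong)

lemma Lam_id: "x \<in> lambda_all n \<Longrightarrow> Lam (1\<^sub>m n) x = x"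
proof -
  assume x: "x \<in> lambda_all n"
  have "oprod (cvec (1\<^sub>m n)) I = (basis I :: 'a ext)" if "I \<subseteq> {..<n}" for I
  proof -
    have "finite I" using that by (rule finite_subset) simp
    then have "oprod (cvec (1\<^sub>m n)) I = (oprod (\<lambda>i. basis {i}) I :: 'a ext)"
      unfolding oprod_def using that by (intro arg_cong[where f = prod_list] map_cong) (auto simp: cvec_one)
    with \<open>finite I\<close> show ?thesis by (simp add: oprod_basis)
  qed
  then show ?thesis using lambda_all_expand[OF x] by (simp add: Lam_def)
qed

section \<open>Similitudes and the Pluecker relations\<close>

lemma msubsets_iff: "I \<in> msubsets n m \<longleftrightarrow> finite I \<and> I \<subseteq> {..<n} \<and> card I = m"
  by (auto simp: msubsets_def intro: finite_subset)

definition lin :: "('a::comm_ring_1 ext \<Rightarrow> 'a ext) \<Rightarrow> bool" where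
  "lin T \<longleftrightarrow> (\<forall>x y. T (x + y) = T x + T y) \<and> (\<forall>c x. T (sc c x) = sc c (T x))"

lemma lin_add: "lin T \<Longrightarrow> T (x + y) = T x + T y"
  and lin_sc: "lin T \<Longrightarrow> T (sc c x) = sc c (T x)"
  by (auto simp: lin_def)

lemma lin_zero: "lin T \<Longrightarrow> T 0 = 0"
  using lin_sc[of T 0 0] by simp

lemma lin_sum: "lin T \<Longrightarrow> T (sum f A) = (\<Sum>a\<in>A. T (f a))"
  by (induction A rule: infinite_finite_induct) (auto simp: lin_add lin_zero)

lemma lin_Lam: "lin (Lam A)"
  by (simp add: lin_def Lam_add Lam_sc)

text \<open>The inverse H is carried along as data because basis vectors are pulled back through G
  again and again. Outside \<open>lambda_space n m\<close> only linearity is required of the two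
  maps.\<close>

definition similitude :: "nat \<Rightarrow> nat \<Rightarrow> ('a::comm_ring_1 ext \<Rightarrow> 'a ext) \<Rightarrow> ('a ext \<Rightarrow> 'a ext) \<Rightarrow> bool" where
  "similitude n m G H \<longleftrightarrow> lin G \<and> lin H \<and>
     (\<forall>x\<in>lambda_space n m. G x \<in> lambda_space n m \<and> H x \<in> lambda_space n m \<and> H (G x) = x \<and> G (H x) = x) \<and>
     (\<exists>c. c dvd 1 \<and> (\<forall>xs. length xs = n div m \<and> set xs \<subseteq> lambda_space n m \<longrightarrow>
        coord (prod_list (map G xs)) {..<n} = c * coord (prod_list xs) {..<n}))"

lemma similitudeD:
  assumes "similitude n m G H"
  shows "lin G" "lin H" "x \<in> lambda_space n m \<Longrightarrow> G x \<in> lambda_space n m"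
    "x \<in> lambda_space n m \<Longrightarrow> H x \<in> lambda_space n m"
    "x \<in> lambda_space n m \<Longrightarrow> H (G x) = x" "x \<in> lambda_space n m \<Longrightarrow> G (H x) = x"
  using assms by (auto simp: similitude_def)

lemma similitude_form:
  assumes "similitude n m G H"
  obtains c where "c dvd 1" "\<And>xs. length xs = n div m \<Longrightarrow> set xs \<subseteq> lambda_space n m \<Longrightarrow>
        coord (prod_list (map G xs)) {..<n} = c * coord (prod_list xs) {..<n}"
  using assms by (auto simp: similitude_def)

lemma similitude_comp:
  assumes "similitude n m G H" "similitude n m G' H'"
  shows "similitude n m (\<lambda>x. G (G' x)) (\<lambda>x. H' (H x))"
proof -
  obtain c where c: "c dvd 1" "\<And>xs. length xs = n div m \<Longrightarrow> set xs \<subseteq> lambda_space n m \<Longrightarrow>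
        coord (prod_list (map G xs)) {..<n} = c * coord (prod_list xs) {..<n}" using similitude_form[OF assms(1)] by blast
  obtain d where d: "d dvd 1" "\<And>xs. length xs = n div m \<Longrightarrow> set xs \<subseteq> lambda_space n m \<Longrightarrow>
        coord (prod_list (map G' xs)) {..<n} = d * coord (prod_list xs) {..<n}" using similitude_form[OF assms(2)] by blast
  have "coord (prod_list (map (\<lambda>x. G (G' x)) xs)) {..<n} = (c * d) * coord (prod_list xs) {..<n}"
    if "length xs = n div m" "set xs \<subseteq> lambda_space n m" for xs
  proof -
    have "coord (prod_list (map G (map G' xs))) {..<n} = c * coord (prod_list (map G' xs)) {..<n}"
      using that similitudeD(3)[OF assms(2)] by (intro c(2)) auto
    then show ?thesis using d(2)[OF that] by (simp add: o_def mult.assoc)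
  qed
  moreover have "(c * d) dvd 1" using mult_dvd_mono[OF c(1) d(1)] by simp
  ultimately show ?thesis
    using similitudeD[OF assms(1)] similitudeD[OF assms(2)] unfolding similitude_def lin_def by (auto intro!: exI[of _ "c * d"])
qed

lemma similitude_inv: assumes "similitude n m G H" shows "similitude n m H G"
proof -
  obtain c where c: "c dvd 1" "\<And>xs. length xs = n div m \<Longrightarrow> set xs \<subseteq> lambda_space n m \<Longrightarrow>
        coord (prod_list (map G xs)) {..<n} = c * coord (prod_list xs) {..<n}" using similitude_form[OF assms] by blast
  then obtain d where d: "c * d = 1" by (metis dvdE)
  have "coord (prod_list (map H xs)) {..<n} = d * coord (prod_list xs) {..<n}"
    if "length xs = n div m" "set xs \<subseteq> lambda_space n m" for xs
  proof -
    have "map G (map H xs) = xs" using similitudeD(6)[OF assms] that by (auto simp: o_def intro!: map_idI)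
    then have "coord (prod_list xs) {..<n} = c * coord (prod_list (map H xs)) {..<n}"
      using c(2)[of "map H xs"] that similitudeD(4)[OF assms] by auto
    then have "d * coord (prod_list xs) {..<n} = (c * d) * coord (prod_list (map H xs)) {..<n}"
      by (simp add: algebra_simps)
    then show ?thesis using d by simp
  qed
  moreover have "d dvd 1" using d by (metis dvd_triv_right)
  ultimately show ?thesis using similitudeD[OF assms] unfolding similitude_def by auto
qed

lemma lambda_space_top: "x \<in> lambda_space n n \<Longrightarrow> x = sc (coord x {..<n}) (basis {..<n})"
proof -
  assume x: "x \<in> lambda_space n n"
  have "I = {..<n}" if "I \<in> msubsets n n" for I
    using that card_subset_eq[of "{..<n}" I] by (simp add: msubsets_def)
  moreover have "{..<n} \<in> msubsets n n" by (simp add: msubsets_def)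
  ultimately have "msubsets n n = {{..<n}}" by blast
  then show ?thesis by (intro trans[OF lambda_space_expand[OF x]]) simp
qed

text \<open>The part of degree n has rank one, so \<open>Lam A\<close> acts there by a scalar, and
  the scalar of \<open>Lam B\<close> is its inverse.\<close>

lemma similitude_Lam:
  assumes "A \<in> carrier_mat n n" "B \<in> carrier_mat n n" "A * B = 1\<^sub>m n" "B * A = 1\<^sub>m n" "m dvd n"
  shows "similitude n m (Lam A) (Lam B)"
proof -
  have AB: "Lam A (Lam B x) = x" "Lam B (Lam A x) = x" if "x \<in> lambda_all n" for x
    using that assms by (simp_all add: Lam_mult Lam_id)
  have full: "basis {..<n} \<in> lambda_space n n" by (auto simp: msubsets_def)
  define c where "c = coord (Lam A (basis {..<n})) {..<n}"
  define d where "d = coord (Lam B (basis {..<n})) {..<n}"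
  have "Lam A (basis {..<n}) = sc c (basis {..<n})" "Lam B (basis {..<n}) = sc d (basis {..<n})"
    unfolding c_def d_def using Lam_in[of _ A n] Lam_in[of _ B n] assms(1,2) full
    by (auto intro!: lambda_space_top)
  then have "sc (d * c) (basis {..<n}) = basis {..<n}"
    using AB(1)[OF lambda_space_subset_all[OF full]] by (simp add: Lam_sc)
  then have "coord (sc (d * c) (basis {..<n})) {..<n} = coord (basis {..<n}) {..<n}" by (rule arg_cong)
  then have "d * c = 1" by (simp add: coord_basis)
  then have "c dvd 1" by (metis dvd_triv_right)
  moreover have "coord (prod_list (map (Lam A) xs)) {..<n} = c * coord (prod_list xs) {..<n}"
    if "length xs = n div m" "set xs \<subseteq> lambda_space n m" for xs
  proof -
    have "prod_list xs \<in> lambda_space n n"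
      using prod_list_in_lambda_space[of xs n m] that assms(5) by auto
    then have "prod_list xs = sc (coord (prod_list xs) {..<n}) (basis {..<n})" by (rule lambda_space_top)
    then have "Lam A (prod_list xs) = sc (coord (prod_list xs) {..<n}) (Lam A (basis {..<n}))" by (metis Lam_sc)
    moreover have "Lam A (prod_list xs) = prod_list (map (Lam A) xs)"
      using that assms(1) by (intro Lam_prod_list) (auto intro: lambda_space_subset_all)
    ultimately show ?thesis by (simp add: c_def)
  qed
  ultimately show ?thesis unfolding similitude_def
    using assms(1,2) lin_Lam[of A] lin_Lam[of B] AB lambda_space_subset_all[of _ n m] Lam_in[of _ A m] Lam_in[of _ B m]
    by auto
qed

lemma prod_list_sc: "prod_list (map (sc c) xs) = sc (c ^ length xs) (prod_list xs)"
  by (induction xs) (simp_all add: sc_mult_left sc_mult_right algebra_simps)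

lemma similitude_sc:
  assumes "c * d = 1"
  shows "similitude n m (sc c) (sc d)"
proof -
  have u: "(c ^ k) dvd 1" for k using assms by (metis dvd_triv_left power_mult_distrib power_one)
  show ?thesis unfolding similitude_def lin_def
    using assms u by (auto simp: sc_add lambda_space_sc mult.commute prod_list_sc intro!: exI[of _ "c ^ (n div m)"])
qed

lemma coord_times_basis:
  assumes "finite C" "finite K"
  shows "coord (w * basis C) K = (if C \<subseteq> K then sg (K - C) C * coord w (K - C) else 0)"
proof -
  have "coord (w * basis C) K = (\<Sum>I\<in>Pow K. if I = K - C \<and> C \<subseteq> K then sg I C * coord w I else 0)"
    unfolding coord_times using assms by (intro sum.cong) (auto simp: coord_basis)
  also have "\<dots> = (if C \<subseteq> K then sg (K - C) C * coord w (K - C) else 0)"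
    using assms by (auto simp: sum.delta')
  finally show ?thesis .
qed

lemma coord_basis_times:
  assumes "finite C" "finite K"
  shows "coord (basis C * w) K = (if C \<subseteq> K then sg C (K - C) * coord w (K - C) else 0)"
proof -
  have "coord (basis C * w) K = (\<Sum>I\<in>Pow K. if I = C then sg C (K - C) * coord w (K - C) else 0)"
    unfolding coord_times using assms by (intro sum.cong) (auto simp: coord_basis)
  also have "\<dots> = (if C \<subseteq> K then sg C (K - C) * coord w (K - C) else 0)"
    using assms by (auto simp: sum.delta')
  finally show ?thesis .
qed

text \<open>The sign of the ordered partition is recorded only through \<open>s * s = 1\<close>,
  which suffices to cancel it later.\<close>

lemma block_partition:
  assumes "finite C" "card C = d * m"
  shows "\<exists>Zs s. length Zs = d \<and> (\<forall>Z\<in>set Zs. Z \<subseteq> C \<and> card Z = m) \<and> s * s = (1 :: 'a::comm_ring_1) \<and>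
     prod_list (map basis Zs) = sc s (basis C)"
  using assms
proof (induction d arbitrary: C)
  case 0
  then show ?case by (intro exI[of _ "[]"] exI[of _ 1]) (auto simp: one_ext_def)
next
  case (Suc d)
  then obtain Z where Z: "Z \<subseteq> C" "card Z = m" "finite Z"
    by (metis le_add1 mult_Suc obtain_subset_with_card_n)
  then have "card (C - Z) = d * m" using Suc.prems by (simp add: card_Diff_subset)
  then obtain Zs and s :: 'a where s: "length Zs = d" "\<forall>W\<in>set Zs. W \<subseteq> C - Z \<and> card W = m" "s * s = 1"
     "prod_list (map basis Zs) = sc s (basis (C - Z))"
    using Suc.IH[of "C - Z"] Suc.prems by auto
  have "Z \<union> (C - Z) = C" using Z by auto
  then have "prod_list (map basis (Z # Zs)) = sc (s * sg Z (C - Z)) (basis C)"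
    using Z Suc.prems by (simp add: s(4) sc_mult_right basis_mult)
  moreover have "(s * sg Z (C - Z)) * (s * sg Z (C - Z)) = 1"
    using s(3) sg_square[of Z "C - Z"] by (metis (no_types, opaque_lifting) mult.assoc mult.commute mult.left_neutral)
  ultimately show ?case using s(1,2) Z by (intro exI[of _ "Z # Zs"] exI[of _ "s * sg Z (C - Z)"]) auto
qed

text \<open>From AB = 1 the determinant of A is a unit and the adjugate of A is (det A) B;
  cancelling det A from (det A) BA = (det A) 1 gives the claim.\<close>

lemma mat_right_inverse:
  assumes A: "(A :: 'a::comm_ring_1 mat) \<in> carrier_mat n n" and B: "B \<in> carrier_mat n n" and AB: "A * B = 1\<^sub>m n"
  shows "B * A = 1\<^sub>m n"
proof -
  have d: "det A * det B = 1" using det_mult[OF A B] AB by simp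
  note adj = adj_mat[OF A]
  have "adj_mat A = adj_mat A * (A * B)" using AB adj(1) by simp
  also have "\<dots> = (adj_mat A * A) * B" using A B adj(1) by (simp add: assoc_mult_mat)
  also have "\<dots> = det A \<cdot>\<^sub>m B" using adj(3) B mult_smult_assoc_mat[of "1\<^sub>m n" n n B n "det A"] by simp
  finally have "adj_mat A = det A \<cdot>\<^sub>m B" .
  then have "det A \<cdot>\<^sub>m (B * A) = det A \<cdot>\<^sub>m 1\<^sub>m n" using adj(3) A B by (metis mult_smult_assoc_mat)
  then have e: "(det A \<cdot>\<^sub>m (B * A)) $$ (i, j) = (det A \<cdot>\<^sub>m 1\<^sub>m n) $$ (i, j)" for i j by simp
  show ?thesis
  proof (rule eq_matI)
    fix i j assume ij: "i < dim_row (1\<^sub>m n :: 'a mat)" "j < dim_col (1\<^sub>m n :: 'a mat)"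
    then have "det A * (B * A) $$ (i, j) = det A * 1\<^sub>m n $$ (i, j)" using e[of i j] A B by simp
    then have "(det A * det B) * (B * A) $$ (i, j) = (det A * det B) * 1\<^sub>m n $$ (i, j)"
      by (metis mult.assoc mult.commute)
    then show "(B * A) $$ (i, j) = 1\<^sub>m n $$ (i, j)" using d by simp
  qed (use A B in auto)
qed

text \<open>\<open>mat_right_inverse\<close> over abstract index sets and with a unit c in place of
  1. It is applied to rows and columns numbered by families of m-sets, where equal cardinality makes
  the matrices square.\<close>

lemma square_inverse:
  fixes P Q :: "'b \<Rightarrow> 'b \<Rightarrow> 'a::comm_ring_1"
  assumes fin: "finite A" "finite B" "card A = card B" and c: "c dvd 1"
    and PQ: "\<And>a a'. a \<in> A \<Longrightarrow> a' \<in> A \<Longrightarrow> (\<Sum>b\<in>B. P a b * Q b a') = (if a = a' then c else 0)"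
    and b: "b \<in> B" "b' \<in> B"
  shows "(\<Sum>a\<in>A. Q b a * P a b') = (if b = b' then c else 0)"
proof -
  obtain d where d: "c * d = 1" using c by (metis dvdE)
  let ?N = "card A"
  obtain f where f: "bij_betw f {..<?N} A" using fin(1) ex_bij_betw_nat_finite lessThan_atLeast0 by metis
  obtain g where g: "bij_betw g {..<?N} B" using fin(2,3) ex_bij_betw_nat_finite lessThan_atLeast0 by metis
  define X where "X = mat ?N ?N (\<lambda>(i, j). d * P (f i) (g j))"
  define Y where "Y = mat ?N ?N (\<lambda>(i, j). Q (g i) (f j))"
  have fA: "f i \<in> A" if "i < ?N" for i using f that by (auto simp: bij_betw_def)
  have finj: "f i = f j \<longleftrightarrow> i = j" if "i < ?N" "j < ?N" for i j
    using f that by (auto simp: bij_betw_def inj_on_def)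
  have ginj: "g i = g j \<longleftrightarrow> i = j" if "i < ?N" "j < ?N" for i j
    using g that by (auto simp: bij_betw_def inj_on_def)
  have XY: "X * Y = 1\<^sub>m ?N"
  proof (rule eq_matI)
    fix i j assume ij: "i < dim_row (1\<^sub>m ?N :: 'a mat)" "j < dim_col (1\<^sub>m ?N :: 'a mat)"
    then have "(X * Y) $$ (i, j) = d * (\<Sum>k<?N. P (f i) (g k) * Q (g k) (f j))"
      by (simp add: X_def Y_def scalar_prod_def lessThan_atLeast0 sum_distrib_left mult.assoc)
    also have "(\<Sum>k<?N. P (f i) (g k) * Q (g k) (f j)) = (\<Sum>b\<in>B. P (f i) b * Q b (f j))"
      by (rule sum.reindex_bij_betw[OF g])
    also have "d * \<dots> = (if i = j then 1 else 0)"
      using ij d by (simp add: PQ fA finj mult.commute)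
    finally show "(X * Y) $$ (i, j) = 1\<^sub>m ?N $$ (i, j)" using ij by simp
  qed (auto simp: X_def Y_def)
  have "X \<in> carrier_mat ?N ?N" "Y \<in> carrier_mat ?N ?N" by (simp_all add: X_def Y_def)
  from mat_right_inverse[OF this XY] have YX: "Y * X = 1\<^sub>m ?N" .
  obtain i j where ij: "i < ?N" "j < ?N" "b = g i" "b' = g j"
    using b g by (auto simp: bij_betw_def)
  have "(\<Sum>a\<in>A. Q b a * P a b') = (\<Sum>k<?N. Q (g i) (f k) * P (f k) (g j))"
    unfolding ij(3,4) by (rule sum.reindex_bij_betw[OF f, symmetric])
  also have "\<dots> = (c * d) * (\<Sum>k<?N. Q (g i) (f k) * P (f k) (g j))" using d by simp
  also have "\<dots> = c * (Y * X) $$ (i, j)"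
    using ij by (simp add: X_def Y_def scalar_prod_def lessThan_atLeast0 sum_distrib_left algebra_simps)
  also have "\<dots> = (if b = b' then c else 0)" using ij by (simp add: YX ginj)
  finally show ?thesis .
qed

text \<open>The quadratic relations satisfied by a decomposable vector \<open>x\<close> at a coordinate \<open>J\<close>.\<close>

definition pluecker :: "nat \<Rightarrow> nat \<Rightarrow> 'a::comm_ring_1 ext \<Rightarrow> nat set \<Rightarrow> bool" where
  "pluecker n m x J \<longleftrightarrow> (\<forall>K\<in>msubsets n m. \<forall>L. K \<inter> J \<noteq> {} \<and> \<not> J \<subseteq> L \<and> finite L \<longrightarrow>
     coord x J * coord (x * basis K) L =
     (\<Sum>T | T \<in> msubsets n m \<and> T \<inter> J = {}. sg J T * coord (x * basis T) L * coord (x * basis K) (J \<union> T)))"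

lemma pluecker_sc: "pluecker n m x J \<Longrightarrow> pluecker n m (sc c x) J"
proof -
  assume *: "pluecker n m x J"
  show ?thesis unfolding pluecker_def
  proof (intro ballI allI impI)
    fix K L assume "K \<in> msubsets n m" "K \<inter> J \<noteq> {} \<and> \<not> J \<subseteq> L \<and> finite L"
    with * have "coord x J * coord (x * basis K) L =
     (\<Sum>T | T \<in> msubsets n m \<and> T \<inter> J = {}. sg J T * coord (x * basis T) L * coord (x * basis K) (J \<union> T))"
      unfolding pluecker_def by blast
    then have "c * c * (coord x J * coord (x * basis K) L) =
     c * c * (\<Sum>T | T \<in> msubsets n m \<and> T \<inter> J = {}. sg J T * coord (x * basis T) L * coord (x * basis K) (J \<union> T))" by simp
    then show "coord (sc c x) J * coord (sc c x * basis K) L =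
     (\<Sum>T | T \<in> msubsets n m \<and> T \<inter> J = {}. sg J T * coord (sc c x * basis T) L * coord (sc c x * basis K) (J \<union> T))"
      by (simp add: sc_mult_left sum_distrib_left algebra_simps)
  qed
qed

lemma mult_inverse_mat:
  assumes "A \<in> carrier_mat n n" "B \<in> carrier_mat n n" "C \<in> carrier_mat n n" "D \<in> carrier_mat n n"
    "A * B = 1\<^sub>m n" "C * D = (1\<^sub>m n :: 'a::comm_ring_1 mat)"
  shows "(C * A) * (B * D) = 1\<^sub>m n"
proof -
  have "(C * A) * (B * D) = C * (A * (B * D))" using assms by (intro assoc_mult_mat) auto
  also have "A * (B * D) = (A * B) * D" using assms by (intro assoc_mult_mat[symmetric]) auto
  finally show ?thesis using assms by simp
qed

section \<open>Quadratic relations for the images of decomposable vectors\<close>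

locale blocks =
  fixes n m k :: nat
  assumes n: "n = k * m" and k: "3 \<le> k" and m: "1 \<le> m"
begin

lemma nm: "3 * m \<le> n" using n k by simp
lemma divk: "n div m = k" using n m by simp

lemma similitude_prod:
  assumes GH: "similitude n m G H" and mem: "x \<in> lambda_space n m" "y \<in> lambda_space n m" "x' \<in> lambda_space n m" "y' \<in> lambda_space n m"
    and eq: "x * y = x' * (y' :: 'a::comm_ring_1 ext)"
  shows "G x * G y = G x' * G y'"
proof (rule ext_eqI)
  fix L :: "nat set" assume L: "finite L"
  note D = similitudeD[OF GH]
  obtain c where c: "c dvd 1" "\<And>xs. length xs = k \<Longrightarrow> set xs \<subseteq> lambda_space n m \<Longrightarrow>
        coord (prod_list (map G xs)) {..<n} = c * coord (prod_list xs) {..<n}"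
    using similitude_form[OF GH] unfolding divk by blast
  show "coord (G x * G y) L = coord (G x' * G y') L"
  proof (cases "L \<in> msubsets n (m + m)")
    case False
    then show ?thesis using lambda_space_times D(3) mem basis_coord_zero by metis
  next
    case True
    \<comment> \<open>The coordinate at L is read off by multiplying with the complementary basis
      element, which up to sign is a product of k - 2 blocks. Each block is the image under G of a
      vector, so the invariance of the form applies to the whole list.\<close>
    let ?C = "{..<n} - L"
    have "card ?C = n - (m + m)" using True L by (auto simp: msubsets_def card_Diff_subset)
    also have "\<dots> = (k - 2) * m" using n by (simp add: diff_mult_distrib)
    finally obtain Zs and s :: 'a where Zs: "length Zs = k - 2" "\<forall>Z\<in>set Zs. Z \<subseteq> ?C \<and> card Z = m"
       "s * s = 1" "prod_list (map basis Zs) = sc s (basis ?C)"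
      using block_partition[of ?C "k - 2" m] by auto
    have Zm: "(basis Z :: 'a ext) \<in> lambda_space n m" if "Z \<in> set Zs" for Z
      using Zs(2) that by (intro basis_in_lambda_space) (auto simp: msubsets_def)
    define zs where "zs = map (\<lambda>Z. H (basis Z)) Zs"
    have zs: "set zs \<subseteq> lambda_space n m" using Zm D(4) by (auto simp: zs_def)
    have Gzs: "prod_list (map G zs) = sc s (basis ?C)"
      using Zm D(6) unfolding zs_def Zs(4)[symmetric] by (auto intro!: arg_cong[where f = prod_list])
    have len: "length (u # v # zs) = k" for u v using Zs(1) k by (simp add: zs_def)
    have key: "s * sg L ?C * coord (G u * G v) L = c * coord (u * v * prod_list zs) {..<n}"
      if "u \<in> lambda_space n m" "v \<in> lambda_space n m" for u v
    proof -
      have "coord (prod_list (map G (u # v # zs))) {..<n} = c * coord (prod_list (u # v # zs)) {..<n}"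
        using that zs len by (intro c(2)) auto
      moreover have "{..<n} - ?C = L" using True by (auto simp: msubsets_def)
      ultimately show ?thesis using Gzs
        by (simp add: mult.assoc[symmetric] sc_mult_right coord_times_basis)
    qed
    have "s * sg L ?C * coord (G x * G y) L = s * sg L ?C * coord (G x' * G y') L"
      using key[OF mem(1,2)] key[OF mem(3,4)] eq by simp
    then have "(s * sg L ?C) * (s * sg L ?C * coord (G x * G y) L) = (s * sg L ?C) * (s * sg L ?C * coord (G x' * G y') L)"
      by simp
    moreover have "(s * sg L ?C) * (s * sg L ?C * r) = r" for r :: 'a
      using Zs(3) sg_square[of L ?C, where 'a = 'a] by (metis (no_types, opaque_lifting) mult.assoc mult.commute mult.left_neutral)
    ultimately show ?thesis by simp
  qed
qed

lemma similitude_prod_zero: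
  assumes "similitude n m G H" "x \<in> lambda_space n m" "y \<in> lambda_space n m" "x * y = 0"
  shows "G x * G y = 0"
  using similitude_prod[OF assms(1-3) lambda_space_zero lambda_space_zero] assms(4) lin_zero[OF similitudeD(1)[OF assms(1)]] by simp

lemma card_disjoint_msubsets:
  assumes "J \<in> msubsets n m"
  shows "card {T. T \<in> msubsets n m \<and> T \<inter> J = {}} = (n - m) choose m"
proof -
  have "{T. T \<in> msubsets n m \<and> T \<inter> J = {}} = {T. T \<subseteq> {..<n} - J \<and> card T = m}"
    by (auto simp: msubsets_def)
  moreover have "card ({..<n} - J) = n - m" using assms
    by (auto simp: msubsets_def card_Diff_subset finite_subset)
  ultimately show ?thesis using n_subsets[of "{..<n} - J" m] by simp
qed

text \<open>Let x be the image of e_J. Its products with the vectors G e_T vanish when T meets J, so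
  multiplication by x factors as P Q through the T disjoint from J; these are as many as the sets
  disjoint from J0. At the coordinates J0 with S adjoined, the composite is a signed c times the
  identity on the sets disjoint from J0, where c is the unit coordinate of x at J0. Being square,
  the factors then also satisfy QP = c in the other order, signs included, and inserting this
  between P and Q yields the quadratic relation.\<close>

lemma similitude_pluecker_basis:
  assumes GH: "similitude n m G H" and J: "J \<in> msubsets n m" and J0: "J0 \<in> msubsets n m"
    and u: "(coord (G (basis J)) J0 :: 'a::comm_ring_1) dvd 1"
  shows "pluecker n m (G (basis J)) J0"
  unfolding pluecker_def
proof (intro ballI allI impI)
  note D = similitudeD[OF GH]
  let ?x = "G (basis J)"
  let ?A = "{T. T \<in> msubsets n m \<and> T \<inter> J0 = {}}" and ?B = "{T. T \<in> msubsets n m \<and> T \<inter> J = {}}"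
  define P where "P L T = coord (G (basis J) * G (basis T)) L" for L T
  define Q where "Q T K = coord (H (basis K)) T" for T K
  have fin: "finite ?A" "finite ?B" by (auto intro: finite_subset[OF _ finite_msubsets])
  have M: "coord (?x * basis K) L = (\<Sum>T\<in>?B. P L T * Q T K)" if K: "K \<in> msubsets n m" for K L
  proof -
    have Hm: "H (basis K) \<in> lambda_space n m" using K by (auto intro: D(4))
    have "G (H (basis K)) = (\<Sum>T\<in>msubsets n m. sc (Q T K) (G (basis T)))"
      by (subst lambda_space_expand[OF Hm]) (simp add: lin_sum[OF D(1)] lin_sc[OF D(1)] Q_def)
    then have "basis K = (\<Sum>T\<in>msubsets n m. sc (Q T K) (G (basis T)))"
      using D(6)[OF basis_in_lambda_space[OF K]] by simp
    then have "coord (?x * basis K) L = (\<Sum>T\<in>msubsets n m. P L T * Q T K)"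
      by (simp add: sum_distrib_left sc_mult_right coord_sum P_def mult.commute)
    also have "\<dots> = (\<Sum>T\<in>?B. P L T * Q T K)"
    proof (rule sum.mono_neutral_right)
      show "\<forall>T\<in>msubsets n m - ?B. P L T * Q T K = 0"
      proof
        fix T assume T: "T \<in> msubsets n m - ?B"
        then have "basis J * basis T = (0 :: 'a ext)"
          using J msubsets_finite[of T n m] msubsets_finite[of J n m] basis_mult[of J T, where 'a = 'a]
          by (simp add: Int_commute)
        then have "G (basis J) * G (basis T) = 0"
          using T J by (intro similitude_prod_zero[OF GH]) auto
        then show "P L T * Q T K = 0" by (simp add: P_def)
      qed
    qed auto
    finally show ?thesis .
  qed
  fix K L assume K: "K \<in> msubsets n m" and KL: "K \<inter> J0 \<noteq> {} \<and> \<not> J0 \<subseteq> L \<and> finite L"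
  define c where "c = coord ?x J0"
  \<comment> \<open>If S' lies in the union of J0 and S, then S' = S, as both are disjoint from J0
    and of size m; removing S' then leaves J0, where the coordinate is c.\<close>
  have PQ: "(\<Sum>T\<in>?B. (sg J0 S * P (J0 \<union> S) T) * Q T S') = (if S = S' then c else 0)" if "S \<in> ?A" "S' \<in> ?A" for S S'
  proof -
    have mem: "S \<in> msubsets n m" "S' \<in> msubsets n m" and disj: "J0 \<inter> S = {}" "J0 \<inter> S' = {}"
      using that by blast+
    have S: "finite S" "finite S'" "finite J0" "card S = card S'"
      using msubsets_finite[OF mem(1)] msubsets_finite[OF mem(2)] msubsets_finite[OF J0] mem
      by (simp_all add: msubsets_def)
    have "(\<Sum>T\<in>?B. (sg J0 S * P (J0 \<union> S) T) * Q T S') = sg J0 S * coord (?x * basis S') (J0 \<union> S)"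
      unfolding M[OF mem(2)] sum_distrib_left by (simp add: mult.assoc)
    also have "\<dots> = (if S = S' then c else 0)"
    proof (cases "S = S'")
      case True
      have "J0 \<union> S' - S' = J0" using disj by blast
      then show ?thesis using True S by (simp add: coord_times_basis c_def)
    next
      case False
      have "\<not> S' \<subseteq> J0 \<union> S"
      proof
        assume "S' \<subseteq> J0 \<union> S"
        then have "S' \<subseteq> S" using disj by blast
        then have "S' = S" by (rule card_subset_eq[OF S(1)]) (simp add: S(4))
        then show False using False by simp
      qed
      then show ?thesis using False S by (simp add: coord_times_basis)
    qed
    finally show ?thesis .
  qed
  have QP: "(\<Sum>S\<in>?A. Q T S * (sg J0 S * P (J0 \<union> S) T')) = (if T = T' then c else 0)" if "T \<in> ?B" "T' \<in> ?B" for T T'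
  proof (rule square_inverse[where P = "\<lambda>S T. sg J0 S * P (J0 \<union> S) T" and Q = Q])
    show "card ?A = card ?B" using card_disjoint_msubsets J J0 by simp
    show "c dvd 1" using u by (simp add: c_def)
  qed (use fin PQ that in auto)
  have "c * coord (?x * basis K) L = (\<Sum>T\<in>?B. \<Sum>T'\<in>?B. P L T * (if T = T' then c else 0) * Q T' K)"
    unfolding M[OF K] using fin by (simp add: sum_distrib_left algebra_simps if_distrib[of "\<lambda>c. _ * c"] cong: if_cong)
  also have "\<dots> = (\<Sum>T\<in>?B. \<Sum>T'\<in>?B. P L T * (\<Sum>S\<in>?A. Q T S * (sg J0 S * P (J0 \<union> S) T')) * Q T' K)"
    by (intro sum.cong refl) (simp add: QP)
  also have "\<dots> = (\<Sum>T\<in>?B. \<Sum>T'\<in>?B. \<Sum>S\<in>?A. sg J0 S * (P L T * Q T S) * (P (J0 \<union> S) T' * Q T' K))"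
    by (simp add: sum_distrib_left sum_distrib_right algebra_simps)
  also have "\<dots> = (\<Sum>T\<in>?B. \<Sum>S\<in>?A. \<Sum>T'\<in>?B. sg J0 S * (P L T * Q T S) * (P (J0 \<union> S) T' * Q T' K))"
    by (intro sum.cong refl sum.swap)
  also have "\<dots> = (\<Sum>S\<in>?A. \<Sum>T\<in>?B. \<Sum>T'\<in>?B. sg J0 S * (P L T * Q T S) * (P (J0 \<union> S) T' * Q T' K))"
    by (rule sum.swap)
  also have "\<dots> = (\<Sum>S\<in>?A. sg J0 S * coord (?x * basis S) L * coord (?x * basis K) (J0 \<union> S))"
  proof (rule sum.cong[OF refl])
    fix S assume "S \<in> ?A"
    then have "S \<in> msubsets n m" by simp
    show "(\<Sum>T\<in>?B. \<Sum>T'\<in>?B. sg J0 S * (P L T * Q T S) * (P (J0 \<union> S) T' * Q T' K)) =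
        sg J0 S * coord (?x * basis S) L * coord (?x * basis K) (J0 \<union> S)"
      unfolding M[OF K] M[OF \<open>S \<in> msubsets n m\<close>] by (simp add: sum_distrib_left sum_distrib_right mult.assoc)
        (subst sum.swap, simp)
  qed
  finally show "coord ?x J0 * coord (?x * basis K) L = (\<Sum>T\<in>?A. sg J0 T * coord (?x * basis T) L * coord (?x * basis K) (J0 \<union> T))"
    by (simp add: c_def)
qed

text \<open>Unit multiples of the orbit of the basis vectors under invertible matrices, rather than
  products of m vectors: relations at basis vectors then carry over by composing with
  \<open>Lam A\<close>.\<close>

definition decomposable :: "'a::comm_ring_1 ext \<Rightarrow> bool" where
  "decomposable z \<longleftrightarrow> (\<exists>A B J s. A \<in> carrier_mat n n \<and> B \<in> carrier_mat n n \<and> A * B = 1\<^sub>m n \<and> B * A = 1\<^sub>m n \<and>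
     J \<in> msubsets n m \<and> s dvd 1 \<and> z = sc s (Lam A (basis J)))"

lemma decomposable_basis: "J \<in> msubsets n m \<Longrightarrow> decomposable (basis J :: 'a::comm_ring_1 ext)"
proof -
  assume J: "J \<in> msubsets n m"
  then have "Lam (1\<^sub>m n) (basis J) = (basis J :: 'a ext)"
    by (intro Lam_id lambda_space_subset_all[of _ n m] basis_in_lambda_space)
  then show ?thesis unfolding decomposable_def using J
    by (intro exI[of _ "1\<^sub>m n"] exI[of _ J] exI[of _ 1]) auto
qed

lemma decomposable_sc: "decomposable z \<Longrightarrow> c dvd 1 \<Longrightarrow> decomposable (sc c z)"
  unfolding decomposable_def by (metis sc_sc mult_dvd_mono mult_1)

lemma decomposable_Lam:
  assumes "decomposable z" "C \<in> carrier_mat n n" "D \<in> carrier_mat n n" "C * D = 1\<^sub>m n" "D * C = 1\<^sub>m n"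
  shows "decomposable (Lam C z)"
proof -
  obtain A B J s where *: "A \<in> carrier_mat n n" "B \<in> carrier_mat n n" "A * B = 1\<^sub>m n" "B * A = 1\<^sub>m n"
     "J \<in> msubsets n m" "s dvd 1" "z = sc s (Lam A (basis J))" using assms(1) by (auto simp: decomposable_def)
  have "(C * A) * (B * D) = 1\<^sub>m n" "(B * D) * (C * A) = 1\<^sub>m n"
    using mult_inverse_mat[of A n B C D] mult_inverse_mat[of D n C B A] * assms by simp_all
  moreover have "Lam C z = sc s (Lam (C * A) (basis J))"
    using * assms by (simp add: Lam_sc Lam_mult)
  ultimately show ?thesis unfolding decomposable_def using * assms
    by (intro exI[of _ "C * A"] exI[of _ "B * D"] exI[of _ J] exI[of _ s]) simp
qed

lemma similitude_pluecker:
  assumes GH: "similitude n m G H" and z: "decomposable z" and J0: "J0 \<in> msubsets n m" and u: "coord (G z) J0 dvd 1"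
  shows "pluecker n m (G z) J0"
proof -
  obtain A B J s where *: "A \<in> carrier_mat n n" "B \<in> carrier_mat n n" "A * B = 1\<^sub>m n" "B * A = 1\<^sub>m n"
     "J \<in> msubsets n m" "s dvd 1" "z = sc s (Lam A (basis J))" using z by (auto simp: decomposable_def)
  have s: "similitude n m (\<lambda>x. G (Lam A x)) (\<lambda>x. Lam B (H x))"
    using * n by (intro similitude_comp[OF GH] similitude_Lam) auto
  have Gz: "G z = sc s (G (Lam A (basis J)))" using * lin_sc[OF similitudeD(1)[OF GH]] by simp
  then have "coord (G (Lam A (basis J))) J0 dvd 1" using u by (metis coord_simps(5) dvd_mult_right)
  from pluecker_sc[OF similitude_pluecker_basis[OF s *(5) J0 this]] show ?thesis using Gz by simp
qed

text \<open>I and J cover at most 2m indices, and n >= 3m leaves at least m others. The set Z with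
  one further index becomes a multiplier that isolates a single coordinate inside a product.\<close>

lemma exchange_exists:
  assumes "I \<in> msubsets n m" "J \<in> msubsets n m"
  obtains Z where "Z \<subseteq> {..<n} - (J \<union> I)" "card Z = m - 1" "finite Z"
proof -
  have "card (J \<union> I) \<le> m + m" using assms card_Un_le[of J I] by (auto simp: msubsets_def)
  moreover have "finite (J \<union> I)" "J \<union> I \<subseteq> {..<n}" using assms by (auto simp: msubsets_iff)
  ultimately have "m - 1 \<le> card ({..<n} - (J \<union> I))" using nm by (simp add: card_Diff_subset)
  then show thesis using obtain_subset_with_card_n that by (metis finite_Diff finite_lessThan finite_subset)
qed

lemma card_diff_eq: "I \<in> msubsets n m \<Longrightarrow> J \<in> msubsets n m \<Longrightarrow> card (J - I) = card (I - J)"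
  by (simp add: card_Diff_subset_Int msubsets_iff Int_commute)

text \<open>Take the relation for K consisting of Z and j, and for L consisting of I and K. Up to
  signs its left side is the product of the coordinates at J and I, while every term on the right
  contains either 0 or a coordinate at J with one element exchanged, and these vanish by
  hypothesis.\<close>

lemma pluecker_far_zero:
  assumes p: "pluecker n m x J" and J: "J \<in> msubsets n m" and u: "coord x J dvd 1"
    and z: "\<And>j t. j \<in> J \<Longrightarrow> t < n \<Longrightarrow> t \<notin> J \<Longrightarrow> coord x (insert t (J - {j})) = 0"
    and I: "I \<in> msubsets n m" "2 \<le> card (I - J)"
  shows "coord x I = 0"
proof -
  have c2: "2 \<le> card (J - I)" using card_diff_eq[OF I(1) J] I(2) by simp
  then obtain j where j: "j \<in> J" "j \<notin> I" by (metis Diff_eq_empty_iff card.empty not_numeral_le_zero subsetI)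
  obtain Z where Z: "Z \<subseteq> {..<n} - (J \<union> I)" "card Z = m - 1" "finite Z" using exchange_exists[OF I(1) J] .
  define K where "K = insert j Z"
  have jn: "j < n" using j J by (auto simp: msubsets_def)
  have jZ: "j \<notin> Z" using Z j by auto
  have K: "K \<in> msubsets n m" using Z jn jZ m by (auto simp: K_def msubsets_def)
  have finI: "finite I" "finite J" "finite K" using I J K by (auto simp: msubsets_iff)
  have "\<not> J \<subseteq> I \<union> K"
  proof
    assume "J \<subseteq> I \<union> K"
    then have "J - I \<subseteq> {j}" using Z by (auto simp: K_def)
    then have "card (J - I) \<le> card {j}" by (intro card_mono) auto
    then show False using c2 by simp
  qed
  then have "coord x J * coord (x * basis K) (I \<union> K) =
     (\<Sum>T | T \<in> msubsets n m \<and> T \<inter> J = {}. sg J T * coord (x * basis T) (I \<union> K) * coord (x * basis K) (J \<union> T))"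
    using p K j finI unfolding pluecker_def by (auto simp: K_def)
  also have "\<dots> = 0"
  proof (intro sum.neutral ballI)
    fix T assume T: "T \<in> {T. T \<in> msubsets n m \<and> T \<inter> J = {}}"
    then have finT: "finite T" by (auto simp: msubsets_iff)
    have "coord (x * basis K) (J \<union> T) = 0"
    proof (cases "K \<subseteq> J \<union> T")
      case True
      then have ZT: "Z \<subseteq> T" using Z by (auto simp: K_def)
      then have "card (T - Z) = 1" using T Z m by (simp add: card_Diff_subset msubsets_def)
      then obtain t where t: "T - Z = {t}" by (rule card_1_singletonE)
      have "J \<union> T - K = insert t (J - {j})" using t ZT Z T jZ j by (auto simp: K_def)
      moreover have "t < n" "t \<notin> J" using t T by (auto simp: msubsets_def)
      ultimately show ?thesis using z[OF j(1)] finI finT by (simp add: coord_times_basis)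
    qed (use finI finT in \<open>simp add: coord_times_basis\<close>)
    then show "sg J T * coord (x * basis T) (I \<union> K) * coord (x * basis K) (J \<union> T) = 0" by simp
  qed
  finally have "coord x J * coord (x * basis K) (I \<union> K) = 0" .
  moreover have "I \<union> K - K = I" using Z j by (auto simp: K_def)
  ultimately have "coord x J * (sg I K * coord x I) = 0" using finI by (simp add: coord_times_basis)
  moreover obtain d where "coord x J * d = 1" using u by (metis dvdE)
  ultimately have "sg I K * coord x I = 0" by (metis mult.left_commute mult.right_neutral mult_zero_right)
  then show ?thesis by (metis mult_zero_right sg_square_left)
qed

end

lemma oprod_cong: "finite I \<Longrightarrow> (\<And>i. i \<in> I \<Longrightarrow> v i = w i) \<Longrightarrow> oprod v I = oprod w I"
  unfolding oprod_def by (intro arg_cong[where f = prod_list] map_cong) auto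

lemma Lam_fix:
  assumes "J \<subseteq> {..<dim_row A}" "\<And>j. j \<in> J \<Longrightarrow> cvec A j = basis {j}"
  shows "Lam A (basis J) = basis J"
proof -
  have fin: "finite J" using assms(1) by (rule finite_subset) simp
  have "oprod (cvec A) J = oprod (\<lambda>j. basis {j}) J" using fin assms(2) by (rule oprod_cong)
  then show ?thesis using assms(1) fin by (simp add: Lam_basis oprod_basis)
qed

lemma cvec_addrow:
  assumes "l < n" "a < n" "t < n" "a \<noteq> t"
  shows "cvec (addrow_mat n c a t) l = (if l = t then basis {t} + sc c (basis {a}) else basis {l})"
proof -
  have "cvec (addrow_mat n c a t) l = (\<Sum>i<n. (if i = l then basis {l} else 0) + (if i = a then if l = t then sc c (basis {a}) else 0 else 0))"
    unfolding cvec_def evec_def using assms by (intro sum.cong) auto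
  also have "\<dots> = (if l = t then basis {t} + sc c (basis {a}) else basis {l})"
    using assms by (simp add: sum.distrib)
  finally show ?thesis .
qed

lemma addrow_inverse:
  assumes "a < n" "t < n" "a \<noteq> t"
  shows "addrow_mat n (c :: 'a::comm_ring_1) a t * addrow_mat n (- c) a t = 1\<^sub>m n"
    "addrow_mat n (- c) a t * addrow_mat n c a t = 1\<^sub>m n"
  using addrow_mat_inv[OF assms, of c] addrow_mat_inv[OF assms, of "- c"] by simp_all

section \<open>Three-term relations\<close>

context blocks
begin

text \<open>With K consisting of Z and p, only the sets T consisting of Z and r, or of Z and s,
  contribute to the quadratic relation. What remains is the three-term relation for the pairs from
  p, q, r, s over the common part w; the vanishing of one of two coordinates removes its third term.
  The sign e depends on the sets alone, not on x, so it can be determined on an example.\<close>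

lemma pluecker_exchange:
  assumes w: "finite w" "w \<subseteq> {..<n}" "card w + 2 = m"
    and d: "distinct [p, q, r, s]" "{p, q, r, s} \<inter> w = {}" "{p, q, r, s} \<subseteq> {..<n}"
  shows "\<exists>e :: 'a::comm_ring_1. \<forall>x. pluecker n m x (w \<union> {p, q}) \<longrightarrow> coord x (w \<union> {p, r}) = 0 \<or> coord x (w \<union> {q, s}) = 0 \<longrightarrow>
     coord x (w \<union> {p, q}) * coord x (w \<union> {r, s}) = e * (coord x (w \<union> {p, s}) * coord x (w \<union> {r, q}))"
proof -
  let ?J = "w \<union> {p, q}" and ?I = "w \<union> {r, s}"
  have J: "?J \<in> msubsets n m" and I: "?I \<in> msubsets n m"
    using w d by (simp_all add: msubsets_iff)
  obtain Z where Z: "Z \<subseteq> {..<n} - (?J \<union> ?I)" "card Z = m - 1" "finite Z" using exchange_exists[OF I J] .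
  define K where "K = insert p Z"
  define Tr where "Tr = insert r Z"
  define Ts where "Ts = insert s Z"
  define L where "L = ?I \<union> K"
  have K: "K \<in> msubsets n m" and Tr: "Tr \<in> msubsets n m" and Ts: "Ts \<in> msubsets n m"
  proof -
    have "p \<notin> Z" "r \<notin> Z" "s \<notin> Z" using Z(1) by auto
    then show "K \<in> msubsets n m" "Tr \<in> msubsets n m" "Ts \<in> msubsets n m"
      using Z d(3) m by (auto simp: msubsets_iff K_def Tr_def Ts_def)
  qed
  have fin: "finite L" "finite K" "finite Tr" "finite Ts" "finite ?J" using w Z by (simp_all add: L_def K_def Tr_def Ts_def)
  have diffs: "L - K = ?I" "L - Tr = w \<union> {p, s}" "L - Ts = w \<union> {p, r}" "?J \<union> Tr - K = w \<union> {r, q}" "?J \<union> Ts - K = w \<union> {q, s}"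
    "K \<subseteq> L" "Tr \<subseteq> L" "Ts \<subseteq> L" "K \<subseteq> ?J \<union> Tr" "K \<subseteq> ?J \<union> Ts"
    using Z d by (auto simp: L_def K_def Tr_def Ts_def)
  have rs: "Tr \<noteq> Ts" using Z d by (auto simp: Tr_def Ts_def)
  have nsub: "\<not> ?J \<subseteq> L" "K \<inter> ?J \<noteq> {}" using Z d by (auto simp: L_def K_def)
  define e :: 'a where "e = sg ?I K * (sg ?J Tr * sg (w \<union> {p, s}) Tr * sg (w \<union> {r, q}) K)"
  show ?thesis
  proof (intro exI[of _ e] allI impI)
    fix x :: "'a ext" assume x: "pluecker n m x ?J" and z: "coord x (w \<union> {p, r}) = 0 \<or> coord x (w \<union> {q, s}) = 0"
    have "coord x ?J * coord (x * basis K) L =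
      (\<Sum>T | T \<in> msubsets n m \<and> T \<inter> ?J = {}. sg ?J T * coord (x * basis T) L * coord (x * basis K) (?J \<union> T))"
      using x K nsub fin(1) unfolding pluecker_def by blast
    also have "\<dots> = (\<Sum>T\<in>{Tr, Ts}. sg ?J T * coord (x * basis T) L * coord (x * basis K) (?J \<union> T))"
    proof (rule sum.mono_neutral_right)
      show "finite {T. T \<in> msubsets n m \<and> T \<inter> ?J = {}}" by (rule finite_subset[OF _ finite_msubsets]) auto
      show "{Tr, Ts} \<subseteq> {T. T \<in> msubsets n m \<and> T \<inter> ?J = {}}" using Tr Ts Z d by (auto simp: Tr_def Ts_def)
      show "\<forall>T\<in>{T. T \<in> msubsets n m \<and> T \<inter> ?J = {}} - {Tr, Ts}.
         sg ?J T * coord (x * basis T) L * coord (x * basis K) (?J \<union> T) = 0"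
      proof
        fix T assume T: "T \<in> {T. T \<in> msubsets n m \<and> T \<inter> ?J = {}} - {Tr, Ts}"
        then have finT: "finite T" and cT: "card T = m" and TJ: "T \<inter> ?J = {}" by (auto simp: msubsets_iff)
        show "sg ?J T * coord (x * basis T) L * coord (x * basis K) (?J \<union> T) = 0"
        proof (rule ccontr)
          assume "\<not> ?thesis"
          then have "T \<subseteq> L" "K \<subseteq> ?J \<union> T"
            using fin finT by (auto simp: coord_times_basis split: if_splits)
          then have "Z \<subseteq> T" "T \<subseteq> {r, s} \<union> Z" using TJ Z by (auto simp: L_def K_def)
          then have "card (T - Z) = 1" using cT Z m by (simp add: card_Diff_subset)
          then obtain t where "T - Z = {t}" by (rule card_1_singletonE)
          then have "T = insert t Z" "t \<in> {r, s}" using \<open>Z \<subseteq> T\<close> \<open>T \<subseteq> {r, s} \<union> Z\<close> by auto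
          then show False using T by (auto simp: Tr_def Ts_def)
        qed
      qed
    qed
    also have "\<dots> = sg ?J Tr * coord (x * basis Tr) L * coord (x * basis K) (?J \<union> Tr) +
        sg ?J Ts * coord (x * basis Ts) L * coord (x * basis K) (?J \<union> Ts)" using rs by simp
    also have "sg ?J Ts * coord (x * basis Ts) L * coord (x * basis K) (?J \<union> Ts) = 0"
      using z fin diffs by (auto simp: coord_times_basis)
    finally have *: "coord x ?J * (sg ?I K * coord x ?I) =
       sg ?J Tr * (sg (w \<union> {p, s}) Tr * coord x (w \<union> {p, s})) * (sg (w \<union> {r, q}) K * coord x (w \<union> {r, q}))"
      using fin diffs by (simp add: coord_times_basis)
    have "coord x ?J * coord x ?I = sg ?I K * (coord x ?J * (sg ?I K * coord x ?I))"
      by (metis mult.left_commute sg_square_left)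
    also have "\<dots> = e * (coord x (w \<union> {p, s}) * coord x (w \<union> {r, q}))"
      unfolding * e_def by (simp add: mult_ac)
    finally show "coord x ?J * coord x ?I = e * (coord x (w \<union> {p, s}) * coord x (w \<union> {r, q}))" .
  qed
qed

definition ew :: "nat set \<Rightarrow> nat \<Rightarrow> nat \<Rightarrow> 'a::comm_ring_1 ext" where
  "ew w p q = basis w * basis {p} * basis {q}"

text \<open>The coefficient at \<open>ew w p q\<close>: for distinct p and q outside w that vector
  is a basis vector up to sign, and its own coordinate is the sign.\<close>

definition cf :: "nat set \<Rightarrow> nat \<Rightarrow> nat \<Rightarrow> 'a::comm_ring_1 ext \<Rightarrow> 'a" where
  "cf w p q x = coord (ew w p q) (w \<union> {p, q}) * coord x (w \<union> {p, q})"

lemma ew_basis: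
  assumes "finite w" "p \<notin> w" "q \<notin> w" "p \<noteq> q"
  obtains s :: "'a::comm_ring_1" where "s * s = 1" "ew w p q = sc s (basis (w \<union> {p, q}))"
proof
  show "(sg w {p} * sg (insert p w) {q}) * (sg w {p} * sg (insert p w) {q}) = (1::'a)"
    by (simp add: mult_ac)
  show "ew w p q = sc (sg w {p} * sg (insert p w) {q}) (basis (w \<union> {p, q}))"
    using assms by (simp add: ew_def basis_mult sc_mult_left insert_commute)
qed

lemma cf_ew:
  assumes "finite w" "p \<notin> w" "q \<notin> w" "p \<noteq> q" "r \<notin> w" "s \<notin> w" "r \<noteq> s"
  shows "cf w p q (ew w r s) = (if r = p \<and> s = q then 1 else if r = q \<and> s = p then -1 else (0 :: 'a::comm_ring_1))"
proof -
  obtain a :: 'a where a: "a * a = 1" "ew w p q = sc a (basis (w \<union> {p, q}))" using ew_basis[OF assms(1-4)] .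
  show ?thesis
  proof (cases "{r, s} = {p, q}")
    case True
    consider "r = p" "s = q" | "r = q" "s = p" using True by (auto simp: doubleton_eq_iff)
    then show ?thesis
    proof cases
      case 1
      then show ?thesis using a assms by (simp add: cf_def coord_basis)
    next
      case 2
      have "ew w q p = - (ew w p q :: 'a ext)"
        using basis_anticommute[OF assms(4)[symmetric], where 'a = 'a] by (simp add: ew_def mult.assoc)
      then show ?thesis using 2 a assms by (simp add: cf_def coord_basis)
    qed
  next
    case False
    obtain b :: 'a where b: "b * b = 1" "ew w r s = sc b (basis (w \<union> {r, s}))" using ew_basis[OF assms(1,5-7)] .
    have "w \<union> {r, s} \<noteq> w \<union> {p, q}"
    proof
      assume "w \<union> {r, s} = w \<union> {p, q}"
      then have "(w \<union> {r, s}) - w = (w \<union> {p, q}) - w" by simp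
      then show False using False assms by auto
    qed
    then show ?thesis using False assms(1) b(2) by (auto simp: cf_def coord_basis)
  qed
qed

lemma cf_add: "cf w p q (x + y) = cf w p q x + cf w p q y"
  and cf_sc: "cf w p q (sc c x) = c * cf w p q x"
  by (simp_all add: cf_def algebra_simps)

lemma cf_swap: "p \<noteq> q \<Longrightarrow> cf w q p x = - cf w p q x"
proof -
  assume pq: "p \<noteq> q"
  have "ew w q p = - (ew w p q :: 'a ext)"
    using basis_anticommute[OF pq[symmetric], where 'a = 'a] by (simp add: ew_def mult.assoc)
  then show ?thesis by (simp add: cf_def insert_commute)
qed

lemma Lam_addrow_ew:
  assumes "w \<subseteq> {..<n}" "p < n" "q < n" "a < n" "t < n" "a \<noteq> t" "t \<notin> w"
  shows "Lam (addrow_mat n c a t) (ew w p q) = basis w * (if p = t then basis {t} + sc c (basis {a}) else basis {p}) *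
     (if q = t then basis {t} + sc c (basis {a}) else basis {q} :: 'a::comm_ring_1 ext)"
proof -
  let ?A = "addrow_mat n c a t"
  have w: "Lam ?A (basis w) = basis w"
    using assms by (intro Lam_fix) (auto simp: cvec_addrow)
  have 1: "Lam ?A (basis {l}) = (if l = t then basis {t} + sc c (basis {a}) else basis {l})" if "l < n" for l
    using that assms by (simp add: Lam_basis1 cvec_addrow)
  have mem: "(basis w :: 'a ext) \<in> lambda_all n" "(basis {p} :: 'a ext) \<in> lambda_all n" "(basis {q} :: 'a ext) \<in> lambda_all n"
    using assms by (auto intro!: lambda_all_basis)
  have "Lam ?A (ew w p q) = Lam ?A (basis w) * Lam ?A (basis {p}) * Lam ?A (basis {q})"
    unfolding ew_def using mem by (simp add: Lam_times lambda_all_times)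
  then show ?thesis unfolding w 1[OF assms(2)] 1[OF assms(3)] .
qed

lemma decomposable_ew:
  assumes w: "finite w" "w \<subseteq> {..<n}" "card w + 2 = m" and d: "p \<noteq> q" "p \<notin> w" "q \<notin> w" "p < n" "q < n"
  shows "decomposable (ew w p q :: 'a::comm_ring_1 ext)"
proof -
  obtain a :: 'a where a: "a * a = 1" "ew w p q = sc a (basis (w \<union> {p, q}))" using ew_basis[OF w(1) d(2,3,1)] .
  have "w \<union> {p, q} \<in> msubsets n m" using assms by (simp add: msubsets_iff)
  moreover have "a dvd 1" using a(1) by (metis dvd_triv_left)
  ultimately show ?thesis unfolding a(2) by (intro decomposable_sc decomposable_basis)
qed

lemma decomposable_addrow: "decomposable z \<Longrightarrow> a < n \<Longrightarrow> t < n \<Longrightarrow> a \<noteq> t \<Longrightarrow> decomposable (Lam (addrow_mat n c a t) z)"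
  by (rule decomposable_Lam[where D = "addrow_mat n (- c) a t"]) (auto simp: addrow_inverse)

lemma decomposable_ew2:
  assumes w: "finite w" "w \<subseteq> {..<n}" "card w + 2 = m"
    and d: "distinct [p, q, s]" "{p, q, s} \<inter> w = {}" "{p, q, s} \<subseteq> {..<n}"
  shows "decomposable (ew w p q + ew w p s :: 'a::comm_ring_1 ext)"
proof -
  have "decomposable (Lam (addrow_mat n 1 s q) (ew w p q :: 'a ext))"
    using d by (intro decomposable_addrow decomposable_ew w) auto
  then show ?thesis using w d by (simp add: Lam_addrow_ew) (simp add: ew_def algebra_simps)
qed

lemma decomposable_ew4:
  assumes w: "finite w" "w \<subseteq> {..<n}" "card w + 2 = m"
    and d: "distinct [p, q, r, s]" "{p, q, r, s} \<inter> w = {}" "{p, q, r, s} \<subseteq> {..<n}"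
  shows "decomposable (ew w p q + ew w p s + ew w r q + ew w r s :: 'a::comm_ring_1 ext)"
proof -
  have "decomposable (Lam (addrow_mat n 1 r p) (ew w p q + ew w p s :: 'a ext))"
    using d by (intro decomposable_addrow decomposable_ew2 w) auto
  then show ?thesis using w d by (simp add: Lam_addrow_ew Lam_add) (simp add: ew_def algebra_simps)
qed

lemma similitude_id: "similitude n m (\<lambda>x. x) (\<lambda>x. x :: 'a::comm_ring_1 ext)"
  unfolding similitude_def lin_def by (auto intro!: exI[of _ 1])

text \<open>The sign in the exchange relation is determined by evaluating it at \<open>(e\<^sub>p + e\<^sub>r) \<and> (e\<^sub>q + e\<^sub>s)\<close>.\<close>

lemma decomposable_rel:
  assumes w: "finite w" "w \<subseteq> {..<n}" "card w + 2 = m"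
    and d: "distinct [p, q, r, s]" "{p, q, r, s} \<inter> w = {}" "{p, q, r, s} \<subseteq> {..<n}"
    and GH: "similitude n m G H" and z: "decomposable z" and u: "cf w p q (G z) dvd 1"
    and third: "cf w p r (G z) = 0 \<or> cf w q s (G z) = (0 :: 'a::comm_ring_1)"
  shows "cf w p q (G z) * cf w r s (G z) = cf w p s (G z) * cf w r q (G z)"
proof -
  obtain e :: 'a where e: "\<And>x :: 'a ext. pluecker n m x (w \<union> {p, q}) \<Longrightarrow> coord x (w \<union> {p, r}) = 0 \<or> coord x (w \<union> {q, s}) = 0 \<Longrightarrow>
     coord x (w \<union> {p, q}) * coord x (w \<union> {r, s}) = e * (coord x (w \<union> {p, s}) * coord x (w \<union> {r, q}))"
    using pluecker_exchange[OF w d, where 'a = 'a] by blast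
  have sgn: "\<exists>t. t * t = 1 \<and> (\<forall>x :: 'a ext. cf w a b x = t * coord x (w \<union> {a, b}))" if ab: "a \<noteq> b" "a \<in> {p, q, r, s}" "b \<in> {p, q, r, s}" for a b
  proof -
    obtain t :: 'a where "t * t = 1" "ew w a b = sc t (basis (w \<union> {a, b}))"
      using ew_basis[OF w(1) _ _ ab(1)] ab(2,3) d(2) by blast
    then show ?thesis using w(1) by (intro exI[of _ t]) (simp add: cf_def coord_basis)
  qed
  obtain t1 where t1: "t1 * t1 = 1" "\<And>x :: 'a ext. cf w p q x = t1 * coord x (w \<union> {p, q})" using sgn[of p q] d by auto
  obtain t2 where t2: "t2 * t2 = 1" "\<And>x :: 'a ext. cf w r s x = t2 * coord x (w \<union> {r, s})" using sgn[of r s] d by auto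
  obtain t3 where t3: "t3 * t3 = 1" "\<And>x :: 'a ext. cf w p s x = t3 * coord x (w \<union> {p, s})" using sgn[of p s] d by auto
  obtain t4 where t4: "t4 * t4 = 1" "\<And>x :: 'a ext. cf w r q x = t4 * coord x (w \<union> {r, q})" using sgn[of r q] d by auto
  obtain t5 where t5: "t5 * t5 = 1" "\<And>x :: 'a ext. cf w p r x = t5 * coord x (w \<union> {p, r})" using sgn[of p r] d by auto
  obtain t6 where t6: "t6 * t6 = 1" "\<And>x :: 'a ext. cf w q s x = t6 * coord x (w \<union> {q, s})" using sgn[of q s] d by auto
  have cancel: "c = 0" if "t * t = 1" "t * c = 0" for t c :: 'a
    using that by (metis mult.assoc mult.left_neutral mult_zero_right)
  have unit: "c dvd 1" if "t * c dvd 1" for t c :: 'a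
    using that dvd_mult_right by blast
  define f where "f = t1 * t2 * t3 * t4 * e"
  have rel: "cf w p q (G' z') * cf w r s (G' z') = f * (cf w p s (G' z') * cf w r q (G' z'))"
    if sG: "similitude n m G' H'" and sz: "decomposable z'" and su: "cf w p q (G' z') dvd 1" and s3: "cf w p r (G' z') = 0 \<or> cf w q s (G' z') = 0"
    for G' H' z'
  proof -
    let ?x = "G' z'"
    have "pluecker n m ?x (w \<union> {p, q})"
      using su w d by (intro similitude_pluecker[OF sG sz]) (auto simp: msubsets_iff t1(2) intro: unit)
    moreover have "coord ?x (w \<union> {p, r}) = 0 \<or> coord ?x (w \<union> {q, s}) = 0"
      using s3 cancel t5 t6 by metis
    ultimately have "coord ?x (w \<union> {p, q}) * coord ?x (w \<union> {r, s}) = e * (coord ?x (w \<union> {p, s}) * coord ?x (w \<union> {r, q}))"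
      by (rule e)
    then have "t1 * t2 * (coord ?x (w \<union> {p, q}) * coord ?x (w \<union> {r, s})) =
       (t3 * t3) * (t4 * t4) * (t1 * t2 * (e * (coord ?x (w \<union> {p, s}) * coord ?x (w \<union> {r, q}))))"
      using t3(1) t4(1) by simp
    then show ?thesis unfolding t1(2) t2(2) t3(2) t4(2) f_def by (simp add: mult_ac)
  qed
  define x0 :: "'a ext" where "x0 = ew w p q + ew w p s + ew w r q + ew w r s"
  have c0: "cf w p q x0 = 1" "cf w r s x0 = 1" "cf w p s x0 = 1" "cf w r q x0 = 1" "cf w p r x0 = 0"
    using d w(1) unfolding x0_def cf_add by (auto simp: cf_ew)
  have "decomposable x0" unfolding x0_def using w d by (rule decomposable_ew4)
  from rel[OF similitude_id this] c0 have "f = 1" by simp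
  with rel[OF GH z u third] show ?thesis by simp
qed

text \<open>The span of e_J and its neighbours is the tangent space at e_J to the cone of
  decomposable vectors. In terms of products: whenever e_J \<and> y = 0, the product e_J' \<and> y
  is divisible by e_J. G preserves this property; taken at y = H e_K, it shows that G e_J' \<and>
  e_K has no coordinate at a set which fails to contain J, and the union of I and K is such a
  set.\<close>

lemma similitude_tangent:
  assumes GH: "similitude n m G H" and J: "J \<in> msubsets n m" and GJ: "G (basis J) = sc c (basis J)" and c: "(c :: 'a::comm_ring_1) dvd 1"
    and J': "J' \<in> msubsets n m" "card (J - J') = 1" and I: "I \<in> msubsets n m" "2 \<le> card (I - J)"
  shows "coord (G (basis J')) I = 0"
proof -
  note D = similitudeD[OF GH]
  obtain d where d: "c * d = 1" using c by (metis dvdE)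
  have c2: "2 \<le> card (J - I)" using card_diff_eq[OF I(1) J] I(2) by simp
  then obtain j where j: "j \<in> J" "j \<notin> I" by (metis Diff_eq_empty_iff card.empty not_numeral_le_zero subsetI)
  obtain Z where Z: "Z \<subseteq> {..<n} - (J \<union> I)" "card Z = m - 1" "finite Z" using exchange_exists[OF I(1) J] .
  define K where "K = insert j Z"
  have jZ: "j \<notin> Z" using Z j by auto
  have finJ: "finite J" "finite I" "J \<subseteq> {..<n}" using J I by (auto simp: msubsets_iff)
  have K: "K \<in> msubsets n m" using Z jZ m finJ j by (auto simp: K_def msubsets_iff)
  have finK: "finite K" using Z by (simp add: K_def)
  have nsub: "\<not> J \<subseteq> I \<union> K"
  proof
    assume "J \<subseteq> I \<union> K"
    then have "J - I \<subseteq> {j}" using Z by (auto simp: K_def)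
    then have "card (J - I) \<le> card {j}" by (intro card_mono) auto
    then show False using c2 by simp
  qed
  \<comment> \<open>The vector with G y = e_K. It inherits e_J \<and> y = 0 from e_J \<and> e_K = 0
    because H scales e_J as well.\<close>
  define y where "y = H (basis K)"
  have y: "y \<in> lambda_space n m" "G y = basis K" using D(4,6)[OF basis_in_lambda_space[OF K]] by (auto simp: y_def)
  have HJ: "H (basis J) = sc d (basis J)"
  proof -
    have "basis J = H (sc c (basis J))" using D(5)[OF basis_in_lambda_space[OF J]] GJ by simp
    also have "\<dots> = sc c (H (basis J))" by (rule lin_sc[OF D(2)])
    finally have "sc d (basis J) = sc d (sc c (H (basis J)))" by simp
    then show ?thesis using d by (simp add: mult.commute)
  qed
  have "basis J * basis K = (0 :: 'a ext)" using j finJ finK by (auto simp: basis_mult K_def)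
  then have "H (basis J) * H (basis K) = 0"
    by (intro similitude_prod_zero[OF similitude_inv[OF GH]] basis_in_lambda_space J K)
  then have "sc c (sc d (basis J * y)) = 0" unfolding HJ y_def by (simp add: sc_mult_left)
  then have Jy: "basis J * y = 0" using d by simp
  have y0: "coord y T = 0" if "T \<in> msubsets n m" "T \<inter> J = {}" for T
  proof -
    have "finite T" "J \<union> T - J = T" using that by (auto simp: msubsets_iff)
    have "coord (basis J * y) (J \<union> T) = 0" unfolding Jy by simp
    then have "sg J T * coord y T = 0" using \<open>finite T\<close> \<open>J \<union> T - J = T\<close> finJ by (simp add: coord_basis_times)
    then show ?thesis by (metis mult_zero_right sg_square_left)
  qed
  obtain i where i: "J - J' = {i}" using J'(2) by (rule card_1_singletonE)
  have finJ': "finite J'" "J' \<subseteq> {..<n}" "card J' = m" using J'(1) by (auto simp: msubsets_iff)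
  have "\<exists>z. z \<in> lambda_space n m \<and> basis J' * basis T = basis J * (z :: 'a ext)" if T: "T \<in> msubsets n m" "T \<inter> J \<noteq> {}" for T
  proof (cases "J' \<inter> T = {}")
    case False
    then show ?thesis using T finJ' by (intro exI[of _ 0]) (auto simp: basis_mult msubsets_iff)
  next
    case True
    have finT: "finite T" "T \<subseteq> {..<n}" "card T = m" using T by (auto simp: msubsets_iff)
    have iT: "i \<in> T" using True T i by auto
    have sub: "J \<subseteq> J' \<union> T" using i iT by auto
    let ?U = "J' \<union> T - J"
    have "card (J' \<union> T) = m + m" using True finT finJ' by (simp add: card_Un_disjoint)
    then have "card ?U = m" using sub finJ J by (simp add: card_Diff_subset msubsets_def)
    then have U: "?U \<in> msubsets n m" using finT finJ' by (auto simp: msubsets_iff)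
    have "J \<union> ?U = J' \<union> T" using sub by auto
    then have "basis J * sc (sg J' T * sg J ?U) (basis ?U) = (basis J' * basis T :: 'a ext)"
      using True finT finJ finJ' by (simp add: basis_mult sc_mult_right mult.assoc)
    then show ?thesis using U by (intro exI[of _ "sc (sg J' T * sg J ?U) (basis ?U)"]) (auto intro: lambda_space_sc)
  qed
  then obtain zf where zf: "\<And>T. T \<in> msubsets n m \<Longrightarrow> T \<inter> J \<noteq> {} \<Longrightarrow> zf T \<in> lambda_space n m \<and> basis J' * basis T = basis J * (zf T :: 'a ext)"
    by metis
  define z where "z = (\<Sum>T | T \<in> msubsets n m \<and> T \<inter> J \<noteq> {}. sc (coord y T) (zf T))"
  have z: "z \<in> lambda_space n m" unfolding z_def using zf by (intro lambda_space_sum lambda_space_sc) auto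
  have "y = (\<Sum>T\<in>msubsets n m. sc (coord y T) (basis T))" by (rule lambda_space_expand[OF y(1)])
  also have "\<dots> = (\<Sum>T | T \<in> msubsets n m \<and> T \<inter> J \<noteq> {}. sc (coord y T) (basis T))"
    by (rule sum.mono_neutral_right) (auto simp: y0)
  finally have "basis J' * y = basis J' * (\<Sum>T | T \<in> msubsets n m \<and> T \<inter> J \<noteq> {}. sc (coord y T) (basis T))"
    by (rule arg_cong)
  also have "\<dots> = basis J * z"
    unfolding z_def sum_distrib_left sc_mult_right using zf by (intro sum.cong) auto
  finally have "G (basis J') * G y = G (basis J) * G z"
    by (intro similitude_prod[OF GH] y z basis_in_lambda_space J J'(1))
  then have "coord (G (basis J') * basis K) (I \<union> K) = coord (sc c (basis J * G z)) (I \<union> K)"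
    unfolding y(2) GJ sc_mult_left by (rule arg_cong)
  also have "\<dots> = 0" using nsub finJ finK by (simp add: coord_basis_times)
  finally have "coord (G (basis J') * basis K) (I \<union> K) = 0" .
  moreover have "I \<union> K - K = I" using Z j by (auto simp: K_def)
  ultimately have "sg I K * coord (G (basis J')) I = 0" using finJ finK by (simp add: coord_times_basis)
  then show ?thesis by (metis mult_zero_right sg_square_left)
qed

section \<open>Propagation of fixed vectors from a set to its neighbours\<close>

definition normalized :: "('a::comm_ring_1 ext \<Rightarrow> 'a ext) \<Rightarrow> nat set \<Rightarrow> bool" where
  "normalized G J \<longleftrightarrow> G (basis J) = basis J \<and>
     (\<forall>i\<in>J. \<forall>a<n. a \<notin> J \<longrightarrow> G (basis (insert a (J - {i}))) = basis (insert a (J - {i})))"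

lemma normalizedD:
  assumes "normalized G J"
  shows "G (basis J) = basis J" "i \<in> J \<Longrightarrow> a < n \<Longrightarrow> a \<notin> J \<Longrightarrow> G (basis (insert a (J - {i}))) = basis (insert a (J - {i}))"
  using assms by (auto simp: normalized_def)

text \<open>The six pairs from i, j, a, b, joined to w, are the vertices of an octahedron, adjacent
  when they differ by one exchange. The pairs {i, j} and {a, b} are opposite vertices, and the four
  sets of the hypothesis are the remaining ones, which form a 4-cycle around them.\<close>

lemma near_four:
  assumes w: "finite w" "card w + 2 = m" and d: "distinct [i, j, a, b]" "{i, j, a, b} \<inter> w = {}"
    and I: "I \<in> msubsets n m"
    and c: "card (I - (w \<union> {a, j})) \<le> 1" "card (I - (w \<union> {i, b})) \<le> 1" "card (I - (w \<union> {j, b})) \<le> 1" "card (I - (w \<union> {i, a})) \<le> 1"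
  shows "I = w \<union> {i, j} \<or> I = w \<union> {a, b}"
proof -
  have finI: "finite I" "card I = m" using I by (auto simp: msubsets_iff)
  have two: "u = v" if "card (I - B) \<le> 1" "u \<in> I - B" "v \<in> I - B" for u v B
    using that finI by (metis card_le_Suc0_iff_eq finite_Diff One_nat_def)
  note t1 = two[OF c(1)] and t2 = two[OF c(2)] and t3 = two[OF c(3)] and t4 = two[OF c(4)]
  have eq: "I = w \<union> {u, v}" if uv: "I \<subseteq> w \<union> {u, v}" "u \<noteq> v" "u \<notin> w" "v \<notin> w" for u v
  proof -
    have "card (w \<union> {u, v}) = m" using uv(2-4) w by simp
    with finI(2) show ?thesis by (intro card_subset_eq uv(1)) (simp_all add: w(1))
  qed
  have small: False if uw: "I \<subseteq> insert u w" for u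
  proof -
    have "card I \<le> card (insert u w)" using uw w(1) by (intro card_mono) simp_all
    also have "\<dots> \<le> card w + 1" using w(1) by (simp add: card_insert_if)
    finally show False using finI w(2) by simp
  qed
  show ?thesis
  proof (cases "i \<in> I")
    case True
    have "x \<in> w \<union> {i, j}" if x: "x \<in> I" for x
      using t1[of i x] t3[of i x] True x d by auto
    then have "I \<subseteq> w \<union> {i, j}" by (rule subsetI)
    then have "I = w \<union> {i, j}" by (rule eq) (use d in auto)
    then show ?thesis by simp
  next
    case i: False
    show ?thesis
    proof (cases "a \<in> I")
      case True
      have "x \<in> w \<union> {a, b}" if x: "x \<in> I" for x
        using t2[of a x] t3[of a x] True x d i by auto
      then have "I \<subseteq> w \<union> {a, b}" by (rule subsetI)
    then have "I = w \<union> {a, b}" by (rule eq) (use d in auto)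
    then show ?thesis by simp
    next
      case a: False
      have "\<exists>u. I \<subseteq> insert u w"
      proof (cases "I \<subseteq> w")
        case False
        then obtain u where u: "u \<in> I" "u \<notin> w" by auto
        have "x \<in> insert u w" if x: "x \<in> I" for x
          using t1[of u x] t2[of u x] t3[of u x] t4[of u x] u x d i a by auto
        then show ?thesis by blast
      qed auto
      then show ?thesis using small by blast
    qed
  qed
qed

text \<open>A neighbour of the new set that is neither J nor a neighbour of J consists of w = J -
  {i, j} together with a and b. It lies on an octahedron whose other five vertices are fixed. The
  tangent condition at four of them leaves two coefficients \<open>al\<close> and \<open>be\<close>,
  and two decomposable test vectors give be (al + 1) = 1 and be al = 0.\<close>

lemma normalized_step:
  assumes GH: "similitude n m G H" and N: "normalized G J" and J: "J \<in> msubsets n m" and i: "i \<in> J" and a: "a < n" "a \<notin> J"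
  shows "normalized (G :: 'a::comm_ring_1 ext \<Rightarrow> 'a ext) (insert a (J - {i}))"
proof -
  note D = similitudeD[OF GH]
  have finJ: "finite J" "J \<subseteq> {..<n}" "card J = m" using J by (auto simp: msubsets_iff)
  let ?J' = "insert a (J - {i})"
  have main: "G (basis (insert b (?J' - {j}))) = basis (insert b (?J' - {j}))" if j: "j \<in> ?J'" and b: "b < n" "b \<notin> ?J'" for j b
  proof (cases "j = a")
    case True
    then have e: "insert b (?J' - {j}) = insert b (J - {i})" using a by auto
    show ?thesis
    proof (cases "b = i")
      case True
      then have "insert b (J - {i}) = J" using i by auto
      then show ?thesis unfolding e using normalizedD(1)[OF N] by simp
    next
      case False
      then show ?thesis unfolding e using normalizedD(2)[OF N i, of b] b by auto
    qed
  next
    case False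
    then have jJ: "j \<in> J" "j \<noteq> i" using j by auto
    show ?thesis
    proof (cases "b = i")
      case True
      then have e: "insert b (?J' - {j}) = insert a (J - {j})" using i jJ a by auto
      show ?thesis unfolding e by (rule normalizedD(2)[OF N jJ(1) a])
    next
      case bi: False
      have bJ: "b \<notin> J" "b \<noteq> a" using b bi by auto
      define w where "w = J - {i, j}"
      have w: "finite w" "w \<subseteq> {..<n}" using finJ by (auto simp: w_def)
      have "card w + 2 = card J" unfolding w_def using finJ i jJ
        by (simp add: card_Diff_subset) (metis One_nat_def Suc_1 Suc_leI add.commute add_2_eq_Suc' card_2_iff card_mono empty_subsetI insert_subset le_add_diff_inverse2)
      then have w2: "card w + 2 = m" using finJ by simp
      have d: "distinct [i, j, a, b]" "{i, j, a, b} \<inter> w = {}" "{i, j, a, b} \<subseteq> {..<n}"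
        using i jJ a bJ b finJ by (auto simp: w_def)
      have Jw: "J = w \<union> {i, j}" using i jJ by (auto simp: w_def)
      have sets: "insert b (?J' - {j}) = w \<union> {a, b}" "insert a (J - {i}) = w \<union> {a, j}" "insert b (J - {j}) = w \<union> {i, b}"
        "insert b (J - {i}) = w \<union> {j, b}" "insert a (J - {j}) = w \<union> {i, a}"
        using i jJ a bJ by (auto simp: w_def)
      have fixed: "G (basis (w \<union> {a, j})) = basis (w \<union> {a, j})" "G (basis (w \<union> {i, b})) = basis (w \<union> {i, b})"
         "G (basis (w \<union> {j, b})) = basis (w \<union> {j, b})" "G (basis (w \<union> {i, a})) = basis (w \<union> {i, a})"
         "G (basis (w \<union> {i, j})) = basis (w \<union> {i, j})"
        using normalizedD(2)[OF N i a] normalizedD(2)[OF N jJ(1) b(1) bJ(1)] normalizedD(2)[OF N i b(1) bJ(1)]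
          normalizedD(2)[OF N jJ(1) a] normalizedD(1)[OF N] unfolding sets(2-5) Jw[symmetric] by simp_all
      let ?J2 = "w \<union> {a, b}"
      define x where "x = G (basis ?J2)"
      have J2: "?J2 \<in> msubsets n m" using w w2 d by (simp add: msubsets_iff)
      then have xm: "x \<in> lambda_space n m" unfolding x_def by (intro D(3) basis_in_lambda_space)
      \<comment> \<open>The sets in question are the four vertices other than the two opposite ones:
        they are fixed by G and differ from w with a, b by one exchange, as the tangent condition
        requires.\<close>
      have near: "card (I - (w \<union> {p, q})) \<le> 1"
        if I: "coord x I \<noteq> 0" and pq: "p \<noteq> q" "{p, q} \<subseteq> {i, j, a, b}" "{p, q} \<noteq> {i, j}" "{p, q} \<noteq> {a, b}" for I p q
      proof (rule ccontr)
        assume "\<not> ?thesis"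
        then have c2: "2 \<le> card (I - (w \<union> {p, q}))" by simp
        have B: "w \<union> {p, q} \<in> msubsets n m" using w w2 d pq by (auto simp: msubsets_iff)
        have "G (basis (w \<union> {p, q})) = sc 1 (basis (w \<union> {p, q}))"
          using pq fixed by (auto simp: insert_commute)
        moreover have "card (w \<union> {p, q} - ?J2) = 1"
        proof -
          have "(p \<in> {a, b}) \<noteq> (q \<in> {a, b})" using pq by auto
          then have "\<exists>u. w \<union> {p, q} - ?J2 = {u}" using pq d by (auto simp: set_eq_iff)
          then show ?thesis unfolding One_nat_def card_1_singleton_iff .
        qed
        ultimately have "coord x I = 0" unfolding x_def
          by (rule similitude_tangent[OF GH B _ one_dvd J2 _ lambda_spaceD[OF xm I] c2])
        then show False using I by simp
      qed
      have supp: "I = w \<union> {i, j} \<or> I = w \<union> {a, b}" if I: "coord x I \<noteq> 0" for I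
        using d by (intro near_four w w2 lambda_spaceD[OF xm I] near[OF I]) (auto simp: doubleton_eq_iff)
      obtain s1 :: 'a where s1: "s1 * s1 = 1" "ew w i j = sc s1 (basis (w \<union> {i, j}))" using ew_basis[of w i j] w d by auto
      obtain s2 :: 'a where s2: "s2 * s2 = 1" "ew w a b = sc s2 (basis (w \<union> {a, b}))" using ew_basis[of w a b] w d by auto
      have "x = (\<Sum>I\<in>{w \<union> {i, j}, w \<union> {a, b}}. sc (coord x I) (basis I))"
        by (rule ext_expand) (use supp in auto)
      also have "\<dots> = sc (coord x (w \<union> {i, j})) (basis (w \<union> {i, j})) + sc (coord x (w \<union> {a, b})) (basis (w \<union> {a, b}))"
        using d by (subst sum.insert) auto
      finally have xeq: "x = sc (coord x (w \<union> {i, j})) (basis (w \<union> {i, j})) + sc (coord x (w \<union> {a, b})) (basis (w \<union> {a, b}))" .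
      define al where "al = s2 * coord x (w \<union> {i, j}) * s1"
      define be where "be = coord x (w \<union> {a, b})"
      have "G (ew w a b) = sc s2 x" unfolding s2(2) x_def by (rule lin_sc[OF D(1)])
      also have "\<dots> = sc (s2 * coord x (w \<union> {i, j})) (basis (w \<union> {i, j})) + sc (s2 * be) (basis (w \<union> {a, b}))"
        by (subst xeq) (simp add: sc_add be_def)
      also have "sc (s2 * coord x (w \<union> {i, j})) (basis (w \<union> {i, j})) = sc al (ew w i j)"
        unfolding al_def s1(2) using s1(1) by (simp add: mult.assoc)
      also have "sc (s2 * be) (basis (w \<union> {a, b})) = sc be (ew w a b)"
        unfolding s2(2) by (simp add: mult.commute)
      finally have Gab: "G (ew w a b) = sc al (ew w i j) + sc be (ew w a b)" .
      have Gfix: "G (ew w p q) = ew w p q" if pq: "p \<noteq> q" "{p, q} \<subseteq> {i, j, a, b}" "{p, q} \<noteq> {a, b}" for p q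
      proof -
        obtain s :: 'a where "s * s = 1" "ew w p q = sc s (basis (w \<union> {p, q}))"
          using ew_basis[OF w(1) _ _ pq(1)] pq(2) d(2) by blast
        moreover have "G (basis (w \<union> {p, q})) = basis (w \<union> {p, q})"
          using pq fixed by (auto simp: insert_commute)
        ultimately show ?thesis by (simp add: lin_sc[OF D(1)])
      qed
      \<comment> \<open>These are e_w \<and> (e_a + e_i) \<and> (e_j + e_b) and e_w \<and> e_a
        \<and> (e_j + e_b). Among their terms only the one at a, b is not yet known to be
        fixed.\<close>
      define z1 :: "'a ext" where "z1 = ew w a j + ew w a b + ew w i j + ew w i b"
      define z2 :: "'a ext" where "z2 = ew w a j + ew w a b"
      have Gz1: "G z1 = ew w a j + (sc al (ew w i j) + sc be (ew w a b)) + ew w i j + ew w i b"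
        unfolding z1_def using d by (simp add: lin_add[OF D(1)] Gab Gfix doubleton_eq_iff)
      have Gz2: "G z2 = ew w a j + (sc al (ew w i j) + sc be (ew w a b))"
        unfolding z2_def using d by (simp add: lin_add[OF D(1)] Gab Gfix doubleton_eq_iff)
      have dd: "distinct [a, j, i, b]" "{a, j, i, b} \<inter> w = {}" "{a, j, i, b} \<subseteq> {..<n}" using d by auto
      have cf1: "cf w a j (G z1) = 1" "cf w i b (G z1) = 1" "cf w a b (G z1) = be" "cf w i j (G z1) = al + 1" "cf w a i (G z1) = 0"
        unfolding Gz1 cf_add cf_sc using dd w(1) by (auto simp: cf_ew)
      have cf2: "cf w a j (G z2) = 1" "cf w i b (G z2) = 0" "cf w a b (G z2) = be" "cf w i j (G z2) = al" "cf w a i (G z2) = 0"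
        unfolding Gz2 cf_add cf_sc using dd w(1) by (auto simp: cf_ew)
      have "decomposable z1" unfolding z1_def by (rule decomposable_ew4[OF w w2 dd])
      then have "1 = be * (al + 1)" using decomposable_rel[OF w w2 dd GH, of z1] cf1 by simp
      moreover have "decomposable z2" unfolding z2_def using dd by (intro decomposable_ew2[OF w w2]) auto
      then have "0 = be * al" using decomposable_rel[OF w w2 dd GH, of z2] cf2 by simp
      ultimately have be: "be = 1" and al: "al = 0" by (simp_all add: algebra_simps)
      have "G (ew w a b) = ew w a b" using Gab be al by simp
      then have "sc s2 (sc s2 (G (basis (w \<union> {a, b})))) = sc s2 (sc s2 (basis (w \<union> {a, b})))"
        unfolding s2(2) lin_sc[OF D(1)] by simp
      then show ?thesis unfolding sets(1) using s2(1) by simp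
    qed
  qed
  show ?thesis unfolding normalized_def using main normalizedD(2)[OF N i a] by blast
qed

text \<open>Any two m-sets are joined by a chain of single exchanges, whose length is the size of
  the difference.\<close>

lemma normalized_all:
  assumes GH: "similitude n m G H" and N: "normalized G J0" and J0: "J0 \<in> msubsets n m"
  shows "J \<in> msubsets n m \<Longrightarrow> normalized G J"
proof (induction "card (J - J0)" arbitrary: J)
  case 0
  then have "J \<subseteq> J0" by (auto simp: msubsets_iff)
  then have "J = J0" using 0 J0 by (intro card_subset_eq) (auto simp: msubsets_iff)
  then show ?case using N by simp
next
  case (Suc d)
  have "card (J0 - J) = Suc d" using card_diff_eq[OF Suc.prems J0] Suc(2) by simp
  then obtain i where i: "i \<in> J0" "i \<notin> J" by (metis Diff_eq_empty_iff card.empty nat.distinct(1) subsetI)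
  obtain t where t: "t \<in> J" "t \<notin> J0" using Suc(2) by (metis Diff_eq_empty_iff card.empty nat.distinct(1) subsetI)
  let ?J1 = "insert i (J - {t})"
  have finJ: "finite J" "J \<subseteq> {..<n}" "card J = m" "J0 \<subseteq> {..<n}" using Suc.prems J0 by (auto simp: msubsets_iff)
  have J1: "?J1 \<in> msubsets n m" using finJ i t m by (auto simp: msubsets_iff)
  have "?J1 - J0 = (J - J0) - {t}" using i by auto
  then have "d = card (?J1 - J0)" using Suc(2) t finJ by simp
  from Suc(1)[OF this J1] have "normalized G ?J1" .
  then have "normalized G (insert t (?J1 - {i}))"
    using i t finJ by (intro normalized_step[OF GH _ J1]) auto
  moreover have "insert t (?J1 - {i}) = J" using i t by auto
  ultimately show ?case by simp
qed

end

section \<open>Local rings: reduction to a block frame\<close>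

text \<open>Locality in a form that needs no ideals; it yields at once that a sum which is a unit
  has a unit among its summands.\<close>

class local_ring = comm_ring_1 +
  assumes unit_or_unit: "x dvd 1 \<or> (1 - x) dvd 1"

lemma local_add: "(x + y) dvd 1 \<Longrightarrow> x dvd 1 \<or> (y :: 'a::local_ring) dvd 1"
proof -
  assume "(x + y) dvd 1"
  then obtain d where d: "(x + y) * d = 1" by (metis dvdE)
  then have "1 - x * d = y * d" by (simp add: algebra_simps)
  then have "(x * d) dvd 1 \<or> (y * d) dvd 1" using unit_or_unit[of "x * d"] by metis
  then show ?thesis using dvd_mult_left by blast
qed

lemma local_sum:
  fixes f :: "'b \<Rightarrow> 'a::local_ring"
  assumes "finite A" "sum f A dvd 1"
  shows "\<exists>a\<in>A. f a dvd 1"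
  using assms
proof (induction A)
  case empty
  then show ?case by simp
next
  case (insert a A)
  then show ?case using local_add[of "f a" "sum f A"] by auto
qed

lemma unit_mult_left: "(x * y) dvd 1 \<Longrightarrow> (x::'a::comm_ring_1) dvd 1"
  and unit_mult_right: "(x * y) dvd 1 \<Longrightarrow> (y::'a::comm_ring_1) dvd 1"
  and unit_mult: "(x::'a::comm_ring_1) dvd 1 \<Longrightarrow> y dvd 1 \<Longrightarrow> (x * y) dvd 1"
  using dvd_mult_left dvd_mult_right mult_dvd_mono[of x 1 y 1] by auto

text \<open>Meant for x = G e_J and H inverse to G: the coordinate 1 of H x = e_J is a linear
  combination of the coordinates of x.\<close>

lemma local_coord_unit:
  assumes "lin H" "x \<in> lambda_space n m" "coord (H x) K dvd (1 :: 'a::local_ring)"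
  shows "\<exists>I\<in>msubsets n m. coord x I dvd 1"
proof -
  have "H x = (\<Sum>I\<in>msubsets n m. sc (coord x I) (H (basis I)))"
    by (subst lambda_space_expand[OF assms(2)]) (simp add: lin_sum[OF assms(1)] lin_sc[OF assms(1)])
  then have "(\<Sum>I\<in>msubsets n m. coord x I * coord (H (basis I)) K) dvd 1"
    using assms(3) by (simp add: coord_sum)
  then show ?thesis using local_sum[OF finite_msubsets] unit_mult_left by blast
qed

section \<open>Coordinates of products as minors\<close>

lemma sorted_list_of_set_remove_nth:
  fixes I :: "nat set"
  assumes I: "finite I" "card I = Suc m" and a: "a < Suc m"
  defines "xs \<equiv> sorted_list_of_set I"
  shows "sorted_list_of_set (I - {xs ! a}) = take a xs @ drop (Suc a) xs"
    "sg {xs ! a} (I - {xs ! a}) = ((-1) ^ a :: 'b::comm_ring_1)"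
proof -
  have xs: "sorted xs" "distinct xs" "length xs = Suc m" "set xs = I" using I by (auto simp: xs_def)
  have sd: "sorted_wrt (<) xs" using xs by (simp add: strict_sorted_iff)
  have split: "xs = take a xs @ xs ! a # drop (Suc a) xs" using a xs(3) by (simp add: id_take_nth_drop)
  have sd': "sorted_wrt (<) (take a xs @ xs ! a # drop (Suc a) xs)" using sd split by metis
  have ds: "distinct (take a xs @ xs ! a # drop (Suc a) xs)" using xs(2) split by metis
  have "sorted_wrt (<) (take a xs @ drop (Suc a) xs)" using sd' by (auto simp: sorted_wrt_append)
  moreover have "set (take a xs @ xs ! a # drop (Suc a) xs) = I" using xs(4) split by metis
  then have "set (take a xs @ drop (Suc a) xs) = I - {xs ! a}" using ds by auto
  ultimately show "sorted_list_of_set (I - {xs ! a}) = take a xs @ drop (Suc a) xs"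
    using sorted_list_of_set.idem_if_sorted_distinct[of "take a xs @ drop (Suc a) xs"] by (simp add: strict_sorted_iff)
  have "{p \<in> {xs ! a} \<times> (I - {xs ! a}). snd p < fst p} = Pair (xs ! a) ` set (take a xs)"
    using sd' \<open>set (take a xs @ xs ! a # drop (Suc a) xs) = I\<close> by (auto simp: sorted_wrt_append)
  then have "card {p \<in> {xs ! a} \<times> (I - {xs ! a}). snd p < fst p} = card (set (take a xs))"
    by (simp add: card_image inj_on_def)
  also have "\<dots> = a" using xs a by (simp add: distinct_card)
  finally show "sg {xs ! a} (I - {xs ! a}) = ((-1) ^ a :: 'b)" by (simp add: sg_def)
qed

text \<open>Splitting off the left factor of the product is the Laplace expansion along the first
  column: the sign of an element of I against the rest of I is the cofactor sign of its
  position.\<close>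

lemma coord_prod_list_det:
  assumes "\<And>v. v \<in> set vs \<Longrightarrow> v \<in> lambda_space n 1" "finite I" "card I = length vs"
  shows "coord (prod_list vs) I =
    det (mat (length vs) (length vs) (\<lambda>(a, b). coord (vs ! b) {sorted_list_of_set I ! a}))"
  using assms
proof (induction vs arbitrary: I)
  case Nil
  then show ?case by (simp add: coord_one)
next
  case (Cons v vs)
  let ?m = "length vs" and ?xs = "sorted_list_of_set I"
  let ?A = "mat (Suc ?m) (Suc ?m) (\<lambda>(a, b). coord ((v # vs) ! b) {?xs ! a})"
  have bij: "bij_betw ((!) ?xs) {..<Suc ?m} I"
    using Cons.prems(2,3) bij_betw_nth[of ?xs "{..<Suc ?m}" I] by simp
  have xsI: "?xs ! a \<in> I" if "a < Suc ?m" for a using bij that by (auto simp: bij_betw_def)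
  have "coord (prod_list (v # vs)) I = (\<Sum>K\<in>Pow I. sg K (I - K) * (coord v K * coord (prod_list vs) (I - K)))"
    by (simp add: coord_times)
  also have "\<dots> = (\<Sum>K\<in>(\<lambda>i. {i}) ` I. sg K (I - K) * (coord v K * coord (prod_list vs) (I - K)))"
  proof (rule sum.mono_neutral_right)
    show "\<forall>K\<in>Pow I - (\<lambda>i. {i}) ` I. sg K (I - K) * (coord v K * coord (prod_list vs) (I - K)) = 0"
    proof
      fix K assume K: "K \<in> Pow I - (\<lambda>i. {i}) ` I"
      have "coord v K = 0"
      proof (rule ccontr)
        assume "coord v K \<noteq> 0"
        then have "card K = 1" using Cons.prems(1)[of v] by (auto simp: lambda_space_def msubsets_def)
        then obtain i where "K = {i}" by (rule card_1_singletonE)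
        then show False using K by auto
      qed
      then show "sg K (I - K) * (coord v K * coord (prod_list vs) (I - K)) = 0" by simp
    qed
  qed (use Cons.prems in auto)
  also have "\<dots> = (\<Sum>i\<in>I. sg {i} (I - {i}) * (coord v {i} * coord (prod_list vs) (I - {i})))"
    by (simp add: sum.reindex)
  also have "\<dots> = (\<Sum>a<Suc ?m. sg {?xs ! a} (I - {?xs ! a}) * (coord v {?xs ! a} * coord (prod_list vs) (I - {?xs ! a})))"
    by (rule sum.reindex_bij_betw[OF bij, symmetric])
  also have "\<dots> = (\<Sum>a<Suc ?m. ?A $$ (a, 0) * cofactor ?A a 0)"
  proof (rule sum.cong[OF refl])
    fix a assume "a \<in> {..<Suc ?m}"
    then have a: "a < Suc ?m" by simp
    have cI: "card I = Suc ?m" using Cons.prems(3) by simp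
    note rem = sorted_list_of_set_remove_nth[OF Cons.prems(2) cI a]
    have "coord (prod_list vs) (I - {?xs ! a}) =
       det (mat ?m ?m (\<lambda>(a', b). coord (vs ! b) {sorted_list_of_set (I - {?xs ! a}) ! a'}))"
      using Cons.prems xsI[OF a] by (intro Cons.IH) auto
    also have "mat ?m ?m (\<lambda>(a', b). coord (vs ! b) {sorted_list_of_set (I - {?xs ! a}) ! a'}) = mat_delete ?A a 0"
    proof (rule eq_matI)
      fix i j assume ij: "i < dim_row (mat_delete ?A a 0)" "j < dim_col (mat_delete ?A a 0)"
      then have "sorted_list_of_set (I - {?xs ! a}) ! i = ?xs ! (if i < a then i else Suc i)"
        using a cI Cons.prems(2) by (auto simp: rem(1) nth_append min_def)
      then show "mat ?m ?m (\<lambda>(a', b). coord (vs ! b) {sorted_list_of_set (I - {?xs ! a}) ! a'}) $$ (i, j) = mat_delete ?A a 0 $$ (i, j)"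
        using ij by (simp add: mat_delete_def)
    qed simp_all
    finally show "sg {?xs ! a} (I - {?xs ! a}) * (coord v {?xs ! a} * coord (prod_list vs) (I - {?xs ! a})) = ?A $$ (a, 0) * cofactor ?A a 0"
      using a by (simp add: rem(2) cofactor_def mult_ac)
  qed
  also have "\<dots> = det ?A"
    by (rule laplace_expansion_column[symmetric]) auto
  finally show ?case by simp
qed

lemma coord_cvec: "i < dim_row A \<Longrightarrow> coord (cvec A j) {i} = A $$ (i, j)"
  by (simp add: cvec_def coord_evec)

lemma sorted_list_of_lessThan [simp]: "sorted_list_of_set {..<n :: nat} = [0..<n]"
  by (simp add: lessThan_atLeast0)

lemma coord_Lam_top:
  assumes "A \<in> carrier_mat n n"
  shows "coord (Lam A (basis {..<n})) {..<n} = det A"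
proof -
  have "coord (Lam A (basis {..<n})) {..<n} = coord (prod_list (map (cvec A) [0..<n])) {..<n}"
    using assms by (simp add: Lam_basis oprod_def)
  also have "\<dots> = det (mat n n (\<lambda>(a, b). coord (map (cvec A) [0..<n] ! b) {[0..<n] ! a}))"
    using cvec_in[of A] assms by (subst coord_prod_list_det[where n = n]) auto
  also have "mat n n (\<lambda>(a, b). coord (map (cvec A) [0..<n] ! b) {[0..<n] ! a}) = A"
    using assms by (intro eq_matI) (auto simp: coord_cvec)
  finally show ?thesis .
qed

lemma unit_det_inverse:
  assumes A: "A \<in> carrier_mat n n" and u: "det A dvd (1 :: 'a::comm_ring_1)"
  obtains B where "B \<in> carrier_mat n n" "A * B = 1\<^sub>m n" "B * A = 1\<^sub>m n"
proof -
  obtain d where d: "det A * d = 1" using u by (metis dvdE)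
  note adj = adj_mat[OF A]
  have "A * (d \<cdot>\<^sub>m adj_mat A) = d \<cdot>\<^sub>m (A * adj_mat A)" using A adj(1) by (simp add: mult_smult_distrib)
  also have "\<dots> = 1\<^sub>m n" unfolding adj(2) using d by (intro eq_matI) (auto simp: mult.commute)
  finally have *: "A * (d \<cdot>\<^sub>m adj_mat A) = 1\<^sub>m n" .
  have B: "d \<cdot>\<^sub>m adj_mat A \<in> carrier_mat n n" using adj(1) by simp
  from that[OF B * mat_right_inverse[OF A B *]] show thesis .
qed

text \<open>The map sends e_t to e_t + c e_a, so a coordinate at I can change only through the set
  that becomes I when t is exchanged for a. This allows coordinates to be cleared one at a
  time.\<close>

lemma coord_Lam_addrow:
  assumes at: "a < n" "t < n" "a \<noteq> t" and y: "y \<in> lambda_all n" and I: "finite I"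
  shows "coord (Lam (addrow_mat n c a t) y) I = coord y I +
     (if a \<in> I \<and> t \<notin> I then c * (sg {t} (I - {a}) * sg {a} (I - {a})) * coord y (insert t (I - {a})) else (0 :: 'a::comm_ring_1))"
proof -
  let ?E = "addrow_mat n c a t"
  let ?f = "\<lambda>y. coord y I + (if a \<in> I \<and> t \<notin> I then c * (sg {t} (I - {a}) * sg {a} (I - {a})) * coord y (insert t (I - {a})) else (0 :: 'a))"
  have b: "coord (Lam ?E (basis J)) I = ?f (basis J)" if J: "J \<subseteq> {..<n}" for J
  proof (cases "t \<in> J")
    case False
    have "Lam ?E (basis J) = basis J"
      using J False at by (intro Lam_fix) (auto simp: cvec_addrow)
    moreover have "insert t (I - {a}) \<noteq> J" using False by auto
    moreover have "finite J" using J by (rule finite_subset) simp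
    ultimately show ?thesis using I by (simp add: coord_basis)
  next
    case True
    have fin: "finite J" using J by (rule finite_subset) simp
    let ?J = "J - {t}"
    have J': "?J \<subseteq> {..<n}" "insert t ?J = J" "a \<in> J \<longleftrightarrow> a \<in> ?J" using J True at by auto
    have fix1: "Lam ?E (basis ?J) = basis ?J" using J at by (intro Lam_fix) (auto simp: cvec_addrow)
    have fix2: "Lam ?E (basis {t}) = basis {t} + sc c (basis {a})" using at by (simp add: Lam_basis1 cvec_addrow)
    have prod: "basis {t} * basis ?J = sc (sg {t} ?J) (basis J :: 'a ext)"
      using fin J' by (simp add: basis_mult)
    then have "basis J = sc (sg {t} ?J) (basis {t} * basis ?J :: 'a ext)" by simp
    then have "Lam ?E (basis J) = sc (sg {t} ?J) (Lam ?E (basis {t}) * Lam ?E (basis ?J))"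
      using J' at by (simp add: Lam_sc Lam_times lambda_all_basis)
    also have "\<dots> = basis J + sc (sg {t} ?J * c) (basis {a} * basis ?J)"
      unfolding fix1 fix2 by (simp add: distrib_right sc_add prod sc_mult_left)
    also have "basis {a} * basis ?J = (if a \<in> ?J then 0 else sc (sg {a} ?J) (basis (insert a ?J)) :: 'a ext)"
      using fin by (simp add: basis_mult)
    finally have L: "Lam ?E (basis J) = basis J + sc (sg {t} ?J * c) (if a \<in> ?J then 0 else sc (sg {a} ?J) (basis (insert a ?J)))" .
    show ?thesis
    proof (cases "a \<in> I \<and> t \<notin> I \<and> insert t (I - {a}) = J")
      case True
      then have "I - {a} = ?J" "a \<notin> ?J" "insert a ?J = I" using at by auto
      then show ?thesis unfolding L using True fin I at by (simp add: coord_basis mult_ac)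
    next
      case False
      have "a \<in> ?J \<or> insert a ?J \<noteq> I"
      proof (rule ccontr)
        assume "\<not> ?thesis"
        then have "a \<notin> ?J" "I = insert a ?J" by auto
        then show False using False True at by auto
      qed
      then show ?thesis unfolding L using False fin by (auto simp: coord_basis)
    qed
  qed
  have "coord (Lam ?E y) I = (\<Sum>J\<in>Pow {..<n}. coord y J * coord (Lam ?E (basis J)) I)"
    by (subst lambda_all_expand[OF y]) (simp add: Lam_sum Lam_sc coord_sum)
  also have "\<dots> = (\<Sum>J\<in>Pow {..<n}. coord y J * ?f (basis J))" using b by (intro sum.cong) auto
  also have "\<dots> = ?f (\<Sum>J\<in>Pow {..<n}. sc (coord y J) (basis J))"
    by (cases "a \<in> I"; cases "t \<in> I") (simp_all add: coord_sum sum_distrib_left distrib_left sum.distrib mult_ac)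
  also have "(\<Sum>J\<in>Pow {..<n}. sc (coord y J) (basis J)) = y" by (rule lambda_all_expand[OF y, symmetric])
  finally show ?thesis .
qed

section \<open>Decomposability at a unit coordinate and the frame of blocks\<close>

context blocks
begin

definition invmat :: "'a::comm_ring_1 mat \<Rightarrow> 'a mat \<Rightarrow> bool" where
  "invmat A B \<longleftrightarrow> A \<in> carrier_mat n n \<and> B \<in> carrier_mat n n \<and> A * B = 1\<^sub>m n \<and> B * A = 1\<^sub>m n"

lemma m_dvd_n: "m dvd n" by (simp add: n)

lemma invmat_similitude: "invmat A B \<Longrightarrow> similitude n m (Lam A) (Lam B)"
  by (intro similitude_Lam) (auto simp: invmat_def m_dvd_n)

lemma invmat_sym: "invmat A B \<Longrightarrow> invmat B A"
  by (auto simp: invmat_def)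

lemma invmat_mult: "invmat A B \<Longrightarrow> invmat C D \<Longrightarrow> invmat (C * A) (B * D)"
  unfolding invmat_def using mult_inverse_mat[of A n B C D] mult_inverse_mat[of D n C B A] by auto

lemma invmat_Lam: "invmat A B \<Longrightarrow> x \<in> lambda_all n \<Longrightarrow> Lam A (Lam B x) = x"
  by (simp add: invmat_def Lam_mult[of A n B] Lam_id)

text \<open>Gauss elimination with the unit coordinate at T as pivot. Elementary matrices clear the
  coordinates at the neighbours of T one by one, without touching the pivot or the neighbours
  cleared before; the quadratic relations at T then kill all coordinates farther away.\<close>

lemma decomposable_at_unit:
  assumes GH: "similitude n m G H" and J: "J \<in> msubsets n m" and T: "T \<in> msubsets n m"
    and u: "coord (G (basis J)) T dvd (1 :: 'a::comm_ring_1)"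
  obtains A B where "invmat A B" "G (basis J) = sc (coord (G (basis J)) T) (Lam A (basis T))"
proof -
  define x where "x = G (basis J)"
  have xm: "x \<in> lambda_space n m" unfolding x_def by (intro similitudeD(3)[OF GH] basis_in_lambda_space J)
  obtain d where d: "coord x T * d = 1" using u by (metis dvdE x_def)
  have finT: "finite T" "T \<subseteq> {..<n}" "card T = m" using T by (auto simp: msubsets_iff)
  \<comment> \<open>P collects the exchanges whose coordinates have been cleared so far.\<close>
  have ex: "\<exists>A B. invmat A B \<and> coord (Lam B x) T = coord x T \<and> (\<forall>(t, a)\<in>P. coord (Lam B x) (insert a (T - {t})) = 0)"
    if "finite P" "P \<subseteq> T \<times> ({..<n} - T)" for P
    using that
  proof (induction P)
    case empty
    have "invmat (1\<^sub>m n) (1\<^sub>m n :: 'a mat)" by (simp add: invmat_def)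
    then show ?case using lambda_space_subset_all[OF xm]
      by (intro exI[of _ "1\<^sub>m n"]) (simp add: Lam_id)
  next
    case (insert p P)
    obtain t a where p: "p = (t, a)" by (cases p)
    have ta: "t \<in> T" "a < n" "a \<notin> T" "t < n" "a \<noteq> t" using insert.prems finT p by auto
    obtain A B where AB: "invmat A B" "coord (Lam B x) T = coord x T" "\<forall>(t, a)\<in>P. coord (Lam B x) (insert a (T - {t})) = 0"
      using insert by auto
    define y where "y = Lam B x"
    have ya: "y \<in> lambda_all n" unfolding y_def
      using AB(1) xm Lam_in[of x B m] by (auto simp: invmat_def intro: lambda_space_subset_all)
    have yT: "coord y T = coord x T" using AB(2) by (simp add: y_def)
    define s :: 'a where "s = sg {t} (T - {t}) * sg {a} (T - {t})"
    have s: "s * s = 1" by (simp add: s_def mult_ac)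
    \<comment> \<open>The elementary matrix adds \<open>c * s\<close> times the pivot to the
      coordinate at T with t exchanged for a; d is the inverse of the pivot and s the sign of the
      exchange.\<close>
    define c where "c = - (s * coord y (insert a (T - {t})) * d)"
    let ?E = "addrow_mat n c a t" and ?E' = "addrow_mat n (- c) a t"
    have E: "invmat ?E' ?E" using ta by (simp add: invmat_def addrow_inverse)
    have "Lam (?E * B) x = Lam ?E y" unfolding y_def
      using AB(1) E by (simp add: invmat_def Lam_mult[of ?E n B])
    moreover have "coord (Lam ?E y) T = coord x T"
      using ta finT yT by (simp add: coord_Lam_addrow ya)
    moreover have "coord (Lam ?E y) (insert a' (T - {t'})) = 0" if ta': "(t', a') \<in> insert p P" for t' a'
    proof -
      have t': "t' \<in> T" "a' \<notin> T" using insert.prems ta' by auto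
      show ?thesis
      proof (cases "a' = a \<and> t' = t")
        case True
        have "insert a (T - {t}) - {a} = T - {t}" "insert t (T - {t}) = T" using ta by auto
        then have "coord (Lam ?E y) (insert a (T - {t})) = coord y (insert a (T - {t})) + c * s * coord x T"
          using ta finT yT by (simp add: coord_Lam_addrow ya s_def)
        also have "c * s * coord x T = - (coord y (insert a (T - {t}))) * (s * s) * (coord x T * d)"
          by (simp add: c_def algebra_simps)
        finally show ?thesis using True s d by simp
      next
        case False
        \<comment> \<open>Among the neighbours of T, only the one being cleared contains a and
          misses t, so all others keep their coordinates.\<close>
        then have nn: "\<not> (a \<in> insert a' (T - {t'}) \<and> t \<notin> insert a' (T - {t'}))" using ta t' by auto
        have fin: "finite (insert a' (T - {t'}))" using finT by simp
        have "coord y (insert a' (T - {t'})) = 0" using AB(3) False ta' p by (auto simp: y_def)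
        then show ?thesis unfolding coord_Lam_addrow[OF ta(2,4,5) ya fin] if_not_P[OF nn] by simp
      qed
    qed
    ultimately show ?case using invmat_mult[OF E AB(1)[THEN invmat_sym], THEN invmat_sym] invmat_mult[OF invmat_sym[OF AB(1)] invmat_sym[OF E]]
      by (intro exI[of _ "A * ?E'"] exI[of _ "?E * B"]) (auto intro: invmat_sym)
  qed
  obtain A B where AB: "invmat A B" "coord (Lam B x) T = coord x T"
      "\<And>t a. t \<in> T \<Longrightarrow> a < n \<Longrightarrow> a \<notin> T \<Longrightarrow> coord (Lam B x) (insert a (T - {t})) = 0"
    using ex[of "T \<times> ({..<n} - T)"] finT by auto
  define y where "y = Lam B x"
  have ym: "y \<in> lambda_space n m" unfolding y_def using AB(1) xm Lam_in[of x B m] by (auto simp: invmat_def)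
  have s: "similitude n m (\<lambda>x. Lam B (G x)) (\<lambda>x. H (Lam A x))"
    by (rule similitude_comp[OF invmat_similitude[OF invmat_sym[OF AB(1)]] GH])
  have uy: "coord y T dvd 1" using u AB(2) by (simp add: y_def x_def)
  have p: "pluecker n m y T" using similitude_pluecker[OF s decomposable_basis[OF J] T] uy by (simp add: y_def x_def)
  have "coord y I = 0" if "I \<noteq> T" for I
  proof (rule ccontr)
    assume nz: "coord y I \<noteq> 0"
    then have I: "I \<in> msubsets n m" by (rule lambda_spaceD[OF ym])
    then have finI: "finite I" "I \<subseteq> {..<n}" "card I = m" by (auto simp: msubsets_iff)
    consider "card (I - T) = 0" | "card (I - T) = 1" | "2 \<le> card (I - T)" by linarith
    then show False
    proof cases
      case 1
      then have "I \<subseteq> T" using finI by auto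
      then have "I = T" using finT finI by (intro card_subset_eq) auto
      then show False using that by simp
    next
      case 2
      then obtain a where a: "I - T = {a}" by (rule card_1_singletonE)
      have "card (T - I) = 1" using card_diff_eq[OF I T] 2 by simp
      then obtain t where t: "T - I = {t}" by (rule card_1_singletonE)
      have "I = insert a (T - {t})" using a t by auto
      moreover have "t \<in> T" "a < n" "a \<notin> T" using a t finI by auto
      ultimately show False using AB(3) nz by (simp add: y_def)
    next
      case 3
      have "coord y I = 0"
        using pluecker_far_zero[OF p T uy _ I 3] AB(3) by (simp add: y_def)
      then show False using nz by simp
    qed
  qed
  then have "y = (\<Sum>I\<in>{T}. sc (coord y I) (basis I))" by (intro ext_expand) auto
  then have "y = sc (coord x T) (basis T)" using AB(2) by (simp add: y_def)
  then have "x = sc (coord x T) (Lam A (basis T))"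
    using invmat_Lam[OF AB(1), of x] lambda_space_subset_all[OF xm] by (simp add: y_def Lam_sc)
  then show thesis using that AB(1) unfolding x_def by blast
qed

definition blk :: "nat \<Rightarrow> nat set" where "blk b = {b * m..<b * m + m}"

lemma blk_msubset: "b < k \<Longrightarrow> blk b \<in> msubsets n m"
proof -
  assume "b < k"
  then have "b * m + m \<le> k * m" by (metis Suc_leI add.commute mult_Suc mult_le_mono1)
  then show ?thesis using n by (auto simp: blk_def msubsets_iff)
qed

lemma blk_less: "b < k \<Longrightarrow> j \<in> blk b \<Longrightarrow> j < n"
  using blk_msubset[of b] by (auto simp: msubsets_iff)

lemma blk_div: "j \<in> blk b \<longleftrightarrow> j div m = b"
proof
  assume "j \<in> blk b"
  then show "j div m = b" by (intro div_nat_eqI) (simp_all add: blk_def mult.commute)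
next
  assume "j div m = b"
  then have "b * m + j mod m = j" using div_mult_mod_eq[of j m] by simp
  moreover have "j mod m < m" using m by simp
  ultimately show "j \<in> blk b" unfolding blk_def by auto
qed

lemma blk_disjoint: "b \<noteq> b' \<Longrightarrow> blk b \<inter> blk b' = {}"
  by (auto simp: blk_div)

lemma div_less: "j < n \<Longrightarrow> j div m < k"
  unfolding n by (rule less_mult_imp_div_less)

lemma prod_blocks: "prod_list (map (\<lambda>b. oprod v (blk b)) [0..<c]) = prod_list (map v [0..<c * m])"
proof (induction c)
  case (Suc c)
  have "[0..<Suc c * m] = [0..<c * m] @ [c * m..<c * m + m]"
    using upt_add_eq_append[of 0 "c * m" m] by (simp add: add.commute)
  then show ?case using Suc by (simp add: oprod_def blk_def)
qed simp

lemma basis_blocks: "prod_list (map (\<lambda>b. basis (blk b)) [0..<k]) = (basis {..<n} :: 'a::comm_ring_1 ext)"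
proof -
  have eq: "map (\<lambda>b. basis (blk b)) [0..<k] = map (\<lambda>b. oprod (\<lambda>i. basis {i} :: 'a ext) (blk b)) [0..<k]"
    by (simp add: oprod_basis blk_def)
  have "prod_list (map (\<lambda>b. basis (blk b)) [0..<k]) = prod_list (map (\<lambda>i. basis {i} :: 'a ext) [0..<k * m])"
    unfolding eq by (rule prod_blocks)
  also have "\<dots> = oprod (\<lambda>i. basis {i}) {..<n}" by (simp add: oprod_def n)
  finally show ?thesis by (simp add: oprod_basis)
qed

lemma prod_list_sc2: "prod_list (map (\<lambda>b. sc (c b) (x b)) bs) = sc (prod_list (map c bs)) (prod_list (map x bs))"
  by (induction bs) (simp_all add: sc_mult_left sc_mult_right mult.commute)

text \<open>Each image of a block vector is decomposable through a matrix of its own, and h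
  collects, block by block, the columns that span these images. Evaluating the form at the blocks
  gives a multiple of det h on the one hand and the unit multiplier on the other, so det h is a
  unit.\<close>

lemma block_frame:
  assumes GH: "similitude n m G H"
  obtains h h' and c :: "nat \<Rightarrow> 'a::local_ring" where "invmat h h'" "\<And>b. b < k \<Longrightarrow> c b dvd 1"
    "\<And>b. b < k \<Longrightarrow> G (basis (blk b)) = sc (c b) (Lam h (basis (blk b)))"
proof -
  have "\<exists>T A B. T \<in> msubsets n m \<and> coord (G (basis (blk b))) T dvd 1 \<and> invmat A B \<and>
      G (basis (blk b)) = sc (coord (G (basis (blk b))) T) (Lam A (basis T))" if b: "b < k" for b
  proof -
    note J = blk_msubset[OF b]
    have "coord (H (G (basis (blk b)))) (blk b) dvd (1 :: 'a)"
      using similitudeD(5)[OF GH basis_in_lambda_space[OF J]] by (simp add: coord_basis blk_def)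
    then obtain T where T: "T \<in> msubsets n m" "coord (G (basis (blk b))) T dvd 1"
      using local_coord_unit[OF similitudeD(2)[OF GH] similitudeD(3)[OF GH basis_in_lambda_space[OF J]]] by blast
    then show ?thesis using decomposable_at_unit[OF GH J T] by metis
  qed
  then obtain T A B where TA: "\<And>b. b < k \<Longrightarrow> T b \<in> msubsets n m" "\<And>b. b < k \<Longrightarrow> coord (G (basis (blk b))) (T b) dvd 1"
     "\<And>b. b < k \<Longrightarrow> invmat (A b) (B b)" "\<And>b. b < k \<Longrightarrow> G (basis (blk b)) = sc (coord (G (basis (blk b))) (T b)) (Lam (A b) (basis (T b)))"
    by metis
  define c where "c b = coord (G (basis (blk b))) (T b)" for b
  \<comment> \<open>Column b m + r of h is the r-th vector in the product that represents the image
    of block b.\<close>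
  define h where "h = mat n n (\<lambda>(i, j). A (j div m) $$ (i, sorted_list_of_set (T (j div m)) ! (j mod m)))"
  have h: "h \<in> carrier_mat n n" by (simp add: h_def)
  have cv: "cvec h j = cvec (A (j div m)) (sorted_list_of_set (T (j div m)) ! (j mod m))" if "j < n" for j
    using that TA(3)[OF div_less[OF that]] by (auto simp: cvec_def h_def invmat_def evec_def)
  have Lh: "Lam h (basis (blk b)) = Lam (A b) (basis (T b))" if b: "b < k" for b
  proof -
    have T: "T b \<subseteq> {..<n}" "card (T b) = m" "finite (T b)" using TA(1)[OF b] by (auto simp: msubsets_iff)
    have bn: "blk b \<subseteq> {..<n}" using blk_msubset[OF b] by (simp add: msubsets_iff)
    have "map (cvec h) [b * m..<b * m + m] = map (cvec (A b)) (sorted_list_of_set (T b))"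
    proof (rule nth_equalityI)
      fix i assume "i < length (map (cvec h) [b * m..<b * m + m])"
      then have i: "i < m" by simp
      then have "b * m + i \<in> blk b" by (simp add: blk_def)
      then have "b * m + i < n" using bn by auto
      from cv[OF this] show "map (cvec h) [b * m..<b * m + m] ! i = map (cvec (A b)) (sorted_list_of_set (T b)) ! i"
        using i T by simp
    qed (use T in simp)
    then have "oprod (cvec h) (blk b) = oprod (cvec (A b)) (T b)" by (simp add: oprod_def blk_def)
    moreover have "A b \<in> carrier_mat n n" using TA(3)[OF b] by (simp add: invmat_def)
    ultimately show ?thesis using T bn h by (simp add: Lam_basis)
  qed
  have Gb: "G (basis (blk b)) = sc (c b) (Lam h (basis (blk b)))" if "b < k" for b
    using TA(4)[OF that] Lh[OF that] by (simp add: c_def)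
  obtain l where l: "l dvd 1" "\<And>xs. length xs = k \<Longrightarrow> set xs \<subseteq> lambda_space n m \<Longrightarrow>
        coord (prod_list (map G xs)) {..<n} = l * coord (prod_list xs) {..<n}"
    using similitude_form[OF GH] unfolding divk by blast
  let ?xs = "map (\<lambda>b. basis (blk b)) [0..<k] :: 'a ext list"
  have "prod_list (map G ?xs) = prod_list (map (\<lambda>b. sc (c b) (Lam h (basis (blk b)))) [0..<k])"
    by (intro arg_cong[where f = prod_list]) (simp add: Gb)
  also have "\<dots> = sc (prod_list (map c [0..<k])) (prod_list (map (Lam h) ?xs))"
    by (simp add: prod_list_sc2 o_def)
  also have "prod_list (map (Lam h) ?xs) = Lam h (prod_list ?xs)"
    using h blk_less by (intro Lam_prod_list[symmetric]) (auto intro!: lambda_all_basis)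
  also have "prod_list ?xs = basis {..<n}" by (rule basis_blocks)
  finally have "coord (prod_list (map G ?xs)) {..<n} = prod_list (map c [0..<k]) * det h"
    by (simp add: coord_Lam_top[OF h])
  moreover have "coord (prod_list (map G ?xs)) {..<n} = l * coord (prod_list ?xs) {..<n}"
    using blk_msubset by (intro l(2)) auto
  ultimately have "(prod_list (map c [0..<k]) * det h) dvd 1" using l(1) by (simp add: basis_blocks coord_basis)
  then have "det h dvd 1" by (rule unit_mult_right)
  then obtain h' where "h' \<in> carrier_mat n n" "h * h' = 1\<^sub>m n" "h' * h = 1\<^sub>m n" using unit_det_inverse[OF h] by blast
  then have "invmat h h'" using h by (simp add: invmat_def)
  moreover have "c b dvd 1" if "b < k" for b using TA(2)[OF that] by (simp add: c_def)
  ultimately show thesis using that Gb by blast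
qed

end

section \<open>Local rings: diagonalization on a block frame\<close>

text \<open>\<open>replace_factor J i a\<close> is the basis element of \<open>J\<close> with the factor \<open>e\<^sub>i\<close> replaced by \<open>e\<^sub>a\<close>.\<close>

definition replace_factor :: "nat set \<Rightarrow> nat \<Rightarrow> nat \<Rightarrow> 'a::comm_ring_1 ext" where
  "replace_factor J i a = sc (sg {i} (J - {i})) (basis {a} * basis (J - {i}))"

text \<open>The coefficient at \<open>replace_factor J i a\<close>, which for i in J and a outside J
  is a basis vector with the product of these two signs.\<close>

definition replace_coeff :: "nat set \<Rightarrow> nat \<Rightarrow> nat \<Rightarrow> 'a::comm_ring_1 ext \<Rightarrow> 'a" where
  "replace_coeff J i a x = sg {i} (J - {i}) * sg {a} (J - {i}) * coord x (insert a (J - {i}))"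

lemma replace_factor_same: "finite J \<Longrightarrow> i \<in> J \<Longrightarrow> replace_factor J i i = (basis J :: 'a::comm_ring_1 ext)"
  by (simp add: replace_factor_def basis_mult insert_absorb)

lemma replace_factor_basis:
  "finite J \<Longrightarrow> i \<in> J \<Longrightarrow> a \<notin> J \<Longrightarrow> replace_factor J i a = sc (sg {i} (J - {i}) * sg {a} (J - {i})) (basis (insert a (J - {i})) :: 'a::comm_ring_1 ext)"
  by (simp add: replace_factor_def basis_mult)

lemma basis_replace_factor:
  "finite J \<Longrightarrow> i \<in> J \<Longrightarrow> a \<notin> J \<Longrightarrow> basis (insert a (J - {i})) = sc (sg {i} (J - {i}) * sg {a} (J - {i})) (replace_factor J i a :: 'a::comm_ring_1 ext)"
proof -
  assume "finite J" "i \<in> J" "a \<notin> J"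
  moreover have "sg {i} (J - {i}) * sg {a} (J - {i}) * (sg {i} (J - {i}) * sg {a} (J - {i})) = (1 :: 'a)"
    by (simp add: mult_ac)
  ultimately show ?thesis by (simp add: replace_factor_basis)
qed

lemma replace_coeff_add: "replace_coeff J i a (x + y) = replace_coeff J i a x + replace_coeff J i a y"
  and replace_coeff_sc: "replace_coeff J i a (sc c x) = c * replace_coeff J i a x"
  by (simp_all add: replace_coeff_def algebra_simps)

lemma insert_remove_eq_iff:
  assumes "i \<in> J" "j \<in> J" "a \<notin> J" "b \<notin> J"
  shows "insert a (J - {i}) = insert b (J - {j}) \<longleftrightarrow> i = j \<and> a = b"
proof
  assume eq: "insert a (J - {i}) = insert b (J - {j})"
  have "a \<in> insert b (J - {j})" unfolding eq[symmetric] by simp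
  then have ab: "a = b" using assms(3) by auto
  have "j \<notin> insert b (J - {j})" using assms by auto
  then have "j \<notin> insert a (J - {i})" unfolding eq .
  then show "i = j \<and> a = b" using ab assms(2) by auto
qed simp

lemma replace_coeff_eq_0_iff: "replace_coeff J i a x = 0 \<longleftrightarrow> coord x (insert a (J - {i})) = (0 :: 'a::comm_ring_1)"
proof
  assume "replace_coeff J i a x = 0"
  then have "sg {a} (J - {i}) * (sg {i} (J - {i}) * replace_coeff J i a x) = 0" by simp
  then show "coord x (insert a (J - {i})) = 0" unfolding replace_coeff_def mult.assoc sg_square_left .
qed (simp add: replace_coeff_def)

lemma replace_coeff_unit_iff: "coord x (insert a (J - {i})) dvd 1 \<Longrightarrow> replace_coeff J i a x dvd (1 :: 'a::comm_ring_1)"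
  unfolding replace_coeff_def by (intro unit_mult sg_dvd_1)

lemma replace_factor_expand:
  assumes "finite J" "finite A" "A \<inter> J = {}"
    "\<And>I. coord x I \<noteq> 0 \<Longrightarrow> \<exists>j\<in>J. \<exists>a\<in>A. I = insert a (J - {j})"
  shows "x = (\<Sum>j\<in>J. \<Sum>a\<in>A. sc (replace_coeff J j a x) (replace_factor J j a))"
proof -
  let ?f = "\<lambda>(j, a). insert a (J - {j})"
  have inj: "inj_on ?f (J \<times> A)"
  proof (rule inj_onI)
    fix p q assume "p \<in> J \<times> A" "q \<in> J \<times> A" and eq: "?f p = ?f q"
    moreover obtain j a j' a' where pq: "p = (j, a)" "q = (j', a')" by (cases p, cases q)
    ultimately have "j \<in> J" "j' \<in> J" "a \<notin> J" "a' \<notin> J" using assms(3) by auto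
    from insert_remove_eq_iff[OF this] eq pq show "p = q" by simp
  qed
  have "x = (\<Sum>I\<in>?f ` (J \<times> A). sc (coord x I) (basis I))"
    by (rule ext_expand) (use assms in \<open>auto simp: image_iff\<close>)
  also have "\<dots> = (\<Sum>p\<in>J \<times> A. sc (coord x (?f p)) (basis (?f p)))"
    by (simp add: sum.reindex[OF inj])
  also have "\<dots> = (\<Sum>j\<in>J. \<Sum>a\<in>A. sc (coord x (insert a (J - {j}))) (basis (insert a (J - {j}))))"
    by (simp add: sum.cartesian_product case_prod_unfold)
  also have "\<dots> = (\<Sum>j\<in>J. \<Sum>a\<in>A. sc (replace_coeff J j a x) (replace_factor J j a))"
  proof (intro sum.cong refl)
    fix j a assume "j \<in> J" "a \<in> A"
    then have "a \<notin> J" using assms(3) by auto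
    then show "sc (coord x (insert a (J - {j}))) (basis (insert a (J - {j}))) = sc (replace_coeff J j a x) (replace_factor J j a)"
      using assms(1) \<open>j \<in> J\<close> by (simp add: basis_replace_factor replace_coeff_def mult_ac)
  qed
  finally show ?thesis .
qed

lemma basis_commute:
  assumes "finite J" "i \<notin> J"
  shows "basis J * basis {i} = sc ((-1) ^ card J) (basis {i} * basis J :: 'a::comm_ring_1 ext)"
  using assms sg_swap[of "{i}" J, where 'a = 'a] by (simp add: basis_mult mult.commute)

text \<open>Unless the two replacements undo each other, j or a occurs in both factors and the
  product vanishes. Otherwise it is e_J \<and> e_K with two factors of degree one interchanged,
  whence the minus sign.\<close>

lemma replace_factor_mult_replace_factor:
  assumes J: "finite J" "finite K" "J \<inter> K = {}" "card J = card K" and i: "i \<in> J" "j \<in> J" and a: "a \<in> K" "b \<in> K"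
  shows "replace_factor J i a * replace_factor K b j = (if i = j \<and> a = b then - (basis J * basis K) else (0 :: 'a::comm_ring_1 ext))"
proof -
  have nin: "a \<notin> J" "j \<notin> K" "b \<notin> J" "i \<notin> K" using assms by auto
  show ?thesis
  proof (cases "i = j \<and> a = b")
    case False
    then have ja: "j \<in> insert a (J - {i}) \<inter> insert j (K - {b}) \<or> a \<in> insert a (J - {i}) \<inter> insert j (K - {b})"
      using assms by auto
    define A where "A = insert a (J - {i})"
    define B where "B = insert j (K - {b})"
    have "A \<inter> B \<noteq> {}" using ja unfolding A_def B_def by blast
    moreover have "finite A" "finite B" using J by (simp_all add: A_def B_def)
    ultimately have "basis A * basis B = (0 :: 'a ext)" by (simp add: basis_mult)
    then show ?thesis unfolding replace_factor_basis[OF J(1) i(1) nin(1)] replace_factor_basis[OF J(2) a(2) nin(2)] if_not_P[OF False] A_def B_def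
      by (simp add: sc_mult_left sc_mult_right)
  next
    case True
    let ?J = "J - {i}" and ?K = "K - {a}"
    let ?s = "sg {i} ?J :: 'a" and ?t = "sg {a} ?K :: 'a"
    have e: "basis J = sc ?s (basis {i} * basis ?J)" "basis K = sc ?t (basis {a} * basis ?K)"
      using J i a replace_factor_same[of J i, where 'a = 'a] replace_factor_same[of K a, where 'a = 'a] by (simp_all add: replace_factor_def)
    have ci: "basis ?J * basis {i} = sc ((-1) ^ card ?J) (basis {i} * basis ?J :: 'a ext)"
      using J by (intro basis_commute) auto
    have ca: "basis ?J * basis {a} = sc ((-1) ^ card ?J) (basis {a} * basis ?J :: 'a ext)"
      using J nin by (intro basis_commute) auto
    have ne: "a \<noteq> i" using nin i by auto
    have "basis {a} * basis ?J * (basis {i} * basis ?K) = basis {a} * (basis ?J * basis {i}) * (basis ?K :: 'a ext)"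
      by (simp add: mult.assoc)
    also have "\<dots> = sc ((-1) ^ card ?J) ((basis {a} * basis {i}) * basis ?J * basis ?K)"
      unfolding ci by (simp add: sc_mult_left sc_mult_right mult.assoc)
    also have "\<dots> = - sc ((-1) ^ card ?J) (basis {i} * (basis {a} * basis ?J) * basis ?K)"
      unfolding basis_anticommute[OF ne] by (simp add: sc_uminus mult.assoc)
    also have "\<dots> = - (basis {i} * (basis ?J * basis {a}) * basis ?K)"
      unfolding ca by (simp add: sc_mult_left sc_mult_right)
    finally have "basis {a} * basis ?J * (basis {i} * basis ?K) = - (basis {i} * basis ?J * (basis {a} * basis ?K) :: 'a ext)"
      by (simp add: mult.assoc)
    then show ?thesis using True unfolding e replace_factor_def
      by (simp add: sc_mult_left sc_mult_right sc_uminus)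
  qed
qed

text \<open>\<open>lambda_all\<close> for an arbitrary set of generators, such as a single
  block.\<close>

definition supp_in :: "nat set \<Rightarrow> 'a::comm_ring_1 ext \<Rightarrow> bool" where
  "supp_in S x \<longleftrightarrow> (\<forall>I. coord x I \<noteq> 0 \<longrightarrow> I \<subseteq> S)"

lemma supp_in_mult: "supp_in S x \<Longrightarrow> supp_in S y \<Longrightarrow> supp_in S (x * y)"
proof -
  assume a: "supp_in S x" "supp_in S y"
  { fix K assume "coord (x * y) K \<noteq> 0"
    then obtain I where "I \<in> Pow K" "sg I (K - I) * (coord x I * coord y (K - I)) \<noteq> 0"
      unfolding coord_times by (metis (no_types, lifting) sum.neutral)
    then have "coord x I \<noteq> 0" "coord y (K - I) \<noteq> 0" by auto
    then have "I \<subseteq> S" "K - I \<subseteq> S" using a by (simp_all add: supp_in_def)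
    then have "K \<subseteq> S" by blast }
  then show ?thesis by (auto simp: supp_in_def)
qed

lemma supp_in_one: "supp_in S 1"
  by (simp add: supp_in_def coord_one)

lemma supp_in_prod_list: "(\<And>x. x \<in> set xs \<Longrightarrow> supp_in S x) \<Longrightarrow> supp_in S (prod_list xs)"
proof (induction xs)
  case (Cons x xs)
  then have "supp_in S x" "supp_in S (prod_list xs)" by simp_all
  then show ?case using supp_in_mult by simp
qed (simp add: supp_in_one)

lemma Lam_diag:
  assumes "finite I" "I \<subseteq> {..<n}"
  shows "Lam (mat n n (\<lambda>(i, j). if i = j then \<tau> i else 0)) (basis I) = sc (prod \<tau> I) (basis I :: 'a::comm_ring_1 ext)"
proof -
  let ?D = "mat n n (\<lambda>(i, j). if i = j then \<tau> i else 0)"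
  have c: "cvec ?D j = sc (\<tau> j) (basis {j})" if "j < n" for j
  proof -
    have "cvec ?D j = (\<Sum>i<n. if i = j then sc (\<tau> j) (basis {j}) else 0)"
      unfolding cvec_def evec_def using that by (intro sum.cong) auto
    then show ?thesis using that by simp
  qed
  have "Lam ?D (basis I) = oprod (cvec ?D) I" using assms by (intro Lam_basis) simp
  also have "\<dots> = oprod (\<lambda>j. sc (\<tau> j) (basis {j})) I" using assms c by (intro oprod_cong) auto
  also have "\<dots> = sc (prod \<tau> I) (basis I)" using assms(1)
  proof (induction I rule: finite_min_induct)
    case empty
    show ?case by (simp add: one_ext_def)
  next
    case (insert i I)
    have "oprod (\<lambda>j. sc (\<tau> j) (basis {j})) (insert i I) = sc (\<tau> i) (basis {i}) * oprod (\<lambda>j. sc (\<tau> j) (basis {j})) I"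
      using insert by (intro oprod_insert_less)
    also have "\<dots> = sc (\<tau> i * prod \<tau> I) (basis {i} * basis I)"
      unfolding insert.IH by (simp add: sc_mult_left sc_mult_right mult.commute)
    also have "basis {i} * basis I = (basis (insert i I) :: 'a ext)"
    proof -
      have "i \<notin> I" using insert(2) by blast
      moreover have "sg {i} I = (1 :: 'a)" using insert(2) by (intro sg_singleton_less) (simp add: less_imp_le)
      ultimately show ?thesis using insert(1) by (simp add: basis_mult)
    qed
    finally show ?case using insert(1,2) by (subst prod.insert) auto
  qed
  finally show ?thesis .
qed

section \<open>Coefficients of a similitude that scales the block vectors\<close>

context blocks
begin

text \<open>A single sign r serves for all replacements of both factors. It is found by applying the
  map with e_t going to e_t + e_a to e_J = r \<open>ew w i j\<close>, so that no inversions have to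
  be counted.\<close>

lemma replace_factor_ew:
  assumes J: "J \<in> msubsets n m" and ij: "i \<in> J" "j \<in> J" "i \<noteq> j"
  defines "w \<equiv> J - {i, j}"
  obtains r :: "'a::comm_ring_1" where "r * r = 1" "basis J = sc r (ew w i j)"
    "\<And>a. a < n \<Longrightarrow> a \<notin> J \<Longrightarrow> replace_factor J j a = sc r (ew w i a)"
    "\<And>a. a < n \<Longrightarrow> a \<notin> J \<Longrightarrow> replace_factor J i a = sc r (ew w a j)"
proof -
  have finJ: "finite J" "J \<subseteq> {..<n}" using J by (auto simp: msubsets_iff)
  have w: "finite w" "w \<subseteq> {..<n}" "i \<notin> w" "j \<notin> w" "w \<union> {i, j} = J" using finJ ij by (auto simp: w_def)
  obtain r :: 'a where r: "r * r = 1" "ew w i j = sc r (basis J)"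
    using ew_basis[OF w(1,3,4) ij(3)] w(5) by metis
  have bJ: "basis J = sc r (ew w i j)" using r by simp
  have L: "Lam (addrow_mat n 1 a t) (basis J) = basis J + (replace_factor J t a :: 'a ext)" if ta: "t \<in> J" "a < n" "a \<notin> J" for t a
  proof -
    let ?E = "addrow_mat n 1 a t :: 'a mat"
    have t: "t < n" "a \<noteq> t" using ta finJ by auto
    have f1: "Lam ?E (basis (J - {t})) = basis (J - {t})" using finJ ta t by (intro Lam_fix) (auto simp: cvec_addrow)
    have f2: "Lam ?E (basis {t}) = basis {t} + basis {a}" using ta t by (simp add: Lam_basis1 cvec_addrow)
    have e: "basis J = sc (sg {t} (J - {t})) (basis {t} * basis (J - {t}) :: 'a ext)"
      using replace_factor_same[OF finJ(1) ta(1), where 'a = 'a] by (simp add: replace_factor_def)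
    have mem: "(basis {t} :: 'a ext) \<in> lambda_all n" "(basis (J - {t}) :: 'a ext) \<in> lambda_all n"
      using finJ t by (auto intro!: lambda_all_basis)
    have "Lam ?E (basis J) = sc (sg {t} (J - {t})) (Lam ?E (basis {t}) * Lam ?E (basis (J - {t})))"
      unfolding e Lam_sc using mem by (simp add: Lam_times)
    also have "\<dots> = basis J + replace_factor J t a" unfolding f1 f2 e[symmetric]
      by (simp add: distrib_right sc_add e[symmetric] replace_factor_def)
    finally show ?thesis .
  qed
  have L2: "Lam (addrow_mat n 1 a t) (basis J) = sc r (Lam (addrow_mat n 1 a t) (ew w i j))" for a t
    unfolding bJ Lam_sc ..
  have 1: "replace_factor J j a = sc r (ew w i a)" if a: "a < n" "a \<notin> J" for a
  proof -
    have "basis J + replace_factor J j a = sc r (basis w * basis {i} * (basis {j} + sc 1 (basis {a})))"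
      unfolding L[OF ij(2) a, symmetric] L2 using a ij finJ w by (subst Lam_addrow_ew) auto
    also have "\<dots> = basis J + sc r (ew w i a)" unfolding bJ by (simp add: ew_def distrib_left sc_add)
    finally show ?thesis by simp
  qed
  have 2: "replace_factor J i a = sc r (ew w a j)" if a: "a < n" "a \<notin> J" for a
  proof -
    have "basis J + replace_factor J i a = sc r (basis w * (basis {i} + sc 1 (basis {a})) * basis {j})"
      unfolding L[OF ij(1) a, symmetric] L2 using a ij finJ w by (subst Lam_addrow_ew) auto
    also have "\<dots> = basis J + sc r (ew w a j)" unfolding bJ by (simp add: ew_def distrib_left distrib_right sc_add)
    finally show ?thesis by simp
  qed
  from that[OF r(1) bJ 1 2] show thesis .
qed

text \<open>The coefficients dual to \<open>replace_factor_ew\<close>; the minus sign arises because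
  \<open>cf w j a\<close> has its last two factors in the opposite order.\<close>

lemma cf_replace_coeff:
  assumes J: "J \<in> msubsets n m" and ij: "i \<in> J" "j \<in> J" "i \<noteq> j"
  defines "w \<equiv> J - {i, j}"
  obtains r :: "'a::comm_ring_1" where "r * r = 1"
    "\<And>a x. a < n \<Longrightarrow> a \<notin> J \<Longrightarrow> cf w i a x = r * replace_coeff J j a x"
    "\<And>a x. a < n \<Longrightarrow> a \<notin> J \<Longrightarrow> cf w j a x = - r * replace_coeff J i a x"
proof -
  have finJ: "finite J" "J \<subseteq> {..<n}" using J by (auto simp: msubsets_iff)
  obtain r :: 'a where r: "r * r = 1" "basis J = sc r (ew w i j)"
    "\<And>a. a < n \<Longrightarrow> a \<notin> J \<Longrightarrow> replace_factor J j a = sc r (ew w i a)"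
    "\<And>a. a < n \<Longrightarrow> a \<notin> J \<Longrightarrow> replace_factor J i a = sc r (ew w a j)"
    using replace_factor_ew[OF J ij] unfolding w_def by blast
  have 1: "cf w i a x = r * replace_coeff J j a x" if a: "a < n" "a \<notin> J" for a and x :: "'a ext"
  proof -
    have s: "insert a (J - {j}) = w \<union> {i, a}" using ij by (auto simp: w_def)
    have "ew w i a = sc r (replace_factor J j a)" using r(1) r(3)[OF a] by simp
    then show ?thesis unfolding cf_def replace_coeff_def s[symmetric] using finJ ij a
      by (simp add: replace_factor_basis coord_basis mult_ac)
  qed
  have 2: "cf w j a x = - r * replace_coeff J i a x" if a: "a < n" "a \<notin> J" for a and x :: "'a ext"
  proof -
    have s: "insert a (J - {i}) = w \<union> {a, j}" using ij by (auto simp: w_def)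
    have "ew w a j = sc r (replace_factor J i a)" using r(1) r(4)[OF a] by simp
    then have "cf w a j x = r * replace_coeff J i a x" unfolding cf_def replace_coeff_def s[symmetric] using finJ ij a
      by (simp add: replace_factor_basis coord_basis mult_ac)
    moreover have "a \<noteq> j" using ij a by auto
    ultimately show ?thesis using cf_swap[of a j w x] by simp
  qed
  from that[OF r(1) 1 2] show thesis .
qed

definition framed :: "('a::comm_ring_1 ext \<Rightarrow> 'a ext) \<Rightarrow> ('a ext \<Rightarrow> 'a ext) \<Rightarrow> (nat \<Rightarrow> 'a) \<Rightarrow> bool" where
  "framed G H c \<longleftrightarrow> similitude n m G H \<and> (\<forall>b<k. c b dvd 1 \<and> G (basis (blk b)) = sc (c b) (basis (blk b)))"

lemma framedD:
  assumes "framed G H c"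
  shows "similitude n m G H" "b < k \<Longrightarrow> c b dvd 1" "b < k \<Longrightarrow> G (basis (blk b)) = sc (c b) (basis (blk b))"
  using assms by (auto simp: framed_def)

lemma blk_finite [simp]: "finite (blk b)" by (simp add: blk_def)
lemma blk_card [simp]: "card (blk b) = m" by (simp add: blk_def)

lemma swap_msubset:
  assumes "b < k" "b' < k" "b \<noteq> b'" "i \<in> blk b" "a \<in> blk b'"
  shows "insert a (blk b - {i}) \<in> msubsets n m" "a \<notin> blk b" "i \<notin> blk b'" "a < n" "i < n"
proof -
  show "a \<notin> blk b" "i \<notin> blk b'" "a < n" "i < n" using assms by (auto simp: blk_div intro: blk_less)
  then show "insert a (blk b - {i}) \<in> msubsets n m"
    using assms blk_msubset[of b] m by (auto simp: msubsets_iff)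
qed

lemma replace_factor_in:
  assumes "b < k" "b' < k" "b \<noteq> b'" "i \<in> blk b" "a \<in> blk b'"
  shows "(replace_factor (blk b) i a :: 'a::comm_ring_1 ext) \<in> lambda_space n m"
  using swap_msubset[OF assms] assms by (auto simp: replace_factor_basis intro: lambda_space_sc)

text \<open>The tangent condition at the block allows at most one exchange. The product with the
  vector of the other block is 0 before applying G, hence also after, and this forces every set in
  the support to meet that other block.\<close>

lemma framed_support:
  assumes F: "framed G H c" and b: "b < k" "b' < k" "b \<noteq> b'" "i \<in> blk b" "a \<in> blk b'"
    and nz: "coord (G (replace_factor (blk b) i a)) I \<noteq> (0 :: 'a::comm_ring_1)"
  shows "\<exists>j\<in>blk b. \<exists>d\<in>blk b'. I = insert d (blk b - {j})"
proof -
  note GH = framedD(1)[OF F]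
  note J' = swap_msubset[OF b]
  let ?J' = "insert a (blk b - {i})"
  have "G (replace_factor (blk b) i a) = sc (sg {i} (blk b - {i}) * sg {a} (blk b - {i})) (G (basis ?J'))"
    using J' b by (simp add: replace_factor_basis lin_sc[OF similitudeD(1)[OF GH]])
  then have nz': "coord (G (basis ?J')) I \<noteq> 0" using nz by auto
  have I: "I \<in> msubsets n m"
    by (rule lambda_spaceD[OF similitudeD(3)[OF GH basis_in_lambda_space[OF J'(1)]] nz'])
  then have finI: "finite I" "card I = m" "I \<subseteq> {..<n}" by (auto simp: msubsets_iff)
  have "blk b - ?J' = {i}" using b J' by auto
  then have "card (blk b - ?J') = 1" by simp
  from similitude_tangent[OF GH blk_msubset[OF b(1)] framedD(3)[OF F b(1)] framedD(2)[OF F b(1)] J'(1) this I]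
  have c1: "card (I - blk b) \<le> 1" using nz' by linarith
  have "basis ?J' * basis (blk b') = (0 :: 'a ext)" using b by (auto simp: basis_mult)
  then have "G (basis ?J') * G (basis (blk b')) = 0"
    by (intro similitude_prod_zero[OF GH] basis_in_lambda_space J'(1) blk_msubset b)
  then have z: "sc (c b') (G (basis ?J') * basis (blk b')) = 0"
    unfolding framedD(3)[OF F b(2)] sc_mult_right .
  obtain e where "c b' * e = 1" using framedD(2)[OF F b(2)] by (metis dvdE)
  then have "sc (c b' * e) (G (basis ?J') * basis (blk b')) = 0" using z
    by (metis mult.commute sc_sc sc_zero(2))
  then have z: "G (basis ?J') * basis (blk b') = 0" using \<open>c b' * e = 1\<close> by simp
  have "I \<inter> blk b' \<noteq> {}"
  proof
    assume "I \<inter> blk b' = {}"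
    then have "I \<union> blk b' - blk b' = I" by auto
    then have "coord (G (basis ?J') * basis (blk b')) (I \<union> blk b') = sg I (blk b') * coord (G (basis ?J')) I"
      using finI by (simp add: coord_times_basis)
    then have "sg I (blk b') * coord (G (basis ?J')) I = 0" using z by simp
    then show False using nz' by (metis mult_zero_right sg_square_left)
  qed
  then obtain d where d: "d \<in> I" "d \<in> blk b'" by auto
  have dn: "d \<notin> blk b" using d b by (auto simp: blk_div)
  have "I - blk b \<noteq> {}" using d dn by blast
  then have "card (I - blk b) \<noteq> 0" using finI by simp
  then have c1: "card (I - blk b) = 1" using c1 by linarith
  then obtain e where "I - blk b = {e}" by (rule card_1_singletonE)
  then have sub: "I - blk b = {d}" using d dn by (metis DiffI singletonD)
  have "card (blk b - I) = 1" using card_diff_eq[OF I blk_msubset[OF b(1)]] c1 by simp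
  then obtain j where j: "blk b - I = {j}" by (rule card_1_singletonE)
  have "I = insert d (blk b - {j})" using sub j by auto
  then show ?thesis using j d by auto
qed

lemma framed_expand:
  assumes F: "framed G H c" and b: "b < k" "b' < k" "b \<noteq> b'" "i \<in> blk b" "a \<in> blk b'"
  shows "G (replace_factor (blk b) i a) = (\<Sum>j\<in>blk b. \<Sum>d\<in>blk b'. sc (replace_coeff (blk b) j d (G (replace_factor (blk b) i a))) (replace_factor (blk b) j d :: 'a::comm_ring_1 ext))"
  by (rule replace_factor_expand) (use b blk_disjoint[of b' b] framed_support[OF F b] in auto)

lemma framed_replace_coeff_zero:
  assumes F: "framed G H c" and b: "b < k" "b' < k" "b \<noteq> b'" "i \<in> blk b" "a \<in> blk b'"
    and j: "j \<in> blk b" and d: "d \<notin> blk b" "d \<notin> blk b'"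
  shows "replace_coeff (blk b) j d (G (replace_factor (blk b) i a)) = (0 :: 'a::comm_ring_1)"
proof (rule ccontr)
  assume "\<not> ?thesis"
  then have "coord (G (replace_factor (blk b) i a)) (insert d (blk b - {j})) \<noteq> 0" by (simp add: replace_coeff_eq_0_iff)
  from framed_support[OF F b this] obtain j' d' where *: "j' \<in> blk b" "d' \<in> blk b'" "insert d (blk b - {j}) = insert d' (blk b - {j'})"
    by blast
  then have "d' \<notin> blk b" using b by (auto simp: blk_div)
  then have "d = d'" using insert_remove_eq_iff[OF j *(1) d(1)] *(3) by blast
  then show False using d * by simp
qed

lemma framed_self_zero:
  assumes F: "framed G H c" and b: "b < k" "b' < k" "b \<noteq> b'" "i \<in> blk b" "a \<in> blk b'"
  shows "coord (G (replace_factor (blk b) i a)) (blk b) = (0 :: 'a::comm_ring_1)"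
proof (rule ccontr)
  assume "\<not> ?thesis"
  from framed_support[OF F b this] obtain j d where *: "d \<in> blk b'" "blk b = insert d (blk b - {j})" by blast
  then have "d \<in> blk b" by blast
  then show False using *(1) b(3) by (simp add: blk_div)
qed

lemma framed_unit:
  assumes F: "framed G H c" and b: "b < k" "b' < k" "b \<noteq> b'" "i \<in> blk b" "a \<in> blk b'"
  shows "\<exists>j\<in>blk b. \<exists>d\<in>blk b'. replace_coeff (blk b) j d (G (replace_factor (blk b) i a)) dvd (1 :: 'a::local_ring)"
proof -
  note GH = framedD(1)[OF F] and J' = swap_msubset[OF b] and mem = replace_factor_in[OF b, where 'a = 'a]
  have "coord (H (G (replace_factor (blk b) i a))) (insert a (blk b - {i})) dvd 1"
    using similitudeD(5)[OF GH mem] J' b by (simp add: replace_factor_basis coord_basis) (metis mult.right_neutral sg_dvd_1 unit_mult)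
  then obtain I where I: "coord (G (replace_factor (blk b) i a)) I dvd 1"
    using local_coord_unit[OF similitudeD(2)[OF GH] similitudeD(3)[OF GH mem]] by blast
  then have "coord (G (replace_factor (blk b) i a)) I \<noteq> 0" by auto
  from framed_support[OF F b this] I show ?thesis using replace_coeff_unit_iff by blast
qed

text \<open>Replacing e_i by e_a + e_a' gives a decomposable vector. In the three-term relation for
  its image the pair j, j' stands for the coordinate at the block itself, which is 0; and as d and
  d' lie in different blocks, each of the other coordinates comes from only one of the two
  summands.\<close>

lemma framed_rank_one:
  assumes F: "framed G H c" and b: "b < k" "b' < k" "b'' < k" "b \<noteq> b'" "b \<noteq> b''" "b' \<noteq> b''"
    and i: "i \<in> blk b" "a \<in> blk b'" "a' \<in> blk b''" and j: "j \<in> blk b" "j' \<in> blk b" "d \<in> blk b'" "d' \<in> blk b''"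
    and u: "replace_coeff (blk b) j' d' (G (replace_factor (blk b) i a')) dvd 1"
  shows "replace_coeff (blk b) j d (G (replace_factor (blk b) i a)) * replace_coeff (blk b) j' d' (G (replace_factor (blk b) i a')) =
    replace_coeff (blk b) j' d (G (replace_factor (blk b) i a)) * (replace_coeff (blk b) j d' (G (replace_factor (blk b) i a')) :: 'a::comm_ring_1)"
proof (cases "j = j'")
  case False
  note GH = framedD(1)[OF F]
  let ?J = "blk b"
  have J: "?J \<in> msubsets n m" by (rule blk_msubset[OF b(1)])
  have nJ: "a \<notin> ?J" "a' \<notin> ?J" "d \<notin> ?J" "d' \<notin> ?J" "a < n" "a' < n" "d < n" "d' < n" "a \<noteq> a'" "d \<noteq> d'"
    using b i j by (auto simp: blk_div intro: blk_less)
  \<comment> \<open>A second element exists because j and j' differ; it plays the part of the factor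
    that stays when the replacements are written with \<open>ew\<close>.\<close>
  obtain i2 where i2: "i2 \<in> ?J" "i2 \<noteq> i" using j(1,2) False by metis
  have c2: "card (?J - {p, q}) + 2 = m" if pq: "p \<in> ?J" "q \<in> ?J" "p \<noteq> q" for p q
  proof -
    have "card {p, q} \<le> card ?J" using pq by (intro card_mono) auto
    then show ?thesis using pq by (simp add: card_Diff_subset)
  qed
  define z :: "'a ext" where "z = replace_factor ?J i a + replace_factor ?J i a'"
  have "decomposable z"
  proof -
    let ?w = "?J - {i2, i}"
    obtain r :: 'a where r: "r * r = 1" "\<And>a. a < n \<Longrightarrow> a \<notin> ?J \<Longrightarrow> replace_factor ?J i a = sc r (ew ?w i2 a)"
      using replace_factor_ew[OF J i2(1) i(1) i2(2)] by blast
    have "decomposable (ew ?w i2 a + ew ?w i2 a' :: 'a ext)"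
      using nJ i i2 J c2[OF i2(1) i(1) i2(2)] by (intro decomposable_ew2) (auto simp: msubsets_iff)
    then have "decomposable (sc r (ew ?w i2 a + ew ?w i2 a'))" using r(1) by (intro decomposable_sc) (metis dvd_triv_left)+
    then show ?thesis using r(2) nJ by (simp add: z_def sc_add)
  qed
  let ?w = "?J - {j, j'}"
  obtain r :: 'a where r: "r * r = 1"
    "\<And>a x. a < n \<Longrightarrow> a \<notin> ?J \<Longrightarrow> cf ?w j a x = r * replace_coeff ?J j' a x"
    "\<And>a x. a < n \<Longrightarrow> a \<notin> ?J \<Longrightarrow> cf ?w j' a x = - r * replace_coeff ?J j a x"
    using cf_replace_coeff[OF J j(1,2) False, where 'a = 'a] by blast
  have Gz: "G z = G (replace_factor ?J i a) + G (replace_factor ?J i a')" by (simp add: z_def lin_add[OF similitudeD(1)[OF GH]])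
  have dn: "d' \<notin> blk b'" "d \<notin> blk b''" using b(6) j(3,4) by (auto simp: blk_div)
  have z0: "replace_coeff ?J l d' (G (replace_factor ?J i a)) = 0" "replace_coeff ?J l d (G (replace_factor ?J i a')) = 0" if "l \<in> ?J" for l
    by (rule framed_replace_coeff_zero[OF F b(1,2,4) i(1,2) that nJ(4) dn(1)])
       (rule framed_replace_coeff_zero[OF F b(1,3,5) i(1,3) that nJ(3) dn(2)])
  have vals: "cf ?w j d' (G z) = r * replace_coeff ?J j' d' (G (replace_factor ?J i a'))" "cf ?w j' d (G z) = - r * replace_coeff ?J j d (G (replace_factor ?J i a))"
    "cf ?w j d (G z) = r * replace_coeff ?J j' d (G (replace_factor ?J i a))" "cf ?w j' d' (G z) = - r * replace_coeff ?J j d' (G (replace_factor ?J i a'))"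
    unfolding r(2)[OF nJ(8) nJ(4)] r(3)[OF nJ(7) nJ(3)] r(2)[OF nJ(7) nJ(3)] r(3)[OF nJ(8) nJ(4)] Gz replace_coeff_add
    using z0 j by simp_all
  have "coord (G (replace_factor ?J i a)) ?J = 0" by (rule framed_self_zero[OF F b(1,2,4) i(1,2)])
  moreover have "coord (G (replace_factor ?J i a')) ?J = 0" by (rule framed_self_zero[OF F b(1,3,5) i(1,3)])
  moreover have "?w \<union> {j, j'} = ?J" using j by auto
  ultimately have third: "cf ?w j j' (G z) = 0" unfolding Gz cf_def by simp
  have dis: "distinct [j, d', j', d]" "{j, d', j', d} \<inter> ?w = {}" "{j, d', j', d} \<subseteq> {..<n}"
    using False nJ j J by (auto simp: msubsets_iff)
  have wm: "finite ?w" "?w \<subseteq> {..<n}" using J by (auto simp: msubsets_iff)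
  have "r dvd 1" using r(1) by (metis dvd_triv_left)
  then have "cf ?w j d' (G z) dvd 1" unfolding vals using u by (rule unit_mult)
  from decomposable_rel[OF wm c2[OF j(1,2) False] dis GH \<open>decomposable z\<close> this] third
  have "cf ?w j d' (G z) * cf ?w j' d (G z) = cf ?w j d (G z) * cf ?w j' d' (G z)" by simp
  then have "(r * r) * (replace_coeff ?J j d (G (replace_factor ?J i a)) * replace_coeff ?J j' d' (G (replace_factor ?J i a'))) =
    (r * r) * (replace_coeff ?J j' d (G (replace_factor ?J i a)) * replace_coeff ?J j d' (G (replace_factor ?J i a')))"
    unfolding vals by (simp add: algebra_simps)
  then show ?thesis using r(1) by simp
qed simp

text \<open>A replacement in one block times a replacement in the other is 0 or minus the product of
  the two block vectors, and G respects such equalities between products by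
  \<open>similitude_prod\<close>. Expanding the two images turns this into a pairing of their
  coefficient matrices.\<close>

lemma framed_pairing:
  assumes F: "framed G H c" and b: "b < k" "b' < k" "b \<noteq> b'" and i: "i \<in> blk b" "j \<in> blk b" and a: "a \<in> blk b'" "a' \<in> blk b'"
  shows "(\<Sum>l\<in>blk b. \<Sum>d\<in>blk b'. replace_coeff (blk b) l d (G (replace_factor (blk b) i a)) * replace_coeff (blk b') d l (G (replace_factor (blk b') a' j))) =
    (if i = j \<and> a = a' then c b * c b' else (0 :: 'a::comm_ring_1))"
proof -
  note GH = framedD(1)[OF F]
  let ?J = "blk b" and ?K = "blk b'"
  have JK: "?J \<inter> ?K = {}" "?K \<inter> ?J = {}" using blk_disjoint b by auto
  define X where "X l d = replace_coeff ?J l d (G (replace_factor ?J i a))" for l d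
  define Y where "Y d l = replace_coeff ?K d l (G (replace_factor ?K a' j))" for d l
  have "G (replace_factor ?J i a) * G (replace_factor ?K a' j) = (\<Sum>l\<in>?J. \<Sum>d\<in>?K. sc (X l d) (replace_factor ?J l d)) * (\<Sum>d'\<in>?K. \<Sum>l'\<in>?J. sc (Y d' l') (replace_factor ?K d' l'))"
    using framed_expand[OF F b i(1) a(1)] framed_expand[OF F b(2,1) b(3)[symmetric] a(2) i(2)] by (simp add: X_def Y_def)
  also have "\<dots> = (\<Sum>l\<in>?J. \<Sum>d\<in>?K. \<Sum>d'\<in>?K. \<Sum>l'\<in>?J. sc (X l d * Y d' l') (replace_factor ?J l d * replace_factor ?K d' l'))"
    by (simp only: sum_distrib_right) (simp only: sum_distrib_left sc_mult_left sc_mult_right sc_sc mult.commute)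
  also have "\<dots> = (\<Sum>l\<in>?J. \<Sum>d\<in>?K. \<Sum>d'\<in>?K. \<Sum>l'\<in>?J. if l' = l then if d' = d then sc (X l d * Y d l) (- (basis ?J * basis ?K)) else 0 else 0)"
    using JK by (intro sum.cong refl) (simp add: replace_factor_mult_replace_factor)
  also have "\<dots> = (\<Sum>l\<in>?J. \<Sum>d\<in>?K. sc (X l d * Y d l) (- (basis ?J * basis ?K)))"
    by simp
  also have "\<dots> = sc (\<Sum>l\<in>?J. \<Sum>d\<in>?K. X l d * Y d l) (- (basis ?J * basis ?K))"
  proof -
    have s: "(\<Sum>l\<in>S. sc (f l) x) = sc (\<Sum>l\<in>S. f l) x" for S and f :: "nat \<Rightarrow> 'a" and x
      by (induction S rule: infinite_finite_induct) (auto simp: sc_add)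
    show ?thesis by (simp only: s)
  qed
  finally have 1: "G (replace_factor ?J i a) * G (replace_factor ?K a' j) = sc (\<Sum>l\<in>?J. \<Sum>d\<in>?K. X l d * Y d l) (- (basis ?J * basis ?K))" .
  have 2: "G (replace_factor ?J i a) * G (replace_factor ?K a' j) = (if i = j \<and> a = a' then sc (c b * c b') (- (basis ?J * basis ?K)) else 0)"
  proof (cases "i = j \<and> a = a'")
    case True
    have "replace_factor ?J i a * replace_factor ?K a' j = sc (-1) (basis ?J) * basis ?K" using True JK i a by (simp add: replace_factor_mult_replace_factor)
    then have "G (replace_factor ?J i a) * G (replace_factor ?K a' j) = G (sc (-1) (basis ?J)) * G (basis ?K)"
      using b i a by (intro similitude_prod[OF GH] replace_factor_in[OF b] replace_factor_in[OF b(2,1)] lambda_space_sc basis_in_lambda_space blk_msubset) auto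
    also have "\<dots> = sc (c b * c b') (- (basis ?J * basis ?K))"
      unfolding lin_sc[OF similitudeD(1)[OF GH]] framedD(3)[OF F b(1)] framedD(3)[OF F b(2)]
      by (simp add: sc_mult_left sc_mult_right sc_uminus mult.commute)
    finally show ?thesis using True by simp
  next
    case False
    have "replace_factor ?J i a * replace_factor ?K a' j = (0 :: 'a ext)"
      using replace_factor_mult_replace_factor[OF blk_finite blk_finite JK(1) _ i a, where 'a = 'a] unfolding if_not_P[OF False] by simp
    then have "G (replace_factor ?J i a) * G (replace_factor ?K a' j) = 0"
      using b i a by (intro similitude_prod_zero[OF GH] replace_factor_in[OF b] replace_factor_in[OF b(2,1)]) auto
    then show ?thesis using False by auto
  qed
  have nz: "coord (basis ?J * basis ?K) (?J \<union> ?K) = (sg ?J ?K :: 'a)"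
    using JK by (simp add: basis_mult coord_basis)
  have "coord (sc (\<Sum>l\<in>?J. \<Sum>d\<in>?K. X l d * Y d l) (- (basis ?J * basis ?K))) (?J \<union> ?K) =
     coord (if i = j \<and> a = a' then sc (c b * c b') (- (basis ?J * basis ?K)) else 0) (?J \<union> ?K)"
    using 1 2 by simp
  then have "(\<Sum>l\<in>?J. \<Sum>d\<in>?K. X l d * Y d l) * sg ?J ?K = (if i = j \<and> a = a' then c b * c b' else 0) * sg ?J ?K"
    using nz by (auto split: if_splits)
  then have "(\<Sum>l\<in>?J. \<Sum>d\<in>?K. X l d * Y d l) * sg ?J ?K * sg ?J ?K = (if i = j \<and> a = a' then c b * c b' else 0) * sg ?J ?K * sg ?J ?K"
    by simp
  then show ?thesis unfolding X_def Y_def mult.assoc by simp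
qed

end

section \<open>Factorization of the coefficients and diagonalization\<close>

context blocks
begin

lemma other_blocks:
  assumes "b < k"
  obtains b1 b2 where "b1 < k" "b2 < k" "b1 \<noteq> b" "b2 \<noteq> b" "b1 \<noteq> b2"
proof (cases "b = 0")
  case True
  then show thesis using that[of 1 2] k by simp
next
  case False
  then show thesis using that[of 0 "if b = 1 then 2 else 1"] k by (auto split: if_splits)
qed

lemma in_own_blk: "i \<in> blk (i div m)" by (simp add: blk_div)

text \<open>By \<open>framed_rank_one\<close> the dependence on l is proportional for arguments from
  two different other blocks. So p can be read off from one reference block b1, normalized at a unit
  entry; arguments in b1 itself are compared with the third block b2.\<close>

lemma framed_factor:
  assumes F: "framed G H c" and b: "b < k" and i: "i \<in> blk b"
  shows "\<exists>p q. \<forall>b'<k. b' \<noteq> b \<longrightarrow> (\<forall>a\<in>blk b'. \<forall>l\<in>blk b. \<forall>d\<in>blk b'.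
     replace_coeff (blk b) l d (G (replace_factor (blk b) i a)) = p l * (q a d :: 'a::local_ring))"
proof -
  obtain b1 b2 where bs: "b1 < k" "b2 < k" "b1 \<noteq> b" "b2 \<noteq> b" "b1 \<noteq> b2" using other_blocks[OF b] .
  define X where "X a l d = replace_coeff (blk b) l d (G (replace_factor (blk b) i a))" for a l d
  have a1: "b1 * m \<in> blk b1" and a2: "b2 * m \<in> blk b2" using m by (simp_all add: blk_div)
  obtain j1 d1 where u1: "j1 \<in> blk b" "d1 \<in> blk b1" "X (b1 * m) j1 d1 dvd 1"
    using framed_unit[OF F b bs(1) bs(3)[symmetric] i a1] by (auto simp: X_def)
  obtain j2 d2 where u2: "j2 \<in> blk b" "d2 \<in> blk b2" "X (b2 * m) j2 d2 dvd 1"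
    using framed_unit[OF F b bs(2) bs(4)[symmetric] i a2] by (auto simp: X_def)
  obtain e1 where e1: "X (b1 * m) j1 d1 * e1 = 1" using u1(3) by (metis dvdE)
  obtain e2 where e2: "X (b2 * m) j2 d2 * e2 = 1" using u2(3) by (metis dvdE)
  define p where "p l = X (b1 * m) l d1" for l
  have 1: "X a l d = p l * (X a j1 d * e1)" if "b' < k" "b' \<noteq> b" "b' \<noteq> b1" "a \<in> blk b'" "l \<in> blk b" "d \<in> blk b'" for b' a l d
  proof -
    have "X a l d * X (b1 * m) j1 d1 = X a j1 d * X (b1 * m) l d1"
      unfolding X_def by (rule framed_rank_one[OF F b that(1) bs(1)]) (use that bs i a1 u1 in \<open>auto simp: X_def\<close>)
    then have "X a l d * (X (b1 * m) j1 d1 * e1) = p l * (X a j1 d * e1)"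
      unfolding p_def by (simp add: mult_ac)
    then show ?thesis using e1 by simp
  qed
  have 2: "X a l d = p l * (X a j2 d * e2 * (X (b2 * m) j1 d2 * e1))" if "a \<in> blk b1" "l \<in> blk b" "d \<in> blk b1" for a l d
  proof -
    have "X a l d * X (b2 * m) j2 d2 = X a j2 d * X (b2 * m) l d2"
      unfolding X_def by (rule framed_rank_one[OF F b bs(1) bs(2)]) (use that bs i a2 u2 in \<open>auto simp: X_def\<close>)
    also have "X (b2 * m) l d2 = p l * (X (b2 * m) j1 d2 * e1)"
      using that bs a2 u2 by (intro 1[of b2]) auto
    finally have "X a l d * (X (b2 * m) j2 d2 * e2) = p l * (X a j2 d * e2 * (X (b2 * m) j1 d2 * e1))"
      by (simp add: mult_ac)
    then show ?thesis using e2 by simp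
  qed
  show ?thesis
  proof (rule exI[of _ p], rule exI[of _ "\<lambda>a d. if a \<in> blk b1 then X a j2 d * e2 * (X (b2 * m) j1 d2 * e1) else X a j1 d * e1"],
      intro allI impI ballI)
    fix b' a l d assume *: "b' < k" "b' \<noteq> b" "a \<in> blk b'" "l \<in> blk b" "d \<in> blk b'"
    show "replace_coeff (blk b) l d (G (replace_factor (blk b) i a)) =
       p l * (if a \<in> blk b1 then X a j2 d * e2 * (X (b2 * m) j1 d2 * e1) else X a j1 d * e1)"
    proof (cases "b' = b1")
      case True
      then show ?thesis using 2[of a l d] * by (simp add: X_def)
    next
      case False
      then have "a \<notin> blk b1" using * by (simp add: blk_div)
      then show ?thesis using 1[of b' a l d] * False by (simp add: X_def)
    qed
  qed
qed

lemma supp_top: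
  assumes "x \<in> lambda_space n m" "supp_in (blk b) x"
  shows "x = sc (coord x (blk b)) (basis (blk b))"
proof -
  have "I = blk b" if "coord x I \<noteq> 0" for I
    using assms lambda_spaceD[OF assms(1) that] that by (intro card_subset_eq) (auto simp: supp_in_def msubsets_iff)
  then have "x = (\<Sum>I\<in>{blk b}. sc (coord x I) (basis I))" by (intro ext_expand) auto
  then show ?thesis by simp
qed

text \<open>Write the coefficients as \<open>P i l * Q i a d\<close>. The pairing shows that within
  a block the vectors P i and Q a j are dual up to units, for every a outside it. The block diagonal
  matrix with rows P i therefore turns the vector Q i a into a multiple of e_a. After composing with
  it, the image of a replacement involves only e_a and the block, and the pairing, applied once
  more, leaves only the position i.\<close>

lemma diagonal_frame:
  assumes F: "framed G H (c :: nat \<Rightarrow> 'a::local_ring)"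
  obtains A A' c' where "invmat A A'" "framed (\<lambda>x. Lam A (G x)) (\<lambda>x. H (Lam A' x)) c'"
    "\<And>b b' i a. b < k \<Longrightarrow> b' < k \<Longrightarrow> b \<noteq> b' \<Longrightarrow> i \<in> blk b \<Longrightarrow> a \<in> blk b' \<Longrightarrow>
       \<exists>y. y dvd 1 \<and> Lam A (G (replace_factor (blk b) i a)) = sc y (replace_factor (blk b) i a)"
proof -
  note GH = framedD(1)[OF F]
  have "\<exists>p q. \<forall>b'<k. b' \<noteq> i div m \<longrightarrow> (\<forall>a\<in>blk b'. \<forall>l\<in>blk (i div m). \<forall>d\<in>blk b'.
     replace_coeff (blk (i div m)) l d (G (replace_factor (blk (i div m)) i a)) = p l * q a d)" if "i < n" for i
    using framed_factor[OF F div_less[OF that] in_own_blk] .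
  then obtain P Q where PQ0: "\<And>i b' a l d. i < n \<Longrightarrow> b' < k \<Longrightarrow> b' \<noteq> i div m \<Longrightarrow> a \<in> blk b' \<Longrightarrow> l \<in> blk (i div m) \<Longrightarrow> d \<in> blk b' \<Longrightarrow>
     replace_coeff (blk (i div m)) l d (G (replace_factor (blk (i div m)) i a)) = P i l * Q i a d" by metis
  have PQ: "replace_coeff (blk b) l d (G (replace_factor (blk b) i a)) = P i l * Q i a d"
    if "b < k" "b' < k" "b \<noteq> b'" "i \<in> blk b" "a \<in> blk b'" "l \<in> blk b" "d \<in> blk b'" for b b' i a l d
    using PQ0[of i b' a l d] that blk_less[OF that(1,4)] by (simp add: blk_div)
  define al where "al b i a j = (\<Sum>l\<in>blk b. P i l * Q a j l)" for b i a j
  \<comment> \<open>Since the coefficients factor, the double sum of \<open>framed_pairing\<close>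
    is the product of two scalar products, one over each block. For i = j and a = a' it is a unit,
    which makes both factors units; the scalar products with i different from j then vanish.\<close>
  have pair: "al b i a' j * al b' a' i a = (if i = j \<and> a = a' then c b * c b' else 0)"
    if b: "b < k" "b' < k" "b \<noteq> b'" and i: "i \<in> blk b" "j \<in> blk b" "a \<in> blk b'" "a' \<in> blk b'" for b b' i j a a'
  proof -
    have "al b i a' j * al b' a' i a = (\<Sum>l\<in>blk b. \<Sum>d\<in>blk b'. P i l * Q a' j l * (P a' d * Q i a d))"
      unfolding al_def by (rule sum_product)
    also have "\<dots> = (\<Sum>l\<in>blk b. \<Sum>d\<in>blk b'. replace_coeff (blk b) l d (G (replace_factor (blk b) i a)) * replace_coeff (blk b') d l (G (replace_factor (blk b') a' j)))"
    proof (intro sum.cong refl)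
      fix l d assume ld: "l \<in> blk b" "d \<in> blk b'"
      show "P i l * Q a' j l * (P a' d * Q i a d) = replace_coeff (blk b) l d (G (replace_factor (blk b) i a)) * replace_coeff (blk b') d l (G (replace_factor (blk b') a' j))"
        unfolding PQ[OF b i(1) i(3) ld] PQ[OF b(2,1) b(3)[symmetric] i(4) i(2) ld(2,1)] by (simp add: mult_ac)
    qed
    finally show ?thesis using framed_pairing[OF F b i(1,2,3,4)] by simp
  qed
  have al_unit: "al b i a i dvd 1" if "b < k" "b' < k" "b \<noteq> b'" "i \<in> blk b" "a \<in> blk b'" for b b' i a
  proof -
    have "(c b * c b') dvd 1" using framedD(2)[OF F] that by (intro unit_mult) auto
    then have "al b i a i * al b' a i a dvd 1" using pair[OF that(1-4) that(4,5,5)] by simp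
    then show ?thesis by (rule unit_mult_left)
  qed
  have al_zero: "al b i a j = 0" if "b < k" "b' < k" "b \<noteq> b'" "i \<in> blk b" "j \<in> blk b" "a \<in> blk b'" "i \<noteq> j" for b b' i a j
  proof -
    have "al b i a j * al b' a i a = 0" using pair[OF that(1-6) that(6)] that(7) by simp
    moreover have "al b' a i a dvd 1" using that by (intro al_unit[of b' b]) auto
    then obtain e where "al b' a i a * e = 1" by (metis dvdE)
    ultimately show ?thesis by (metis mult.assoc mult.right_neutral mult_zero_left)
  qed
  \<comment> \<open>A sample index outside the block of j: 0 lies in block 0 and m in block
    1.\<close>
  define pt where "pt j = (if j div m = 0 then m else 0)" for j
  have pt: "pt j \<in> blk (if j div m = 0 then 1 else 0)" for j
    using m by (simp add: pt_def blk_div)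
  have "\<exists>e. al (j div m) j (pt j) j * e = 1" if "j < n" for j
  proof -
    have "al (j div m) j (pt j) j dvd 1"
      using pt[of j] div_less[OF that] k by (intro al_unit[of _ "if j div m = 0 then 1 else 0"]) (auto simp: in_own_blk)
    then show ?thesis by (metis dvdE)
  qed
  then obtain e where e: "\<And>j. j < n \<Longrightarrow> al (j div m) j (pt j) j * e j = 1" by metis
  \<comment> \<open>Row i of A is P i, and column j of \<open>A'\<close> is the dual vector Q (pt j)
    j divided by the unit scalar product with P j.\<close>
  define A where "A = mat n n (\<lambda>(i, l). if l div m = i div m then P i l else 0)"
  define A' where "A' = mat n n (\<lambda>(l, j). if l div m = j div m then Q (pt j) j l * e j else 0)"
  have sumblk: "(\<Sum>l<n. if l div m = b then f l else 0) = sum f (blk b)" if "b < k" for f :: "nat \<Rightarrow> 'a" and b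
  proof -
    have "sum f (blk b) = (\<Sum>l\<in>blk b. if l div m = b then f l else 0)" by (intro sum.cong) (auto simp: blk_div)
    also have "\<dots> = (\<Sum>l<n. if l div m = b then f l else 0)"
      using blk_less[OF that] by (intro sum.mono_neutral_left) (auto simp: blk_div)
    finally show ?thesis by simp
  qed
  have "A * A' = 1\<^sub>m n"
  proof (rule eq_matI)
    fix i j assume "i < dim_row (1\<^sub>m n :: 'a mat)" "j < dim_col (1\<^sub>m n :: 'a mat)"
    then have ij: "i < n" "j < n" by auto
    have "(A * A') $$ (i, j) = (\<Sum>l<n. (if l div m = i div m then P i l else 0) * (if l div m = j div m then Q (pt j) j l * e j else 0))"
      using ij by (simp add: A_def A'_def scalar_prod_def lessThan_atLeast0)
    also have "\<dots> = (\<Sum>l<n. if l div m = i div m then (if i div m = j div m then P i l * Q (pt j) j l * e j else 0) else 0)"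
      by (intro sum.cong) (auto simp: mult.assoc)
    also have "\<dots> = (\<Sum>l\<in>blk (i div m). if i div m = j div m then P i l * Q (pt j) j l * e j else 0)"
      by (rule sumblk[OF div_less[OF ij(1)]])
    also have "\<dots> = (if i div m = j div m then al (i div m) i (pt j) j * e j else 0)"
      by (simp add: al_def sum_distrib_right)
    also have "\<dots> = (if i = j then 1 else 0)"
    proof (cases "i = j")
      case False
      have "al (i div m) i (pt j) j = 0" if "i div m = j div m"
        using pt[of j] div_less[OF ij(1)] k False that in_own_blk[of i] in_own_blk[of j]
        by (intro al_zero[of _ "if j div m = 0 then 1 else 0"]) (auto simp: blk_div)
      then show ?thesis using False by simp
    qed (use e ij in simp)
    finally show "(A * A') $$ (i, j) = 1\<^sub>m n $$ (i, j)" using ij by simp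
  qed (simp_all add: A_def A'_def)
  then have inv: "invmat A A'"
    using mat_right_inverse[of A n A'] by (simp add: invmat_def A_def A'_def)
  have dimA: "dim_row A = n" by (simp add: A_def)
  have cvA: "supp_in (blk b) (cvec A l)" if "l \<in> blk b" "b < k" for b l
  proof -
    have "I \<subseteq> blk b" if "coord (cvec A l) I \<noteq> 0" for I
    proof -
      have "I \<in> msubsets n 1" using lambda_spaceD[OF cvec_in that] by (simp add: A_def)
      then obtain r where r: "I = {r}" "r < n" by (auto simp: msubsets_def card_1_singleton_iff)
      then have "A $$ (r, l) \<noteq> 0" using that by (simp add: coord_cvec A_def)
      then show ?thesis using r blk_less[OF \<open>b < k\<close> \<open>l \<in> blk b\<close>] \<open>l \<in> blk b\<close> by (simp add: A_def blk_div split: if_splits)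
    qed
    then show ?thesis by (simp add: supp_in_def)
  qed
  have LA: "supp_in (blk b) (Lam A (basis J))" if "J \<subseteq> blk b" "b < k" for b J
  proof -
    have "J \<subseteq> {..<n}" "finite J" using that blk_less by (auto intro: finite_subset[OF _ blk_finite])
    moreover have "supp_in (blk b) (cvec A l)" if "l \<in> J" for l
      using that \<open>J \<subseteq> blk b\<close> \<open>b < k\<close> by (intro cvA) auto
    ultimately show ?thesis by (auto simp: Lam_basis dimA oprod_def intro!: supp_in_prod_list)
  qed
  define G' where "G' x = Lam A (G x)" for x
  define H' where "H' x = H (Lam A' x)" for x
  have sG': "similitude n m G' H'" unfolding G'_def H'_def by (rule similitude_comp[OF invmat_similitude[OF inv] GH])
  define c' where "c' b = c b * coord (Lam A (basis (blk b))) (blk b)" for b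
  have LAb: "Lam A (basis (blk b)) = sc (coord (Lam A (basis (blk b))) (blk b)) (basis (blk b))" if "b < k" for b
    using that by (intro supp_top LA similitudeD(3)[OF invmat_similitude[OF inv]] basis_in_lambda_space blk_msubset) auto
  have F': "framed G' H' c'"
    unfolding framed_def
  proof (intro conjI allI impI sG')
    fix b assume b: "b < k"
    have "basis (blk b) = Lam A' (Lam A (basis (blk b) :: 'a ext))"
      by (rule invmat_Lam[OF invmat_sym[OF inv], symmetric]) (intro lambda_space_subset_all[of _ n m] basis_in_lambda_space blk_msubset b)
    also have "\<dots> = sc (coord (Lam A (basis (blk b))) (blk b)) (Lam A' (basis (blk b)))"
      by (subst LAb[OF b]) (rule Lam_sc)
    finally have "coord (basis (blk b)) (blk b) = coord (sc (coord (Lam A (basis (blk b))) (blk b)) (Lam A' (basis (blk b)))) (blk b)"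
      by (rule arg_cong)
    then have "coord (Lam A (basis (blk b))) (blk b) * coord (Lam A' (basis (blk b))) (blk b) = 1" by (simp add: coord_basis)
    then have "coord (Lam A (basis (blk b))) (blk b) dvd 1" by (metis dvd_triv_left)
    then show "c' b dvd 1" using framedD(2)[OF F b] by (simp add: c'_def unit_mult)
    show "G' (basis (blk b)) = sc (c' b) (basis (blk b))"
      unfolding G'_def framedD(3)[OF F b] Lam_sc by (subst LAb[OF b]) (simp add: c'_def)
  qed
  have vec: "Lam A (\<Sum>d\<in>blk b'. sc (Q i a d) (basis {d})) = sc (al b' a i a) (basis {a})"
    if b: "b < k" "b' < k" "b \<noteq> b'" "i \<in> blk b" "a \<in> blk b'" for b b' i a
  proof -
    have "Lam A (\<Sum>d\<in>blk b'. sc (Q i a d) (basis {d})) = (\<Sum>d\<in>blk b'. sc (Q i a d) (\<Sum>r<n. sc (A $$ (r, d)) (basis {r})))"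
      using blk_less[OF b(2)] by (simp add: Lam_sum Lam_sc Lam_basis1 dimA cvec_def evec_def)
    also have "\<dots> = (\<Sum>r<n. \<Sum>d\<in>blk b'. sc (A $$ (r, d) * Q i a d) (basis {r}))"
      by (simp add: sc_sum mult.commute) (rule sum.swap)
    also have "\<dots> = (\<Sum>r<n. if r = a then sc (al b' a i a) (basis {a}) else 0)"
    proof (intro sum.cong refl)
      fix r assume "r \<in> {..<n}"
      then have r: "r < n" by simp
      have s: "(\<Sum>d\<in>S. sc (f d) x) = sc (\<Sum>d\<in>S. f d) x" for S and f :: "nat \<Rightarrow> 'a" and x
        by (induction S rule: infinite_finite_induct) (auto simp: sc_add)
      have "(\<Sum>d\<in>blk b'. A $$ (r, d) * Q i a d) = (\<Sum>d\<in>blk b'. if r div m = b' then P r d * Q i a d else 0)"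
        using r blk_less[OF b(2)] by (intro sum.cong) (auto simp: A_def blk_div)
      also have "\<dots> = (if r div m = b' then al b' r i a else 0)" by (simp add: al_def)
      also have "\<dots> = (if r = a then al b' a i a else 0)"
      proof (cases "r = a")
        case True
        then show ?thesis using b by (simp add: blk_div)
      next
        case False
        have "al b' r i a = 0" if "r div m = b'"
          using b that False by (intro al_zero[of b' b]) (auto simp: blk_div)
        then show ?thesis using False by simp
      qed
      finally show "(\<Sum>d\<in>blk b'. sc (A $$ (r, d) * Q i a d) (basis {r})) = (if r = a then sc (al b' a i a) (basis {a}) else 0)"
        unfolding s by auto
    qed
    also have "\<dots> = sc (al b' a i a) (basis {a})" using blk_less[OF b(2,5)] by simp
    finally show ?thesis .
  qed
  \<comment> \<open>The sum over d that replaces a factor is turned into a multiple of e_a, and A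
    maps the span of each block into itself; so no index outside the block other than a can
    occur.\<close>
  have supp: "supp_in (insert a (blk b)) (G' (replace_factor (blk b) i a))"
    if b: "b < k" "b' < k" "b \<noteq> b'" "i \<in> blk b" "a \<in> blk b'" for b b' i a
  proof -
    have "G (replace_factor (blk b) i a) = (\<Sum>l\<in>blk b. \<Sum>d\<in>blk b'. sc (P i l * Q i a d) (replace_factor (blk b) l d))"
      by (subst framed_expand[OF F b]) (intro sum.cong refl, simp add: PQ[OF b])
    also have "\<dots> = (\<Sum>l\<in>blk b. sc (P i l * sg {l} (blk b - {l})) ((\<Sum>d\<in>blk b'. sc (Q i a d) (basis {d})) * basis (blk b - {l})))"
      by (simp add: replace_factor_def sum_distrib_right sc_mult_left sc_sum mult_ac)
    finally have "G' (replace_factor (blk b) i a) = (\<Sum>l\<in>blk b. sc (P i l * sg {l} (blk b - {l})) (Lam A ((\<Sum>d\<in>blk b'. sc (Q i a d) (basis {d})) * basis (blk b - {l}))))"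
      by (simp add: G'_def Lam_sum Lam_sc)
    also have "\<dots> = (\<Sum>l\<in>blk b. sc (P i l * sg {l} (blk b - {l}) * al b' a i a) (basis {a} * Lam A (basis (blk b - {l}))))"
    proof (intro sum.cong refl)
      fix l
      have "(\<Sum>d\<in>blk b'. sc (Q i a d) (basis {d})) \<in> lambda_all n" "(basis (blk b - {l}) :: 'a ext) \<in> lambda_all n"
        using blk_less[OF b(1)] blk_less[OF b(2)] by (auto intro!: lambda_all_sum lambda_all_sc lambda_all_basis)
      then have "Lam A ((\<Sum>d\<in>blk b'. sc (Q i a d) (basis {d})) * basis (blk b - {l})) = sc (al b' a i a) (basis {a}) * Lam A (basis (blk b - {l}))"
        using vec[OF b] by (simp add: Lam_times dimA)
      then show "sc (P i l * sg {l} (blk b - {l})) (Lam A ((\<Sum>d\<in>blk b'. sc (Q i a d) (basis {d})) * basis (blk b - {l}))) =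
        sc (P i l * sg {l} (blk b - {l}) * al b' a i a) (basis {a} * Lam A (basis (blk b - {l})))"
        by (simp add: sc_mult_left)
    qed
    finally have eq: "G' (replace_factor (blk b) i a) = (\<Sum>l\<in>blk b. sc (P i l * sg {l} (blk b - {l}) * al b' a i a) (basis {a} * Lam A (basis (blk b - {l}))))" .
    have t: "coord (basis {a} * Lam A (basis (blk b - {l}))) I = 0" if "\<not> I \<subseteq> insert a (blk b)" for I l
    proof -
      have "supp_in (insert a (blk b)) (Lam A (basis (blk b - {l})))"
        using LA[of "blk b - {l}" b] b by (auto simp: supp_in_def)
      moreover have "supp_in (insert a (blk b)) (basis {a})" by (auto simp: supp_in_def coord_basis split: if_splits)
      ultimately have "supp_in (insert a (blk b)) (basis {a} * Lam A (basis (blk b - {l})))" by (intro supp_in_mult)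
      then show ?thesis using that unfolding supp_in_def by blast
    qed
    show ?thesis unfolding supp_in_def eq
    proof (intro allI impI)
      fix I assume nz: "coord (\<Sum>l\<in>blk b. sc (P i l * sg {l} (blk b - {l}) * al b' a i a) (basis {a} * Lam A (basis (blk b - {l})))) I \<noteq> 0"
      show "I \<subseteq> insert a (blk b)"
      proof (rule ccontr)
        assume "\<not> I \<subseteq> insert a (blk b)"
        from t[OF this] nz show False by (simp add: coord_sum)
      qed
    qed
  qed
  have rz: "replace_coeff (blk b) l d (G' (replace_factor (blk b) i a)) = 0"
    if b: "b < k" "b' < k" "b \<noteq> b'" "i \<in> blk b" "a \<in> blk b'" and d: "d \<in> blk b'" "d \<noteq> a" for b b' i a l d
  proof -
    have "d \<notin> blk b" using d b by (auto simp: blk_div)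
    then have "\<not> insert d (blk b - {l}) \<subseteq> insert a (blk b)" using d by auto
    then show ?thesis using supp[OF b] by (auto simp: supp_in_def replace_coeff_eq_0_iff)
  qed
  \<comment> \<open>In the double sum of \<open>framed_pairing\<close> only l = j and d = a is left:
    one factor vanishes unless d = a, the other unless l = j.\<close>
  have pair': "replace_coeff (blk b) j a (G' (replace_factor (blk b) i a)) * replace_coeff (blk b') a j (G' (replace_factor (blk b') a j)) = (if i = j then c' b * c' b' else 0)"
    if b: "b < k" "b' < k" "b \<noteq> b'" "i \<in> blk b" "j \<in> blk b" "a \<in> blk b'" for b b' i j a
  proof -
    have "(\<Sum>l\<in>blk b. \<Sum>d\<in>blk b'. replace_coeff (blk b) l d (G' (replace_factor (blk b) i a)) * replace_coeff (blk b') d l (G' (replace_factor (blk b') a j))) =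
      (\<Sum>l\<in>blk b. \<Sum>d\<in>blk b'. if d = a then if l = j then replace_coeff (blk b) j a (G' (replace_factor (blk b) i a)) * replace_coeff (blk b') a j (G' (replace_factor (blk b') a j)) else 0 else 0)"
      using rz[OF b(1-4,6)] rz[OF b(2,1) b(3)[symmetric] b(6,5)] by (intro sum.cong refl) auto
    also have "\<dots> = replace_coeff (blk b) j a (G' (replace_factor (blk b) i a)) * replace_coeff (blk b') a j (G' (replace_factor (blk b') a j))"
      using b by simp
    finally show ?thesis using framed_pairing[OF F' b(1-5) b(6,6)] by simp
  qed
  have diag: "\<exists>y. y dvd 1 \<and> G' (replace_factor (blk b) i a) = sc y (replace_factor (blk b) i a)"
    if b: "b < k" "b' < k" "b \<noteq> b'" "i \<in> blk b" "a \<in> blk b'" for b b' i a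
  proof -
    have uu: "replace_coeff (blk b) j a (G' (replace_factor (blk b) j a)) * replace_coeff (blk b') a j (G' (replace_factor (blk b') a j)) dvd 1" if "j \<in> blk b" for j
      using pair'[OF b(1-3) that that b(5)] framedD(2)[OF F'] b by (simp add: unit_mult)
    have z: "replace_coeff (blk b) j a (G' (replace_factor (blk b) i a)) = 0" if j: "j \<in> blk b" "j \<noteq> i" for j
    proof -
      have "replace_coeff (blk b) j a (G' (replace_factor (blk b) i a)) * replace_coeff (blk b') a j (G' (replace_factor (blk b') a j)) = 0"
        using pair'[OF b(1-4) j(1) b(5)] j(2) by simp
      moreover obtain f where "replace_coeff (blk b') a j (G' (replace_factor (blk b') a j)) * f = 1"
        using unit_mult_right[OF uu[OF j(1)]] by (metis dvdE)
      ultimately show ?thesis by (metis mult.assoc mult.right_neutral mult_zero_left)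
    qed
    let ?y = "replace_coeff (blk b) i a (G' (replace_factor (blk b) i a))"
    have "G' (replace_factor (blk b) i a) = (\<Sum>j\<in>blk b. \<Sum>d\<in>blk b'. sc (replace_coeff (blk b) j d (G' (replace_factor (blk b) i a))) (replace_factor (blk b) j d))"
      by (rule framed_expand[OF F' b])
    also have "\<dots> = (\<Sum>j\<in>blk b. \<Sum>d\<in>blk b'. if d = a then if j = i then sc ?y (replace_factor (blk b) i a) else 0 else 0)"
      using z rz[OF b] by (intro sum.cong refl) auto
    also have "\<dots> = sc ?y (replace_factor (blk b) i a)" using b by simp
    finally show ?thesis using unit_mult_left[OF uu[OF b(4)]] by blast
  qed
  show thesis using that[OF inv F'[unfolded G'_def H'_def]] diag unfolding G'_def by blast
qed

lemma card_remove_two: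
  assumes "J \<in> msubsets n m" "p \<in> J" "q \<in> J" "p \<noteq> q"
  shows "card (J - {p, q}) + 2 = m"
proof -
  have J: "finite J" "card J = m" using assms(1) by (auto simp: msubsets_iff)
  have "card {p, q} \<le> card J" using assms J by (intro card_mono) auto
  then show ?thesis using assms J by (simp add: card_Diff_subset)
qed

text \<open>The three-term relation at the image of e_w \<and> (e_i + e_j) \<and> (e_a + e_b). It
  says that the scalars form a matrix of rank one, as they must if they are to come from a diagonal
  matrix.\<close>

lemma diagonal_rel:
  assumes GH: "similitude n m G H" and J: "J \<in> msubsets n m"
    and x: "\<And>i a. i \<in> J \<Longrightarrow> a < n \<Longrightarrow> a \<notin> J \<Longrightarrow> x i a dvd 1 \<and> G (replace_factor J i a) = sc (x i a) (replace_factor J i a)"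
    and i: "i \<in> J" "j \<in> J" and a: "a < n" "a \<notin> J" "b < n" "b \<notin> J"
  shows "x i a * x j b = x i b * (x j a :: 'a::comm_ring_1)"
proof (cases "i = j \<or> a = b")
  case True
  then show ?thesis by (auto simp: mult.commute)
next
  case False
  then have ne: "i \<noteq> j" "a \<noteq> b" by auto
  let ?w = "J - {i, j}"
  have finJ: "finite J" "J \<subseteq> {..<n}" using J by (auto simp: msubsets_iff)
  obtain r :: 'a where r: "r * r = 1" "\<And>a. a < n \<Longrightarrow> a \<notin> J \<Longrightarrow> replace_factor J j a = sc r (ew ?w i a)"
    "\<And>a. a < n \<Longrightarrow> a \<notin> J \<Longrightarrow> replace_factor J i a = sc r (ew ?w a j)"
    using replace_factor_ew[OF J i ne(1)] by blast
  have E1: "G (ew ?w i a) = sc (x j a) (ew ?w i a)" if "a < n" "a \<notin> J" for a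
  proof -
    have e: "ew ?w i a = sc r (replace_factor J j a)" using r(1) r(2)[OF that] by simp
    show ?thesis unfolding e lin_sc[OF similitudeD(1)[OF GH]] using x[OF i(2) that] by (simp add: mult.commute)
  qed
  have E2: "G (ew ?w j a) = sc (x i a) (ew ?w j a)" if "a < n" "a \<notin> J" for a
  proof -
    have "a \<noteq> j" using that i by auto
    then have "ew ?w j a = sc (-1) (ew ?w a j :: 'a ext)"
      using basis_anticommute[of j a, where 'a = 'a] by (simp add: ew_def mult.assoc)
    then have e: "ew ?w j a = sc (-r) (replace_factor J i a)" using r(1) r(3)[OF that] by simp
    show ?thesis unfolding e lin_sc[OF similitudeD(1)[OF GH]] using x[OF i(1) that] by (simp add: mult.commute)
  qed
  have dis: "distinct [i, a, j, b]" "{i, a, j, b} \<inter> ?w = {}" "{i, a, j, b} \<subseteq> {..<n}"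
    using ne i a finJ by auto
  have wm: "finite ?w" "?w \<subseteq> {..<n}" "card ?w + 2 = m" using finJ card_remove_two[OF J i ne(1)] by auto
  define z :: "'a ext" where "z = ew ?w i a + ew ?w i b + ew ?w j a + ew ?w j b"
  have Gz: "G z = sc (x j a) (ew ?w i a) + sc (x j b) (ew ?w i b) + sc (x i a) (ew ?w j a) + sc (x i b) (ew ?w j b)"
    unfolding z_def lin_add[OF similitudeD(1)[OF GH]] using E1 E2 a by simp
  have v: "cf ?w i a (G z) = x j a" "cf ?w j b (G z) = x i b" "cf ?w i b (G z) = x j b" "cf ?w j a (G z) = x i a" "cf ?w i j (G z) = 0"
    unfolding Gz cf_add cf_sc using dis wm(1) by (auto simp: cf_ew)
  have "decomposable z" unfolding z_def by (rule decomposable_ew4[OF wm dis])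
  from decomposable_rel[OF wm dis GH this] have "x j a * x i b = x j b * x i a"
    unfolding v using x[OF i(2) a(1,2)] by simp
  then show ?thesis by (simp add: mult.commute)
qed

lemma lin_ext:
  assumes "lin G" "\<And>J. J \<in> msubsets n m \<Longrightarrow> G (basis J) = basis J" "x \<in> lambda_space n m"
  shows "G x = (x :: 'a::comm_ring_1 ext)"
proof -
  have "G x = G (\<Sum>I\<in>msubsets n m. sc (coord x I) (basis I))"
    using lambda_space_expand[OF assms(3)] by simp
  also have "\<dots> = (\<Sum>I\<in>msubsets n m. sc (coord x I) (basis I))"
    using assms(1,2) by (simp add: lin_sum lin_sc)
  also have "\<dots> = x" using lambda_space_expand[OF assms(3)] by simp
  finally show ?thesis .
qed

end

section \<open>The form of a similitude over a local ring\<close>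

context blocks
begin

lemma diagonal_frame_ex:
  assumes F: "framed G H (c :: nat \<Rightarrow> 'a::local_ring)"
  shows "\<exists>A A' c'. invmat A A' \<and> framed (\<lambda>x. Lam A (G x)) (\<lambda>x. H (Lam A' x)) c' \<and>
    (\<forall>b b' i a. b < k \<longrightarrow> b' < k \<longrightarrow> b \<noteq> b' \<longrightarrow> i \<in> blk b \<longrightarrow> a \<in> blk b' \<longrightarrow>
       (\<exists>y. y dvd 1 \<and> Lam A (G (replace_factor (blk b) i a)) = sc y (replace_factor (blk b) i a)))"
proof (rule diagonal_frame[OF F])
  fix A A' c' assume 1: "invmat A A'" and 2: "framed (\<lambda>x. Lam A (G x)) (\<lambda>x. H (Lam A' x)) c'"
    and 3: "\<And>b b' i a. b < k \<Longrightarrow> b' < k \<Longrightarrow> b \<noteq> b' \<Longrightarrow> i \<in> blk b \<Longrightarrow> a \<in> blk b' \<Longrightarrow>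
       \<exists>y. y dvd 1 \<and> Lam A (G (replace_factor (blk b) i a)) = sc y (replace_factor (blk b) i a)"
  show ?thesis
    by (rule exI[of _ A], rule exI[of _ A'], rule exI[of _ c'], intro conjI allI impI 1 2 3)
qed

theorem local_similitudes:
  assumes GH: "similitude n m G (H :: 'a::local_ring ext \<Rightarrow> 'a ext)"
  shows "\<exists>u A. A \<in> carrier_mat n n \<and> (\<forall>x\<in>lambda_space n m. G x = sc u (Lam A x))"
proof -
  obtain h h' and c :: "nat \<Rightarrow> 'a" where h: "invmat h h'" "\<And>b. b < k \<Longrightarrow> c b dvd 1"
    "\<And>b. b < k \<Longrightarrow> G (basis (blk b)) = sc (c b) (Lam h (basis (blk b)))"
    using block_frame[OF GH] by blast
  have F1: "framed (\<lambda>x. Lam h' (G x)) (\<lambda>x. H (Lam h x)) c"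
    unfolding framed_def
  proof (intro conjI allI impI)
    show "similitude n m (\<lambda>x. Lam h' (G x)) (\<lambda>x. H (Lam h x))"
      by (rule similitude_comp[OF invmat_similitude[OF invmat_sym[OF h(1)]] GH])
    fix b assume b: "b < k"
    show "c b dvd 1" by (rule h(2)[OF b])
    have "Lam h' (Lam h (basis (blk b))) = (basis (blk b) :: 'a ext)"
      by (rule invmat_Lam[OF invmat_sym[OF h(1)]]) (intro lambda_space_subset_all[of _ n m] basis_in_lambda_space blk_msubset b)
    then show "Lam h' (G (basis (blk b))) = sc (c b) (basis (blk b))"
      unfolding h(3)[OF b] Lam_sc by simp
  qed
  obtain A A' c' where AA: "invmat A A' \<and> framed (\<lambda>x. Lam A (Lam h' (G x))) (\<lambda>x. H (Lam h (Lam A' x))) c' \<and>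
    (\<forall>b b' i a. b < k \<longrightarrow> b' < k \<longrightarrow> b \<noteq> b' \<longrightarrow> i \<in> blk b \<longrightarrow> a \<in> blk b' \<longrightarrow>
       (\<exists>y. y dvd 1 \<and> Lam A (Lam h' (G (replace_factor (blk b) i a))) = sc y (replace_factor (blk b) i a)))"
    using diagonal_frame_ex[OF F1] by (elim exE) (rule that)
  note A = conjunct1[OF AA] conjunct1[OF conjunct2[OF AA]] and diag = conjunct2[OF conjunct2[OF AA], rule_format]
  define G2 where "G2 = (\<lambda>x. Lam A (Lam h' (G x)))"
  define H2 where "H2 = (\<lambda>x. H (Lam h (Lam A' x)))"
  have F2: "framed G2 H2 c'" unfolding G2_def H2_def by (rule A(2))
  note S2 = framedD(1)[OF F2]
  have k0: "0 < k" using k by simp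
  let ?J = "blk 0"
  have J: "?J \<in> msubsets n m" by (rule blk_msubset[OF k0])
  have "\<exists>y. y dvd 1 \<and> G2 (replace_factor ?J i a) = sc y (replace_factor ?J i a)" if "i \<in> ?J" "a < n" "a \<notin> ?J" for i a
  proof -
    have "0 \<noteq> a div m" using that(3) by (simp add: blk_div)
    from diag[OF k0 div_less[OF that(2)] this that(1) in_own_blk] show ?thesis by (simp add: G2_def)
  qed
  then obtain x where x: "\<And>i a. i \<in> ?J \<Longrightarrow> a < n \<Longrightarrow> a \<notin> ?J \<Longrightarrow> x i a dvd 1 \<and> G2 (replace_factor ?J i a) = sc (x i a) (replace_factor ?J i a)"
    by metis
  then have "\<exists>y. x i a * y = 1" if "i \<in> ?J" "a < n" "a \<notin> ?J" for i a using that by (metis dvdE)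
  then obtain y where y: "\<And>i a. i \<in> ?J \<Longrightarrow> a < n \<Longrightarrow> a \<notin> ?J \<Longrightarrow> x i a * y i a = 1" by metis
  have rel: "x i a * x j b = x i b * x j a"
    if "i \<in> ?J" "j \<in> ?J" "a < n" "a \<notin> ?J" "b < n" "b \<notin> ?J" for i j a b
    by (rule diagonal_rel[OF S2 J _ that]) (rule x)
  have i0: "0 \<in> ?J" using m by (simp add: blk_div)
  have a0: "m < n" "m \<notin> ?J" using m nm by (simp_all add: blk_div)
  obtain c0' where c0: "c' 0 * c0' = 1" using framedD(2)[OF F2 k0] by (metis dvdE)
  \<comment> \<open>A scalar u and a diagonal matrix with entries \<tau> reproduce \<open>G2\<close>
    at block 0 and its neighbours if u times the product of \<tau> over the block is
    \<open>c' 0\<close>, and \<open>c' 0\<close> \<tau>_a = \<open>x i a\<close> \<tau>_i for i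
    inside and a outside the block. Starting from \<tau>_0 = \<open>c' 0\<close>, these equations
    force the values chosen here; 0 and m are the base indices inside and outside, and u is
    \<open>v'\<close> below.\<close>
  define \<tau> where "\<tau> l = (if l \<in> ?J then x 0 m * c' 0 * y l m else x 0 l)" for l
  define \<tau>' where "\<tau>' l = (if l \<in> ?J then y 0 m * c0' * x l m else y 0 l)" for l
  have inv: "\<tau> l * \<tau>' l = 1" if "l < n" for l
  proof (cases "l \<in> ?J")
    case True
    have "\<tau> l * \<tau>' l = (x 0 m * y 0 m) * (c' 0 * c0') * (x l m * y l m)" using True by (simp add: \<tau>_def \<tau>'_def mult_ac)
    then show ?thesis using y[OF i0 a0] y[OF True a0] c0 by simp
  qed (use y[OF i0 that] in \<open>simp add: \<tau>_def \<tau>'_def\<close>)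
  let ?D = "mat n n (\<lambda>(i, j). if i = j then \<tau> i else 0)" and ?D' = "mat n n (\<lambda>(i, j). if i = j then \<tau>' i else 0)"
  have DD: "?D' * ?D = 1\<^sub>m n"
  proof (rule eq_matI)
    fix i j assume ij: "i < dim_row (1\<^sub>m n :: 'a mat)" "j < dim_col (1\<^sub>m n :: 'a mat)"
    then have "(?D' * ?D) $$ (i, j) = (\<Sum>l<n. (if i = l then \<tau>' i else 0) * (if l = j then \<tau> l else 0))"
      by (simp add: scalar_prod_def lessThan_atLeast0)
    also have "\<dots> = (\<Sum>l<n. if l = i then (if i = j then \<tau>' i * \<tau> i else 0) else 0)"
      by (intro sum.cong) auto
    finally have "(?D' * ?D) $$ (i, j) = (\<Sum>l<n. if l = i then (if i = j then \<tau>' i * \<tau> i else 0) else 0)" .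
    then show "(?D' * ?D) $$ (i, j) = 1\<^sub>m n $$ (i, j)" using ij inv by (simp add: mult.commute)
  qed simp_all
  have D: "invmat ?D' ?D" using DD mat_right_inverse[of ?D' n ?D] by (simp add: invmat_def)
  define v where "v = prod \<tau> ?J * c0'"
  define v' where "v' = prod \<tau>' ?J * c' 0"
  have "prod \<tau> ?J * prod \<tau>' ?J = 1"
    unfolding prod.distrib[symmetric] using blk_less[OF k0] inv by (intro prod.neutral) auto
  then have vv: "v * v' = 1" using c0 unfolding v_def v'_def by (metis (no_types, lifting) mult.assoc mult.commute mult.left_neutral)
  define G3 where "G3 = (\<lambda>x. sc v (Lam ?D' (G2 x)))"
  have S3: "similitude n m G3 (\<lambda>x. H2 (Lam ?D (sc v' x)))"
    unfolding G3_def by (rule similitude_comp[OF similitude_sc[OF vv] similitude_comp[OF invmat_similitude[OF D] S2]])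
  have LD: "Lam ?D' (basis I) = sc (prod \<tau>' I) (basis I :: 'a ext)" if "I \<in> msubsets n m" for I
    using that by (intro Lam_diag) (auto simp: msubsets_iff)
  have N: "normalized G3 ?J"
    unfolding normalized_def
  proof (intro conjI ballI allI impI)
    show "G3 (basis ?J) = basis ?J"
      unfolding G3_def framedD(3)[OF F2 k0] Lam_sc LD[OF J] using vv by (simp add: v'_def mult_ac)
  next
    fix i a assume i: "i \<in> ?J" and a: "a < n" "a \<notin> ?J"
    let ?I = "insert a (?J - {i})"
    have I: "?I \<in> msubsets n m"
      using swap_msubset(1)[OF k0 div_less[OF a(1)] _ i in_own_blk] a by (simp add: blk_div)
    have G2I: "G2 (basis ?I) = sc (x i a) (basis ?I)"
      using x[OF i a] i a basis_replace_factor[of ?J i a, where 'a = 'a] by (simp add: lin_sc[OF similitudeD(1)[OF S2]] mult_ac)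
    have in': "i < n" by (rule blk_less[OF k0 i])
    have "prod \<tau>' ?J = \<tau>' i * prod \<tau>' (?J - {i})" using i by (intro prod.remove) auto
    moreover have "prod \<tau>' ?I = \<tau>' a * prod \<tau>' (?J - {i})" using a by (intro prod.insert) auto
    moreover have "x i a * \<tau>' a = c' 0 * \<tau>' i"
    proof -
      have "x i a * \<tau>' a = x i a * y 0 a * (x 0 m * y 0 m)" using a y[OF i0 a0] by (simp add: \<tau>'_def)
      also have "\<dots> = (x i a * x 0 m) * y 0 a * y 0 m" by (simp add: mult_ac)
      also have "x i a * x 0 m = x i m * x 0 a" by (rule rel[OF i i0 a a0])
      also have "x i m * x 0 a * y 0 a * y 0 m = x i m * (x 0 a * y 0 a) * y 0 m" by (simp add: mult_ac)
      also have "\<dots> = c' 0 * c0' * x i m * y 0 m" using y[OF i0 a] c0 by simp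
      also have "\<dots> = c' 0 * \<tau>' i" using i by (simp add: \<tau>'_def mult_ac)
      finally show ?thesis .
    qed
    ultimately have "x i a * prod \<tau>' ?I = c' 0 * prod \<tau>' ?J" by (simp add: mult.assoc[symmetric])
    then have "v * (x i a * prod \<tau>' ?I) = 1" using vv by (simp add: v'_def mult_ac)
    then show "G3 (basis ?I) = basis ?I"
      unfolding G3_def G2I Lam_sc LD[OF I] by simp
  qed
  have id: "G3 z = z" if "z \<in> lambda_space n m" for z
    by (rule lin_ext[OF similitudeD(1)[OF S3] _ that]) (rule normalizedD(1)[OF normalized_all[OF S3 N J]])
  \<comment> \<open>The matrix undoes the normalizations in reverse order. The scalar is kept
    outside because it need not be an m-th power.\<close>
  show ?thesis
  proof (intro exI[of _ v'] exI[of _ "h * (A' * ?D)"] conjI ballI)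
    have car: "h \<in> carrier_mat n n" "A' \<in> carrier_mat n n" "?D \<in> carrier_mat n n"
      using h(1) A(1) D by (simp_all add: invmat_def)
    then show "h * (A' * ?D) \<in> carrier_mat n n" by simp
    fix z :: "'a ext" assume z: "z \<in> lambda_space n m"
    have m1: "G z \<in> lambda_all n" by (rule lambda_space_subset_all[OF similitudeD(3)[OF GH z]])
    have m3: "G2 z \<in> lambda_all n" by (rule lambda_space_subset_all[OF similitudeD(3)[OF S2 z]])
    have m2: "Lam h' (G z) \<in> lambda_all n" by (rule lambda_space_subset_all[OF similitudeD(3)[OF framedD(1)[OF F1] z]])
    have "G z = Lam h (Lam h' (G z))" by (rule invmat_Lam[OF h(1) m1, symmetric])
    also have "Lam h' (G z) = Lam A' (G2 z)" unfolding G2_def by (rule invmat_Lam[OF invmat_sym[OF A(1)] m2, symmetric])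
    also have "G2 z = Lam ?D (Lam ?D' (G2 z))" by (rule invmat_Lam[OF invmat_sym[OF D] m3, symmetric])
    also have "Lam ?D' (G2 z) = sc v' (G3 z)" using vv by (simp add: G3_def mult.commute)
    also have "G3 z = z" by (rule id[OF z])
    finally have "G z = Lam h (Lam A' (Lam ?D (sc v' z)))" .
    also have "\<dots> = sc v' (Lam (h * (A' * ?D)) z)"
      using car by (simp add: Lam_sc Lam_mult[of A' n] Lam_mult[of h n])
    finally show "G z = sc v' (Lam (h * (A' * ?D)) z)" .
  qed
qed

end

section \<open>Coordinates and matrices of operators\<close>

definition of_vec :: "nat \<Rightarrow> nat \<Rightarrow> 'a::comm_ring_1 vec \<Rightarrow> 'a ext" where
  "of_vec n m v = (\<Sum>I\<in>msubsets n m. sc (v $ idx n m I) (basis I))"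

definition to_vec :: "nat \<Rightarrow> nat \<Rightarrow> 'a::comm_ring_1 ext \<Rightarrow> 'a vec" where
  "to_vec n m x = vec (n choose m) (\<lambda>i. coord x (msubset_list n m ! i))"

lemma coord_lincomb:
  assumes "finite S" "\<And>I. I \<in> S \<Longrightarrow> finite I"
  shows "coord (\<Sum>I\<in>S. sc (c I) (basis I)) K = (if K \<in> S then c K else (0 :: 'a::comm_ring_1))"
proof -
  have "coord (\<Sum>I\<in>S. sc (c I) (basis I)) K = (\<Sum>I\<in>S. if I = K then c I else 0)"
    unfolding coord_sum using assms(2) by (intro sum.cong) (auto simp: coord_basis)
  then show ?thesis using assms(1) by simp
qed

lemma coord_of_vec: "coord (of_vec n m v) K = (if K \<in> msubsets n m then v $ idx n m K else 0)"
  unfolding of_vec_def by (rule coord_lincomb) (auto simp: msubsets_iff)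

lemma of_vec_in: "of_vec n m v \<in> lambda_space n m"
  by (auto simp: lambda_space_def coord_of_vec split: if_splits)

lemma msubset_list_mem: "i < n choose m \<Longrightarrow> msubset_list n m ! i \<in> msubsets n m"
  by (metis length_msubset_list nth_mem set_msubset_list)

lemma of_to_vec: "x \<in> lambda_space n m \<Longrightarrow> of_vec n m (to_vec n m x) = x"
proof (rule ext_eqI)
  fix K assume x: "x \<in> lambda_space n m"
  show "coord (of_vec n m (to_vec n m x)) K = coord x K"
    using basis_coord_zero[OF x, of K]
    by (auto simp: coord_of_vec to_vec_def idx_less msubset_list_idx)
qed

lemma to_vec_carrier: "to_vec n m x \<in> carrier_vec (n choose m)"
  by (simp add: to_vec_def)

lemma ext_eq_lambdaI:
  assumes "x \<in> lambda_space n m" "y \<in> lambda_space n m" "\<And>I. I \<in> msubsets n m \<Longrightarrow> coord x I = coord y I"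
  shows "x = y"
proof (rule ext_eqI)
  fix K
  show "coord x K = coord y K"
    using basis_coord_zero[OF assms(1), of K] basis_coord_zero[OF assms(2), of K] assms(3)[of K]
    by (cases "K \<in> msubsets n m") simp_all
qed

text \<open>The coordinate is the determinant of a permutation matrix, in whose Leibniz expansion
  only the permutation given by the list survives.\<close>

lemma prod_list_basis_singletons:
  assumes "length l = n" "set l = {..<n}"
  shows "coord (prod_list (map (\<lambda>i. basis {i}) l)) {..<n} =
    (of_int (sign (\<lambda>i. if i < n then l ! i else i)) :: 'a::comm_ring_1)"
proof -
  define \<sigma> where "\<sigma> = (\<lambda>i. if i < n then l ! i else i)"
  have dl: "distinct l" using assms by (intro card_distinct) simp
  have "bij_betw \<sigma> {..<n} {..<n} = bij_betw ((!) l) {..<n} {..<n}"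
    by (rule bij_betw_cong) (simp add: \<sigma>_def)
  then have "bij_betw \<sigma> {..<n} {..<n}"
    using bij_betw_nth[OF dl _ assms(2)[symmetric], of "{..<n}"] assms(1) by simp
  then have \<sigma>: "\<sigma> permutes {..<n}" by (intro bij_imp_permutes) (auto simp: \<sigma>_def)
  let ?A = "mat n n (\<lambda>(a, b). if l ! b = a then 1 else (0 :: 'a))"
  define vs :: "'a ext list" where "vs = map (\<lambda>i. basis {i}) l"
  have vs: "v \<in> lambda_space n 1" if v: "v \<in> set vs" for v
  proof -
    obtain i where "i < n" "v = basis {i}" using v assms(2) by (auto simp: vs_def)
    then show ?thesis by (auto simp: msubsets_iff)
  qed
  have len: "length vs = n" using assms(1) by (simp add: vs_def)
  have "coord (prod_list vs) {..<n} = det (mat (length vs) (length vs) (\<lambda>(a, b). coord (vs ! b) {sorted_list_of_set {..<n} ! a}))"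
    by (rule coord_prod_list_det[OF vs]) (simp_all add: len)
  also have "mat (length vs) (length vs) (\<lambda>(a, b). coord (vs ! b) {sorted_list_of_set {..<n} ! a}) = ?A"
    unfolding len using assms(1) by (intro cong_mat refl) (simp add: coord_basis vs_def)
  also have "det ?A = (\<Sum>p | p permutes {0..<n}. signof p * (\<Prod>j<n. ?A $$ (p j, j)))"
    by (rule det_col) simp
  also have "\<dots> = (\<Sum>p | p permutes {0..<n}. if p = \<sigma> then signof p else 0)"
  proof (rule sum.cong[OF refl])
    fix p assume "p \<in> {p. p permutes {0..<n}}"
    then have p: "p permutes {..<n}" by (simp add: lessThan_atLeast0)
    then have pn: "p j < n" if "j < n" for j using permutes_in_image[OF p, of j] that by simp
    have "(\<Prod>j<n. ?A $$ (p j, j)) = (\<Prod>j<n. if l ! j = p j then 1 else 0)"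
      using pn by (intro prod.cong) auto
    also have "\<dots> = (if p = \<sigma> then 1 else 0)"
    proof (cases "p = \<sigma>")
      case False
      then obtain j where "p j \<noteq> \<sigma> j" by auto
      then have "j < n" using permutes_not_in[OF p, of j] by (auto simp: \<sigma>_def split: if_splits)
      then have "j \<in> {..<n}" "(if l ! j = p j then 1 else 0) = (0 :: 'a)" using \<open>p j \<noteq> \<sigma> j\<close> by (auto simp: \<sigma>_def)
      then have "(\<Prod>j<n. if l ! j = p j then 1 else 0) = (0 :: 'a)" by (intro prod_zero) blast+
      then show ?thesis using False by simp
    qed (simp add: \<sigma>_def)
    finally show "signof p * (\<Prod>j<n. ?A $$ (p j, j)) = (if p = \<sigma> then signof p else 0)" by simp
  qed
  also have "\<dots> = signof \<sigma>" using \<sigma> by (simp add: lessThan_atLeast0 finite_permutations)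
  finally show ?thesis unfolding vs_def \<sigma>_def .
qed

section \<open>The form as the top coefficient of a product\<close>

definition disj_list :: "'b set list \<Rightarrow> bool" where
  "disj_list Is \<longleftrightarrow> (\<forall>i<length Is. \<forall>j<length Is. i \<noteq> j \<longrightarrow> Is ! i \<inter> Is ! j = {})"

lemma disj_list_Cons: "disj_list (I # Is) \<longleftrightarrow> disj_list Is \<and> (\<forall>J\<in>set Is. I \<inter> J = {})"
proof
  assume d: "disj_list (I # Is)"
  have a: "Is ! i \<inter> Is ! j = {}" if "i < length Is" "j < length Is" "i \<noteq> j" for i j
    using d[unfolded disj_list_def, rule_format, of "Suc i" "Suc j"] that by simp
  have b: "I \<inter> Is ! j = {}" if "j < length Is" for j
    using d[unfolded disj_list_def, rule_format, of 0 "Suc j"] that by simp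
  show "disj_list Is \<and> (\<forall>J\<in>set Is. I \<inter> J = {})"
  proof (intro conjI ballI)
    show "disj_list Is" using a by (simp add: disj_list_def)
    fix J assume "J \<in> set Is"
    then obtain j where "j < length Is" "J = Is ! j" by (auto simp: in_set_conv_nth)
    then show "I \<inter> J = {}" using b by simp
  qed
next
  assume d: "disj_list Is \<and> (\<forall>J\<in>set Is. I \<inter> J = {})"
  then have I: "I \<inter> Is ! j = {}" "Is ! j \<inter> I = {}" if "j < length Is" for j using that nth_mem by blast+
  show "disj_list (I # Is)" unfolding disj_list_def
  proof (intro allI impI)
    fix i j assume "i < length (I # Is)" "j < length (I # Is)" "i \<noteq> j"
    then show "(I # Is) ! i \<inter> (I # Is) ! j = {}"
      using d I by (cases i; cases j) (auto simp: disj_list_def)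
  qed
qed

lemma prod_list_basis:
  assumes "\<And>I. I \<in> set Is \<Longrightarrow> finite I"
  shows "\<exists>s. s * s = 1 \<and> prod_list (map basis Is) = (if disj_list Is then sc s (basis (\<Union> (set Is))) else (0 :: 'a::comm_ring_1 ext))"
  using assms
proof (induction Is)
  case Nil
  show ?case by (intro exI[of _ 1]) (simp add: disj_list_def one_ext_def)
next
  case (Cons I Is)
  then obtain s :: 'a where s: "s * s = 1" "prod_list (map basis Is) = (if disj_list Is then sc s (basis (\<Union> (set Is))) else 0)"
    by auto
  have fin: "finite I" "finite (\<Union> (set Is))" using Cons.prems by auto
  have "(\<forall>J\<in>set Is. I \<inter> J = {}) \<longleftrightarrow> I \<inter> \<Union> (set Is) = {}" by auto
  then show ?case using s fin
    by (intro exI[of _ "s * sg I (\<Union> (set Is))"]) (auto simp: disj_list_Cons basis_mult sc_mult_right mult_ac)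
qed

lemma prod_list_lincomb:
  assumes "finite S"
  shows "prod_list (map (\<lambda>x. \<Sum>I\<in>S. sc (c x I) (b I)) xs) =
    (\<Sum>Is | set Is \<subseteq> S \<and> length Is = length xs. sc (\<Prod>j<length xs. c (xs ! j) (Is ! j)) (prod_list (map b Is) :: 'a::comm_ring_1 ext))"
proof (induction xs)
  case Nil
  have "{Is. set Is \<subseteq> S \<and> length Is = length ([] :: 'c list)} = {[]}" by auto
  then show ?case by simp
next
  case (Cons x xs)
  let ?L = "{Is. set Is \<subseteq> S \<and> length Is = length xs}"
  have fin: "finite ?L" using assms by (rule finite_lists_length_eq)
  have "prod_list (map (\<lambda>x. \<Sum>I\<in>S. sc (c x I) (b I)) (x # xs)) =
     (\<Sum>I\<in>S. sc (c x I) (b I)) * (\<Sum>Is\<in>?L. sc (\<Prod>j<length xs. c (xs ! j) (Is ! j)) (prod_list (map b Is)))"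
    using Cons.IH by simp
  also have "\<dots> = (\<Sum>Is\<in>?L. \<Sum>I\<in>S. sc ((\<Prod>j<length xs. c (xs ! j) (Is ! j)) * c x I) (b I * prod_list (map b Is)))"
    by (simp add: sum_distrib_left sum_distrib_right sc_mult_left sc_mult_right sc_sum mult.commute)
  also have "\<dots> = (\<Sum>(Is, I)\<in>?L \<times> S. sc ((\<Prod>j<length xs. c (xs ! j) (Is ! j)) * c x I) (b I * prod_list (map b Is)))"
    by (simp add: sum.cartesian_product)
  also have "\<dots> = (\<Sum>Is\<in>(\<lambda>(xs, n). n # xs) ` (?L \<times> S). sc (\<Prod>j<Suc (length xs). c ((x # xs) ! j) (Is ! j)) (prod_list (map b Is)))"
  proof -
    have inj: "inj_on (\<lambda>(xs, n). n # xs) (?L \<times> S)" by (auto simp: inj_on_def)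
    show ?thesis unfolding sum.reindex[OF inj]
      by (intro sum.cong) (auto simp: prod.lessThan_Suc_shift mult.commute simp del: prod.lessThan_Suc)
  qed
  also have "(\<lambda>(xs, n). n # xs) ` (?L \<times> S) = {Is. set Is \<subseteq> S \<and> length Is = length (x # xs)}"
    using lists_length_Suc_eq[of S "length xs"] by simp
  finally show ?case by simp
qed

text \<open>Expanding the product of the vectors gives all tuples of m-sets. Tuples that overlap or
  do not exhaust the indices contribute nothing at the top coordinate; an ordered partition
  contributes the sign of the concatenation of its sorted blocks.\<close>

lemma ext_form_eq:
  assumes "length xs = n div m" and "m dvd n"
  shows "ext_form n m xs = coord (prod_list (map (of_vec n m) xs)) {..<(n :: nat)}"
proof -
  let ?L = "{Is. set Is \<subseteq> msubsets n m \<and> length Is = length xs}"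
  have fin: "finite ?L" by (rule finite_lists_length_eq) simp
  have sub: "ordered_partitions n m \<subseteq> ?L" using assms by (auto simp: ordered_partitions_def)
  have "coord (prod_list (map (of_vec n m) xs)) {..<n} =
     (\<Sum>Is\<in>?L. (\<Prod>j<length xs. (xs ! j) $ idx n m (Is ! j)) * coord (prod_list (map basis Is)) {..<n})"
    unfolding of_vec_def prod_list_lincomb[OF finite_msubsets] coord_sum by simp
  also have "\<dots> = (\<Sum>Is\<in>ordered_partitions n m. (\<Prod>j<length xs. (xs ! j) $ idx n m (Is ! j)) * coord (prod_list (map basis Is)) {..<n})"
  proof (rule sum.mono_neutral_right[OF fin sub], rule ballI)
    fix Is assume Is: "Is \<in> ?L - ordered_partitions n m"
    then have finI: "\<And>I. I \<in> set Is \<Longrightarrow> finite I" by (auto simp: msubsets_iff)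
    obtain s :: 'a where s: "prod_list (map basis Is) = (if disj_list Is then sc s (basis (\<Union> (set Is))) else 0)"
      using prod_list_basis[OF finI, where 'a = 'a] by blast
    have "\<not> (disj_list Is \<and> \<Union> (set Is) = {..<n})"
      using Is assms by (auto simp: ordered_partitions_def disj_list_def)
    then have "coord (prod_list (map basis Is)) {..<n} = (0 :: 'a)"
      unfolding s using finI by (auto simp: coord_basis)
    then show "(\<Prod>j<length xs. (xs ! j) $ idx n m (Is ! j)) * coord (prod_list (map basis Is)) {..<n} = 0" by simp
  qed
  also have "\<dots> = (\<Sum>Is\<in>ordered_partitions n m. of_int (partition_sign n Is) * (\<Prod>j<n div m. (xs ! j) $ idx n m (Is ! j)))"
  proof (rule sum.cong[OF refl])
    fix Is assume Is: "Is \<in> ordered_partitions n m"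
    let ?l = "concat (map sorted_list_of_set Is)"
    have mem: "I \<in> msubsets n m" if "I \<in> set Is" for I using Is that by (auto simp: ordered_partitions_def)
    have finI: "finite I" "card I = m" if "I \<in> set Is" for I using mem[OF that] by (auto simp: msubsets_iff)
    have "length ?l = (\<Sum>I\<leftarrow>Is. card I)" by (simp add: length_concat o_def)
    also have "\<dots> = (\<Sum>I\<leftarrow>Is. m)" using finI by (intro arg_cong[where f = sum_list] map_cong) auto
    also have "\<dots> = n" using Is assms by (simp add: ordered_partitions_def sum_list_triv)
    finally have len: "length ?l = n" .
    have set: "set ?l = {..<n}" using Is finI by (auto simp: ordered_partitions_def)
    have "prod_list (map basis Is) = prod_list (map (\<lambda>i. basis {i} :: 'a ext) ?l)"
    proof -
      have "prod_list (map (\<lambda>i. basis {i} :: 'a ext) (concat (map sorted_list_of_set Js))) = prod_list (map basis Js)"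
        if "\<And>I. I \<in> set Js \<Longrightarrow> finite I" for Js
        using that
      proof (induction Js)
        case (Cons J Js)
        then show ?case using oprod_basis[of J, where 'a = 'a] by (simp add: oprod_def)
      qed simp
      from this[of Is] show ?thesis using finI by simp
    qed
    then have "coord (prod_list (map basis Is)) {..<n} = (of_int (partition_sign n Is) :: 'a)"
      using prod_list_basis_singletons[OF len set, where 'a = 'a] by (simp add: partition_sign_def)
    then show "(\<Prod>j<length xs. (xs ! j) $ idx n m (Is ! j)) * coord (prod_list (map basis Is)) {..<n} =
       of_int (partition_sign n Is) * (\<Prod>j<n div m. (xs ! j) $ idx n m (Is ! j))"
      using assms(1) by (simp add: mult.commute)
  qed
  finally show ?thesis by (simp add: ext_form_def)
qed

section \<open>Matrices as operators on the degree-m part\<close>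

definition mat_op :: "nat \<Rightarrow> nat \<Rightarrow> 'a::comm_ring_1 mat \<Rightarrow> 'a ext \<Rightarrow> 'a ext" where
  "mat_op n m g x = (\<Sum>J\<in>msubsets n m. sc (coord x J) (of_vec n m (col g (idx n m J))))"

lemma mat_op_in: "mat_op n m g x \<in> lambda_space n m"
  unfolding mat_op_def by (intro lambda_space_sum lambda_space_sc of_vec_in)

lemma lin_mat_op: "lin (mat_op n m g)"
  by (simp add: lin_def mat_op_def sc_add sum.distrib sc_sum)

lemma mat_op_basis: "J \<in> msubsets n m \<Longrightarrow> mat_op n m g (basis J) = of_vec n m (col g (idx n m J))"
proof -
  assume J: "J \<in> msubsets n m"
  then have "mat_op n m g (basis J) = (\<Sum>I\<in>{J}. sc (coord (basis J) I) (of_vec n m (col g (idx n m I))))"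
    unfolding mat_op_def by (intro sum.mono_neutral_right) (auto simp: coord_basis msubsets_iff)
  then show ?thesis using J by (simp add: coord_basis msubsets_iff)
qed

lemma bij_betw_idx: "bij_betw (idx n m) (msubsets n m) {..<n choose m}"
  by (rule bij_betw_byWitness[where f' = "(!) (msubset_list n m)"])
    (auto simp: msubset_list_idx idx_msubset_list idx_less msubset_list_mem)

lemma mat_op_of_vec:
  assumes "g \<in> carrier_mat (n choose m) (n choose m)" "v \<in> carrier_vec (n choose m)"
  shows "mat_op n m g (of_vec n m v) = of_vec n m (g *\<^sub>v v)"
proof (rule ext_eq_lambdaI[OF mat_op_in of_vec_in])
  fix I assume I: "I \<in> msubsets n m"
  have "coord (mat_op n m g (of_vec n m v)) I = (\<Sum>J\<in>msubsets n m. v $ idx n m J * g $$ (idx n m I, idx n m J))"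
    unfolding mat_op_def coord_sum using I assms by (intro sum.cong) (auto simp: coord_of_vec idx_less)
  also have "\<dots> = (\<Sum>j<n choose m. v $ j * g $$ (idx n m I, j))"
    by (rule sum.reindex_bij_betw[OF bij_betw_idx])
  also have "\<dots> = (g *\<^sub>v v) $ idx n m I"
    using I assms by (simp add: scalar_prod_def idx_less lessThan_atLeast0 mult.commute)
  finally show "coord (mat_op n m g (of_vec n m v)) I = coord (of_vec n m (g *\<^sub>v v)) I" using I by (simp add: coord_of_vec)
qed

lemma mat_op_mult:
  assumes "g \<in> carrier_mat (n choose m) (n choose m)" "h \<in> carrier_mat (n choose m) (n choose m)" "x \<in> lambda_space n m"
  shows "mat_op n m g (mat_op n m h x) = mat_op n m (g * h) x"
proof -
  have x: "x = of_vec n m (to_vec n m x)" using of_to_vec[OF assms(3)] by simp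
  show ?thesis
    by (subst (1 2) x) (use assms(1,2) to_vec_carrier[of n m x] in \<open>simp add: mat_op_of_vec assoc_mult_mat_vec\<close>)
qed

lemma mat_op_one: "x \<in> lambda_space n m \<Longrightarrow> mat_op n m (1\<^sub>m (n choose m)) x = x"
  using mat_op_of_vec[of "1\<^sub>m (n choose m)" n m "to_vec n m x"] to_vec_carrier[of n m x] by (simp add: of_to_vec)

lemma GL_iff: "g \<in> carrier (GL N) \<longleftrightarrow>
    g \<in> carrier_mat N N \<and> (\<exists>h\<in>carrier_mat N N. g * h = 1\<^sub>m N \<and> h * g = (1\<^sub>m N :: 'a::comm_ring_1 mat))"
  by (auto simp: GL_def units_of_def Units_def ring_mat_simps)

lemma mat_op_form:
  assumes "g \<in> carrier_mat (n choose m) (n choose m)" "length xs = n div m" "m dvd n" "set xs \<subseteq> carrier_vec (n choose m)"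
  shows "ext_form n m (map (\<lambda>x. g *\<^sub>v x) xs) = coord (prod_list (map (mat_op n m g) (map (of_vec n m) xs))) {..<n}"
proof -
  have eq: "map (of_vec n m) (map (\<lambda>x. g *\<^sub>v x) xs) = map (mat_op n m g) (map (of_vec n m) xs)"
    using assms(1,4) by (auto simp: mat_op_of_vec)
  show ?thesis unfolding eq[symmetric] by (rule ext_form_eq) (simp_all add: assms)
qed

lemma form_similitudes_similitude:
  assumes "m dvd n" "g \<in> form_similitudes n m"
  obtains h where "similitude n m (mat_op n m g) (mat_op n m h)"
proof -
  let ?N = "n choose m"
  obtain h where g: "g \<in> carrier_mat ?N ?N" and h: "h \<in> carrier_mat ?N ?N" "g * h = 1\<^sub>m ?N" "h * g = 1\<^sub>m ?N"
    using assms(2) by (auto simp: form_similitudes_def GL_iff)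
  obtain c where c: "c dvd 1" "\<And>xs. length xs = n div m \<Longrightarrow> set xs \<subseteq> carrier_vec ?N \<Longrightarrow>
     ext_form n m (map (\<lambda>x. g *\<^sub>v x) xs) = c * ext_form n m xs"
    using assms(2) by (auto simp: form_similitudes_def)
  have "coord (prod_list (map (mat_op n m g) xs)) {..<n} = c * coord (prod_list xs) {..<n}"
    if xs: "length xs = n div m" "set xs \<subseteq> lambda_space n m" for xs
  proof -
    let ?vs = "map (to_vec n m) xs"
    have m: "map (of_vec n m) ?vs = xs" using xs(2) by (auto simp: of_to_vec intro!: map_idI)
    have vs: "set ?vs \<subseteq> carrier_vec ?N" "length ?vs = n div m" using xs by (auto simp: to_vec_carrier)
    from c(2)[OF vs(2,1)] mat_op_form[OF g vs(2) assms(1) vs(1)] ext_form_eq[OF vs(2) assms(1)]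
    show ?thesis unfolding m by simp
  qed
  then have "similitude n m (mat_op n m g) (mat_op n m h)"
    unfolding similitude_def using c(1) g h by (auto simp: lin_mat_op mat_op_in mat_op_mult mat_op_one)
  then show thesis by (rule that)
qed

text \<open>On both sides the coordinate at I is the minor of A with rows I and columns J.\<close>

lemma wedge_eq:
  assumes A: "A \<in> carrier_mat n n" and J: "J \<in> msubsets n m"
  shows "of_vec n m (wedge n m (map (\<lambda>j. A *\<^sub>v unit_vec n j) (sorted_list_of_set J))) = Lam A (basis J)"
proof (rule ext_eq_lambdaI[OF of_vec_in])
  have Jf: "finite J" "J \<subseteq> {..<n}" "card J = m" using J by (auto simp: msubsets_iff)
  have dimA: "dim_row A = n" using A by simp
  have Jn: "sorted_list_of_set J ! b < n" if "b < m" for b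
    using Jf that nth_mem[of b "sorted_list_of_set J"] by auto
  show "Lam A (basis J) \<in> lambda_space n m" using Lam_in[of "basis J" A m] J A by auto
  fix I assume I: "I \<in> msubsets n m"
  then have If: "finite I" "I \<subseteq> {..<n}" "card I = m" by (auto simp: msubsets_iff)
  have In: "sorted_list_of_set I ! b < n" if "b < m" for b
    using If that nth_mem[of b "sorted_list_of_set I"] by auto
  have "coord (Lam A (basis J)) I = coord (prod_list (map (cvec A) (sorted_list_of_set J))) I"
    using Jf dimA by (simp add: Lam_basis oprod_def)
  also have "\<dots> = det (mat m m (\<lambda>(a, b). coord (map (cvec A) (sorted_list_of_set J) ! b) {sorted_list_of_set I ! a}))"
    using Jf If cvec_in[of A] dimA by (subst coord_prod_list_det[where n = n]) auto
  also have "mat m m (\<lambda>(a, b). coord (map (cvec A) (sorted_list_of_set J) ! b) {sorted_list_of_set I ! a}) =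
     mat m m (\<lambda>(a, b). (map (\<lambda>j. A *\<^sub>v unit_vec n j) (sorted_list_of_set J) ! b) $ (sorted_list_of_set (msubset_list n m ! idx n m I) ! a))"
  proof (rule cong_mat[OF refl refl])
    fix a b assume ab: "a < m" "b < m"
    have "coord (cvec A (sorted_list_of_set J ! b)) {sorted_list_of_set I ! a} = A $$ (sorted_list_of_set I ! a, sorted_list_of_set J ! b)"
      using In[OF ab(1)] dimA by (simp add: coord_cvec)
    also have "\<dots> = (A *\<^sub>v unit_vec n (sorted_list_of_set J ! b)) $ (sorted_list_of_set I ! a)"
      using In[OF ab(1)] Jn[OF ab(2)] A by (simp add: scalar_prod_right_unit)
    finally show "(case (a, b) of (a, b) \<Rightarrow> coord (map (cvec A) (sorted_list_of_set J) ! b) {sorted_list_of_set I ! a}) =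
       (case (a, b) of (a, b) \<Rightarrow> (map (\<lambda>j. A *\<^sub>v unit_vec n j) (sorted_list_of_set J) ! b) $ (sorted_list_of_set (msubset_list n m ! idx n m I) ! a))"
      using ab Jf I by (simp add: msubset_list_idx)
  qed
  finally show "coord (of_vec n m (wedge n m (map (\<lambda>j. A *\<^sub>v unit_vec n j) (sorted_list_of_set J)))) I = coord (Lam A (basis J)) I"
    using I by (simp add: coord_of_vec wedge_def idx_less)
qed

lemma ext_power_carrier: "ext_power n m A \<in> carrier_mat (n choose m) (n choose m)"
  by (simp add: ext_power_def length_msubset_list carrier_matI)

lemma col_ext_power:
  assumes "J \<in> msubsets n m"
  shows "col (ext_power n m A) (idx n m J) = wedge n m (map (\<lambda>j. A *\<^sub>v unit_vec n j) (sorted_list_of_set J))"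
proof -
  have "idx n m J < length (map (\<lambda>J. wedge n m (map (\<lambda>j. A *\<^sub>v unit_vec n j) (sorted_list_of_set J))) (msubset_list n m))"
    using assms by (simp add: length_msubset_list idx_less)
  then show ?thesis unfolding ext_power_def using assms
    by (subst col_mat_of_cols) (auto simp: msubset_list_idx length_msubset_list idx_less wedge_def)
qed

lemma mat_op_ext_power:
  assumes A: "A \<in> carrier_mat n n" and x: "x \<in> lambda_space n m"
  shows "mat_op n m (ext_power n m A) x = Lam A x"
proof -
  have "mat_op n m (ext_power n m A) x = (\<Sum>J\<in>msubsets n m. sc (coord x J) (Lam A (basis J)))"
    unfolding mat_op_def by (intro sum.cong refl) (simp only: col_ext_power wedge_eq[OF A])
  also have "\<dots> = Lam A (\<Sum>J\<in>msubsets n m. sc (coord x J) (basis J))" by (simp add: Lam_sum Lam_sc)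
  also have "\<dots> = Lam A x" using lambda_space_expand[OF x] by simp
  finally show ?thesis .
qed

lemma mat_op_inject:
  assumes g: "g \<in> carrier_mat (n choose m) (n choose m)" "h \<in> carrier_mat (n choose m) (n choose m)"
    and eq: "\<And>x. x \<in> lambda_space n m \<Longrightarrow> mat_op n m g x = mat_op n m h x"
  shows "g = h"
proof (rule eq_matI)
  fix i j assume "i < dim_row h" "j < dim_col h"
  then have ij: "i < n choose m" "j < n choose m" using g by auto
  let ?I = "msubset_list n m ! i" and ?J = "msubset_list n m ! j"
  have IJ: "?I \<in> msubsets n m" "?J \<in> msubsets n m" using ij msubset_list_mem by auto
  have "coord (mat_op n m g (basis ?J)) ?I = coord (mat_op n m h (basis ?J)) ?I"
    using eq[OF basis_in_lambda_space[OF IJ(2)]] by simp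
  then show "g $$ (i, j) = h $$ (i, j)" using IJ ij g by (simp add: mat_op_basis coord_of_vec idx_msubset_list)
qed (use g in auto)

lemma ext_power_mult:
  assumes "A \<in> carrier_mat n n" "B \<in> carrier_mat n n"
  shows "ext_power n m (A * B) = ext_power n m A * (ext_power n m B :: 'a::comm_ring_1 mat)"
proof (rule mat_op_inject)
  fix x :: "'a ext" assume x: "x \<in> lambda_space n m"
  have "mat_op n m (ext_power n m A * ext_power n m B) x = mat_op n m (ext_power n m A) (mat_op n m (ext_power n m B) x)"
    using x by (simp add: mat_op_mult ext_power_carrier)
  also have "\<dots> = Lam A (Lam B x)"
    using x assms by (subst mat_op_ext_power[OF assms(1) mat_op_in]) (simp add: mat_op_ext_power)
  also have "\<dots> = Lam (A * B) x" using assms by (rule Lam_mult)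
  also have "\<dots> = mat_op n m (ext_power n m (A * B)) x" using x assms by (simp add: mat_op_ext_power)
  finally show "mat_op n m (ext_power n m (A * B)) x = mat_op n m (ext_power n m A * ext_power n m B) x" by simp
qed (simp_all add: ext_power_carrier mult_carrier_mat[OF ext_power_carrier ext_power_carrier])

lemma local_form_similitude:
  assumes n: "n = k * m" "3 \<le> k" "1 \<le> m" and g: "(g :: 'a::local_ring mat) \<in> form_similitudes n m"
  shows "\<exists>u A. A \<in> carrier_mat n n \<and> g = u \<cdot>\<^sub>m ext_power n m A"
proof -
  interpret blocks n m k using n by unfold_locales
  have gc: "g \<in> carrier_mat (n choose m) (n choose m)" using g by (auto simp: form_similitudes_def GL_iff)
  obtain h where "similitude n m (mat_op n m g) (mat_op n m h)" using form_similitudes_similitude[OF m_dvd_n g] .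
  from local_similitudes[OF this] obtain u A where uA: "A \<in> carrier_mat n n"
    "\<And>x. x \<in> lambda_space n m \<Longrightarrow> mat_op n m g x = sc u (Lam A x)" by blast
  have "g = u \<cdot>\<^sub>m ext_power n m A"
  proof (rule mat_op_inject[OF gc])
    fix x :: "'a ext" assume x: "x \<in> lambda_space n m"
    have "mat_op n m (u \<cdot>\<^sub>m ext_power n m A) x = sc u (mat_op n m (ext_power n m A) x)"
    proof (rule ext_eq_lambdaI[OF mat_op_in lambda_space_sc[OF mat_op_in]])
      fix I assume I: "I \<in> msubsets n m"
      show "coord (mat_op n m (u \<cdot>\<^sub>m ext_power n m A) x) I = coord (sc u (mat_op n m (ext_power n m A) x)) I"
        unfolding mat_op_def using I ext_power_carrier[of n m A]
        by (simp add: coord_sum coord_of_vec sum_distrib_left idx_less mult_ac)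
    qed
    then show "mat_op n m g x = mat_op n m (u \<cdot>\<^sub>m ext_power n m A) x"
      using uA x by (simp add: mat_op_ext_power)
  qed (simp add: ext_power_carrier)
  then show ?thesis using uA(1) by blast
qed

section \<open>Integer polynomials in matrix entries\<close>

definition mono_at :: "('p \<Rightarrow> 'b::comm_ring_1) \<Rightarrow> ('p \<Rightarrow>\<^sub>0 nat) \<Rightarrow> 'b" where
  "mono_at a u = (\<Prod>p\<in>Poly_Mapping.keys u. a p ^ Poly_Mapping.lookup u p)"

text \<open>\<open>eval_at\<close> with an arbitrary map \<kappa> on the coefficients: the
  comultiplication needs polynomials whose coefficients are polynomials again.\<close>

definition poly_at :: "('c \<Rightarrow> 'b) \<Rightarrow> ('p \<Rightarrow> 'b) \<Rightarrow> (('p \<Rightarrow>\<^sub>0 nat) \<Rightarrow>\<^sub>0 'c::comm_ring_1) \<Rightarrow> 'b::comm_ring_1" where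
  "poly_at \<kappa> a P = (\<Sum>u\<in>Poly_Mapping.keys P. \<kappa> (Poly_Mapping.lookup P u) * mono_at a u)"

lemma mono_at_superset:
  "finite S \<Longrightarrow> Poly_Mapping.keys u \<subseteq> S \<Longrightarrow> mono_at a u = (\<Prod>p\<in>S. a p ^ Poly_Mapping.lookup u p)"
  unfolding mono_at_def by (rule prod.mono_neutral_left) (auto simp: in_keys_iff)

lemma mono_at_add: "mono_at a (u + v) = mono_at a u * mono_at a v"
proof -
  let ?S = "Poly_Mapping.keys u \<union> Poly_Mapping.keys v"
  have "mono_at a (u + v) = (\<Prod>p\<in>?S. a p ^ Poly_Mapping.lookup (u + v) p)"
    using keys_add[of u v] by (intro mono_at_superset) auto
  also have "\<dots> = (\<Prod>p\<in>?S. a p ^ Poly_Mapping.lookup u p) * (\<Prod>p\<in>?S. a p ^ Poly_Mapping.lookup v p)"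
    by (simp add: lookup_add power_add prod.distrib)
  also have "\<dots> = mono_at a u * mono_at a v"
    by (simp add: mono_at_superset[of ?S])
  finally show ?thesis .
qed

lemma mono_at_zero [simp]: "mono_at a 0 = 1"
  by (simp add: mono_at_def)

lemma mono_at_single [simp]: "mono_at a (Poly_Mapping.single p (Suc 0)) = a p"
  by (simp add: mono_at_def)

lemma poly_mapping_expand: "P = (\<Sum>u\<in>Poly_Mapping.keys P. Poly_Mapping.single u (Poly_Mapping.lookup P u))"
proof (rule poly_mapping_eqI)
  fix k
  have "Poly_Mapping.lookup (\<Sum>u\<in>Poly_Mapping.keys P. Poly_Mapping.single u (Poly_Mapping.lookup P u)) k =
     (\<Sum>u\<in>Poly_Mapping.keys P. if u = k then Poly_Mapping.lookup P k else 0)"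
    unfolding lookup_sum by (intro sum.cong) (auto simp: lookup_single)
  then show "Poly_Mapping.lookup P k = Poly_Mapping.lookup (\<Sum>u\<in>Poly_Mapping.keys P. Poly_Mapping.single u (Poly_Mapping.lookup P u)) k"
    by (simp add: in_keys_iff)
qed

lemma poly_at_single: "\<kappa> 0 = 0 \<Longrightarrow> poly_at \<kappa> a (Poly_Mapping.single u c) = \<kappa> c * mono_at a u"
  by (simp add: poly_at_def)

lemma poly_at_hom:
  fixes \<kappa> :: "'c::comm_ring_1 \<Rightarrow> 'b::comm_ring_1" and a :: "'p \<Rightarrow> 'b"
  assumes "comm_ring_hom \<kappa>"
  shows "comm_ring_hom (poly_at \<kappa> a)"
proof -
  interpret \<kappa>: comm_ring_hom \<kappa> by fact
  have add: "poly_at \<kappa> a (P + Q) = poly_at \<kappa> a P + poly_at \<kappa> a Q" for P Q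
    unfolding poly_at_def
    by (rule setsum_keys_plus_distrib[where f = "\<lambda>u c. \<kappa> c * mono_at a u"]) (auto simp: \<kappa>.hom_add distrib_right)
  have zero: "poly_at \<kappa> a 0 = 0" by (simp add: poly_at_def)
  have sum: "poly_at \<kappa> a (sum f S) = (\<Sum>s\<in>S. poly_at \<kappa> a (f s))" for f :: "('p \<Rightarrow>\<^sub>0 nat) \<Rightarrow> _" and S
    by (induction S rule: infinite_finite_induct) (auto simp: add zero)
  have sum2: "poly_at \<kappa> a (\<Sum>s\<in>S. \<Sum>t\<in>T. f s t) = (\<Sum>s\<in>S. \<Sum>t\<in>T. poly_at \<kappa> a (f s t))"
    for f :: "('p \<Rightarrow>\<^sub>0 nat) \<Rightarrow> ('p \<Rightarrow>\<^sub>0 nat) \<Rightarrow> _" and S T by (simp add: sum)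
  have mult: "poly_at \<kappa> a (P * Q) = poly_at \<kappa> a P * poly_at \<kappa> a Q" for P Q
  proof -
    have "P * Q = (\<Sum>u\<in>Poly_Mapping.keys P. Poly_Mapping.single u (Poly_Mapping.lookup P u)) *
        (\<Sum>v\<in>Poly_Mapping.keys Q. Poly_Mapping.single v (Poly_Mapping.lookup Q v))"
      using poly_mapping_expand[of P] poly_mapping_expand[of Q] by simp
    also have "\<dots> = (\<Sum>u\<in>Poly_Mapping.keys P. \<Sum>v\<in>Poly_Mapping.keys Q.
        Poly_Mapping.single (u + v) (Poly_Mapping.lookup P u * Poly_Mapping.lookup Q v))"
      unfolding sum_product by (simp add: mult_single)
    finally have "poly_at \<kappa> a (P * Q) = (\<Sum>u\<in>Poly_Mapping.keys P. \<Sum>v\<in>Poly_Mapping.keys Q.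
        \<kappa> (Poly_Mapping.lookup P u) * mono_at a u * (\<kappa> (Poly_Mapping.lookup Q v) * mono_at a v))"
      by (simp add: sum2 poly_at_single \<kappa>.hom_mult mono_at_add mult_ac)
    then show ?thesis unfolding poly_at_def sum_product .
  qed
  have "poly_at \<kappa> a 1 = 1" using poly_at_single[of \<kappa> a 0 1] by simp
  then show ?thesis using add mult zero by unfold_locales auto
qed

lemma hom_mono_at:
  assumes "comm_ring_hom \<phi>"
  shows "\<phi> (mono_at a u) = mono_at (\<lambda>p. \<phi> (a p)) u"
proof -
  interpret comm_ring_hom \<phi> by fact
  show ?thesis unfolding mono_at_def by (simp add: hom_prod hom_power)
qed

lemma hom_poly_at:
  assumes "comm_ring_hom \<phi>"
  shows "\<phi> (poly_at \<kappa> a P) = poly_at (\<lambda>c. \<phi> (\<kappa> c)) (\<lambda>p. \<phi> (a p)) P"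
proof -
  interpret comm_ring_hom \<phi> by fact
  show ?thesis unfolding poly_at_def by (simp add: hom_sum hom_mult hom_mono_at[OF assms])
qed

lemma eval_at_eq: "eval_at g F = poly_at of_int (\<lambda>p. g $$ p) F"
  by (simp add: eval_at_def poly_at_def mono_at_def)

lemma eval_at_comm_hom: "comm_ring_hom (eval_at g)"
  unfolding eval_at_eq[abs_def] by (rule poly_at_hom) unfold_locales

lemma mono_at_cong: "(\<And>p. p \<in> Poly_Mapping.keys u \<Longrightarrow> a p = b p) \<Longrightarrow> mono_at a u = mono_at b u"
  by (simp add: mono_at_def)

lemma poly_at_cong:
  assumes "F \<in> matrix_polys N" "\<And>p. p \<in> {..<N} \<times> {..<N} \<Longrightarrow> a p = b p"
  shows "poly_at \<kappa> a F = poly_at \<kappa> b F"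
  unfolding poly_at_def using assms by (intro sum.cong arg_cong2[where f = "(*)"] mono_at_cong refl) (auto simp: matrix_polys_def)

lemma hom_eval_at:
  assumes "comm_ring_hom \<phi>" "F \<in> matrix_polys N" "g \<in> carrier_mat N N"
  shows "\<phi> (eval_at g F) = eval_at (map_mat \<phi> g) F"
proof -
  interpret comm_ring_hom \<phi> by fact
  have "\<phi> (eval_at g F) = poly_at of_int (\<lambda>p. \<phi> (g $$ p)) F"
    unfolding eval_at_eq hom_poly_at[OF assms(1)] by (simp add: hom_of_int)
  also have "\<dots> = eval_at (map_mat \<phi> g) F"
    unfolding eval_at_eq using assms(3) by (intro poly_at_cong[OF assms(2)]) auto
  finally show ?thesis .
qed

section \<open>Specialization of the generic matrix and of its exterior power\<close>

lemma generic_mat_carrier [simp]: "generic_mat n \<in> carrier_mat n n"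
  by (simp add: generic_mat_def)

lemma map_generic_mat: "h \<in> carrier_mat n n \<Longrightarrow> map_mat (eval_at h) (generic_mat n) = h"
  by (rule eq_matI) (auto simp: generic_mat_def eval_at_eq poly_at_single)

lemma ext_power_entry:
  assumes A: "A \<in> carrier_mat n n" and ij: "i < n choose m" "j < n choose m"
  shows "ext_power n m A $$ (i, j) = det (mat m m (\<lambda>(a, b).
     A $$ (sorted_list_of_set (msubset_list n m ! i) ! a, sorted_list_of_set (msubset_list n m ! j) ! b)))"
proof -
  let ?I = "msubset_list n m ! i" and ?J = "msubset_list n m ! j"
  have sub: "sorted_list_of_set K ! a < n" if "K \<in> msubsets n m" "a < m" for K a
    using that nth_mem[of a "sorted_list_of_set K"] by (auto simp: msubsets_iff)
  have len: "length (sorted_list_of_set K) = m" if "K \<in> msubsets n m" for K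
    using that by (auto simp: msubsets_iff)
  note IJ = msubset_list_mem[OF ij(1)] msubset_list_mem[OF ij(2)]
  have "ext_power n m A $$ (i, j) = col (ext_power n m A) (idx n m ?J) $ i"
    using ij ext_power_carrier[of n m A] by (simp add: idx_msubset_list)
  also have "\<dots> = wedge n m (map (\<lambda>j. A *\<^sub>v unit_vec n j) (sorted_list_of_set ?J)) $ i"
    by (simp only: col_ext_power[OF IJ(2)])
  also have "\<dots> = det (mat m m (\<lambda>(a, b). (map (\<lambda>j. A *\<^sub>v unit_vec n j) (sorted_list_of_set ?J) ! b) $ (sorted_list_of_set ?I ! a)))"
    using ij by (simp add: wedge_def)
  also have "mat m m (\<lambda>(a, b). (map (\<lambda>j. A *\<^sub>v unit_vec n j) (sorted_list_of_set ?J) ! b) $ (sorted_list_of_set ?I ! a)) =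
     mat m m (\<lambda>(a, b). A $$ (sorted_list_of_set ?I ! a, sorted_list_of_set ?J ! b))"
    using A sub[OF IJ(1)] sub[OF IJ(2)] len[OF IJ(2)] by (intro cong_mat refl) (simp add: scalar_prod_right_unit)
  finally show ?thesis .
qed

lemma hom_ext_power:
  assumes "comm_ring_hom \<phi>" and A: "A \<in> carrier_mat n n"
  shows "map_mat \<phi> (ext_power n m A) = ext_power n m (map_mat \<phi> A)"
proof -
  interpret comm_ring_hom \<phi> by fact
  note c = ext_power_carrier[of n m A] ext_power_carrier[of n m "map_mat \<phi> A"]
  show ?thesis
  proof (rule eq_matI)
    fix i j assume "i < dim_row (ext_power n m (map_mat \<phi> A))" "j < dim_col (ext_power n m (map_mat \<phi> A))"
    then have ij: "i < n choose m" "j < n choose m" using c by auto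
    have sub: "sorted_list_of_set K ! a < n" if "K \<in> msubsets n m" "a < m" for K a
      using that nth_mem[of a "sorted_list_of_set K"] by (auto simp: msubsets_iff)
    note IJ = msubset_list_mem[OF ij(1)] msubset_list_mem[OF ij(2)]
    let ?f = "\<lambda>B. mat m m (\<lambda>(a, b). B $$ (sorted_list_of_set (msubset_list n m ! i) ! a, sorted_list_of_set (msubset_list n m ! j) ! b))"
    have "map_mat \<phi> (ext_power n m A) $$ (i, j) = \<phi> (ext_power n m A $$ (i, j))" using ij c by simp
    also have "\<dots> = \<phi> (det (?f A))" unfolding ext_power_entry[OF A ij] ..
    also have "\<dots> = det (map_mat \<phi> (?f A))" by (rule hom_det[symmetric])
    also have "map_mat \<phi> (?f A) = ?f (map_mat \<phi> A)"
      using A sub[OF IJ(1)] sub[OF IJ(2)] by (intro eq_matI) auto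
    also have "det (?f (map_mat \<phi> A)) = ext_power n m (map_mat \<phi> A) $$ (i, j)"
      using A ij by (intro ext_power_entry[symmetric]) auto
    finally show "map_mat \<phi> (ext_power n m A) $$ (i, j) = ext_power n m (map_mat \<phi> A) $$ (i, j)" .
  qed (use c in auto)
qed

lemma ext_power_smult:
  assumes A: "A \<in> carrier_mat n n"
  shows "ext_power n m (t \<cdot>\<^sub>m A) = t ^ m \<cdot>\<^sub>m ext_power n m A"
proof (rule eq_matI)
  fix i j assume "i < dim_row (t ^ m \<cdot>\<^sub>m ext_power n m A)" "j < dim_col (t ^ m \<cdot>\<^sub>m ext_power n m A)"
  then have ij: "i < n choose m" "j < n choose m" using ext_power_carrier[of n m A] by auto
  have sub: "sorted_list_of_set K ! a < n" if "K \<in> msubsets n m" "a < m" for K a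
    using that nth_mem[of a "sorted_list_of_set K"] by (auto simp: msubsets_iff)
  note IJ = msubset_list_mem[OF ij(1)] msubset_list_mem[OF ij(2)]
  let ?f = "\<lambda>A. mat m m (\<lambda>(a, b). A $$ (sorted_list_of_set (msubset_list n m ! i) ! a, sorted_list_of_set (msubset_list n m ! j) ! b))"
  have "?f (t \<cdot>\<^sub>m A) = t \<cdot>\<^sub>m ?f A" using A sub[OF IJ(1)] sub[OF IJ(2)] by (intro eq_matI) auto
  then have "det (?f (t \<cdot>\<^sub>m A)) = t ^ m * det (?f A)" by simp
  then show "ext_power n m (t \<cdot>\<^sub>m A) $$ (i, j) = (t ^ m \<cdot>\<^sub>m ext_power n m A) $$ (i, j)"
    using A ij ext_power_carrier[of n m A] by (simp add: ext_power_entry)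
qed (use ext_power_carrier[of n m A] ext_power_carrier[of n m "t \<cdot>\<^sub>m A"] in auto)

text \<open>Every h is a specialization of the generic matrix, and determinants and exterior powers
  commute with ring homomorphisms.\<close>

lemma kernel_mult_zero:
  assumes F: "F \<in> comorphism_kernel n m" and h: "h \<in> carrier_mat n n"
  shows "\<exists>s. det h ^ s * eval_at (ext_power n m h) F = (0 :: 'a::comm_ring_1)"
proof -
  obtain s where s: "det (generic_mat n) ^ s * eval_at (ext_power n m (generic_mat n)) F = 0"
    and FN: "F \<in> matrix_polys (n choose m)" using F by (auto simp: comorphism_kernel_def)
  have hom: "comm_ring_hom (eval_at h)" by (rule eval_at_comm_hom)
  interpret comm_ring_hom "eval_at h" by (rule hom)
  have "eval_at h (det (generic_mat n) ^ s * eval_at (ext_power n m (generic_mat n)) F) =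
     det (map_mat (eval_at h) (generic_mat n)) ^ s * eval_at (ext_power n m (map_mat (eval_at h) (generic_mat n))) F"
    using hom_eval_at[OF hom FN ext_power_carrier] hom_ext_power[OF hom generic_mat_carrier]
    by (simp add: hom_mult hom_power)
  then show ?thesis using s h by (auto simp: map_generic_mat)
qed

lemma monic_mult_eq_0:
  assumes "coeff p (degree p) = (1 :: 'a::comm_ring_1)" "p * q = 0"
  shows "q = 0"
  using coeff_mult_degree_sum[of p q] assms by simp

text \<open>To cancel the power of det h, the matrix is deformed to X + h over the polynomial ring.
  Its determinant is the characteristic polynomial of -h, which is monic and so not a zero divisor;
  setting X = 0 gives h back.\<close>

lemma kernel_zero:
  assumes F: "F \<in> comorphism_kernel n m" and h: "h \<in> carrier_mat n n"
  shows "eval_at (ext_power n m h) F = (0 :: 'a::comm_ring_1)"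
proof -
  let ?H = "char_poly_matrix (- h)"
  have H: "?H \<in> carrier_mat n n" using h by simp
  have FN: "F \<in> matrix_polys (n choose m)" using F by (auto simp: comorphism_kernel_def)
  obtain s where s: "det ?H ^ s * eval_at (ext_power n m ?H) F = 0" using kernel_mult_zero[OF F H] by blast
  have mon: "coeff (det ?H) (degree (det ?H)) = 1"
    using degree_monic_char_poly[of "- h" n] h by (simp add: char_poly_def)
  have "q = 0" if "det ?H ^ s * q = 0" for q s
    using that by (induction s) (auto simp: mult.assoc dest: monic_mult_eq_0[OF mon])
  from this[OF s] have z: "eval_at (ext_power n m ?H) F = 0" .
  have hom: "comm_ring_hom (\<lambda>p :: 'a poly. poly p 0)" by unfold_locales auto
  have "map_mat (\<lambda>p. poly p 0) ?H = h"
    using h by (intro eq_matI) (auto simp: char_poly_matrix_def)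
  then have "eval_at (ext_power n m h) F = poly (eval_at (ext_power n m ?H) F) 0"
    using hom_eval_at[OF hom FN ext_power_carrier] hom_ext_power[OF hom H] by metis
  then show ?thesis using z by simp
qed

section \<open>Homogeneous components of kernel polynomials\<close>

definition mdeg :: "('p \<Rightarrow>\<^sub>0 nat) \<Rightarrow> nat" where
  "mdeg u = (\<Sum>p\<in>Poly_Mapping.keys u. Poly_Mapping.lookup u p)"

lemma mono_at_smult:
  "mono_at (\<lambda>p. t * a p) u = t ^ mdeg u * mono_at a u"
  by (simp add: mono_at_def mdeg_def power_mult_distrib prod.distrib power_sum)

text \<open>Replacing h by T h over the polynomial ring multiplies the exterior power by T^m, so the
  component of degree d contributes only to the coefficient of T^(m d); as m >= 1, different degrees
  give different exponents.\<close>

lemma kernel_homogeneous_zero: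
  assumes F: "F \<in> comorphism_kernel n m" and m: "1 \<le> m" and h: "h \<in> carrier_mat n n"
  shows "(\<Sum>u | u \<in> Poly_Mapping.keys F \<and> mdeg u = d. of_int (Poly_Mapping.lookup F u) * mono_at (\<lambda>p. ext_power n m h $$ p) u) = (0 :: 'a::comm_ring_1)"
proof -
  let ?T = "[:0, 1:] :: 'a poly" and ?E = "ext_power n m h"
  have hom: "comm_ring_hom (\<lambda>x :: 'a. [:x:])" by unfold_locales (auto simp: one_pCons)
  have FN: "F \<in> matrix_polys (n choose m)" using F by (auto simp: comorphism_kernel_def)
  let ?h = "?T \<cdot>\<^sub>m map_mat (\<lambda>x. [:x:]) h"
  have "eval_at (ext_power n m ?h) F = 0" using h by (intro kernel_zero[OF F]) simp
  also have "ext_power n m ?h = ?T ^ m \<cdot>\<^sub>m map_mat (\<lambda>x. [:x:]) ?E"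
    using h hom_ext_power[OF hom h, of m] by (simp add: ext_power_smult)
  also have "eval_at \<dots> F = poly_at of_int (\<lambda>p. ?T ^ m * [:?E $$ p:]) F"
    unfolding eval_at_eq using ext_power_carrier[of n m h] by (intro poly_at_cong[OF FN]) auto
  also have "\<dots> = (\<Sum>u\<in>Poly_Mapping.keys F. monom (of_int (Poly_Mapping.lookup F u) * mono_at (\<lambda>p. ?E $$ p) u) (m * mdeg u))"
    unfolding poly_at_def
  proof (rule sum.cong[OF refl])
    fix u
    have T: "?T ^ j = monom 1 j" for j by (simp add: monom_altdef)
    have c: "of_int c * (monom 1 j * [:x:]) = monom (of_int c * x) j" for c j and x :: 'a
      unfolding of_int_poly monom_0[symmetric] mult_monom by simp
    have "of_int c * mono_at (\<lambda>p. ?T ^ m * [:?E $$ p:]) u = monom (of_int c * mono_at (\<lambda>p. ?E $$ p) u) (m * mdeg u)" for c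
      unfolding mono_at_smult hom_mono_at[OF hom, symmetric] T monom_power power_one by (rule c)
    then show "of_int (Poly_Mapping.lookup F u) * mono_at (\<lambda>p. ?T ^ m * [:?E $$ p:]) u =
       monom (of_int (Poly_Mapping.lookup F u) * mono_at (\<lambda>p. ?E $$ p) u) (m * mdeg u)" .
  qed
  finally have "coeff (\<Sum>u\<in>Poly_Mapping.keys F. monom (of_int (Poly_Mapping.lookup F u) * mono_at (\<lambda>p. ?E $$ p) u) (m * mdeg u)) (m * d) = 0"
    by simp
  then have "(\<Sum>u\<in>Poly_Mapping.keys F. if mdeg u = d then of_int (Poly_Mapping.lookup F u) * mono_at (\<lambda>p. ?E $$ p) u else 0) = 0"
    using m by (simp add: coeff_sum)
  then show ?thesis by (simp only: sum.inter_filter[OF finite_keys])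
qed

lemma sum_by_mdeg:
  fixes f :: "('p \<Rightarrow>\<^sub>0 nat) \<Rightarrow> 'a::comm_ring_1"
  assumes "finite S" "\<And>d. (\<Sum>u | u \<in> S \<and> mdeg u = d. f u) = 0"
  shows "(\<Sum>u\<in>S. c (mdeg u) * f u) = 0"
proof -
  have "(\<Sum>u\<in>S. c (mdeg u) * f u) = (\<Sum>d\<in>mdeg ` S. \<Sum>u | u \<in> S \<and> mdeg u = d. c (mdeg u) * f u)"
    using assms(1) by (rule sum.image_gen)
  also have "\<dots> = (\<Sum>d\<in>mdeg ` S. c d * (\<Sum>u | u \<in> S \<and> mdeg u = d. f u))"
    by (simp add: sum_distrib_left)
  finally show ?thesis using assms(2) by simp
qed

text \<open>Deals with the scalar left over in the local case: v need not be an m-th power, so it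
  cannot in general be absorbed into h.\<close>

lemma kernel_scaled_zero:
  assumes F: "F \<in> comorphism_kernel n m" and m: "1 \<le> m" and h: "h \<in> carrier_mat n n"
  shows "eval_at (v \<cdot>\<^sub>m ext_power n m h) F = (0 :: 'a::comm_ring_1)"
proof -
  have FN: "F \<in> matrix_polys (n choose m)" using F by (auto simp: comorphism_kernel_def)
  have "eval_at (v \<cdot>\<^sub>m ext_power n m h) F = poly_at of_int (\<lambda>p. v * ext_power n m h $$ p) F"
    unfolding eval_at_eq using ext_power_carrier[of n m h] by (intro poly_at_cong[OF FN]) auto
  also have "\<dots> = (\<Sum>u\<in>Poly_Mapping.keys F. v ^ mdeg u * (of_int (Poly_Mapping.lookup F u) * mono_at (\<lambda>p. ext_power n m h $$ p) u))"
    by (simp add: poly_at_def mono_at_smult mult_ac)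
  also have "\<dots> = 0"
    by (rule sum_by_mdeg[OF finite_keys kernel_homogeneous_zero[OF F m h]])
  finally show ?thesis .
qed

section \<open>The similitude condition as a system of polynomial equations\<close>

lemma matrix_polys_zero [simp]: "0 \<in> matrix_polys N"
  and matrix_polys_one [simp]: "1 \<in> matrix_polys N"
  by (simp_all add: matrix_polys_def)

lemma matrix_polys_add: "F \<in> matrix_polys N \<Longrightarrow> G \<in> matrix_polys N \<Longrightarrow> F + G \<in> matrix_polys N"
  using keys_add[of F G] by (auto simp: matrix_polys_def dest!: subsetD)

lemma matrix_polys_uminus: "F \<in> matrix_polys N \<Longrightarrow> - F \<in> matrix_polys N"
  by (simp add: matrix_polys_def)

lemma matrix_polys_diff: "F \<in> matrix_polys N \<Longrightarrow> G \<in> matrix_polys N \<Longrightarrow> F - G \<in> matrix_polys N"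
  using matrix_polys_add[of F N "- G"] matrix_polys_uminus[of G N] by simp

lemma matrix_polys_mult:
  assumes "F \<in> matrix_polys N" "G \<in> matrix_polys N"
  shows "F * G \<in> matrix_polys N"
  unfolding matrix_polys_def
proof (intro CollectI ballI)
  fix u assume "u \<in> Poly_Mapping.keys (F * G)"
  then obtain a b where ab: "u = a + b" "a \<in> Poly_Mapping.keys F" "b \<in> Poly_Mapping.keys G"
    using keys_mult[of F G] by blast
  then show "Poly_Mapping.keys u \<subseteq> {..<N} \<times> {..<N}"
    using assms keys_add[of a b] unfolding matrix_polys_def by blast
qed

lemma matrix_polys_sum: "(\<And>x. x \<in> S \<Longrightarrow> f x \<in> matrix_polys N) \<Longrightarrow> sum f S \<in> matrix_polys N"
  by (induction S rule: infinite_finite_induct) (auto intro: matrix_polys_add)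

lemma matrix_polys_prod: "(\<And>x. x \<in> S \<Longrightarrow> f x \<in> matrix_polys N) \<Longrightarrow> prod f S \<in> matrix_polys N"
  by (induction S rule: infinite_finite_induct) (auto intro: matrix_polys_mult)

lemma matrix_polys_power: "F \<in> matrix_polys N \<Longrightarrow> F ^ k \<in> matrix_polys N"
  by (induction k) (auto intro: matrix_polys_mult)

lemma matrix_polys_of_int: "of_int c \<in> matrix_polys N"
proof -
  have "of_nat k \<in> matrix_polys N" for k by (induction k) (auto intro: matrix_polys_add)
  then show ?thesis by (cases c) (auto intro!: matrix_polys_uminus matrix_polys_diff)
qed

lemma matrix_polys_generic: "i < N \<Longrightarrow> j < N \<Longrightarrow> generic_mat N $$ (i, j) \<in> matrix_polys N"
  by (simp add: generic_mat_def matrix_polys_def)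

lemma ordered_partitions_mem:
  assumes "Is \<in> ordered_partitions n m" "j < n div m"
  shows "Is ! j \<in> msubsets n m"
  using assms nth_mem[of j Is] by (auto simp: ordered_partitions_def)

lemma hom_ext_form:
  assumes "comm_ring_hom \<phi>" "length xs = n div m" "set xs \<subseteq> carrier_vec (n choose m)"
  shows "\<phi> (ext_form n m xs) = ext_form n m (map (map_vec \<phi>) xs)"
proof -
  interpret comm_ring_hom \<phi> by fact
  have dim: "dim_vec (xs ! j) = n choose m" if "j < n div m" for j
  proof -
    have "xs ! j \<in> set xs" using that assms(2) by simp
    then have "xs ! j \<in> carrier_vec (n choose m)" using assms(3) by blast
    then show ?thesis by (rule carrier_vecD)
  qed
  have e: "\<phi> (xs ! j $ idx n m (Is ! j)) = map (map_vec \<phi>) xs ! j $ idx n m (Is ! j)"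
    if "Is \<in> ordered_partitions n m" "j < n div m" for Is j
    using that assms(2) dim[OF that(2)] idx_less[OF ordered_partitions_mem[OF that]] by simp
  show ?thesis unfolding ext_form_def hom_sum hom_mult hom_prod hom_of_int
  proof (rule sum.cong[OF refl])
    fix Is assume "Is \<in> ordered_partitions n m"
    then have "(\<Prod>j<n div m. \<phi> (xs ! j $ idx n m (Is ! j))) = (\<Prod>j<n div m. map (map_vec \<phi>) xs ! j $ idx n m (Is ! j))"
      using e by (intro prod.cong refl) simp
    then show "of_int (partition_sign n Is) * (\<Prod>j<n div m. \<phi> (xs ! j $ idx n m (Is ! j))) =
       of_int (partition_sign n Is) * (\<Prod>j<n div m. map (map_vec \<phi>) xs ! j $ idx n m (Is ! j))" by simp
  qed
qed

text \<open>The form on tuples of basis vectors, where \<open>col_form\<close> takes the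
  corresponding columns of g. Being a similitude becomes the finite system
  \<open>col_form = c * unit_form\<close>.\<close>

definition unit_form :: "nat \<Rightarrow> nat \<Rightarrow> nat set list \<Rightarrow> 'a::comm_ring_1" where
  "unit_form n m Js = ext_form n m (map (\<lambda>J. unit_vec (n choose m) (idx n m J)) Js)"

definition col_form :: "nat \<Rightarrow> nat \<Rightarrow> 'a::comm_ring_1 mat \<Rightarrow> nat set list \<Rightarrow> 'a" where
  "col_form n m g Js = ext_form n m (map (\<lambda>J. col g (idx n m J)) Js)"

lemma hom_unit_form:
  assumes "comm_ring_hom \<phi>" "length Js = n div m"
  shows "\<phi> (unit_form n m Js) = unit_form n m Js"
proof -
  interpret comm_ring_hom \<phi> by fact
  have "map_vec \<phi> (unit_vec N i) = unit_vec N i" for N i by (rule eq_vecI) (auto simp: unit_vec_def)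
  then show ?thesis unfolding unit_form_def using assms by (subst hom_ext_form[OF assms(1)]) (auto simp: o_def)
qed

lemma hom_col_form:
  assumes "comm_ring_hom \<phi>" "length Js = n div m" "set Js \<subseteq> msubsets n m" "g \<in> carrier_mat (n choose m) (n choose m)"
  shows "\<phi> (col_form n m g Js) = col_form n m (map_mat \<phi> g) Js"
proof -
  have "map_vec \<phi> (col g (idx n m J)) = col (map_mat \<phi> g) (idx n m J)" if "J \<in> set Js" for J
    using that assms(3,4) idx_less[of J n m] by (intro eq_vecI) auto
  then have eq: "map (map_vec \<phi>) (map (\<lambda>J. col g (idx n m J)) Js) = map (\<lambda>J. col (map_mat \<phi> g) (idx n m J)) Js" by simp
  have "set (map (\<lambda>J. col g (idx n m J)) Js) \<subseteq> carrier_vec (n choose m)" using assms(4) by (auto intro!: carrier_vecI)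
  then show ?thesis unfolding col_form_def eq[symmetric] using assms(2) by (intro hom_ext_form[OF assms(1)]) simp_all
qed

lemma of_vec_unit: "J \<in> msubsets n m \<Longrightarrow> of_vec n m (unit_vec (n choose m) (idx n m J)) = basis J"
proof (rule ext_eq_lambdaI[OF of_vec_in basis_in_lambda_space])
  fix I assume "J \<in> msubsets n m" "I \<in> msubsets n m"
  moreover from this have "idx n m I = idx n m J \<longleftrightarrow> I = J" by (metis msubset_list_idx)
  ultimately show "coord (of_vec n m (unit_vec (n choose m) (idx n m J))) I = coord (basis J) I"
    by (auto simp: coord_of_vec idx_less coord_basis msubsets_iff)
qed

lemma unit_form_eq:
  assumes "length Js = n div m" "set Js \<subseteq> msubsets n m" "m dvd n"
  shows "unit_form n m Js = coord (prod_list (map basis Js)) {..<n}"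
proof -
  have eq: "map (of_vec n m) (map (\<lambda>J. unit_vec (n choose m) (idx n m J)) Js) = (map basis Js :: 'a::comm_ring_1 ext list)"
    using assms(2) by (auto simp: of_vec_unit)
  show "unit_form n m Js = (coord (prod_list (map basis Js)) {..<n} :: 'a)"
    unfolding unit_form_def eq[symmetric] by (rule ext_form_eq) (simp_all add: assms)
qed

lemma col_form_eq:
  assumes "length Js = n div m" "set Js \<subseteq> msubsets n m" "m dvd n"
  shows "col_form n m g Js = coord (prod_list (map (\<lambda>J. mat_op n m g (basis J)) Js)) {..<n}"
proof -
  have eq: "map (of_vec n m) (map (\<lambda>J. col g (idx n m J)) Js) = map (\<lambda>J. mat_op n m g (basis J)) Js"
    using assms(2) by (auto simp: mat_op_basis)
  show ?thesis unfolding col_form_def eq[symmetric] by (rule ext_form_eq) (simp_all add: assms)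
qed

lemma form_multilinear:
  assumes g: "g \<in> carrier_mat (n choose m) (n choose m)" and dvd: "m dvd n"
    and c: "\<And>Js. length Js = n div m \<Longrightarrow> set Js \<subseteq> msubsets n m \<Longrightarrow> col_form n m g Js = c * unit_form n m Js"
    and xs: "length xs = n div m" "set xs \<subseteq> carrier_vec (n choose m)"
  shows "ext_form n m (map (\<lambda>x. g *\<^sub>v x) xs) = c * ext_form n m xs"
proof -
  let ?L = "{Is. set Is \<subseteq> msubsets n m \<and> length Is = length xs}"
  have gx: "of_vec n m (g *\<^sub>v x) = (\<Sum>I\<in>msubsets n m. sc (x $ idx n m I) (mat_op n m g (basis I)))" if "x \<in> carrier_vec (n choose m)" for x
    unfolding mat_op_of_vec[OF g that, symmetric] of_vec_def[of n m x] lin_sum[OF lin_mat_op] lin_sc[OF lin_mat_op] ..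
  have "ext_form n m (map (\<lambda>x. g *\<^sub>v x) xs) = coord (prod_list (map (of_vec n m) (map (\<lambda>x. g *\<^sub>v x) xs))) {..<n}"
    using xs dvd by (intro ext_form_eq) auto
  also have "map (of_vec n m) (map (\<lambda>x. g *\<^sub>v x) xs) = map (\<lambda>x. \<Sum>I\<in>msubsets n m. sc (x $ idx n m I) (mat_op n m g (basis I))) xs"
    using gx xs(2) by auto
  also have "coord (prod_list \<dots>) {..<n} = (\<Sum>Is\<in>?L. (\<Prod>j<length xs. xs ! j $ idx n m (Is ! j)) * col_form n m g Is)"
    unfolding prod_list_lincomb[OF finite_msubsets] coord_sum using xs dvd
    by (intro sum.cong) (auto simp: col_form_eq)
  also have "\<dots> = c * (\<Sum>Is\<in>?L. (\<Prod>j<length xs. xs ! j $ idx n m (Is ! j)) * unit_form n m Is)"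
    unfolding sum_distrib_left using xs by (intro sum.cong) (auto simp: c mult_ac)
  also have "(\<Sum>Is\<in>?L. (\<Prod>j<length xs. xs ! j $ idx n m (Is ! j)) * unit_form n m Is) = coord (prod_list (map (of_vec n m) xs)) {..<n}"
    unfolding of_vec_def prod_list_lincomb[OF finite_msubsets] coord_sum using xs dvd
    by (intro sum.cong) (auto simp: unit_form_eq)
  also have "\<dots> = ext_form n m xs" using xs dvd by (intro ext_form_eq[symmetric]) auto
  finally show ?thesis .
qed

lemma form_similitudesI:
  assumes "g \<in> carrier (GL (n choose m))" "c dvd 1" "m dvd n"
    "\<And>Js. length Js = n div m \<Longrightarrow> set Js \<subseteq> msubsets n m \<Longrightarrow> col_form n m g Js = c * unit_form n m Js"
  shows "g \<in> form_similitudes n m"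
  using assms form_multilinear[of g n m c] by (auto simp: form_similitudes_def GL_iff)

lemma ext_form_ext_power:
  assumes A: "A \<in> carrier_mat n n" and dvd: "m dvd n" and xs: "length xs = n div m" "set xs \<subseteq> carrier_vec (n choose m)"
  shows "ext_form n m (map (\<lambda>x. ext_power n m A *\<^sub>v x) xs) = det A * ext_form n m xs"
proof -
  let ?ys = "map (of_vec n m) xs"
  have ys: "set ?ys \<subseteq> lambda_space n m" using of_vec_in by auto
  have "prod_list ?ys \<in> lambda_space n (length ?ys * m)"
    using ys by (intro prod_list_in_lambda_space) auto
  then have top: "prod_list ?ys = sc (coord (prod_list ?ys) {..<n}) (basis {..<n})"
    using xs dvd by (intro lambda_space_top) simp
  have eq: "map (mat_op n m (ext_power n m A)) ?ys = map (Lam A) ?ys"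
    by (simp add: mat_op_ext_power[OF A of_vec_in])
  have "ext_form n m (map (\<lambda>x. ext_power n m A *\<^sub>v x) xs) = coord (prod_list (map (mat_op n m (ext_power n m A)) ?ys)) {..<n}"
    using mat_op_form[OF ext_power_carrier xs(1) dvd xs(2), of A] by simp
  then have "ext_form n m (map (\<lambda>x. ext_power n m A *\<^sub>v x) xs) = coord (prod_list (map (Lam A) ?ys)) {..<n}"
    unfolding eq .
  also have "prod_list (map (Lam A) ?ys) = Lam A (prod_list ?ys)"
    using ys A by (intro Lam_prod_list[symmetric]) (auto intro: lambda_space_subset_all[OF of_vec_in])
  also have "coord \<dots> {..<n} = coord (prod_list ?ys) {..<n} * det A"
    by (subst top) (simp add: Lam_sc coord_Lam_top[OF A])
  also have "coord (prod_list ?ys) {..<n} = ext_form n m xs" using xs dvd by (intro ext_form_eq[symmetric])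
  finally show ?thesis by (simp add: mult.commute)
qed

lemma col_form_mult_vec:
  assumes "g \<in> carrier_mat (n choose m) (n choose m)" "set Js \<subseteq> msubsets n m"
  shows "col_form n m g Js = ext_form n m (map (\<lambda>x. g *\<^sub>v x) (map (\<lambda>J. unit_vec (n choose m) (idx n m J)) Js))"
proof -
  have "col g (idx n m J) = g *\<^sub>v unit_vec (n choose m) (idx n m J)" if "J \<in> set Js" for J
    using assms that idx_less[of J n m] by (intro eq_vecI) (auto simp: scalar_prod_right_unit)
  then have eq: "map (\<lambda>J. col g (idx n m J)) Js = map (\<lambda>x. g *\<^sub>v x) (map (\<lambda>J. unit_vec (n choose m) (idx n m J)) Js)" by auto
  show ?thesis unfolding col_form_def eq ..
qed

lemma col_form_ext_power:
  assumes "A \<in> carrier_mat n n" "m dvd n" "length Js = n div m" "set Js \<subseteq> msubsets n m"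
  shows "col_form n m (ext_power n m A) Js = det A * unit_form n m Js"
  unfolding col_form_mult_vec[OF ext_power_carrier assms(4)] unit_form_def
  using assms by (intro ext_form_ext_power) auto

lemma unit_form_unit:
  assumes "m dvd n"
  obtains Ks where "length Ks = n div m" "set Ks \<subseteq> msubsets n m" "unit_form n m Ks * unit_form n m Ks = (1 :: 'a::comm_ring_1)"
proof -
  have "card {..<n} = (n div m) * m" using assms by simp
  from block_partition[OF finite_lessThan this] obtain Ks and s :: 'a where K: "length Ks = n div m"
    "\<forall>Z\<in>set Ks. Z \<subseteq> {..<n} \<and> card Z = m" "s * s = 1" "prod_list (map basis Ks) = sc s (basis {..<n})" by blast
  then have sub: "set Ks \<subseteq> msubsets n m" by (auto simp: msubsets_def)
  have "unit_form n m Ks = s" using K sub assms by (simp add: unit_form_eq coord_basis)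
  with K(3) have "unit_form n m Ks * unit_form n m Ks = (1 :: 'a)" by simp
  from that[OF K(1) sub this] show thesis .
qed

text \<open>The unknown multiplier is eliminated by comparing every tuple Js with one ordered
  partition Ks, on which the form is a sign. At the exterior power of the generic matrix y both
  sides of the comparison acquire the factor det y, so their difference is a kernel polynomial and
  vanishes at g. The multiplier is then recovered from the value at Ks.\<close>

lemma ext_power_GL_subset:
  assumes dvd: "m dvd n"
  shows "(ext_power_GL n m :: 'a::comm_ring_1 mat set) \<subseteq> form_similitudes n m"
proof
  fix g :: "'a mat" assume g: "g \<in> ext_power_GL n m"
  let ?N = "n choose m"
  have gGL: "g \<in> carrier (GL ?N)" using g by (simp add: ext_power_GL_def)
  then obtain h where gc: "g \<in> carrier_mat ?N ?N" and hc: "h \<in> carrier_mat ?N ?N" and gh: "g * h = 1\<^sub>m ?N"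
    by (auto simp: GL_iff)
  obtain Ks where K: "length Ks = n div m" "set Ks \<subseteq> msubsets n m" "unit_form n m Ks * unit_form n m Ks = (1 :: 'a)"
    using unit_form_unit[OF dvd] .
  have rel: "unit_form n m Ks * col_form n m g Js = unit_form n m Js * col_form n m g Ks"
    if Js: "length Js = n div m" "set Js \<subseteq> msubsets n m" for Js
  proof -
    define F :: ipoly where "F = of_int (unit_form n m Ks) * col_form n m (generic_mat ?N) Js - of_int (unit_form n m Js) * col_form n m (generic_mat ?N) Ks"
    have ev: "eval_at a F = unit_form n m Ks * col_form n m a Js - unit_form n m Js * col_form n m a Ks"
      if a: "a \<in> carrier_mat ?N ?N" for a :: "'b::comm_ring_1 mat"
    proof -
      interpret comm_ring_hom "eval_at a" by (rule eval_at_comm_hom)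
      have u: "of_int (unit_form n m Is) = (unit_form n m Is :: 'b)" if "length Is = n div m" for Is
        by (rule hom_unit_form[OF _ that]) unfold_locales
      show ?thesis unfolding F_def
        using hom_col_form[OF eval_at_comm_hom Js generic_mat_carrier, of a] hom_col_form[OF eval_at_comm_hom K(1,2) generic_mat_carrier, of a]
          u[OF Js(1)] u[OF K(1)] a
        by (simp add: hom_minus hom_mult hom_of_int map_generic_mat)
    qed
    have cf: "col_form n m (generic_mat ?N) Is \<in> matrix_polys ?N" if Is: "length Is = n div m" "set Is \<subseteq> msubsets n m" for Is
    proof -
      have e: "map (\<lambda>J. col (generic_mat ?N) (idx n m J)) Is ! j $ idx n m I \<in> matrix_polys ?N"
        if "j < n div m" "I \<in> msubsets n m" for j I
      proof -
        have "Is ! j \<in> set Is" using Is(1) that(1) by simp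
        then have "idx n m (Is ! j) < ?N" using Is(2) by (intro idx_less) auto
        then show ?thesis using Is that matrix_polys_generic[of "idx n m I" ?N "idx n m (Is ! j)"]
          by (simp add: idx_less carrier_matD[OF generic_mat_carrier[of ?N]])
      qed
      show ?thesis unfolding col_form_def ext_form_def
        by (intro matrix_polys_sum matrix_polys_mult matrix_polys_of_int matrix_polys_prod e ordered_partitions_mem) auto
    qed
    have "F \<in> matrix_polys ?N" unfolding F_def
      by (intro matrix_polys_diff matrix_polys_mult matrix_polys_of_int cf Js K(1,2))
    moreover have "eval_at (ext_power n m (generic_mat n)) F = 0"
      unfolding ev[OF ext_power_carrier] col_form_ext_power[OF generic_mat_carrier dvd Js] col_form_ext_power[OF generic_mat_carrier dvd K(1,2)]
      by (simp add: mult_ac)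
    ultimately have "F \<in> comorphism_kernel n m" unfolding comorphism_kernel_def by simp
    then have "eval_at g F = 0" using g by (simp add: ext_power_GL_def)
    then show ?thesis unfolding ev[OF gc] by simp
  qed
  define c where "c = unit_form n m Ks * col_form n m g Ks"
  have c: "col_form n m g Js = c * unit_form n m Js" if "length Js = n div m" "set Js \<subseteq> msubsets n m" for Js
  proof -
    have "col_form n m g Js = unit_form n m Ks * (unit_form n m Ks * col_form n m g Js)"
      using K(3) by (simp flip: mult.assoc)
    then show ?thesis unfolding rel[OF that] by (simp add: c_def mult_ac)
  qed
  \<comment> \<open>The tuple that g maps to the basis vectors of Ks: the form is a sign after
    applying g, which shows that c is a unit.\<close>
  let ?xs = "map (\<lambda>J. h *\<^sub>v unit_vec ?N (idx n m J)) Ks"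
  have "map (\<lambda>x. g *\<^sub>v x) ?xs = map (\<lambda>J. unit_vec ?N (idx n m J)) Ks"
    using gc hc gh K(2) by (auto simp flip: assoc_mult_mat_vec)
  moreover have "ext_form n m (map (\<lambda>x. g *\<^sub>v x) ?xs) = c * ext_form n m ?xs"
    using K(1) hc by (intro form_multilinear[OF gc dvd c]) auto
  ultimately have "unit_form n m Ks = c * ext_form n m ?xs" by (simp only: unit_form_def)
  then have "c * (ext_form n m ?xs * unit_form n m Ks) = 1" using K(3) by (metis mult.assoc)
  then have "c dvd 1" by (metis dvd_triv_left)
  then show "g \<in> form_similitudes n m" using form_similitudesI[OF gGL _ dvd c] by blast
qed

lemma hom_form_similitudes:
  assumes "comm_ring_hom \<phi>" "m dvd n" and g: "(g :: 'a::comm_ring_1 mat) \<in> form_similitudes n m"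
  shows "map_mat \<phi> g \<in> form_similitudes n m"
proof -
  interpret comm_ring_hom \<phi> by fact
  let ?N = "n choose m"
  obtain h where gc: "g \<in> carrier_mat ?N ?N" and hc: "h \<in> carrier_mat ?N ?N" and gh: "g * h = 1\<^sub>m ?N" "h * g = 1\<^sub>m ?N"
    using g by (auto simp: form_similitudes_def GL_iff)
  obtain c where c: "c dvd 1" "\<And>xs. length xs = n div m \<Longrightarrow> set xs \<subseteq> carrier_vec ?N \<Longrightarrow>
     ext_form n m (map (\<lambda>x. g *\<^sub>v x) xs) = c * ext_form n m xs"
    using g by (auto simp: form_similitudes_def)
  have "map_mat \<phi> g * map_mat \<phi> h = 1\<^sub>m ?N" "map_mat \<phi> h * map_mat \<phi> g = 1\<^sub>m ?N"
    using mat_hom_mult[OF gc hc] mat_hom_mult[OF hc gc] gh mat_hom_one by metis+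
  then have GL: "map_mat \<phi> g \<in> carrier (GL ?N)"
    unfolding GL_iff using gc hc by (intro conjI bexI[of _ "map_mat \<phi> h"]) auto
  have "\<phi> c dvd 1" using c(1) by (metis dvdE dvd_triv_left hom_mult hom_one)
  then show ?thesis
  proof (rule form_similitudesI[OF GL _ assms(2)])
    fix Js assume Js: "length Js = n div m" "set Js \<subseteq> msubsets n m"
    have "col_form n m g Js = c * unit_form n m Js"
      unfolding col_form_mult_vec[OF gc Js(2)] unit_form_def using Js by (intro c(2)) auto
    then have "\<phi> (col_form n m g Js) = \<phi> (c * unit_form n m Js)" by simp
    then show "col_form n m (map_mat \<phi> g) Js = \<phi> c * unit_form n m Js"
      using hom_col_form[OF assms(1) Js gc] hom_unit_form[OF assms(1) Js(1)] by (simp add: hom_mult)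
  qed
qed

section \<open>Localization\<close>

definition prime_ideal :: "'a::comm_ring_1 set \<Rightarrow> bool" where
  "prime_ideal M \<longleftrightarrow> 0 \<in> M \<and> 1 \<notin> M \<and> (\<forall>x\<in>M. \<forall>y\<in>M. x + y \<in> M) \<and> (\<forall>x\<in>M. \<forall>r. r * x \<in> M) \<and>
     (\<forall>x y. x * y \<in> M \<longrightarrow> x \<in> M \<or> y \<in> M)"

text \<open>The annihilator of a is proper, and an ideal that is maximal among the proper ones
  containing it is prime. No element outside such an ideal kills a, so a stays nonzero in the
  localization there.\<close>

lemma prime_ideal_containing_annihilator:
  fixes a :: "'a::comm_ring_1"
  assumes "a \<noteq> 0"
  shows "\<exists>M. prime_ideal M \<and> (\<forall>s. s * a = 0 \<longrightarrow> s \<in> M)"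
proof -
  define idl :: "'a set \<Rightarrow> bool" where
    "idl I \<longleftrightarrow> 1 \<notin> I \<and> (\<forall>s. s * a = 0 \<longrightarrow> s \<in> I) \<and> (\<forall>x\<in>I. \<forall>y\<in>I. x + y \<in> I) \<and> (\<forall>x\<in>I. \<forall>r. r * x \<in> I)" for I
  let ?A = "{I. idl I}"
  have "idl {s. s * a = 0}" using assms by (auto simp: idl_def distrib_right mult.assoc)
  then have ne: "?A \<noteq> {}" by blast
  have chain: "\<Union>C \<in> ?A" if C: "C \<noteq> {}" "subset.chain ?A C" for C
  proof -
    have mem: "idl I" if "I \<in> C" for I using C(2) that by (auto simp: subset.chain_def)
    have lin: "I \<subseteq> J \<or> J \<subseteq> I" if "I \<in> C" "J \<in> C" for I J using C(2) that by (auto simp: subset.chain_def)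
    have "x + y \<in> \<Union>C" if xy: "x \<in> \<Union>C" "y \<in> \<Union>C" for x y
    proof -
      obtain I J where IJ: "I \<in> C" "x \<in> I" "J \<in> C" "y \<in> J" using xy by blast
      define K where "K = (if I \<subseteq> J then J else I)"
      have K: "K \<in> C" "x \<in> K" "y \<in> K" unfolding K_def using IJ lin[OF IJ(1,3)] by auto
      then have "x + y \<in> K" using mem[OF K(1)] by (simp add: idl_def)
      then show ?thesis using K(1) by blast
    qed
    moreover have "r * x \<in> \<Union>C" if "x \<in> \<Union>C" for x r
      using that mem unfolding idl_def by blast
    moreover have "1 \<notin> \<Union>C" using mem by (auto simp: idl_def)
    moreover obtain I where "I \<in> C" using C(1) by blast
    then have "s \<in> \<Union>C" if "s * a = 0" for s
      using that mem[of I] unfolding idl_def by blast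
    ultimately show ?thesis by (auto simp: idl_def)
  qed
  obtain M where M: "idl M" and max: "\<And>I. idl I \<Longrightarrow> M \<subseteq> I \<Longrightarrow> I = M"
    using subset_Zorn_nonempty[OF ne chain] by blast
  note Md = M[unfolded idl_def]
  have zero: "0 \<in> M" using Md by simp
  \<comment> \<open>By maximality, the ideal generated by M and x contains 1.\<close>
  have ext: "\<exists>r. \<exists>z\<in>M. 1 = z + r * x" if x: "x \<notin> M" for x
  proof -
    let ?I = "{z + r * x | z r. z \<in> M}"
    have "z \<in> ?I" if "z \<in> M" for z
    proof -
      have "z = z + 0 * x" by simp
      then show ?thesis using that by blast
    qed
    then have "M \<subseteq> ?I" by blast
    moreover have "x \<in> ?I"
    proof -
      have "x = 0 + 1 * x" by simp
      then show ?thesis using zero by blast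
    qed
    ultimately have "\<not> idl ?I" using max x by blast
    moreover have "p + q \<in> ?I" if pq: "p \<in> ?I" "q \<in> ?I" for p q
    proof -
      obtain z r z' r' where "z \<in> M" "z' \<in> M" "p = z + r * x" "q = z' + r' * x" using pq by blast
      then have "z + z' \<in> M" "p + q = (z + z') + (r + r') * x" using Md by (auto simp: algebra_simps)
      then show ?thesis by blast
    qed
    moreover have "t * p \<in> ?I" if p: "p \<in> ?I" for t p
    proof -
      obtain z r where "z \<in> M" "p = z + r * x" using p by blast
      then have "t * z \<in> M" "t * p = t * z + (t * r) * x" using Md by (auto simp: algebra_simps)
      then show ?thesis by blast
    qed
    moreover have "s \<in> ?I" if "s * a = 0" for s using Md that \<open>M \<subseteq> ?I\<close> by blast
    ultimately have "1 \<in> ?I" unfolding idl_def by blast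
    then show ?thesis by blast
  qed
  have "x \<in> M \<or> y \<in> M" if xy: "x * y \<in> M" for x y
  proof (rule ccontr)
    assume n: "\<not> (x \<in> M \<or> y \<in> M)"
    obtain r z where z: "z \<in> M" "1 = z + r * x" using ext[of x] n by blast
    obtain r' z' where z': "z' \<in> M" "1 = z' + r' * y" using ext[of y] n by blast
    have "1 = (z + r * x) * (z' + r' * y)" using z(2) z'(2) by simp
    also have "\<dots> = (z' + r' * y) * z + (r * x) * z' + (r * r') * (x * y)" by (simp add: algebra_simps)
    also have "\<dots> \<in> M" using Md z(1) z'(1) xy by (simp only: Md)
    finally show False using Md by blast
  qed
  then have "prime_ideal M" using Md zero unfolding prime_ideal_def by blast
  then show ?thesis using Md by blast
qed

text \<open>
  The localization must be a type that depends only on \<open>'a\<close>, so a single prime ideal is chosen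
  for each ring type: one at which some instance of the claim fails, if there is any.
\<close>

definition failures :: "'a::comm_ring_1 set" where
  "failures = {eval_at g F | n m k (g :: 'a mat) F.
     n = k * m \<and> 3 \<le> k \<and> 1 \<le> m \<and> g \<in> form_similitudes n m \<and> F \<in> comorphism_kernel n m}"

definition bad_prime :: "'a::comm_ring_1 set \<Rightarrow> bool" where
  "bad_prime M \<longleftrightarrow> prime_ideal M \<and> (\<exists>a\<in>failures. \<forall>s. s * a = 0 \<longrightarrow> s \<in> M)"

definition the_prime :: "'a::comm_ring_1 set" where
  "the_prime = (SOME M. prime_ideal M \<and> ((\<exists>M' :: 'a set. bad_prime M') \<longrightarrow> bad_prime M))"

lemma the_prime: "prime_ideal (the_prime :: 'a::comm_ring_1 set) \<and> ((\<exists>M' :: 'a set. bad_prime M') \<longrightarrow> bad_prime (the_prime :: 'a set))"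
  unfolding the_prime_def
proof (rule someI_ex)
  obtain M :: "'a set" where "prime_ideal M" using prime_ideal_containing_annihilator[of "1 :: 'a"] by auto
  then show "\<exists>M :: 'a set. prime_ideal M \<and> ((\<exists>M' :: 'a set. bad_prime M') \<longrightarrow> bad_prime M)"
    unfolding bad_prime_def by blast
qed

section \<open>Fractions at the chosen prime\<close>

lemma the_prime_mult: "x * y \<in> the_prime \<longleftrightarrow> x \<in> the_prime \<or> y \<in> the_prime"
  using the_prime[THEN conjunct1] unfolding prime_ideal_def by (metis mult.commute)

lemma the_prime_0 [simp]: "0 \<in> the_prime" and the_prime_1 [simp]: "1 \<notin> the_prime"
  using the_prime[THEN conjunct1] unfolding prime_ideal_def by blast+

lemma the_prime_diff: "s \<notin> the_prime \<Longrightarrow> a \<in> the_prime \<Longrightarrow> s - a \<notin> the_prime"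
  using the_prime[THEN conjunct1] unfolding prime_ideal_def by (metis diff_add_cancel)

text \<open>The factor w makes the relation transitive in the presence of zero divisors. Pairs whose
  denominator lies in the prime are related to nothing, so the relation is a partial equivalence and
  the type a partial quotient.\<close>

definition locrel :: "'a::comm_ring_1 \<times> 'a \<Rightarrow> 'a \<times> 'a \<Rightarrow> bool" where
  "locrel x y \<longleftrightarrow> snd x \<notin> the_prime \<and> snd y \<notin> the_prime \<and>
     (\<exists>w. w \<notin> the_prime \<and> w * (fst x * snd y) = w * (fst y * snd x))"

lemma locrelI:
  "s \<notin> the_prime \<Longrightarrow> t \<notin> the_prime \<Longrightarrow> w \<notin> the_prime \<Longrightarrow> w * (a * t) = w * (b * s) \<Longrightarrow> locrel (a, s) (b, t)"
  by (auto simp: locrel_def)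

lemma locrel_eqI:
  "s \<notin> the_prime \<Longrightarrow> t \<notin> the_prime \<Longrightarrow> a * t = b * s \<Longrightarrow> locrel (a, s) (b, t)"
  by (rule locrelI[of s t 1]) simp_all

lemma part_equivp_locrel: "part_equivp (locrel :: 'a::comm_ring_1 \<times> 'a \<Rightarrow> _)"
proof (rule part_equivpI)
  show "\<exists>x :: 'a \<times> 'a. locrel x x" by (rule exI[of _ "(0, 1)"]) (auto intro: locrel_eqI)
  show "symp (locrel :: 'a \<times> 'a \<Rightarrow> _)" by (rule sympI) (auto simp: locrel_def intro: sym)
  show "transp (locrel :: 'a \<times> 'a \<Rightarrow> _)"
  proof (rule transpI)
    fix x y z :: "'a \<times> 'a" assume xy: "locrel x y" and yz: "locrel y z"
    obtain a s b t c u where e: "x = (a, s)" "y = (b, t)" "z = (c, u)" by (cases x, cases y, cases z)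
    obtain w v where w: "w \<notin> the_prime" "w * (a * t) = w * (b * s)" and v: "v \<notin> the_prime" "v * (b * u) = v * (c * t)"
      using xy yz by (auto simp: locrel_def e)
    have st: "s \<notin> the_prime" "t \<notin> the_prime" "u \<notin> the_prime" using xy yz by (auto simp: locrel_def e)
    have "(w * v * t) * (a * u) = v * u * (w * (a * t))" by (simp add: mult_ac)
    also have "\<dots> = w * s * (v * (b * u))" unfolding w(2) by (simp add: mult_ac)
    also have "\<dots> = (w * v * t) * (c * s)" unfolding v(2) by (simp add: mult_ac)
    finally show "locrel x z" unfolding e using st w(1) v(1) by (intro locrelI[of s u "w * v * t"]) (auto simp: the_prime_mult)
  qed
qed

quotient_type (overloaded) 'a loc = "'a::comm_ring_1 \<times> 'a" / partial: locrel
  by (rule part_equivp_locrel)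

instantiation loc :: (comm_ring_1) comm_ring_1
begin

lift_definition zero_loc :: "'a loc" is "(0, 1)" by (auto intro: locrel_eqI)

lift_definition one_loc :: "'a loc" is "(1, 1)" by (auto intro: locrel_eqI)

lift_definition plus_loc :: "'a loc \<Rightarrow> 'a loc \<Rightarrow> 'a loc"
  is "\<lambda>x y. (fst x * snd y + fst y * snd x, snd x * snd y)"
proof -
  fix x x' y y' :: "'a \<times> 'a" assume r: "locrel x x'" "locrel y y'"
  obtain a s a' s' b t b' t' where e: "x = (a, s)" "x' = (a', s')" "y = (b, t)" "y' = (b', t')"
    by (cases x, cases x', cases y, cases y')
  obtain w v where w: "w \<notin> the_prime" "w * (a * s') = w * (a' * s)" and v: "v \<notin> the_prime" "v * (b * t') = v * (b' * t)"
    using r by (auto simp: locrel_def e)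
  have "(w * v) * ((a * t + b * s) * (s' * t')) = v * t * t' * (w * (a * s')) + w * s * s' * (v * (b * t'))"
    by (simp add: algebra_simps)
  also have "\<dots> = (w * v) * ((a' * t' + b' * s') * (s * t))" unfolding w v by (simp add: algebra_simps)
  finally show "locrel (fst x * snd y + fst y * snd x, snd x * snd y) (fst x' * snd y' + fst y' * snd x', snd x' * snd y')"
    using r w(1) v(1) by (intro locrelI[of _ _ "w * v"]) (auto simp: the_prime_mult locrel_def e)
qed

lift_definition times_loc :: "'a loc \<Rightarrow> 'a loc \<Rightarrow> 'a loc"
  is "\<lambda>x y. (fst x * fst y, snd x * snd y)"
proof -
  fix x x' y y' :: "'a \<times> 'a" assume r: "locrel x x'" "locrel y y'"
  obtain a s a' s' b t b' t' where e: "x = (a, s)" "x' = (a', s')" "y = (b, t)" "y' = (b', t')"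
    by (cases x, cases x', cases y, cases y')
  obtain w v where w: "w \<notin> the_prime" "w * (a * s') = w * (a' * s)" and v: "v \<notin> the_prime" "v * (b * t') = v * (b' * t)"
    using r by (auto simp: locrel_def e)
  have "(w * v) * ((a * b) * (s' * t')) = (w * (a * s')) * (v * (b * t'))" by (simp add: mult_ac)
  also have "\<dots> = (w * v) * ((a' * b') * (s * t))" unfolding w v by (simp add: mult_ac)
  finally show "locrel (fst x * fst y, snd x * snd y) (fst x' * fst y', snd x' * snd y')"
    using r w(1) v(1) by (intro locrelI[of _ _ "w * v"]) (auto simp: the_prime_mult locrel_def e)
qed

lift_definition uminus_loc :: "'a loc \<Rightarrow> 'a loc" is "\<lambda>x. (- fst x, snd x)"
  by (auto simp: locrel_def)

definition minus_loc :: "'a loc \<Rightarrow> 'a loc \<Rightarrow> 'a loc" where "x - y = x + - (y :: 'a loc)"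

instance
proof
  fix a b c :: "'a loc"
  show "a * b * c = a * (b * c)" by transfer (auto simp: locrel_def the_prime_mult mult_ac intro: exI[of _ 1])
  show "a * b = b * a" by transfer (auto simp: locrel_def the_prime_mult mult_ac intro: exI[of _ 1])
  show "1 * a = a" by transfer (auto simp: locrel_def the_prime_mult mult_ac intro: exI[of _ 1])
  show "a + b + c = a + (b + c)" by transfer (auto simp: locrel_def the_prime_mult algebra_simps intro: exI[of _ 1])
  show "a + b = b + a" by transfer (auto simp: locrel_def the_prime_mult algebra_simps intro: exI[of _ 1])
  show "0 + a = a" by transfer (auto simp: locrel_def the_prime_mult algebra_simps intro: exI[of _ 1])
  show "- a + a = 0" by transfer (auto simp: locrel_def the_prime_mult algebra_simps intro: exI[of _ 1])
  show "a - b = a + - b" by (rule minus_loc_def)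
  show "(a + b) * c = a * c + b * c" by transfer (auto simp: locrel_def the_prime_mult algebra_simps intro: exI[of _ 1])
  show "(0 :: 'a loc) \<noteq> 1" by transfer (auto simp: locrel_def)
qed

end

text \<open>For a fraction a/s with a in the prime, s - a lies outside it and s/(s - a) inverts 1 -
  a/s; with a outside the prime, s/a inverts a/s.\<close>

instance loc :: (comm_ring_1) local_ring
proof
  fix x :: "'a loc"
  have "(\<exists>y. 1 = x * y) \<or> (\<exists>y. 1 = (1 + - x) * y)"
  proof (transfer, goal_cases)
    case (1 x)
    obtain a s where e: "x = (a, s)" by (cases x)
    have s: "s \<notin> the_prime" using 1 by (simp add: locrel_def e)
    show ?case
    proof (cases "a \<in> the_prime")
      case True
      then have "s - a \<notin> the_prime" using s by (rule the_prime_diff[rotated])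
      then have "locrel (1, 1) ((s - a) * s, s * (s - a))" "locrel (s, s - a) (s, s - a)"
        using s by (auto intro!: locrel_eqI simp: the_prime_mult mult_ac)
      then show ?thesis by (intro disjI2 bexI[of _ "(s, s - a)"]) (simp_all add: e mult_ac)
    next
      case False
      then have "locrel (1, 1) (a * s, s * a)" "locrel (s, a) (s, a)"
        using s by (auto intro!: locrel_eqI simp: the_prime_mult mult_ac)
      then show ?thesis by (intro disjI1 bexI[of _ "(s, a)"]) (simp_all add: e)
    qed
  qed
  then show "x dvd 1 \<or> (1 - x) dvd 1" by (simp add: dvd_def)
qed

lift_definition to_loc :: "'a::comm_ring_1 \<Rightarrow> 'a loc" is "\<lambda>a. (a, 1)"
  by (auto intro: locrel_eqI)

lemma to_loc_hom: "comm_ring_hom (to_loc :: 'a::comm_ring_1 \<Rightarrow> _)"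
proof
  fix x y :: 'a
  show "to_loc (x + y) = to_loc x + to_loc y" by transfer (auto intro: locrel_eqI)
  show "to_loc (x * y) = to_loc x * to_loc y" by transfer (auto intro: locrel_eqI)
  show "to_loc (0 :: 'a) = 0" by transfer (auto intro: locrel_eqI)
  show "to_loc (1 :: 'a) = 1" by transfer (auto intro: locrel_eqI)
qed

lemma to_loc_eq_0: "to_loc a = 0 \<Longrightarrow> \<exists>w. w \<notin> the_prime \<and> w * a = 0"
  by transfer (auto simp: locrel_def)

text \<open>By the local case every failure becomes 0 in the localization at
  \<open>the_prime\<close>. If F(g) were nonzero for some kernel polynomial F, then
  \<open>the_prime\<close> would contain the annihilator of some failure a, which therefore could
  not become 0. This a may stem from other n, m, g and F than the given ones, which is why
  \<open>zero\<close> covers all failures at once.\<close>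

lemma form_similitudes_subset:
  assumes n: "n = k * m" "3 \<le> k" "1 \<le> m"
  shows "(form_similitudes n m :: 'a::comm_ring_1 mat set) \<subseteq> ext_power_GL n m"
proof
  fix g :: "'a mat" assume g: "g \<in> form_similitudes n m"
  have zero: "to_loc a = 0" if "a \<in> failures" for a :: 'a
  proof -
    obtain n m k F and g :: "'a mat" where *: "a = eval_at g F" "n = k * m" "3 \<le> k" "1 \<le> m"
      "g \<in> form_similitudes n m" "F \<in> comorphism_kernel n m" using \<open>a \<in> failures\<close> unfolding failures_def by blast
    have dvd: "m dvd n" using *(2) by simp
    have "map_mat to_loc g \<in> form_similitudes n m" by (rule hom_form_similitudes[OF to_loc_hom dvd *(5)])
    then obtain u A where A: "A \<in> carrier_mat n n" "map_mat to_loc g = u \<cdot>\<^sub>m ext_power n m A"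
      using local_form_similitude[OF *(2-4)] by blast
    have "to_loc a = eval_at (map_mat to_loc g) F"
      unfolding *(1) using *(5,6) by (intro hom_eval_at[OF to_loc_hom, of _ "n choose m"])
        (auto simp: comorphism_kernel_def form_similitudes_def GL_iff)
    then show ?thesis unfolding A(2) using kernel_scaled_zero[OF *(6,4) A(1)] by simp
  qed
  have "eval_at g F = 0" if F: "F \<in> comorphism_kernel n m" for F
  proof (rule ccontr)
    assume "eval_at g F \<noteq> 0"
    then obtain M where "prime_ideal M" "\<forall>s. s * eval_at g F = 0 \<longrightarrow> s \<in> M"
      using prime_ideal_containing_annihilator by blast
    moreover have "eval_at g F \<in> failures" unfolding failures_def using n g F by blast
    ultimately have "bad_prime M" unfolding bad_prime_def by blast
    then have "bad_prime (the_prime :: 'a set)" using the_prime by blast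
    then obtain a :: 'a where a: "a \<in> failures" "\<forall>s. s * a = 0 \<longrightarrow> s \<in> the_prime" unfolding bad_prime_def by blast
    then show False using to_loc_eq_0[OF zero[OF a(1)]] by blast
  qed
  then show "g \<in> ext_power_GL n m" using g by (auto simp: ext_power_GL_def form_similitudes_def)
qed

section \<open>The scheme-theoretic image is a group\<close>

text \<open>For row operations, which alter the terms of a sum at two indices and keep their
  total.\<close>

lemma sum_eq_two:
  assumes "finite S" "i \<in> S" "j \<in> S" "i \<noteq> j"
    and "\<And>x. x \<in> S - {i, j} \<Longrightarrow> f x = g x" "f i + f j = (g i + g j :: 'a::comm_ring_1)"
  shows "sum f S = sum g S"
proof -
  have split: "sum h S = h i + h j + sum h (S - {i, j})" for h :: "_ \<Rightarrow> 'a"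
  proof -
    have "sum h S = h i + sum h (S - {i})" using assms(1,2) by (rule sum.remove)
    also have "sum h (S - {i}) = h j + sum h (S - {i} - {j})" using assms by (intro sum.remove) auto
    also have "S - {i} - {j} = S - {i, j}" by blast
    finally show ?thesis by (simp add: add.assoc)
  qed
  have "sum f (S - {i, j}) = sum g (S - {i, j})" using assms(5) by (intro sum.cong) auto
  then show ?thesis unfolding split[of f] split[of g] using assms(6) by simp
qed

section \<open>Additive maps on the spans of families of integer vectors\<close>

definition relation :: "'i set \<Rightarrow> ('i \<Rightarrow> 'b \<Rightarrow> int) \<Rightarrow> ('i \<Rightarrow> int) \<Rightarrow> bool" where
  "relation S C r \<longleftrightarrow> (\<forall>b. (\<Sum>\<nu>\<in>S. r \<nu> * C \<nu> b) = 0)"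

text \<open>Expresses that C \<nu> going to u \<nu> extends to an additive map on the span of the C
  \<nu>.\<close>

definition compatible :: "'i set \<Rightarrow> ('i \<Rightarrow> 'b \<Rightarrow> int) \<Rightarrow> ('i \<Rightarrow> 'a::comm_ring_1) \<Rightarrow> bool" where
  "compatible S C u \<longleftrightarrow> (\<forall>r. relation S C r \<longrightarrow> (\<Sum>\<nu>\<in>S. of_int (r \<nu>) * u \<nu>) = 0)"

lemma compatibleD: "compatible S C u \<Longrightarrow> relation S C r \<Longrightarrow> (\<Sum>\<nu>\<in>S. of_int (r \<nu>) * u \<nu>) = 0"
  by (simp add: compatible_def)

lemma compatible_zero:
  assumes "finite S" "compatible S C u" "i \<in> S" "\<And>b. C i b = 0"
  shows "u i = 0"
proof -
  have "relation S C (\<lambda>\<nu>. if \<nu> = i then 1 else 0)"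
    using assms by (simp add: relation_def if_distrib[of "\<lambda>c. c * _"] cong: if_cong)
  from compatibleD[OF assms(2) this] show ?thesis using assms(1,3)
    by (simp add: if_distrib[of of_int] if_distrib[of "\<lambda>c. c * _"] cong: if_cong)
qed

lemma sum_if_neq:
  "finite S \<Longrightarrow> (\<Sum>x\<in>S. if x = i then 0 else f x) = (\<Sum>x\<in>S - {i}. f x :: 'a::comm_ring_1)"
  by (intro sum.mono_neutral_cong_right) auto

lemma compatible_remove:
  assumes "finite S" "compatible S C u"
  shows "compatible (S - {i}) C u"
  unfolding compatible_def
proof (intro allI impI)
  fix r assume r: "relation (S - {i}) C r"
  have "relation S C (\<lambda>\<nu>. if \<nu> = i then 0 else r \<nu>)"
    using r assms(1) by (simp add: relation_def sum_if_neq if_distrib[of "\<lambda>c. c * _"] cong: if_cong)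
  from compatibleD[OF assms(2) this] show "(\<Sum>\<nu>\<in>S - {i}. of_int (r \<nu>) * u \<nu>) = 0"
    using assms(1) by (simp add: sum_if_neq if_distrib[of "\<lambda>c. c * _"] if_distrib[of of_int] cong: if_cong)
qed

text \<open>The additive map that takes C i and C j to u i and u j takes C i + e C j to u i + e u
  j.\<close>

lemma compatible_shear:
  assumes S: "finite S" "i \<in> S" "j \<in> S" "i \<noteq> j" and u: "compatible S C u"
  shows "compatible S (C(i := \<lambda>b. C i b + e * C j b)) (u(i := u i + of_int e * u j))"
  unfolding compatible_def
proof (intro allI impI)
  fix r assume r: "relation S (C(i := \<lambda>b. C i b + e * C j b)) r"
  have "relation S C (r(j := r j + e * r i))" unfolding relation_def
  proof
    fix b
    have "(\<Sum>\<nu>\<in>S. (r(j := r j + e * r i)) \<nu> * C \<nu> b) = (\<Sum>\<nu>\<in>S. r \<nu> * (C(i := \<lambda>b. C i b + e * C j b)) \<nu> b)"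
      using S(4) by (intro sum_eq_two[OF S]) (auto simp: algebra_simps)
    then show "(\<Sum>\<nu>\<in>S. (r(j := r j + e * r i)) \<nu> * C \<nu> b) = 0" using r by (simp add: relation_def)
  qed
  from compatibleD[OF u this] have "(\<Sum>\<nu>\<in>S. of_int ((r(j := r j + e * r i)) \<nu>) * u \<nu>) = 0" .
  moreover have "(\<Sum>\<nu>\<in>S. of_int (r \<nu>) * (u(i := u i + of_int e * u j)) \<nu>) = (\<Sum>\<nu>\<in>S. of_int ((r(j := r j + e * r i)) \<nu>) * u \<nu>)"
    using S(4) by (intro sum_eq_two[OF S]) (auto simp: algebra_simps)
  ultimately show "(\<Sum>\<nu>\<in>S. of_int (r \<nu>) * (u(i := u i + of_int e * u j)) \<nu>) = 0" by simp
qed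

text \<open>
  This replaces flatness over \<open>\<int>\<close>: the tensor \<open>\<Sum> C\<^sub>\<nu> \<otimes> z\<^sub>\<nu>\<close> vanishes, and additive maps on the spans
  of the \<open>C\<^sub>\<nu>\<close> and of the \<open>z\<^sub>\<nu>\<close> may be applied to it. Euclid's algorithm on a relation, with
  contragredient changes of the two families, reduces to independent \<open>C\<^sub>\<nu>\<close>.
\<close>

lemma relation_pairing:
  fixes u Z :: "'i \<Rightarrow> 'a::comm_ring_1" and C :: "'i \<Rightarrow> 'b \<Rightarrow> int" and z :: "'i \<Rightarrow> 'c \<Rightarrow> int"
  assumes "finite S" "compatible S C u" "compatible S z Z" "\<And>b c. (\<Sum>\<nu>\<in>S. C \<nu> b * z \<nu> c) = 0"
  shows "(\<Sum>\<nu>\<in>S. u \<nu> * Z \<nu>) = 0"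
  using assms
proof (induction "card S" arbitrary: S C z u Z rule: less_induct)
  case less
  note IH = less.hyps
  have descent: "(\<Sum>\<nu>\<in>S. u \<nu> * Z \<nu>) = 0"
    if "compatible S C u" "compatible S z Z" "\<And>b c. (\<Sum>\<nu>\<in>S. C \<nu> b * z \<nu> c) = 0"
      "relation S C r" "i0 \<in> S" "r i0 \<noteq> 0"
    for C :: "'i \<Rightarrow> 'b \<Rightarrow> int" and z :: "'i \<Rightarrow> 'c \<Rightarrow> int" and u Z :: "'i \<Rightarrow> 'a" and r i0
    using that
  proof (induction "nat (\<Sum>\<nu>\<in>S. \<bar>r \<nu>\<bar>)" arbitrary: C z u Z r i0 rule: less_induct)
    case (less r C z u Z i0)
    note u = less.prems(1) and Z = less.prems(2) and pair = less.prems(3) and r = less.prems(4)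
    show ?case
    proof (cases "\<exists>j\<in>S. j \<noteq> i0 \<and> r j \<noteq> 0")
      case True
      then obtain j0 where j0: "j0 \<in> S" "j0 \<noteq> i0" "r j0 \<noteq> 0" by blast
      define i where "i = (if \<bar>r i0\<bar> \<le> \<bar>r j0\<bar> then i0 else j0)"
      define j where "j = (if \<bar>r i0\<bar> \<le> \<bar>r j0\<bar> then j0 else i0)"
      have ij: "i \<in> S" "j \<in> S" "i \<noteq> j" "r i \<noteq> 0" "r j \<noteq> 0" "\<bar>r i\<bar> \<le> \<bar>r j\<bar>"
        using j0 less.prems(5,6) by (auto simp: i_def j_def)
      note S = \<open>finite S\<close> ij(1-3) and S' = \<open>finite S\<close> ij(2,1) ij(3)[symmetric]
      \<comment> \<open>The index i carries the smaller of two nonzero coefficients in absolute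
        value; subtracting it from the other one, with the sign e, makes the sum of absolute values
        smaller.\<close>
      define e where "e = sgn (r i) * sgn (r j)"
      have small: "\<bar>r j - e * r i\<bar> < \<bar>r j\<bar>"
        using ij(4-6) by (cases "r i > 0"; cases "r j > 0") (auto simp: e_def)
      let ?C = "C(i := \<lambda>b. C i b + e * C j b)" and ?u = "u(i := u i + of_int e * u j)"
      let ?z = "z(j := \<lambda>b. z j b + (- e) * z i b)" and ?Z = "Z(j := Z j + of_int (- e) * Z i)"
      let ?r = "r(j := r j - e * r i)"
      have "(\<Sum>\<nu>\<in>S. \<bar>?r \<nu>\<bar>) < (\<Sum>\<nu>\<in>S. \<bar>r \<nu>\<bar>)"
        using small ij S by (intro sum_strict_mono_ex1) auto
      moreover have "(\<Sum>\<nu>\<in>S. \<bar>?r \<nu>\<bar>) \<ge> 0" by (intro sum_nonneg) simp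
      ultimately have "nat (\<Sum>\<nu>\<in>S. \<bar>?r \<nu>\<bar>) < nat (\<Sum>\<nu>\<in>S. \<bar>r \<nu>\<bar>)" by linarith
      moreover have "(\<Sum>\<nu>\<in>S. ?C \<nu> b * ?z \<nu> c) = 0" for b c
        using ij(3) unfolding pair[of b c, symmetric] by (intro sum_eq_two[OF S]) (auto simp: algebra_simps)
      moreover have "relation S ?C ?r" unfolding relation_def
      proof
        fix b
        have "(\<Sum>\<nu>\<in>S. ?r \<nu> * ?C \<nu> b) = (\<Sum>\<nu>\<in>S. r \<nu> * C \<nu> b)"
          using ij(3) by (intro sum_eq_two[OF S]) (auto simp: algebra_simps)
        then show "(\<Sum>\<nu>\<in>S. ?r \<nu> * ?C \<nu> b) = 0" using r by (simp add: relation_def)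
      qed
      moreover have "?r i \<noteq> 0" using ij by simp
      ultimately have "(\<Sum>\<nu>\<in>S. ?u \<nu> * ?Z \<nu>) = 0"
        using compatible_shear[OF S u, of e] compatible_shear[OF S' Z, of "- e"] ij(1) by (intro less.hyps) assumption+
      moreover have "(\<Sum>\<nu>\<in>S. ?u \<nu> * ?Z \<nu>) = (\<Sum>\<nu>\<in>S. u \<nu> * Z \<nu>)"
        using ij(3) by (intro sum_eq_two[OF S]) (auto simp: algebra_simps)
      ultimately show ?thesis by simp
    next
      case False
      have C0: "C i0 b = 0" for b
      proof -
        have "(\<Sum>\<nu>\<in>S. r \<nu> * C \<nu> b) = r i0 * C i0 b + (\<Sum>\<nu>\<in>S - {i0}. r \<nu> * C \<nu> b)"
          using \<open>finite S\<close> less.prems(5) by (rule sum.remove)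
        also have "(\<Sum>\<nu>\<in>S - {i0}. r \<nu> * C \<nu> b) = 0" using False by (intro sum.neutral) auto
        finally show ?thesis using r less.prems(6) by (simp add: relation_def)
      qed
      have "u i0 = 0" by (rule compatible_zero[OF \<open>finite S\<close> u less.prems(5) C0])
      moreover have "(\<Sum>\<nu>\<in>S - {i0}. C \<nu> b * z \<nu> c) = 0" for b c
        using pair[of b c] C0 \<open>finite S\<close> less.prems(5) by (simp add: sum.remove)
      then have "(\<Sum>\<nu>\<in>S - {i0}. u \<nu> * Z \<nu>) = 0"
        by (rule IH[OF card_Diff1_less[OF \<open>finite S\<close> less.prems(5)] finite_Diff[OF \<open>finite S\<close>]
          compatible_remove[OF \<open>finite S\<close> u] compatible_remove[OF \<open>finite S\<close> Z]])
      ultimately show ?thesis using \<open>finite S\<close> less.prems(5) by (simp add: sum.remove)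
    qed
  qed
  show ?case
  proof (cases "\<exists>r. relation S C r \<and> (\<exists>i\<in>S. r i \<noteq> 0)")
    case True
    then obtain r i where "relation S C r" "i \<in> S" "r i \<noteq> 0" by blast
    then show ?thesis by (intro descent[OF less.prems(2-4)])
  next
    case False
    \<comment> \<open>Here the C \<nu> are linearly independent. For each c the vanishing of the
      tensor is a relation with coefficients z \<nu> c, so all of these are 0.\<close>
    have "Z i = 0" if i: "i \<in> S" for i
    proof (rule compatible_zero[OF less.prems(1,3) i])
      fix c
      have "relation S C (\<lambda>\<nu>. z \<nu> c)" using less.prems(4) by (simp add: relation_def mult.commute)
      then show "z i c = 0" using False i by blast
    qed
    then show ?thesis by simp
  qed
qed

section \<open>Comultiplication and products\<close>

type_synonym bipoly = "((nat \<times> nat) \<Rightarrow>\<^sub>0 nat) \<Rightarrow>\<^sub>0 ipoly"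

text \<open>Polynomials with polynomial coefficients model the tensor square of the ring of matrix
  polynomials: the outer variables belong to the left factor of a matrix product, the inner ones to
  the right factor.\<close>

definition bi_polys :: "nat \<Rightarrow> bipoly set" where
  "bi_polys N = {P. \<forall>u. Poly_Mapping.lookup P u \<in> matrix_polys N \<and>
     (u \<in> Poly_Mapping.keys P \<longrightarrow> Poly_Mapping.keys u \<subseteq> {..<N} \<times> {..<N})}"

lemma bi_polys_zero: "0 \<in> bi_polys N"
  by (simp add: bi_polys_def)

lemma bi_polys_add: "P \<in> bi_polys N \<Longrightarrow> Q \<in> bi_polys N \<Longrightarrow> P + Q \<in> bi_polys N"
  using keys_add[of P Q] by (auto simp: bi_polys_def lookup_add intro: matrix_polys_add dest!: subsetD)

lemma bi_polys_sum: "(\<And>x. x \<in> S \<Longrightarrow> f x \<in> bi_polys N) \<Longrightarrow> sum f S \<in> bi_polys N"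
  by (induction S rule: infinite_finite_induct) (auto intro: bi_polys_add bi_polys_zero)

lemma bi_polys_single:
  "c \<in> matrix_polys N \<Longrightarrow> Poly_Mapping.keys u \<subseteq> {..<N} \<times> {..<N} \<Longrightarrow> Poly_Mapping.single u c \<in> bi_polys N"
  by (auto simp: bi_polys_def lookup_single when_def)

lemma bi_polys_mult:
  assumes "P \<in> bi_polys N" "Q \<in> bi_polys N"
  shows "P * Q \<in> bi_polys N"
proof -
  have "P * Q = (\<Sum>u\<in>Poly_Mapping.keys P. \<Sum>v\<in>Poly_Mapping.keys Q.
     Poly_Mapping.single (u + v) (Poly_Mapping.lookup P u * Poly_Mapping.lookup Q v))"
    by (subst poly_mapping_expand[of P], subst poly_mapping_expand[of Q])
      (simp add: sum_product mult_single)
  also have "\<dots> \<in> bi_polys N"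
  proof (intro bi_polys_sum bi_polys_single matrix_polys_mult)
    fix u v assume "u \<in> Poly_Mapping.keys P" "v \<in> Poly_Mapping.keys Q"
    then show "Poly_Mapping.keys (u + v) \<subseteq> {..<N} \<times> {..<N}"
      using assms keys_add[of u v] unfolding bi_polys_def by blast
  qed (use assms in \<open>auto simp: bi_polys_def\<close>)
  finally show ?thesis .
qed

lemma bi_polys_of_int: "of_int c \<in> bi_polys N"
  using bi_polys_single[OF matrix_polys_of_int[of c], of 0] by simp

lemma bi_polys_power: "P \<in> bi_polys N \<Longrightarrow> P ^ k \<in> bi_polys N"
  by (induction k) (use bi_polys_of_int[of 1] in \<open>auto intro: bi_polys_mult\<close>)

lemma bi_polys_prod: "(\<And>x. x \<in> S \<Longrightarrow> f x \<in> bi_polys N) \<Longrightarrow> prod f S \<in> bi_polys N"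
  by (induction S rule: infinite_finite_induct) (use bi_polys_of_int[of 1] in \<open>auto intro: bi_polys_mult\<close>)

definition outer_mat :: "nat \<Rightarrow> bipoly mat" where
  "outer_mat N = mat N N (\<lambda>p. Poly_Mapping.single (Poly_Mapping.single p 1) 1)"

definition inner_mat :: "nat \<Rightarrow> bipoly mat" where
  "inner_mat N = map_mat (Poly_Mapping.single 0) (generic_mat N)"

definition coproduct :: "nat \<Rightarrow> ipoly \<Rightarrow> bipoly" where
  "coproduct N F = eval_at (outer_mat N * inner_mat N) F"

lemma outer_mat_carrier [simp]: "outer_mat N \<in> carrier_mat N N"
  and inner_mat_carrier [simp]: "inner_mat N \<in> carrier_mat N N"
  by (simp_all add: outer_mat_def inner_mat_def)

lemma coproduct_bi_polys: "F \<in> matrix_polys N \<Longrightarrow> coproduct N F \<in> bi_polys N"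
proof -
  assume F: "F \<in> matrix_polys N"
  have "(outer_mat N * inner_mat N) $$ p \<in> bi_polys N" if p: "p \<in> {..<N} \<times> {..<N}" for p
  proof -
    obtain i j where ij: "p = (i, j)" "i < N" "j < N" using p by auto
    have "(outer_mat N * inner_mat N) $$ (i, j) = (\<Sum>l = 0..<N. outer_mat N $$ (i, l) * inner_mat N $$ (l, j))"
      using ij carrier_matD[OF outer_mat_carrier[of N]] carrier_matD[OF inner_mat_carrier[of N]]
      by (simp add: scalar_prod_def)
    also have "\<dots> \<in> bi_polys N"
      using ij by (intro bi_polys_sum bi_polys_mult)
        (auto simp: outer_mat_def inner_mat_def carrier_matD[OF generic_mat_carrier] intro!: bi_polys_single matrix_polys_generic)
    finally show ?thesis unfolding ij(1) .
  qed
  then show ?thesis using F unfolding coproduct_def eval_at_def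
    by (intro bi_polys_sum bi_polys_mult bi_polys_of_int bi_polys_prod bi_polys_power)
      (auto simp: matrix_polys_def)
qed

text \<open>The evaluation that sends the outer variables to g and the inner ones to h is a ring
  homomorphism, and it takes the product of the two generic matrices to g h.\<close>

lemma eval_coproduct:
  assumes F: "F \<in> matrix_polys N" and g: "g \<in> carrier_mat N N" "(h :: 'a::comm_ring_1 mat) \<in> carrier_mat N N"
  shows "eval_at (g * h) F = (\<Sum>u\<in>Poly_Mapping.keys (coproduct N F).
     eval_at h (Poly_Mapping.lookup (coproduct N F) u) * mono_at (\<lambda>p. g $$ p) u)"
proof -
  let ?\<psi> = "poly_at (eval_at h) (\<lambda>p. g $$ p)"
  have hom: "comm_ring_hom ?\<psi>" by (rule poly_at_hom[OF eval_at_comm_hom])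
  interpret comm_ring_hom ?\<psi> by (rule hom)
  interpret h: comm_ring_hom "eval_at h" by (rule eval_at_comm_hom)
  have "map_mat ?\<psi> (outer_mat N) = g"
    using g by (intro eq_matI) (auto simp: outer_mat_def poly_at_single)
  moreover have "map_mat ?\<psi> (inner_mat N) = h"
  proof -
    have "map_mat ?\<psi> (inner_mat N) = map_mat (eval_at h) (generic_mat N)"
      by (intro eq_matI) (auto simp: inner_mat_def poly_at_single)
    then show ?thesis using g by (simp add: map_generic_mat)
  qed
  ultimately have "map_mat ?\<psi> (outer_mat N * inner_mat N) = g * h"
    using mat_hom_mult[OF outer_mat_carrier inner_mat_carrier] by metis
  then have "eval_at (g * h) F = ?\<psi> (coproduct N F)" unfolding coproduct_def
    using hom_eval_at[OF hom F mult_carrier_mat[OF outer_mat_carrier inner_mat_carrier]] by simp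
  then show ?thesis by (simp add: poly_at_def)
qed

lemma mono_at_variables: "mono_at (\<lambda>p. Poly_Mapping.single (Poly_Mapping.single p 1) (1 :: 'c::comm_ring_1)) u = Poly_Mapping.single u 1"
proof -
  have pow: "Poly_Mapping.single (Poly_Mapping.single p 1) (1 :: 'c) ^ k = Poly_Mapping.single (Poly_Mapping.single p k) 1" for p :: 'p and k
    by (induction k) (simp_all add: mult_single flip: single_add)
  have prod: "(\<Prod>p\<in>S. Poly_Mapping.single (f p) (1 :: 'c)) = Poly_Mapping.single (\<Sum>p\<in>S. f p) 1" for S :: "'p set" and f :: "'p \<Rightarrow> 'p \<Rightarrow>\<^sub>0 nat"
    by (induction S rule: infinite_finite_induct) (simp_all add: mult_single)
  show ?thesis unfolding mono_at_def pow prod poly_mapping_expand[of u, symmetric] ..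
qed

lemma lookup_of_int_mult: "Poly_Mapping.lookup (of_int c * P) u = c * Poly_Mapping.lookup (P :: ipoly) u"
proof -
  have n: "Poly_Mapping.lookup (of_nat k * P) u = int k * Poly_Mapping.lookup P u" for k
    by (induction k) (simp_all add: distrib_right lookup_add)
  show ?thesis by (cases c) (simp_all only: of_int_minus of_int_of_nat_eq mult_minus_left lookup_uminus n)
qed

definition outer :: "ipoly \<Rightarrow> bipoly" where
  "outer = poly_at of_int (\<lambda>p. Poly_Mapping.single (Poly_Mapping.single p 1) 1)"

lemma outer_hom: "comm_ring_hom outer"
  unfolding outer_def by (rule poly_at_hom) unfold_locales

text \<open>The coefficients of a pure tensor p \<otimes> q are products of coefficients of p and q.
  This turns the vanishing of a sum of such tensors into the hypothesis of
  \<open>relation_pairing\<close>.\<close>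

lemma outer_mult_inner:
  "Poly_Mapping.lookup (Poly_Mapping.lookup (outer p * Poly_Mapping.single 0 q) c) b = Poly_Mapping.lookup p c * Poly_Mapping.lookup q b"
proof -
  have "of_int c * Poly_Mapping.single u (1 :: ipoly) = Poly_Mapping.single u (of_int c)" for c and u :: "(nat \<times> nat) \<Rightarrow>\<^sub>0 nat"
    by (subst single_of_int[symmetric]) (simp add: mult_single del: single_of_int)
  then have "outer p * Poly_Mapping.single 0 q = (\<Sum>u\<in>Poly_Mapping.keys p. Poly_Mapping.single u (of_int (Poly_Mapping.lookup p u) * q))"
    unfolding outer_def poly_at_def mono_at_variables by (simp add: sum_distrib_right mult_single)
  then have "Poly_Mapping.lookup (outer p * Poly_Mapping.single 0 q) c = (\<Sum>u\<in>Poly_Mapping.keys p. if u = c then of_int (Poly_Mapping.lookup p c) * q else 0)"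
    by (auto simp: lookup_sum lookup_single when_def intro!: sum.cong)
  also have "\<dots> = of_int (Poly_Mapping.lookup p c) * q" by (simp add: in_keys_iff)
  finally show ?thesis by (simp add: lookup_of_int_mult)
qed

text \<open>An integer relation between the values of the f \<nu> at the exterior power of the
  generic matrix is itself a kernel polynomial, so the values at g satisfy it as well.\<close>

lemma ext_power_GL_compatible:
  assumes g: "g \<in> ext_power_GL n m" and f: "\<And>\<nu>. \<nu> \<in> S \<Longrightarrow> f \<nu> \<in> matrix_polys (n choose m)"
  shows "compatible S (\<lambda>\<nu>. Poly_Mapping.lookup (eval_at (ext_power n m (generic_mat n)) (f \<nu>))) (\<lambda>\<nu>. eval_at g (f \<nu>))"
  unfolding compatible_def
proof (intro allI impI)
  fix r assume r: "relation S (\<lambda>\<nu>. Poly_Mapping.lookup (eval_at (ext_power n m (generic_mat n)) (f \<nu>))) r"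
  let ?F = "\<Sum>\<nu>\<in>S. of_int (r \<nu>) * f \<nu>"
  have ev: "eval_at a ?F = (\<Sum>\<nu>\<in>S. of_int (r \<nu>) * eval_at a (f \<nu>))" for a :: "'c::comm_ring_1 mat"
  proof -
    interpret comm_ring_hom "eval_at a" by (rule eval_at_comm_hom)
    show ?thesis by (simp add: hom_sum hom_mult hom_of_int)
  qed
  have "eval_at (ext_power n m (generic_mat n)) ?F = 0" unfolding ev
    by (rule poly_mapping_eqI) (use r in \<open>simp add: relation_def lookup_sum lookup_of_int_mult\<close>)
  moreover have "?F \<in> matrix_polys (n choose m)" by (intro matrix_polys_sum matrix_polys_mult matrix_polys_of_int f)
  ultimately have "?F \<in> comorphism_kernel n m" by (simp add: comorphism_kernel_def)
  then have "eval_at g ?F = 0" using g by (simp add: ext_power_GL_def)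
  then show "(\<Sum>\<nu>\<in>S. of_int (r \<nu>) * eval_at g (f \<nu>)) = 0" by (simp add: ev)
qed

text \<open>Expand F(x x') as a sum over monomials x^u with coefficients \<open>f2 u\<close> in x'.
  At the exterior powers of two independent generic matrices the sum is F at the exterior power of
  their product, hence 0. Evaluation at g and evaluation at h act as additive maps on the spans of
  the two families of values, so \<open>relation_pairing\<close> carries the vanishing over to g
  h.\<close>

lemma kernel_product:
  assumes F: "F \<in> comorphism_kernel n m" and g: "g \<in> ext_power_GL n m" and h: "(h :: 'a::comm_ring_1 mat) \<in> ext_power_GL n m"
  shows "eval_at (g * h) F = 0"
proof -
  let ?N = "n choose m"
  let ?P = "coproduct ?N F"
  let ?S = "Poly_Mapping.keys ?P" and ?E = "ext_power n m (generic_mat n)"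
  define f1 :: "((nat \<times> nat) \<Rightarrow>\<^sub>0 nat) \<Rightarrow> ipoly" where "f1 u = Poly_Mapping.single u 1" for u
  define f2 where "f2 = Poly_Mapping.lookup ?P"
  have Fm: "F \<in> matrix_polys ?N" using F by (simp add: comorphism_kernel_def)
  have f1: "f1 u \<in> matrix_polys ?N" and f2: "f2 u \<in> matrix_polys ?N" if "u \<in> ?S" for u
    using coproduct_bi_polys[OF Fm] that by (auto simp: bi_polys_def f1_def f2_def matrix_polys_def)
  have mono: "eval_at a (f1 u) = mono_at (\<lambda>p. a $$ p) u" for a :: "'c::comm_ring_1 mat" and u
    by (simp add: f1_def eval_at_eq poly_at_single)
  have gc: "g \<in> carrier_mat ?N ?N" "h \<in> carrier_mat ?N ?N" using g h by (auto simp: ext_power_GL_def GL_iff)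
  have "(\<Sum>u\<in>?S. eval_at g (f1 u) * eval_at h (f2 u)) = 0"
  proof (rule relation_pairing[OF finite_keys ext_power_GL_compatible[OF g f1] ext_power_GL_compatible[OF h f2]])
    fix c b
    let ?G = "map_mat outer (generic_mat n)" and ?H = "map_mat (Poly_Mapping.single 0) (generic_mat n) :: bipoly mat"
    have inner_hom: "comm_ring_hom (Poly_Mapping.single 0 :: ipoly \<Rightarrow> bipoly)"
      by unfold_locales (simp_all add: single_add mult_single)
    have GH: "?G \<in> carrier_mat n n" "?H \<in> carrier_mat n n" by simp_all
    have "(\<Sum>u\<in>?S. outer (eval_at ?E (f1 u)) * Poly_Mapping.single 0 (eval_at ?E (f2 u))) =
        (\<Sum>u\<in>?S. eval_at (ext_power n m ?H) (f2 u) * mono_at (\<lambda>p. ext_power n m ?G $$ p) u)"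
    proof (rule sum.cong[OF refl])
      fix u assume u: "u \<in> ?S"
      have "outer (eval_at ?E (f1 u)) = mono_at (\<lambda>p. ext_power n m ?G $$ p) u"
        using hom_eval_at[OF outer_hom f1[OF u] ext_power_carrier, of "generic_mat n"]
        by (simp add: hom_ext_power[OF outer_hom generic_mat_carrier] mono)
      moreover have "Poly_Mapping.single 0 (eval_at ?E (f2 u)) = eval_at (ext_power n m ?H) (f2 u)"
        using hom_eval_at[OF inner_hom f2[OF u] ext_power_carrier, of "generic_mat n"]
        by (simp add: hom_ext_power[OF inner_hom generic_mat_carrier])
      ultimately show "outer (eval_at ?E (f1 u)) * Poly_Mapping.single 0 (eval_at ?E (f2 u)) =
          eval_at (ext_power n m ?H) (f2 u) * mono_at (\<lambda>p. ext_power n m ?G $$ p) u"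
        by (simp add: mult.commute)
    qed
    also have "\<dots> = eval_at (ext_power n m ?G * ext_power n m ?H) F"
      unfolding f2_def by (rule eval_coproduct[OF Fm ext_power_carrier ext_power_carrier, symmetric])
    also have "\<dots> = 0" unfolding ext_power_mult[OF GH, symmetric]
      by (rule kernel_zero[OF F mult_carrier_mat[OF GH]])
    finally have "Poly_Mapping.lookup (Poly_Mapping.lookup (\<Sum>u\<in>?S. outer (eval_at ?E (f1 u)) * Poly_Mapping.single 0 (eval_at ?E (f2 u))) c) b = 0"
      by simp
    then show "(\<Sum>u\<in>?S. Poly_Mapping.lookup (eval_at ?E (f1 u)) c * Poly_Mapping.lookup (eval_at ?E (f2 u)) b) = 0"
      by (simp add: lookup_sum outer_mult_inner)
  qed
  then show ?thesis unfolding eval_coproduct[OF Fm gc] mono f2_def by (simp add: mult.commute)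
qed

section \<open>Inverses\<close>

lemma matrix_polys_det:
  assumes "A \<in> carrier_mat k k" "\<And>i j. i < k \<Longrightarrow> j < k \<Longrightarrow> A $$ (i, j) \<in> matrix_polys N"
  shows "det A \<in> matrix_polys N"
proof -
  have "of_int (sign p) * (\<Prod>i = 0..<k. A $$ (i, p i)) \<in> matrix_polys N" if "p permutes {0..<k}" for p
    using assms(2) permutes_in_image[OF that] by (intro matrix_polys_mult matrix_polys_of_int matrix_polys_prod) simp
  then show ?thesis unfolding det_def'[OF assms(1)] by (intro matrix_polys_sum) auto
qed

lemma matrix_polys_adj:
  assumes "i < N" "j < N"
  shows "adj_mat (generic_mat N) $$ (i, j) \<in> matrix_polys N"
proof -
  have c: "mat_delete (generic_mat N) j i \<in> carrier_mat (N - 1) (N - 1)" by (rule mat_delete_carrier) simp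
  have "mat_delete (generic_mat N) j i $$ (i', j') \<in> matrix_polys N" if "i' < N - 1" "j' < N - 1" for i' j'
    using that carrier_matD[OF generic_mat_carrier[of N]] by (auto simp: mat_delete_def intro!: matrix_polys_generic)
  then have "det (mat_delete (generic_mat N) j i) \<in> matrix_polys N" by (rule matrix_polys_det[OF c])
  moreover have "(- 1) ^ (j + i) \<in> matrix_polys N" using matrix_polys_power[OF matrix_polys_of_int[of "- 1" N], of "j + i"] by simp
  ultimately show ?thesis using assms carrier_matD[OF generic_mat_carrier[of N]]
    by (simp add: adj_mat_def cofactor_def matrix_polys_mult)
qed

lemma hom_adj_mat:
  assumes "comm_ring_hom \<phi>" "A \<in> carrier_mat k k" "i < k" "j < k"
  shows "\<phi> (adj_mat A $$ (i, j)) = adj_mat (map_mat \<phi> A) $$ (i, j)"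
proof -
  interpret comm_ring_hom \<phi> by fact
  have "map_mat \<phi> (mat_delete A j i) = mat_delete (map_mat \<phi> A) j i"
    using assms by (intro eq_matI) (auto simp: mat_delete_def)
  then have "\<phi> (det (mat_delete A j i)) = det (mat_delete (map_mat \<phi> A) j i)" by (metis hom_det)
  then show ?thesis using assms by (simp add: adj_mat_def cofactor_def hom_mult hom_power hom_uminus)
qed

text \<open>The numerator of \<open>F(x\<^sup>-\<^sup>1)\<close>, with \<open>(det x)\<^sup>e\<close> as denominator.\<close>

definition inverse_poly :: "nat \<Rightarrow> ipoly \<Rightarrow> nat \<Rightarrow> ipoly" where
  "inverse_poly N F e = (\<Sum>u\<in>Poly_Mapping.keys F. of_int (Poly_Mapping.lookup F u) *
     (det (generic_mat N) ^ (e - mdeg u) * mono_at (\<lambda>p. adj_mat (generic_mat N) $$ p) u))"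

lemma inverse_poly_in:
  assumes F: "F \<in> matrix_polys N"
  shows "inverse_poly N F e \<in> matrix_polys N"
proof -
  have "det (generic_mat N) \<in> matrix_polys N"
    by (rule matrix_polys_det[OF generic_mat_carrier matrix_polys_generic])
  moreover have "adj_mat (generic_mat N) $$ p \<in> matrix_polys N" if "p \<in> {..<N} \<times> {..<N}" for p
    using that by (auto intro: matrix_polys_adj)
  moreover have "p \<in> {..<N} \<times> {..<N}" if "u \<in> Poly_Mapping.keys F" "p \<in> Poly_Mapping.keys u" for u p
    using F that unfolding matrix_polys_def by blast
  ultimately show ?thesis unfolding inverse_poly_def mono_at_def
    by (intro matrix_polys_sum matrix_polys_mult matrix_polys_of_int matrix_polys_prod matrix_polys_power) blast+
qed

lemma eval_inverse_poly:
  assumes F: "F \<in> matrix_polys N" and a: "a \<in> carrier_mat N N"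
  shows "eval_at a (inverse_poly N F e) = (\<Sum>u\<in>Poly_Mapping.keys F. of_int (Poly_Mapping.lookup F u) *
     (det a ^ (e - mdeg u) * mono_at (\<lambda>p. adj_mat a $$ p) u))"
proof -
  interpret comm_ring_hom "eval_at a" by (rule eval_at_comm_hom)
  have "eval_at a (det (generic_mat N)) = det a" using hom_det[of "generic_mat N"] map_generic_mat[OF a] by simp
  moreover have "eval_at a (mono_at (\<lambda>p. adj_mat (generic_mat N) $$ p) u) = mono_at (\<lambda>p. adj_mat a $$ p) u"
    if "u \<in> Poly_Mapping.keys F" for u
  proof -
    have "eval_at a (adj_mat (generic_mat N) $$ p) = adj_mat a $$ p" if "p \<in> {..<N} \<times> {..<N}" for p
      using that hom_adj_mat[OF eval_at_comm_hom generic_mat_carrier, of "fst p" N "snd p" a] map_generic_mat[OF a] by auto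
    then show ?thesis unfolding hom_mono_at[OF eval_at_comm_hom] using F that
      by (intro mono_at_cong) (auto simp: matrix_polys_def)
  qed
  ultimately show ?thesis unfolding inverse_poly_def by (simp add: hom_sum hom_mult hom_of_int hom_power)
qed

lemma mono_at_scaled_cong:
  assumes "\<And>p. p \<in> Poly_Mapping.keys u \<Longrightarrow> s * a p = t * b p"
  shows "s ^ mdeg u * mono_at a u = t ^ mdeg u * mono_at b u"
  unfolding mono_at_smult[symmetric] using assms by (rule mono_at_cong)

lemma ext_power_one: "ext_power n m (1\<^sub>m n) = 1\<^sub>m (n choose m)"
  by (rule mat_op_inject[OF ext_power_carrier])
    (simp_all add: mat_op_ext_power mat_op_one Lam_id[OF lambda_space_subset_all])

lemma rearrange_products:
  fixes D :: "'a::comm_ring_1"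
  assumes "S * A = t * E" "D = y * S" "T = x * t"
  shows "D * (c * (x * A)) = (y * T) * (c * E)"
proof -
  have "D * (c * (x * A)) = y * x * c * (S * A)" unfolding assms(2) by (simp only: mult_ac)
  then show ?thesis unfolding assms(1,3) by (simp only: mult_ac)
qed

text \<open>Let A and E be the exterior powers of y and of its adjugate. Then AE is (det y)^m times
  the identity, so (det y)^m adj A = (det A) E. Multiplied by a power of det y, the numerator of F
  at the inverse of A is therefore a weighted sum of the homogeneous components of F at E, each of
  which vanishes.\<close>

lemma inverse_poly_kernel:
  assumes F: "F \<in> comorphism_kernel n m" and m: "1 \<le> m" and e: "\<And>u. u \<in> Poly_Mapping.keys F \<Longrightarrow> mdeg u \<le> e"
  shows "inverse_poly (n choose m) F e \<in> comorphism_kernel n m"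
proof -
  let ?N = "n choose m" and ?y = "generic_mat n"
  let ?A = "ext_power n m ?y" and ?E = "ext_power n m (adj_mat ?y)"
  let ?d = "det ?y" and ?k = "Poly_Mapping.keys F"
  have Fm: "F \<in> matrix_polys ?N" using F by (simp add: comorphism_kernel_def)
  note adj = adj_mat[OF generic_mat_carrier[of n]]
  note adjA = adj_mat[OF ext_power_carrier[of n m ?y]]
  have AE: "?A * ?E = ?d ^ m \<cdot>\<^sub>m 1\<^sub>m ?N"
    unfolding ext_power_mult[OF generic_mat_carrier adj(1), symmetric] adj(2)
    by (simp add: ext_power_smult ext_power_one)
  have "?d ^ m \<cdot>\<^sub>m adj_mat ?A = adj_mat ?A * (?d ^ m \<cdot>\<^sub>m 1\<^sub>m ?N)"
    using adjA(1) by (simp add: mult_smult_distrib[OF adjA(1) one_carrier_mat])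
  also have "\<dots> = (adj_mat ?A * ?A) * ?E"
    unfolding AE[symmetric] by (rule assoc_mult_mat[symmetric, OF adjA(1) ext_power_carrier ext_power_carrier])
  also have "\<dots> = det ?A \<cdot>\<^sub>m ?E" unfolding adjA(3)
    by (simp add: mult_smult_assoc_mat[OF one_carrier_mat ext_power_carrier] left_mult_one_mat[OF ext_power_carrier])
  finally have mats: "?d ^ m \<cdot>\<^sub>m adj_mat ?A = det ?A \<cdot>\<^sub>m ?E" .
  have entry: "?d ^ m * adj_mat ?A $$ p = det ?A * ?E $$ p" if p: "p \<in> {..<?N} \<times> {..<?N}" for p
  proof -
    obtain i j where ij: "p = (i, j)" "i < ?N" "j < ?N" using p by auto
    have "(?d ^ m \<cdot>\<^sub>m adj_mat ?A) $$ (i, j) = (det ?A \<cdot>\<^sub>m ?E) $$ (i, j)" unfolding mats ..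
    then show ?thesis unfolding ij(1)
      using ij carrier_matD[OF adjA(1)] carrier_matD[OF ext_power_carrier[of n m "adj_mat ?y"]] by simp
  qed
  have "?d ^ (m * e) * eval_at ?A (inverse_poly ?N F e) =
      (\<Sum>u\<in>?k. (?d ^ (m * (e - mdeg u)) * det ?A ^ e) * (of_int (Poly_Mapping.lookup F u) * mono_at (\<lambda>p. ?E $$ p) u))"
    unfolding eval_inverse_poly[OF Fm ext_power_carrier] sum_distrib_left
  proof (rule sum.cong[OF refl])
    fix u assume u: "u \<in> ?k"
    have "(?d ^ m) ^ mdeg u * mono_at (\<lambda>p. adj_mat ?A $$ p) u = det ?A ^ mdeg u * mono_at (\<lambda>p. ?E $$ p) u"
      using u Fm by (intro mono_at_scaled_cong entry) (auto simp: matrix_polys_def)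
    moreover have "?d ^ (m * e) = ?d ^ (m * (e - mdeg u)) * (?d ^ m) ^ mdeg u"
      using e[OF u] by (simp flip: power_mult power_add add: algebra_simps)
    moreover have "det ?A ^ e = det ?A ^ (e - mdeg u) * det ?A ^ mdeg u"
      using e[OF u] by (simp flip: power_add)
    ultimately show "?d ^ (m * e) * (of_int (Poly_Mapping.lookup F u) * (det ?A ^ (e - mdeg u) * mono_at (\<lambda>p. adj_mat ?A $$ p) u)) =
       (?d ^ (m * (e - mdeg u)) * det ?A ^ e) * (of_int (Poly_Mapping.lookup F u) * mono_at (\<lambda>p. ?E $$ p) u)"
      by (rule rearrange_products)
  qed
  also have "\<dots> = 0"
    by (rule sum_by_mdeg[where c = "\<lambda>d. ?d ^ (m * (e - d)) * det ?A ^ e", OF finite_keys])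
      (rule kernel_homogeneous_zero[OF F m adj(1)])
  finally show ?thesis using inverse_poly_in[OF Fm] by (auto simp: comorphism_kernel_def)
qed

text \<open>As adj g = (det g) h, the numerator polynomial takes the value (det g)^e F(h) at g, and
  det g is a unit.\<close>

lemma kernel_inverse:
  assumes F: "F \<in> comorphism_kernel n m" and m: "1 \<le> m" and g: "(g :: 'a::comm_ring_1 mat) \<in> ext_power_GL n m"
    and h: "h \<in> carrier_mat (n choose m) (n choose m)" "g * h = 1\<^sub>m (n choose m)"
  shows "eval_at h F = 0"
proof -
  let ?N = "n choose m"
  \<comment> \<open>Any common bound for the degrees of the monomials of F serves as exponent; the
    sum of all these degrees is one.\<close>
  define e where "e = (\<Sum>u\<in>Poly_Mapping.keys F. mdeg u)"
  have e: "mdeg u \<le> e" if "u \<in> Poly_Mapping.keys F" for u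
    unfolding e_def using that by (intro member_le_sum) auto
  have Fm: "F \<in> matrix_polys ?N" using F by (simp add: comorphism_kernel_def)
  have gc: "g \<in> carrier_mat ?N ?N" using g by (simp add: ext_power_GL_def GL_iff)
  note adj = adj_mat[OF gc]
  have "adj_mat g = (adj_mat g * g) * h"
    using adj(1) gc h by (simp add: assoc_mult_mat[of _ ?N ?N _ ?N _ ?N])
  also have "\<dots> = det g \<cdot>\<^sub>m h" unfolding adj(3)
    using h by (simp add: mult_smult_assoc_mat[OF one_carrier_mat h(1)])
  finally have adjg: "adj_mat g = det g \<cdot>\<^sub>m h" .
  have "det g ^ e * eval_at h F = (\<Sum>u\<in>Poly_Mapping.keys F. of_int (Poly_Mapping.lookup F u) *
     (det g ^ (e - mdeg u) * mono_at (\<lambda>p. adj_mat g $$ p) u))"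
    unfolding eval_at_eq poly_at_def sum_distrib_left
  proof (rule sum.cong[OF refl])
    fix u assume u: "u \<in> Poly_Mapping.keys F"
    have "mono_at (\<lambda>p. adj_mat g $$ p) u = mono_at (\<lambda>p. det g * h $$ p) u"
      using u Fm h by (intro mono_at_cong) (auto simp: adjg matrix_polys_def dest!: bspec subsetD)
    moreover have "det g ^ e = det g ^ (e - mdeg u) * det g ^ mdeg u"
      using e[OF u] by (simp flip: power_add)
    ultimately show "det g ^ e * (of_int (Poly_Mapping.lookup F u) * mono_at (\<lambda>p. h $$ p) u) =
        of_int (Poly_Mapping.lookup F u) * (det g ^ (e - mdeg u) * mono_at (\<lambda>p. adj_mat g $$ p) u)"
      by (simp only: mono_at_smult mult_ac)
  qed
  also have "\<dots> = eval_at g (inverse_poly ?N F e)" by (rule eval_inverse_poly[OF Fm gc, symmetric])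
  also have "\<dots> = 0" using inverse_poly_kernel[OF F m e] g by (simp add: ext_power_GL_def)
  finally have zero: "det g ^ e * eval_at h F = 0" .
  have "det h * det g = 1" using det_mult[OF gc h(1)] h(2) by (simp add: mult.commute)
  then have "eval_at h F = (det h * det g) ^ e * eval_at h F" by simp
  also have "\<dots> = det h ^ e * (det g ^ e * eval_at h F)" by (simp add: power_mult_distrib mult.assoc)
  finally show ?thesis unfolding zero by simp
qed

section \<open>Subgroups of the general linear group\<close>

lemma GL_group: "group (GL N :: 'a::comm_ring_1 mat monoid)"
proof -
  interpret ring "ring_mat TYPE('a) N ()" by (rule ring_mat)
  show ?thesis unfolding GL_def by (rule units_group)
qed

lemma GL_simps: "x \<otimes>\<^bsub>GL N\<^esub> y = x * y" "\<one>\<^bsub>GL N\<^esub> = 1\<^sub>m N"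
  by (simp_all add: GL_def units_of_def ring_mat_simps)

lemma GL_inv:
  fixes g :: "'a::comm_ring_1 mat"
  assumes "g \<in> carrier (GL N)"
  shows "inv\<^bsub>GL N\<^esub> g \<in> carrier_mat N N" "g * inv\<^bsub>GL N\<^esub> g = 1\<^sub>m N" "inv\<^bsub>GL N\<^esub> g * g = 1\<^sub>m N"
proof -
  interpret group "GL N :: 'a mat monoid" by (rule GL_group)
  show "inv\<^bsub>GL N\<^esub> g \<in> carrier_mat N N" using inv_closed[OF assms] by (simp add: GL_iff)
  show "g * inv\<^bsub>GL N\<^esub> g = 1\<^sub>m N" "inv\<^bsub>GL N\<^esub> g * g = 1\<^sub>m N"
    using r_inv[OF assms] l_inv[OF assms] by (simp_all add: GL_simps)
qed

lemma ext_power_GL_subgroup: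
  assumes m: "1 \<le> m"
  shows "subgroup (ext_power_GL n m :: 'a::comm_ring_1 mat set) (GL (n choose m))"
proof -
  interpret group "GL (n choose m) :: 'a mat monoid" by (rule GL_group)
  show ?thesis
  proof (rule subgroupI)
    show "(ext_power_GL n m :: 'a mat set) \<subseteq> carrier (GL (n choose m))" by (auto simp: ext_power_GL_def)
    have "eval_at (1\<^sub>m (n choose m)) F = (0 :: 'a)" if "F \<in> comorphism_kernel n m" for F
      unfolding ext_power_one[symmetric] using that by (rule kernel_zero) simp
    then have "\<one>\<^bsub>GL (n choose m)\<^esub> \<in> (ext_power_GL n m :: 'a mat set)"
      using one_closed by (simp add: ext_power_GL_def GL_simps)
    then show "(ext_power_GL n m :: 'a mat set) \<noteq> {}" by blast
  next
    fix g :: "'a mat" assume g: "g \<in> ext_power_GL n m"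
    then have G: "g \<in> carrier (GL (n choose m))" by (simp add: ext_power_GL_def)
    show "inv\<^bsub>GL (n choose m)\<^esub> g \<in> ext_power_GL n m"
      using inv_closed[OF G] kernel_inverse[OF _ m g GL_inv(1,2)[OF G]] by (simp add: ext_power_GL_def)
  next
    fix g h :: "'a mat" assume "g \<in> ext_power_GL n m" "h \<in> ext_power_GL n m"
    then show "g \<otimes>\<^bsub>GL (n choose m)\<^esub> h \<in> ext_power_GL n m"
      using m_closed[of g h] kernel_product[of _ n m g h] by (simp add: ext_power_GL_def GL_simps)
  qed
qed

lemma form_similitudes_subgroup:
  "subgroup (form_similitudes n m :: 'a::comm_ring_1 mat set) (GL (n choose m))"
proof -
  let ?N = "n choose m"
  let ?ok = "\<lambda>xs :: 'a vec list. length xs = n div m \<and> set xs \<subseteq> carrier_vec ?N"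
  interpret group "GL ?N :: 'a mat monoid" by (rule GL_group)
  have car: "map (\<lambda>x. g *\<^sub>v x) xs = map (\<lambda>x. g *\<^sub>v x) xs \<and> ?ok (map (\<lambda>x. g *\<^sub>v x) xs)"
    if "g \<in> carrier_mat ?N ?N" "?ok xs" for g xs using that by auto
  have comp: "map (\<lambda>x. g *\<^sub>v x) (map (\<lambda>x. h *\<^sub>v x) xs) = map (\<lambda>x. (g * h) *\<^sub>v x) xs"
    if "g \<in> carrier_mat ?N ?N" "h \<in> carrier_mat ?N ?N" "?ok xs" for g h xs
    using that by (auto simp: assoc_mult_mat_vec[of _ ?N ?N _ ?N])
  have one: "map (\<lambda>x. 1\<^sub>m ?N *\<^sub>v x) xs = xs" if "?ok xs" for xs :: "'a vec list"
    using that by (auto intro!: map_idI)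
  show ?thesis
  proof (rule subgroupI)
    show "(form_similitudes n m :: 'a mat set) \<subseteq> carrier (GL ?N)" by (auto simp: form_similitudes_def)
    have "\<one>\<^bsub>GL ?N\<^esub> \<in> (form_similitudes n m :: 'a mat set)"
      using one_closed one unfolding form_similitudes_def GL_simps by (auto intro!: exI[of _ 1])
    then show "(form_similitudes n m :: 'a mat set) \<noteq> {}" by blast
  next
    fix g :: "'a mat" assume g: "g \<in> form_similitudes n m"
    then have G: "g \<in> carrier (GL ?N)" by (simp add: form_similitudes_def)
    obtain c where c: "c dvd 1" "\<And>xs. ?ok xs \<Longrightarrow> ext_form n m (map (\<lambda>x. g *\<^sub>v x) xs) = c * ext_form n m xs"
      using g by (auto simp: form_similitudes_def)
    obtain d where d: "d * c = 1" using c(1) by (metis dvdE mult.commute)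
    have gc: "g \<in> carrier_mat ?N ?N" using G by (simp add: GL_iff)
    let ?h = "inv\<^bsub>GL ?N\<^esub> g"
    note h = GL_inv[OF G]
    have "ext_form n m (map (\<lambda>x. ?h *\<^sub>v x) xs) = d * ext_form n m xs" if xs: "?ok xs" for xs
    proof -
      have "ext_form n m xs = c * ext_form n m (map (\<lambda>x. ?h *\<^sub>v x) xs)"
        using c(2)[of "map (\<lambda>x. ?h *\<^sub>v x) xs"] car[OF h(1) xs] comp[OF gc h(1) xs] one[OF xs] h(2) by simp
      then show ?thesis using d by (simp flip: mult.assoc)
    qed
    moreover have "d dvd 1" using d by (metis dvd_triv_left)
    ultimately show "?h \<in> form_similitudes n m" using inv_closed[OF G] by (auto simp: form_similitudes_def)
  next
    fix g h :: "'a mat" assume g: "g \<in> form_similitudes n m" and h: "h \<in> form_similitudes n m"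
    obtain c where c: "c dvd 1" "\<And>xs. ?ok xs \<Longrightarrow> ext_form n m (map (\<lambda>x. g *\<^sub>v x) xs) = c * ext_form n m xs"
      using g by (auto simp: form_similitudes_def)
    obtain d where d: "d dvd 1" "\<And>xs. ?ok xs \<Longrightarrow> ext_form n m (map (\<lambda>x. h *\<^sub>v x) xs) = d * ext_form n m xs"
      using h by (auto simp: form_similitudes_def)
    have G: "g \<in> carrier (GL ?N)" "h \<in> carrier (GL ?N)" using g h by (simp_all add: form_similitudes_def)
    then have gc: "g \<in> carrier_mat ?N ?N" "h \<in> carrier_mat ?N ?N" by (simp_all add: GL_iff)
    have "ext_form n m (map (\<lambda>x. (g * h) *\<^sub>v x) xs) = (c * d) * ext_form n m xs" if xs: "?ok xs" for xs
      unfolding comp[OF gc xs, symmetric] using c(2)[OF conjunct2[OF car[OF gc(2) xs]]] d(2)[OF xs] by (simp add: mult.assoc)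
    moreover have "c * d dvd 1" using c(1) d(1) by (rule unit_mult)
    ultimately show "g \<otimes>\<^bsub>GL ?N\<^esub> h \<in> form_similitudes n m"
      using m_closed[OF G] by (auto simp: form_similitudes_def GL_simps)
  qed
qed

section \<open>The case of two factors\<close>

text \<open>\<open>subseqs\<close> lists the sets containing the head before those that do not, each
  half in the order of the tail. Complementation exchanges the halves and, by induction, reverses
  each of them.\<close>

lemma complement_subseqs:
  "distinct xs \<Longrightarrow> map (\<lambda>I. set xs - I) (map set (subseqs xs)) = rev (map set (subseqs xs))"
proof (induction xs)
  case (Cons x xs)
  let ?S = "map set (subseqs xs)"
  have sub: "I \<subseteq> set xs" if "I \<in> set ?S" for I using that subseqs_powset[of xs] by auto
  have IH: "map (\<lambda>I. set xs - I) ?S = rev ?S" using Cons by simp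
  have L: "map set (subseqs (x # xs)) = map (insert x) ?S @ ?S" by (simp add: Let_def)
  have "map (\<lambda>I. set (x # xs) - I) (map (insert x) ?S) = map (\<lambda>I. set xs - I) ?S"
    using Cons.prems by auto
  moreover have "map (\<lambda>I. set (x # xs) - I) ?S = map (insert x) (map (\<lambda>I. set xs - I) ?S)"
    unfolding map_map using Cons.prems sub by (intro map_cong) (auto simp: insert_Diff_if dest!: sub)
  ultimately have "map (\<lambda>I. set (x # xs) - I) (map (insert x) ?S @ ?S) = rev ?S @ map (insert x) (rev ?S)"
    unfolding map_append IH by simp
  then show ?case unfolding L by (simp add: rev_map)
qed simp

text \<open>As n = 2m, complementation preserves the size m, so the reversal of the list of all
  subsets survives the selection of the m-sets.\<close>

lemma msubset_list_complement:
  assumes n: "n = 2 * m" and i: "i < n choose m"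
  shows "msubset_list n m ! ((n choose m) - Suc i) = {..<n} - msubset_list n m ! i"
proof -
  let ?L = "map set (subseqs [0..<n])"
  have L: "msubset_list n m = filter (\<lambda>I. card I = m) ?L"
  proof -
    have "length is = card (set is)" if "is \<in> set (subseqs [0..<n])" for "is"
      using subseqs_distinctD[OF that] by (simp add: distinct_card)
    then show ?thesis unfolding msubset_list_def filter_map by (intro arg_cong[where f = "map set"] filter_cong) auto
  qed
  have sub: "I \<subseteq> {..<n}" if "I \<in> set ?L" for I
    using that subseqs_powset[of "[0..<n]"] by (auto simp: lessThan_atLeast0)
  have "card ({..<n} - I) = m \<longleftrightarrow> card I = m" if "I \<in> set ?L" for I
  proof -
    have "card I \<le> n" using card_mono[OF finite_lessThan sub[OF that]] by simp
    moreover have "card ({..<n} - I) = n - card I"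
      using card_Diff_subset[OF finite_subset[OF sub[OF that]] sub[OF that]] by simp
    ultimately show ?thesis using n by arith
  qed
  then have "filter ((\<lambda>I. card I = m) \<circ> (\<lambda>I. {..<n} - I)) ?L = filter (\<lambda>I. card I = m) ?L"
    by (intro filter_cong) auto
  moreover have "rev ?L = map (\<lambda>I. {..<n} - I) ?L"
    using complement_subseqs[of "[0..<n]"] by (simp add: lessThan_atLeast0)
  ultimately have "rev (msubset_list n m) = map (\<lambda>I. {..<n} - I) (msubset_list n m)"
    unfolding L rev_filter by (simp only: filter_map)
  then have "rev (msubset_list n m) ! i = {..<n} - msubset_list n m ! i"
    using i by (simp add: length_msubset_list)
  then show ?thesis using i by (simp add: rev_nth length_msubset_list)
qed

lemma ext_form_pair:
  fixes x y :: "'a::comm_ring_1 vec"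
  assumes n: "n = 2 * m" "1 \<le> m"
  shows "ext_form n m [x, y] = (\<Sum>i<n choose m.
    sg (msubset_list n m ! i) ({..<n} - msubset_list n m ! i) * (x $ i * y $ ((n choose m) - Suc i)))"
proof -
  let ?N = "n choose m" and ?c = "\<lambda>I. {..<n} - I"
  have c: "?c I \<in> msubsets n m" if "I \<in> msubsets n m" for I
    using that card_Diff_subset[of I "{..<n}"] finite_subset[of I "{..<n}"] n by (auto simp: msubsets_def)
  have "ext_form n m [x, y] = coord (of_vec n m x * of_vec n m y) {..<n}"
    using ext_form_eq[of "[x, y]" n m] n by simp
  also have "\<dots> = (\<Sum>I\<in>msubsets n m. coord (sc (x $ idx n m I) (basis I * of_vec n m y)) {..<n})"
    by (simp add: of_vec_def[of n m x] sum_distrib_right coord_sum sc_mult_left)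
  also have "\<dots> = (\<Sum>I\<in>msubsets n m. sg I (?c I) * (x $ idx n m I * y $ idx n m (?c I)))"
  proof (rule sum.cong[OF refl])
    fix I assume I: "I \<in> msubsets n m"
    then have "finite I" "I \<subseteq> {..<n}" by (auto simp: msubsets_def intro: finite_subset)
    then have "coord (basis I * of_vec n m y) {..<n} = sg I (?c I) * coord (of_vec n m y) (?c I)"
      by (simp add: coord_basis_times)
    also have "coord (of_vec n m y) (?c I) = y $ idx n m (?c I)" using c[OF I] by (simp add: coord_of_vec)
    finally show "coord (sc (x $ idx n m I) (basis I * of_vec n m y)) {..<n} = sg I (?c I) * (x $ idx n m I * y $ idx n m (?c I))"
      by (simp add: mult.left_commute)
  qed
  also have "\<dots> = (\<Sum>i<?N. sg (msubset_list n m ! i) (?c (msubset_list n m ! i)) * (x $ i * y $ (?N - Suc i)))"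
  proof (rule sum.reindex_bij_witness[where j = "idx n m" and i = "(!) (msubset_list n m)"])
    fix I assume I: "I \<in> msubsets n m"
    have "?c I = msubset_list n m ! (?N - Suc (idx n m I))"
      using msubset_list_complement[OF n(1) idx_less[OF I]] by (simp add: msubset_list_idx[OF I])
    then have "idx n m (?c I) = ?N - Suc (idx n m I)" using idx_less[OF I] by (simp add: idx_msubset_list)
    then show "sg (msubset_list n m ! idx n m I) (?c (msubset_list n m ! idx n m I)) * (x $ idx n m I * y $ (?N - Suc (idx n m I))) =
        sg I (?c I) * (x $ idx n m I * y $ idx n m (?c I))"
      by (simp add: msubset_list_idx[OF I])
  qed (auto simp: msubset_list_idx idx_msubset_list idx_less msubset_list_mem)
  finally show ?thesis .
qed

lemma sum_fold_halves:
  fixes h :: "nat \<Rightarrow> 'a::comm_monoid_add"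
  shows "(\<Sum>i<2 * k. h i) = (\<Sum>i<k. h i + h (2 * k - Suc i))"
proof -
  have "(\<Sum>i<2 * k. h i) = sum h {..<k} + sum h {k..<2 * k}"
    using sum.union_disjoint[of "{..<k}" "{k..<2 * k}" h] by (simp add: ivl_disj_un ivl_disj_int)
  also have "sum h {k..<2 * k} = (\<Sum>i<k. h (2 * k - Suc i))"
    by (rule sum.reindex_bij_witness[where i = "\<lambda>i. 2 * k - Suc i" and j = "\<lambda>i. 2 * k - Suc i"]) auto
  finally show ?thesis by (simp add: sum.distrib)
qed

text \<open>With an odd number of m-sets, the one in the middle of the list would be its own
  complement.\<close>

lemma central_binomial_even:
  assumes n: "n = 2 * m" "1 \<le> m"
  obtains k where "n choose m = 2 * k"
proof -
  let ?i = "(n choose m) div 2"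
  have "even (n choose m)"
  proof (rule ccontr)
    assume odd: "odd (n choose m)"
    then have i: "?i < n choose m" "(n choose m) - Suc ?i = ?i" by presburger+
    then have eq: "msubset_list n m ! ?i = {..<n} - msubset_list n m ! ?i"
      using msubset_list_complement[OF n(1) i(1)] by simp
    moreover have "0 \<in> {..<n}" using n by simp
    ultimately show False by blast
  qed
  then show thesis using that by (auto elim: evenE)
qed

section \<open>Reduction to the standard split forms\<close>

definition split_form :: "nat \<Rightarrow> nat \<Rightarrow> 'a::comm_ring_1 vec \<Rightarrow> 'a vec \<Rightarrow> 'a" where
  "split_form m N x y = (\<Sum>i<N div 2. x $ i * y $ (N - 1 - i) + (-1) ^ m * (x $ (N - 1 - i) * y $ i))"

text \<open>One sign for each pair of complementary sets is enough; it is placed in the first half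
  of the list, and the second half keeps 1.\<close>

definition complement_sign :: "nat \<Rightarrow> nat \<Rightarrow> nat \<Rightarrow> 'a::comm_ring_1" where
  "complement_sign n m i = (if i < (n choose m) div 2
     then sg (msubset_list n m ! i) ({..<n} - msubset_list n m ! i) else 1)"

lemma complement_sign_int: "complement_sign n m i \<in> {1, -1 :: int}"
  using sg_cases[where 'a = int] by (auto simp: complement_sign_def)

lemma of_int_complement_sign: "of_int (complement_sign n m i) = complement_sign n m i"
  by (simp add: complement_sign_def sg_def)

lemma complement_sign_square [simp]: "complement_sign n m i * complement_sign n m i = 1"
  by (simp add: complement_sign_def)

definition sign_mat :: "nat \<Rightarrow> nat \<Rightarrow> 'a::comm_ring_1 mat" where
  "sign_mat n m = mat (n choose m) (n choose m) (\<lambda>(i, j). if i = j then of_int (complement_sign n m j) else 0)"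

lemma sign_mat_carrier: "sign_mat n m \<in> carrier_mat (n choose m) (n choose m)"
  by (simp add: sign_mat_def)

lemma sign_mat_signed_permutation: "sign_mat n m \<in> signed_permutation_mats (n choose m)"
  unfolding signed_permutation_mats_def sign_mat_def
  by (intro CollectI exI[of _ id] exI[of _ "complement_sign n m"]) (simp add: permutes_id complement_sign_int del: insert_iff)

lemma sign_mat_mult_vec:
  assumes "x \<in> carrier_vec (n choose m)" "i < n choose m"
  shows "(sign_mat n m *\<^sub>v x) $ i = complement_sign n m i * x $ i"
proof -
  have "(sign_mat n m *\<^sub>v x) $ i = (\<Sum>j = 0..<n choose m. (if i = j then complement_sign n m j else 0) * x $ j)"
    using assms by (simp add: sign_mat_def scalar_prod_def of_int_complement_sign cong: if_cong)
  also have "\<dots> = (\<Sum>j = 0..<n choose m. if i = j then complement_sign n m j * x $ j else 0)"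
    by (intro sum.cong) auto
  finally show ?thesis using assms(2) by simp
qed

lemma sign_mat_square: "sign_mat n m * sign_mat n m = (1\<^sub>m (n choose m) :: 'a::comm_ring_1 mat)"
proof (rule eq_matI)
  fix i j assume "i < dim_row (1\<^sub>m (n choose m) :: 'a mat)" "j < dim_col (1\<^sub>m (n choose m) :: 'a mat)"
  then have ij: "i < n choose m" "j < n choose m" by auto
  have "(sign_mat n m * sign_mat n m) $$ (i, j) = (sign_mat n m *\<^sub>v col (sign_mat n m) j) $ i"
    using ij by (simp add: sign_mat_def)
  also have "\<dots> = complement_sign n m i * col (sign_mat n m) j $ i"
    using ij by (intro sign_mat_mult_vec) (auto simp: sign_mat_def intro!: carrier_vecI)
  also have "\<dots> = 1\<^sub>m (n choose m) $$ (i, j)"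
    using ij by (simp add: sign_mat_def of_int_complement_sign)
  finally show "(sign_mat n m * sign_mat n m) $$ (i, j) = (1\<^sub>m (n choose m) :: 'a mat) $$ (i, j)" .
qed (simp_all add: sign_mat_def)

lemma ext_form_sign_mat:
  fixes x y :: "'a::comm_ring_1 vec"
  assumes n: "n = 2 * m" "1 \<le> m" and xy: "x \<in> carrier_vec (n choose m)" "y \<in> carrier_vec (n choose m)"
  shows "ext_form n m [sign_mat n m *\<^sub>v x, sign_mat n m *\<^sub>v y] = split_form m (n choose m) x y"
proof -
  obtain k where k: "n choose m = 2 * k" using central_binomial_even[OF n] .
  let ?N = "2 * k" and ?s = "complement_sign n m :: nat \<Rightarrow> 'a"
  define t :: "nat \<Rightarrow> 'a" where "t i = sg (msubset_list n m ! i) ({..<n} - msubset_list n m ! i)" for i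
  have s: "?s i = t i" "?s (?N - Suc i) = 1" if "i < k" for i
    using that by (simp_all add: complement_sign_def k t_def)
  have t2: "t i * t i = 1" for i by (simp add: t_def)
  \<comment> \<open>Exchanging two complementary m-sets costs the sign with exponent m^2, which has
    the parity of m.\<close>
  have swap: "t (?N - Suc i) = (-1) ^ m * t i" if i: "i < k" for i
  proof -
    let ?I = "msubset_list n m ! i"
    have I: "?I \<subseteq> {..<n}" "card ?I = m" "finite ?I"
      using msubset_list_mem[of i n m] i k by (auto simp: msubsets_def intro: finite_subset)
    have compl: "msubset_list n m ! (?N - Suc i) = {..<n} - ?I" using msubset_list_complement[OF n(1), of i] i k by simp
    have "{..<n} - ({..<n} - ?I) = ?I" using I(1) by blast
    then have "t (?N - Suc i) = sg ({..<n} - ?I) ?I" by (simp add: t_def compl)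
    also have "\<dots> = (-1) ^ (card ?I * card ({..<n} - ?I)) * t i"
      unfolding t_def by (rule sg_swap) (use I in auto)
    also have "card ({..<n} - ?I) = m" using I n by (simp add: card_Diff_subset)
    also have "(-1 :: 'a) ^ (card ?I * m) = (-1) ^ m" using I(2) by (cases "even m") auto
    finally show ?thesis .
  qed
  have "ext_form n m [sign_mat n m *\<^sub>v x, sign_mat n m *\<^sub>v y] =
      (\<Sum>i<?N. t i * (?s i * x $ i * (?s (?N - Suc i) * y $ (?N - Suc i))))"
    unfolding ext_form_pair[OF n] using k by (intro sum.cong) (auto simp: sign_mat_mult_vec[OF xy(1)] sign_mat_mult_vec[OF xy(2)] t_def)
  also have "\<dots> = split_form m ?N x y"
    unfolding sum_fold_halves split_form_def
  proof (rule sum.cong)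
    fix i assume "i \<in> {..<?N div 2}"
    then have i: "i < k" by simp
    then have "?N - Suc (?N - Suc i) = i" by simp
    moreover have "t i * (t i * x $ i * (1 * y $ (?N - Suc i))) = x $ i * y $ (?N - Suc i)"
      using t2[of i] by (simp flip: mult.assoc)
    moreover have "((-1) ^ m * t i) * (1 * x $ (?N - Suc i) * (t i * y $ i)) = (-1) ^ m * (t i * t i) * (x $ (?N - Suc i) * y $ i)"
      by (simp only: mult_ac mult_1)
    ultimately show "t i * (?s i * x $ i * (?s (?N - Suc i) * y $ (?N - Suc i))) +
        t (?N - Suc i) * (?s (?N - Suc i) * x $ (?N - Suc i) * (?s (?N - Suc (?N - Suc i)) * y $ (?N - Suc (?N - Suc i)))) =
        x $ i * y $ (?N - 1 - i) + (-1) ^ m * (x $ (?N - 1 - i) * y $ i)"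
      by (simp only: s[OF i] swap[OF i] t2 mult_1_right) simp
  qed simp
  finally show ?thesis unfolding k .
qed

lemma form_similitudes_bilinear:
  assumes n: "n = 2 * m" "1 \<le> m"
  shows "form_similitudes n m = bilinear_similitudes (n choose m) (\<lambda>x y. ext_form n m [x, y])"
proof -
  have eq: "(\<forall>xs. length xs = n div m \<and> set xs \<subseteq> V \<longrightarrow> Q xs) \<longleftrightarrow> (\<forall>x\<in>V. \<forall>y\<in>V. Q [x, y])" for V :: "'b set" and Q
    using n by (auto simp: length_Suc_conv numeral_2_eq_2)
  show ?thesis by (simp add: form_similitudes_def bilinear_similitudes_def eq)
qed

text \<open>P is its own inverse, so the roles of f and B can be interchanged and one computation
  gives both inclusions.\<close>

lemma bilinear_similitudes_conjugate:
  fixes P :: "'a::comm_ring_1 mat"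
  assumes P: "P \<in> carrier_mat N N" "P * P = 1\<^sub>m N"
    and f: "\<And>x y. x \<in> carrier_vec N \<Longrightarrow> y \<in> carrier_vec N \<Longrightarrow> f (P *\<^sub>v x) (P *\<^sub>v y) = B x y"
  shows "bilinear_similitudes N f = conjugate_set N P (bilinear_similitudes N B)"
proof -
  interpret group "GL N :: 'a mat monoid" by (rule GL_group)
  have PG: "P \<in> carrier (GL N)" using P by (auto simp: GL_iff)
  have inv: "inv\<^bsub>GL N\<^esub> P = P" using PG P by (intro inv_equality) (simp_all add: GL_simps)
  have PP: "P *\<^sub>v (P *\<^sub>v x) = x" if "x \<in> carrier_vec N" for x
    using P that by (simp flip: assoc_mult_mat_vec[OF P(1) P(1) that])
  have B: "B (P *\<^sub>v x) (P *\<^sub>v y) = f x y" if "x \<in> carrier_vec N" "y \<in> carrier_vec N" for x y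
    using f[of "P *\<^sub>v x" "P *\<^sub>v y"] P(1) that by (simp add: PP)
  have conj: "P * g * P \<in> bilinear_similitudes N B'"
    if g: "g \<in> bilinear_similitudes N f'"
      and B': "\<And>x y. x \<in> carrier_vec N \<Longrightarrow> y \<in> carrier_vec N \<Longrightarrow> B' (P *\<^sub>v x) (P *\<^sub>v y) = f' x y" for g f' B'
  proof -
    have G: "g \<in> carrier (GL N)" and gc: "g \<in> carrier_mat N N" using g by (auto simp: bilinear_similitudes_def GL_iff)
    obtain c where c: "c dvd 1" "\<And>x y. x \<in> carrier_vec N \<Longrightarrow> y \<in> carrier_vec N \<Longrightarrow> f' (g *\<^sub>v x) (g *\<^sub>v y) = c * f' x y"
      using g by (auto simp: bilinear_similitudes_def)
    have f': "f' (P *\<^sub>v x) (P *\<^sub>v y) = B' x y" if "x \<in> carrier_vec N" "y \<in> carrier_vec N" for x y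
      using B'[of "P *\<^sub>v x" "P *\<^sub>v y"] P(1) that by (simp add: PP)
    have v: "(P * g * P) *\<^sub>v x = P *\<^sub>v (g *\<^sub>v (P *\<^sub>v x))" if "x \<in> carrier_vec N" for x
      using P(1) gc that by (simp add: assoc_mult_mat_vec[of _ N N _ N])
    have "B' ((P * g * P) *\<^sub>v x) ((P * g * P) *\<^sub>v y) = c * B' x y" if "x \<in> carrier_vec N" "y \<in> carrier_vec N" for x y
      unfolding v[OF that(1)] v[OF that(2)] using that P(1) gc by (simp add: B' c(2) f')
    moreover have "P * g * P \<in> carrier (GL N)" using m_closed[OF m_closed[OF PG G] PG] by (simp add: GL_simps)
    ultimately show ?thesis using c(1) by (auto simp: bilinear_similitudes_def)
  qed
  show ?thesis
  proof (intro equalityI subsetI)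
    fix g assume g: "g \<in> bilinear_similitudes N f"
    then have gc: "g \<in> carrier_mat N N" by (auto simp: bilinear_similitudes_def GL_iff)
    have "P * (P * g * P) * P = (P * P) * g * (P * P)"
      using P(1) gc by (simp add: assoc_mult_mat[of _ N N _ N _ N])
    then have "g = P * (P * g * P) * P" using P(2) gc by simp
    then show "g \<in> conjugate_set N P (bilinear_similitudes N B)"
      unfolding conjugate_set_def inv GL_simps using conj[OF g B] by blast
  next
    fix g assume "g \<in> conjugate_set N P (bilinear_similitudes N B)"
    then show "g \<in> bilinear_similitudes N f"
      unfolding conjugate_set_def inv GL_simps using conj f by blast
  qed
qed

lemma form_similitudes_split:
  assumes n: "n = 2 * m" "1 \<le> m"
  shows "form_similitudes n m = conjugate_set (n choose m) (sign_mat n m) (bilinear_similitudes (n choose m) (split_form m (n choose m)))"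
  unfolding form_similitudes_bilinear[OF n]
  by (rule bilinear_similitudes_conjugate[OF sign_mat_carrier sign_mat_square,
    where f = "\<lambda>x y. ext_form n m [x, y]" and B = "split_form m (n choose m)"]) (rule ext_form_sign_mat[OF n])

lemma split_form_symmetric: "even m \<Longrightarrow> split_form m = split_symmetric_form"
  by (intro ext) (simp add: split_form_def split_symmetric_form_def)

lemma split_form_alternating: "odd m \<Longrightarrow> split_form m = split_alternating_form"
  by (intro ext) (simp add: split_form_def split_alternating_form_def)

theorem theorem6:
  fixes n m N :: nat
  assumes "(2::'a::comm_ring_1) dvd 1"
    and "n \<ge> 4" and "1 \<le> m" and "m < n" and "m dvd n"
    and "N = n choose m"
  shows "(n \<noteq> 2 * m \<longrightarrow> (ext_power_GL n m :: 'a mat set) = form_similitudes n m) \<and>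
    (n = 2 * m \<and> even m \<longrightarrow>
      (\<exists>P \<in> signed_permutation_mats N.
        (form_similitudes n m :: 'a mat set) = conjugate_set N P (GO N) \<and>
        subgroup (ext_power_GL n m) (GL N\<lparr>carrier := conjugate_set N P (GO N)\<rparr>))) \<and>
    (n = 2 * m \<and> odd m \<longrightarrow>
      (\<exists>P \<in> signed_permutation_mats N.
        (form_similitudes n m :: 'a mat set) = conjugate_set N P (GSp N) \<and>
        subgroup (ext_power_GL n m) (GL N\<lparr>carrier := conjugate_set N P (GSp N)\<rparr>)))"
proof (intro conjI impI)
  assume ne: "n \<noteq> 2 * m"
  obtain k where k: "n = k * m" using assms(5) by (metis dvdE mult.commute)
  \<comment> \<open>n >= 4 excludes k = 0, m < n excludes k = 1, and n \<noteq> 2m excludes k =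
    2.\<close>
  have "k \<noteq> 0" "k \<noteq> 1" "k \<noteq> 2" using k ne assms(2,4) by auto
  then have "3 \<le> k" by simp
  then show "(ext_power_GL n m :: 'a mat set) = form_similitudes n m"
    using form_similitudes_subset[OF k _ assms(3)] ext_power_GL_subset[OF assms(5)] by blast
next
  have sub: "subgroup (ext_power_GL n m) (GL N\<lparr>carrier := form_similitudes n m :: 'a mat set\<rparr>)"
    unfolding assms(6) by (rule group.subgroup_incl[OF GL_group ext_power_GL_subgroup[OF assms(3)]
      form_similitudes_subgroup ext_power_GL_subset[OF assms(5)]])
  {
    assume nm: "n = 2 * m \<and> even m"
    have "(form_similitudes n m :: 'a mat set) = conjugate_set N (sign_mat n m) (GO N)"
      unfolding assms(6) GO_def using form_similitudes_split[of n m] nm assms(3) by (simp add: split_form_symmetric)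
    then show "\<exists>P \<in> signed_permutation_mats N.
        (form_similitudes n m :: 'a mat set) = conjugate_set N P (GO N) \<and>
        subgroup (ext_power_GL n m) (GL N\<lparr>carrier := conjugate_set N P (GO N)\<rparr>)"
      using sub sign_mat_signed_permutation[of n m] assms(6) by metis
  next
    assume nm: "n = 2 * m \<and> odd m"
    have "(form_similitudes n m :: 'a mat set) = conjugate_set N (sign_mat n m) (GSp N)"
      unfolding assms(6) GSp_def using form_similitudes_split[of n m] nm assms(3) by (simp add: split_form_alternating)
    then show "\<exists>P \<in> signed_permutation_mats N.
        (form_similitudes n m :: 'a mat set) = conjugate_set N P (GSp N) \<and>
        subgroup (ext_power_GL n m) (GL N\<lparr>carrier := conjugate_set N P (GSp N)\<rparr>)"
      using sub sign_mat_signed_permutation[of n m] assms(6) by metis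
  }
qed

end
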